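(* Let $\mathcal P_t$ be the semigroup corresponding to the Boomerang Sampler described in the context. Assume that $\Phi$ satisfies Assumption (G), that $\Phi$ is twice continuously differentiable with bounded Hessian, and that there exist $c_2\ge0$, $c_1>0$ such that $$\mathcal A\Phi(x)\le c_2-c_1\|\Sigma^{1/2}\nabla_x\Phi(x)\|^2\qquad\text{for all }x\in\mathcal H,$$ where $\mathcal Ag(x)=\mathrm{Tr}(\Sigma\nabla_x^2g(x))-\langle x,\nabla_xg(x)\rangle-\langle\nabla_x\Phi(x),\Sigma\nabla_xg(x)\rangle$. Also assume that $e^{-\Phi}\in L^1(\pi_0)$, where $\pi_0=\nu_0=\mathcal N(0,\Sigma)$, and let $\pi$ be the probability measure with $d\pi/d\pi_0\propto e^{-\Phi}$ and $\mu=\pi\times\nu_0$. Then there exist constants $C,\kappa>0$ such that $$\|\mathcal P_tf-\mu(f)\|_{L^2_\mu}\le Ce^{-\kappa t}\|f-\mu(f)\|_{L^2_\mu}$$ for all $f\in L^2_\mu$ and all $t\ge0$.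
   Context: $\mathcal H$ is an infinite dimensional separable real Hilbert space, $\Sigma$ a positive definite self-adjoint trace class operator on $\mathcal H$; $\mu(f)=\int f\,d\mu$. Assumption (G) on $\Phi:\mathcal H\to\mathbb R$: (1) $0\le\Phi(x)\le K(1+\|x\|^2)$ for some $K$; (2) $\Phi$ is Fréchet differentiable, $\nabla\Phi$ is Lipschitz on bounded sets and $\|\nabla\Phi(x)\|\le K(1+\|x\|)$; (3) $\Phi=\Phi_1+\Phi_2$ with $\Phi_1$ convex and bounded from below, $\Phi_2$ bounded with bounded first and second order derivatives. Boomerang Sampler: $\lambda_{\mathrm r}>0$ is a constant and $(R_n)_{n\ge1}$ are linear operators on $\mathcal H$ such that $R_n^2=1$, $\|R_nv\|=\|v\|$, $\langle\Sigma q,q\rangle=\langle R_n\Sigma R_n^*q,q\rangle$ for all $q$, and, for all $v\in\mathcal H$, $$\sum_n\|(1-R_n)v\|^2=4\|v\|^2,\qquad \sum_n(1-R_n)v=2v,$$ $$\tfrac14\sum_n(1-R_n)^*\Sigma(1-R_n)=\Sigma,\qquad (1-R_n)^*\Sigma(1-R_m)=0\ \ (m\ne n).$$ Put $\lambda_n(x,v)=\frac12(\langle\nabla_x\Phi(x),v-R_nv\rangle)^+$. The process $(X_t,V_t)$ on $\mathcal H\times\mathcal H$ follows the flow of $\dot x=v,\ \dot v=-x$ between jumps; from $(x,v)$, at rate $\lambda_n(x,v)$ it jumps to $(x,R_nv)$ and at rate $\lambda_{\mathrm r}$ it jumps to $(x,w)$ with $w\sim\nu_0$. On smooth functions its generator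 is $$\mathcal Lf(x,v)=\langle v,\nabla_xf\rangle-\langle x,\nabla_vf\rangle+\lambda_{\mathrm r}\int_{\mathcal H}[f(x,w)-f(x,v)]\nu_0(dw)+\sum_{n}\lambda_n(x,v)[f(x,R_nv)-f(x,v)].$$ $\mathcal P_tf(x,v)=\mathbb E_{(x,v)}[f(X_t,V_t)]$, extended to a strongly continuous semigroup on $L^2_\mu$. *)

theory Defs
  imports "HOL-Probability.Probability"
begin

section \<open>Operators on a Hilbert space\<close>

definition selfadjoint :: "('a::real_inner \<Rightarrow> 'a) \<Rightarrow> bool" where
  "selfadjoint T \<longleftrightarrow> (\<forall>x y. T x \<bullet> y = x \<bullet> T y)"

definition pos_definite :: "('a::real_inner \<Rightarrow> 'a) \<Rightarrow> bool" where
  "pos_definite T \<longleftrightarrow> (\<forall>x. x \<noteq> 0 \<longrightarrow> T x \<bullet> x > 0)"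

definition op_sqrt :: "('a::real_inner \<Rightarrow> 'a) \<Rightarrow> 'a \<Rightarrow> 'a" where
  "op_sqrt S = (THE Q. bounded_linear Q \<and> selfadjoint Q \<and> (\<forall>x. Q x \<bullet> x \<ge> 0) \<and> Q \<circ> Q = S)"

definition orthonormal_basis :: "'a::real_inner set \<Rightarrow> bool" where
  "orthonormal_basis B \<longleftrightarrow>
     pairwise orthogonal B \<and> (\<forall>e\<in>B. norm e = 1) \<and> closure (span B) = UNIV"

definition trace_class :: "('a::real_inner \<Rightarrow> 'a) \<Rightarrow> bool" where
  "trace_class T \<longleftrightarrow> bounded_linear T \<and>
     (\<forall>B. orthonormal_basis B \<longrightarrow> (\<lambda>e. op_sqrt (adjoint T \<circ> T) e \<bullet> e) summable_on B)"

text \<open>For a trace class operator the value does not depend on the choice of the basis.\<close>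

definition op_trace :: "('a::real_inner \<Rightarrow> 'a) \<Rightarrow> real" where
  "op_trace T = infsum (\<lambda>e. T e \<bullet> e) (SOME B. orthonormal_basis B)"

section \<open>Gradient and Hessian\<close>

definition gradient :: "('a::real_inner \<Rightarrow> real) \<Rightarrow> 'a \<Rightarrow> 'a" where
  "gradient f x = (THE D. GDERIV f x :> D)"

definition hessian :: "('a::real_inner \<Rightarrow> real) \<Rightarrow> 'a \<Rightarrow> 'a \<Rightarrow> 'a" where
  "hessian f x = frechet_derivative (gradient f) (at x)"

definition C2_bounded_hessian :: "('a::real_inner \<Rightarrow> real) \<Rightarrow> bool" where
  "C2_bounded_hessian f \<longleftrightarrow> (\<forall>x. f differentiable (at x)) \<and>
     (\<exists>H :: 'a \<Rightarrow> 'a \<Rightarrow>\<^sub>L 'a.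
        (\<forall>x. (gradient f has_derivative blinfun_apply (H x)) (at x)) \<and>
        continuous_on UNIV H \<and> bounded (range H))"

definition assumption_G :: "('a::real_inner \<Rightarrow> real) \<Rightarrow> bool" where
  "assumption_G \<Phi> \<longleftrightarrow>
     (\<exists>K. (\<forall>x. 0 \<le> \<Phi> x \<and> \<Phi> x \<le> K * (1 + (norm x)\<^sup>2)) \<and>
          (\<forall>x. \<Phi> differentiable (at x)) \<and>
          (\<forall>B. bounded B \<longrightarrow> (\<exists>L. L-lipschitz_on B (gradient \<Phi>))) \<and>
          (\<forall>x. norm (gradient \<Phi> x) \<le> K * (1 + norm x))) \<and>
     (\<exists>\<Phi>\<^sub>1 \<Phi>\<^sub>2. (\<forall>x. \<Phi> x = \<Phi>\<^sub>1 x + \<Phi>\<^sub>2 x) \<and>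
          convex_on UNIV \<Phi>\<^sub>1 \<and> bdd_below (range \<Phi>\<^sub>1) \<and>
          (\<forall>x. \<Phi>\<^sub>2 differentiable (at x) \<and> gradient \<Phi>\<^sub>2 differentiable (at x)) \<and>
          (\<exists>M. \<forall>x. \<bar>\<Phi>\<^sub>2 x\<bar> \<le> M \<and> norm (gradient \<Phi>\<^sub>2 x) \<le> M \<and> onorm (hessian \<Phi>\<^sub>2 x) \<le> M))"

definition gen_A :: "('a::real_inner \<Rightarrow> 'a) \<Rightarrow> ('a \<Rightarrow> real) \<Rightarrow> ('a \<Rightarrow> real) \<Rightarrow> 'a \<Rightarrow> real" where
  "gen_A \<Sigma> \<Phi> g x =
     op_trace (\<Sigma> \<circ> hessian g x) - x \<bullet> gradient g x - gradient \<Phi> x \<bullet> \<Sigma> (gradient g x)"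

section \<open>Measures and the space of square integrable functions\<close>

text \<open>The law \<open>N(0,\<Sigma>)\<close>, for positive definite \<open>\<Sigma>\<close>: positive definiteness makes every marginal in a
  direction \<open>q \<noteq> 0\<close> non-degenerate. The second parameter of \<^const>\<open>normal_density\<close> is the
  standard deviation.\<close>

definition centered_gaussian ::
    "('a::{real_inner, second_countable_topology} \<Rightarrow> 'a) \<Rightarrow> 'a measure \<Rightarrow> bool" where
  "centered_gaussian \<Sigma> M \<longleftrightarrow> prob_space M \<and> sets M = sets borel \<and>
     (\<forall>q. q \<noteq> 0 \<longrightarrow>
        distributed M lborel (\<lambda>x. q \<bullet> x) (normal_density 0 (sqrt (\<Sigma> q \<bullet> q))))"

definition gibbs_measure :: "('a \<Rightarrow> real) \<Rightarrow> 'a measure \<Rightarrow> 'a measure" where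
  "gibbs_measure \<Phi> M = density M (\<lambda>x. ennreal (exp (- \<Phi> x) / (\<integral>y. exp (- \<Phi> y) \<partial>M)))"

definition L2 :: "'b measure \<Rightarrow> ('b \<Rightarrow> real) set" where
  "L2 M = {f \<in> borel_measurable M. integrable M (\<lambda>z. (f z)\<^sup>2)}"

definition L2_norm :: "'b measure \<Rightarrow> ('b \<Rightarrow> real) \<Rightarrow> real" where
  "L2_norm M f = sqrt (\<integral>z. (f z)\<^sup>2 \<partial>M)"

section \<open>The Boomerang Sampler\<close>

text \<open>The family is indexed from 0 instead of 1. The operator series converge strongly.\<close>

definition boomerang_reflections ::
    "('a::real_inner \<Rightarrow> 'a) \<Rightarrow> (nat \<Rightarrow> 'a \<Rightarrow> 'a) \<Rightarrow> bool" where
  "boomerang_reflections \<Sigma> R \<longleftrightarrow>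
     (\<forall>n. linear (R n) \<and> (\<forall>v. R n (R n v) = v) \<and> (\<forall>v. norm (R n v) = norm v) \<and>
          (\<forall>q. \<Sigma> q \<bullet> q = R n (\<Sigma> (adjoint (R n) q)) \<bullet> q)) \<and>
     (\<forall>v. (\<lambda>n. (norm (v - R n v))\<^sup>2) sums (4 * (norm v)\<^sup>2)) \<and>
     (\<forall>v. (\<lambda>n. v - R n v) sums (2 *\<^sub>R v)) \<and>
     (\<forall>v. (\<lambda>n. (1/4) *\<^sub>R adjoint (\<lambda>u. u - R n u) (\<Sigma> (v - R n v))) sums \<Sigma> v) \<and>
     (\<forall>m n. m \<noteq> n \<longrightarrow> (\<forall>v. adjoint (\<lambda>u. u - R n u) (\<Sigma> (v - R m v)) = 0))"

definition boomerang_flow :: "real \<Rightarrow> 'a::real_inner \<times> 'a \<Rightarrow> 'a \<times> 'a" where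
  "boomerang_flow t = (\<lambda>(x, v).
     (cos t *\<^sub>R x + sin t *\<^sub>R v, - sin t *\<^sub>R x + cos t *\<^sub>R v))"

lemma boomerang_flow_0: "boomerang_flow 0 z = z"
  by (simp add: boomerang_flow_def split: prod.split)

lemma boomerang_flow_ode:
  "((\<lambda>t. boomerang_flow t z) has_vector_derivative
      (snd (boomerang_flow t z), - fst (boomerang_flow t z))) (at t)"
  unfolding boomerang_flow_def case_prod_beta fst_conv snd_conv
  by (auto intro!: derivative_eq_intros has_vector_derivative_Pair simp: algebra_simps)

definition event_rate ::
    "('a::real_inner \<Rightarrow> real) \<Rightarrow> (nat \<Rightarrow> 'a \<Rightarrow> 'a) \<Rightarrow> nat \<Rightarrow> 'a \<times> 'a \<Rightarrow> real" where
  "event_rate \<Phi> R n = (\<lambda>(x, v). max 0 (gradient \<Phi> x \<bullet> (v - R n v)) / 2)"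

definition total_rate ::
    "real \<Rightarrow> ('a::real_inner \<Rightarrow> real) \<Rightarrow> (nat \<Rightarrow> 'a \<Rightarrow> 'a) \<Rightarrow> 'a \<times> 'a \<Rightarrow> real" where
  "total_rate lam_r \<Phi> R z = lam_r + (\<Sum>n. event_rate \<Phi> R n z)"

text \<open>The process is built pathwise from independent inputs \<open>(e\<^sub>k, u\<^sub>k, w\<^sub>k)\<close>, one triple per jump:
  \<open>e\<^sub>k\<close> is standard exponential, \<open>u\<^sub>k\<close> is uniform on \<open>[0,1)\<close> and \<open>w\<^sub>k\<close> has law \<open>\<nu>\<^sub>0\<close>. The next jump takes
  place when the total rate, integrated along the flow, reaches \<open>e\<^sub>k\<close>. The variable \<open>u\<^sub>k\<close> selects
  the type of the jump with probability proportional to its rate: refreshment to the velocity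
  \<open>w\<^sub>k\<close> on \<open>u\<^sub>k \<Lambda> < \<lambda>\<^sub>r\<close>, and \<open>R\<^sub>n\<close> on \<open>\<lambda>\<^sub>r + \<lambda>\<^sub>0 + \<dots> + \<lambda>\<^bsub>n-1\<^esub> \<le> u\<^sub>k \<Lambda> < \<lambda>\<^sub>r + \<lambda>\<^sub>0 + \<dots> + \<lambda>\<^sub>n\<close>,
  where \<open>\<Lambda>\<close> is the total rate.\<close>

definition waiting_time ::
    "real \<Rightarrow> ('a::real_inner \<Rightarrow> real) \<Rightarrow> (nat \<Rightarrow> 'a \<Rightarrow> 'a) \<Rightarrow> 'a \<times> 'a \<Rightarrow> real \<Rightarrow> real" where
  "waiting_time lam_r \<Phi> R z e =
     Inf {t. 0 \<le> t \<and> e \<le> (LINT s:{0..t}|lborel. total_rate lam_r \<Phi> R (boomerang_flow s z))}"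

definition post_jump ::
    "real \<Rightarrow> ('a::real_inner \<Rightarrow> real) \<Rightarrow> (nat \<Rightarrow> 'a \<Rightarrow> 'a) \<Rightarrow> 'a \<times> 'a \<Rightarrow> real \<Rightarrow> 'a \<Rightarrow> 'a \<times> 'a" where
  "post_jump lam_r \<Phi> R z u w =
     (if u * total_rate lam_r \<Phi> R z < lam_r then (fst z, w)
      else (fst z, R (LEAST n. u * total_rate lam_r \<Phi> R z < lam_r + (\<Sum>i\<le>n. event_rate \<Phi> R i z)) (snd z)))"

text \<open>The time of the \<open>k\<close>-th jump and the state immediately after it.\<close>

primrec jump_chain ::
    "real \<Rightarrow> ('a::real_inner \<Rightarrow> real) \<Rightarrow> (nat \<Rightarrow> 'a \<Rightarrow> 'a) \<Rightarrow> 'a \<times> 'a \<Rightarrow>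
     (nat \<Rightarrow> real \<times> real \<times> 'a) \<Rightarrow> nat \<Rightarrow> real \<times> ('a \<times> 'a)" where
  "jump_chain lam_r \<Phi> R z \<omega> 0 = (0, z)"
| "jump_chain lam_r \<Phi> R z \<omega> (Suc k) =
     (let (s, y) = jump_chain lam_r \<Phi> R z \<omega> k; (e, u, w) = \<omega> k;
          t = waiting_time lam_r \<Phi> R y e
      in (s + t, post_jump lam_r \<Phi> R (boomerang_flow t y) u w))"

text \<open>State \<open>(X\<^sub>t, V\<^sub>t)\<close> started at \<open>z\<close>. The last branch concerns only paths whose jump times
  accumulate before \<open>t\<close>; for the Boomerang Sampler they form a null set.\<close>

definition boomerang_path ::
    "real \<Rightarrow> ('a::real_inner \<Rightarrow> real) \<Rightarrow> (nat \<Rightarrow> 'a \<Rightarrow> 'a) \<Rightarrow> 'a \<times> 'a \<Rightarrow>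
     (nat \<Rightarrow> real \<times> real \<times> 'a) \<Rightarrow> real \<Rightarrow> 'a \<times> 'a" where
  "boomerang_path lam_r \<Phi> R z \<omega> t =
     (if \<exists>k. t < fst (jump_chain lam_r \<Phi> R z \<omega> (Suc k))
      then let k = (LEAST k. t < fst (jump_chain lam_r \<Phi> R z \<omega> (Suc k)));
               (s, y) = jump_chain lam_r \<Phi> R z \<omega> k
           in boomerang_flow (t - s) y
      else z)"

definition noise :: "'a measure \<Rightarrow> (nat \<Rightarrow> real \<times> real \<times> 'a) measure" where
  "noise \<nu>\<^sub>0 = (\<Pi>\<^sub>M k\<in>UNIV.
     density lborel (exponential_density 1) \<Otimes>\<^sub>M (uniform_measure lborel {0..<1} \<Otimes>\<^sub>M \<nu>\<^sub>0))"

text \<open>The function \<open>P\<^sub>t f (x,v) = E\<^bsub>(x,v)\<^esub>[f (X\<^sub>t, V\<^sub>t)]\<close>. Since \<open>\<mu>\<close> is invariant, for \<open>f\<close> square integrable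
  the expectation exists \<open>\<mu>\<close>-almost everywhere and represents the continuous extension of the
  semigroup from bounded measurable functions to the whole \<open>L\<^sup>2\<close> space.\<close>

definition boomerang_semigroup ::
    "real \<Rightarrow> ('a::real_inner \<Rightarrow> real) \<Rightarrow> (nat \<Rightarrow> 'a \<Rightarrow> 'a) \<Rightarrow> 'a measure \<Rightarrow>
     real \<Rightarrow> ('a \<times> 'a \<Rightarrow> real) \<Rightarrow> 'a \<times> 'a \<Rightarrow> real" where
  "boomerang_semigroup lam_r \<Phi> R \<nu>\<^sub>0 t f z =
     (\<integral>\<omega>. f (boomerang_path lam_r \<Phi> R z \<omega> t) \<partial>(noise \<nu>\<^sub>0))"

end

theory Submission imports Defs begin

text \<open>Write \<open>P\<^sub>t\<close> for the semigroup and \<open>g\<^sub>t(x)\<close> for the average of \<open>P\<^sub>t f(x, \<cdot>)\<close> over the velocity. Expanding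
  \<open>P\<^sub>t\<close> over the number of jumps shows that it is self-dual up to the velocity flip with respect to
  \<open>exp (- \<Phi>) d(\<nu>\<^sub>0 \<times> \<nu>\<^sub>0)\<close>; hence \<open>\<mu>\<close> is invariant. By Jensen's inequality at the jumps, the loss of
  \<open>L\<^sup>2\<close> norm \<open>\<parallel>f\<parallel>\<^sup>2 - \<parallel>P\<^sub>2 f\<parallel>\<^sup>2\<close> dominates two quantities: the time integral of the velocity variance of
  \<open>P\<^sub>s f\<close> (refreshments), and the square of \<open>P\<^sub>t f(z) - P\<^bsub>t-s\<^esub> f(flow\<^sub>s z)\<close>, because for \<open>s\<close> of order
  \<open>1 / (1 + \<parallel>z\<parallel>)\<close> the flow survives up to time \<open>s\<close> with a probability bounded below on bounded
  velocities. Together they bound the energy of \<open>g\<^sub>t(x) - g\<^sub>t(y)\<close> over pairs \<open>x, y\<close> joined by a rotation of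
  such an angle. The reversible chain on positions that makes these rotations satisfies a Poincare
  inequality: inside a ball a quarter turn, which exchanges position and velocity, is a bounded number
  of such rotations, and outside of it \<open>exp (a \<parallel>x\<parallel>\<^sup>2 / 2)\<close> is a Lyapunov function, since by convexity of
  \<open>\<Phi>\<^sub>1\<close> the chain, averaged over \<open>v\<close> and \<open>- v\<close>, moves inward. So the
  variance satisfies \<open>Var (P\<^sub>2 f) \<le> C (Var f - Var (P\<^sub>2 f))\<close>.\<close>

section \<open>Piecewise deterministic processes\<close>

text \<open>The rate and the gradient of \<open>\<Phi>\<close> are unbounded, and this shapes every
  step. On an arc of angle about \<open>1 / (1 + norm z)\<close> the accumulated rate and the change
  of \<open>\<Phi>\<close> are bounded by affine functions of the velocity norm alone. Rotation by
  such an angle must still preserve the Gaussian product, so the angle is constant on shells that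
  the flow leaves invariant, and it divides a quarter turn exactly. The chain of positions carries
  the symmetric weight \<open>exp (- (\<Phi>\<^sub>1 x + \<Phi>\<^sub>1 y) / 2)\<close>, which makes
  it reversible without an acceptance step; Gaussian moments (Fernique) absorb the large velocities
  removed by a cutoff. Refreshments control only a time integral of the velocity variance, and the
  delay along an arc depends on \<open>z\<close>; hence times are averaged over
  \<open>[1,2]\<close>, which explains the horizon 2. No generator or core is used: the semigroup is
  handled through sums and integrals of nonnegative functions in \<open>ennreal\<close>, where
  exchanges are free and non-explosion is a statement about total mass. Bounded functions follow by
  adding a constant, square integrable ones by truncation and Fatou's lemma.\<close>

locale pdmp = N: prob_space N
  for N :: "'n measure" and flow :: "real \<Rightarrow> 'z::topological_space \<Rightarrow> 'z"
    and rate :: "'z \<Rightarrow> real" and jump :: "'z \<Rightarrow> 'n \<Rightarrow> 'z" and lam :: real +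
  assumes flow_0 [simp]: "flow 0 z = z"
    and flow_add: "flow (s + t) z = flow t (flow s z)"
    and flow_measurable_pair: "(\<lambda>(t, z). flow t z) \<in> borel \<Otimes>\<^sub>M borel \<rightarrow>\<^sub>M borel"
    and rate_cont: "continuous_on UNIV (\<lambda>t. rate (flow t z))"
    and rate_measurable [measurable]: "rate \<in> borel_measurable borel"
    and rate_ge: "lam \<le> rate z"
    and lam_pos: "0 < lam"
    and jump_measurable_pair: "(\<lambda>(z, \<xi>). jump z \<xi>) \<in> borel \<Otimes>\<^sub>M N \<rightarrow>\<^sub>M borel"
begin

lemma flow_measurable [measurable (raw)]:
  assumes "f \<in> borel_measurable M" "g \<in> M \<rightarrow>\<^sub>M borel"
  shows "(\<lambda>x. flow (f x) (g x)) \<in> M \<rightarrow>\<^sub>M borel"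
  using measurable_compose[OF measurable_Pair[OF assms] flow_measurable_pair] by simp

lemma jump_measurable [measurable (raw)]:
  assumes "f \<in> M \<rightarrow>\<^sub>M borel" "g \<in> M \<rightarrow>\<^sub>M N"
  shows "(\<lambda>x. jump (f x) (g x)) \<in> M \<rightarrow>\<^sub>M borel"
  using measurable_compose[OF measurable_Pair[OF assms] jump_measurable_pair] by simp

lemma rate_pos: "0 < rate z" using rate_ge[of z] lam_pos by simp
lemma rate_nonneg: "0 \<le> rate z" using rate_pos[of z] by simp

section \<open>Accumulated rate along the flow\<close>

definition cum :: "real \<Rightarrow> 'z \<Rightarrow> real" where
  "cum t z = (LINT s:{0..t}|lborel. rate (flow s z))"

text \<open>A primitive on the whole line replaces \<open>cum\<close> in derivative arguments:
  \<open>cum\<close> is zero for negative \<open>t\<close> and therefore not differentiable at 0,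
  whereas the two-sided derivative rules apply to \<open>H\<close>.\<close>

lemma cum_primitive:
  obtains H where "\<And>t. (H has_real_derivative rate (flow t z)) (at t)" "\<And>t. 0 \<le> t \<Longrightarrow> cum t z = H t" "H 0 = 0"
proof -
  obtain F where F: "\<And>t. (F has_vector_derivative rate (flow t z)) (at t)"
    using einterval_antiderivative[of "-\<infinity>" "\<infinity>" "\<lambda>t. rate (flow t z)"] rate_cont[of z]
    by (auto simp: continuous_on_eq_continuous_at)
  then have F': "\<And>t. (F has_real_derivative rate (flow t z)) (at t)"
    by (simp add: has_real_derivative_iff_has_vector_derivative)
  show ?thesis
  proof (rule that[of "\<lambda>t. F t - F 0"])
    show "((\<lambda>t. F t - F 0) has_real_derivative rate (flow t z)) (at t)" for t
      using F'[of t] by (auto intro!: derivative_eq_intros)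
    show "cum t z = F t - F 0" if "0 \<le> t" for t
      unfolding cum_def set_lebesgue_integral_def
      using integral_FTC_Icc_real[of 0 t F "\<lambda>t. rate (flow t z)"] that F' rate_cont[of z]
      by (auto simp: continuous_on_eq_continuous_at mult.commute)
  qed simp
qed

lemma cum_0 [simp]: "cum 0 z = 0"
  by (rule cum_primitive[of z]) simp

lemma cum_measurable_pair [measurable]: "(\<lambda>(t, z). cum t z) \<in> borel_measurable (borel \<Otimes>\<^sub>M borel)"
proof -
  have "(\<lambda>p. LBINT s. (if 0 \<le> s \<and> s \<le> fst p then rate (flow s (snd p)) else 0))
      \<in> borel_measurable (borel \<Otimes>\<^sub>M (borel :: 'z measure))"
    by measurable
  also have "(\<lambda>p. LBINT s. (if 0 \<le> s \<and> s \<le> fst p then rate (flow s (snd p)) else 0)) = (\<lambda>(t, z). cum t z)"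
    by (auto simp: cum_def set_lebesgue_integral_def fun_eq_iff indicator_def intro!: Bochner_Integration.integral_cong)
  finally show ?thesis .
qed

text \<open>As functions of \<open>t\<close>, both sides are primitives of the rate along the same
  orbit, so their difference is constant.\<close>

lemma cum_add:
  assumes "0 \<le> s" "0 \<le> t"
  shows "cum (s + t) z = cum s z + cum t (flow s z)"
proof -
  obtain H where H: "\<And>t. (H has_real_derivative rate (flow t z)) (at t)" "\<And>t. 0 \<le> t \<Longrightarrow> cum t z = H t"
    by (rule cum_primitive[of z]) blast
  obtain K where K: "\<And>t. (K has_real_derivative rate (flow t (flow s z))) (at t)"
      "\<And>t. 0 \<le> t \<Longrightarrow> cum t (flow s z) = K t"
    by (rule cum_primitive[of "flow s z"]) blast
  have "((\<lambda>t. H (s + t) - K t) has_real_derivative 0) (at t)" for t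
  proof -
    have "((\<lambda>t. H (s + t)) has_real_derivative rate (flow (s + t) z)) (at t)"
      using H(1)[of "t + s"] unfolding DERIV_shift by (simp add: add.commute)
    then show ?thesis using K(1)[of t] by (auto intro!: derivative_eq_intros simp: flow_add)
  qed
  then have "H (s + t) - K t = H (s + 0) - K 0"
    using DERIV_isconst_all[of "\<lambda>t. H (s + t) - K t"] by blast
  moreover have "K 0 = 0" using K(2)[of 0] by simp
  ultimately show ?thesis using assms H(2) K(2) by simp
qed

lemma cum_bounds:
  assumes "0 \<le> t"
  shows "lam * t \<le> cum t z" and "(\<And>s. 0 \<le> s \<Longrightarrow> s \<le> t \<Longrightarrow> rate (flow s z) \<le> B) \<Longrightarrow> cum t z \<le> B * t"
proof -
  obtain H where H: "\<And>t. (H has_real_derivative rate (flow t z)) (at t)" "\<And>t. 0 \<le> t \<Longrightarrow> cum t z = H t"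
    by (rule cum_primitive[of z]) blast
  have H0: "H 0 = 0" using H(2)[of 0] by simp
  have *: "t = 0 \<or> (\<exists>s. 0 < s \<and> s < t \<and> H t = t * rate (flow s z))"
    using MVT2[of 0 t H "\<lambda>s. rate (flow s z)"] H(1) H0 assms by force
  show "lam * t \<le> cum t z"
    using * H0 H(2)[of t] assms rate_ge mult_right_mono[of lam "rate _" t] by (auto simp: mult.commute)
  assume B: "\<And>s. 0 \<le> s \<Longrightarrow> s \<le> t \<Longrightarrow> rate (flow s z) \<le> B"
  show "cum t z \<le> B * t"
    using * H0 H(2)[of t] assms B mult_right_mono[of "rate _" B t] by (auto simp: mult.commute)
qed

lemma cum_nonneg: "0 \<le> t \<Longrightarrow> 0 \<le> cum t z"
  using cum_bounds(1)[of t z] lam_pos by (meson mult_nonneg_nonneg less_imp_le order_trans)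

lemma cum_strict_mono:
  assumes "0 \<le> s" "s < t"
  shows "cum s z < cum t z"
  using cum_add[of s "t - s" z] cum_bounds(1)[of "t - s" "flow s z"] assms lam_pos
  by (smt (verit) mult_pos_pos)

lemma cum_mono: "0 \<le> s \<Longrightarrow> s \<le> t \<Longrightarrow> cum s z \<le> cum t z"
  using cum_strict_mono[of s t z] by (cases "s = t") auto

text \<open>The integrand is the derivative of \<open>- exp (- H s)\<close>. It is the density of
  the first jump time.\<close>

lemma nn_integral_first_jump_density:
  assumes "0 \<le> t"
  shows "(\<integral>\<^sup>+s. ennreal (exp (- cum s z) * rate (flow s z)) * indicator {0..t} s \<partial>lborel)
    = ennreal (1 - exp (- cum t z))"
proof -
  obtain H where H: "\<And>t. (H has_real_derivative rate (flow t z)) (at t)" "\<And>t. 0 \<le> t \<Longrightarrow> cum t z = H t"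
    by (rule cum_primitive[of z]) blast
  have H0: "H 0 = 0" using H(2)[of 0] by simp
  have [measurable]: "H \<in> borel_measurable borel"
    using H(1) by (intro borel_measurable_continuous_onI) (meson DERIV_isCont continuous_at_imp_continuous_on)
  have "(\<integral>\<^sup>+s. ennreal (exp (- cum s z) * rate (flow s z)) * indicator {0..t} s \<partial>lborel)
      = (\<integral>\<^sup>+s. ennreal (exp (- H s) * rate (flow s z)) * indicator {0..t} s \<partial>lborel)"
    by (intro nn_integral_cong) (auto simp: H(2) indicator_def)
  also have "\<dots> = ennreal (- exp (- H t) - (- exp (- H 0)))"
    by (rule nn_integral_FTC_Icc)
      (auto intro!: derivative_eq_intros H(1) simp: rate_nonneg assms)
  finally show ?thesis using H0 H(2)[OF assms] by simp
qed

text \<open>The factor \<open>rate z\<close> is kept because densities of jump times always carry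
  it, and because for several competing jump mechanisms the product is the plain sum of their
  contributions, with no division by the total rate.\<close>

definition J :: "('z \<Rightarrow> ennreal) \<Rightarrow> 'z \<Rightarrow> ennreal" where
  "J h z = ennreal (rate z) * (\<integral>\<^sup>+\<xi>. h (jump z \<xi>) \<partial>N)"

text \<open>Duhamel operator: \<open>s\<close> is the first jump time, the exponential is the
  survival up to it, and \<open>h\<close> receives the remaining time \<open>t - s\<close>.\<close>

definition first_jump :: "(real \<Rightarrow> 'z \<Rightarrow> ennreal) \<Rightarrow> real \<Rightarrow> 'z \<Rightarrow> ennreal" where
  "first_jump h t z =
     (\<integral>\<^sup>+s. ennreal (exp (- cum s z)) * J (h (t - s)) (flow s z) * indicator {0..t} s \<partial>lborel)"

text \<open>\<open>S k f t z\<close> is the expectation of \<open>f\<close> at time \<open>t\<close> on the event of exactly \<open>k\<close> jumps before \<open>t\<close>.\<close>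

primrec S :: "nat \<Rightarrow> ('z \<Rightarrow> ennreal) \<Rightarrow> real \<Rightarrow> 'z \<Rightarrow> ennreal" where
  "S 0 f = (\<lambda>t z. ennreal (exp (- cum t z)) * f (flow t z))"
| "S (Suc k) f = first_jump (S k f)"

text \<open>A priori only a sub-Markov family, the minimal solution of the renewal equation. That no
  mass is lost is non-explosion, proved in \<open>Pt_one\<close>.\<close>

definition Pt :: "('z \<Rightarrow> ennreal) \<Rightarrow> real \<Rightarrow> 'z \<Rightarrow> ennreal" where
  "Pt f t z = (\<Sum>k. S k f t z)"

lemma J_measurable [measurable (raw)]:
  assumes [measurable]: "(\<lambda>(p, z). f p z) \<in> borel_measurable (M \<Otimes>\<^sub>M borel)" "g \<in> M \<rightarrow>\<^sub>M borel"
  shows "(\<lambda>p. J (f p) (g p)) \<in> borel_measurable M"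
proof -
  have "(\<lambda>(p, \<xi>). f p (jump (g p) \<xi>)) \<in> borel_measurable (M \<Otimes>\<^sub>M N)"
    using measurable_compose[of "\<lambda>(p, \<xi>). (p, jump (g p) \<xi>)" "M \<Otimes>\<^sub>M N" "M \<Otimes>\<^sub>M borel" "\<lambda>(p, z). f p z"]
    by (simp add: split_beta')
  then show ?thesis unfolding J_def by measurable
qed

lemma first_jump_measurable:
  assumes [measurable]: "(\<lambda>(p, t, z). h p t z) \<in> borel_measurable (M \<Otimes>\<^sub>M borel \<Otimes>\<^sub>M borel)"
  shows "(\<lambda>(p, t, z). first_jump (h p) t z) \<in> borel_measurable (M \<Otimes>\<^sub>M borel \<Otimes>\<^sub>M borel)"
proof -
  have 1: "(\<lambda>((q, s), z). h (fst q) (fst (snd q) - s) z) \<in> borel_measurable (((M \<Otimes>\<^sub>M borel \<Otimes>\<^sub>M (borel::'z measure)) \<Otimes>\<^sub>M lborel) \<Otimes>\<^sub>M borel)"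
    using measurable_compose[of "\<lambda>((q, s), z). (fst q, fst (snd q) - s, z)" "((M \<Otimes>\<^sub>M borel \<Otimes>\<^sub>M (borel::'z measure)) \<Otimes>\<^sub>M lborel) \<Otimes>\<^sub>M borel"
      "M \<Otimes>\<^sub>M borel \<Otimes>\<^sub>M borel" "\<lambda>(p, t, z). h p t z", OF _ assms]
    by (simp add: split_beta')
  have [measurable]: "(\<lambda>(q, s). J (h (fst q) (fst (snd q) - s)) (flow s (snd (snd q)))) \<in> borel_measurable ((M \<Otimes>\<^sub>M borel \<Otimes>\<^sub>M (borel::'z measure)) \<Otimes>\<^sub>M lborel)"
    using J_measurable[where f="\<lambda>(q, s) z. h (fst q) (fst (snd q) - s) z" and g="\<lambda>(q, s). flow s (snd (snd q))"
       and M="(M \<Otimes>\<^sub>M borel \<Otimes>\<^sub>M (borel::'z measure)) \<Otimes>\<^sub>M lborel"] 1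
    by (simp add: split_beta')
  have "(\<lambda>q. \<integral>\<^sup>+s. ennreal (exp (- cum s (snd (snd q)))) * J (h (fst q) (fst (snd q) - s)) (flow s (snd (snd q))) *
     (if 0 \<le> s \<and> s \<le> fst (snd q) then 1 else 0) \<partial>lborel) \<in> borel_measurable (M \<Otimes>\<^sub>M borel \<Otimes>\<^sub>M (borel::'z measure))"
    by measurable
  also have "(\<lambda>q. \<integral>\<^sup>+s. ennreal (exp (- cum s (snd (snd q)))) * J (h (fst q) (fst (snd q) - s)) (flow s (snd (snd q))) *
     (if 0 \<le> s \<and> s \<le> fst (snd q) then 1 else 0) \<partial>lborel) = (\<lambda>(p, t, z). first_jump (h p) t z)"
    by (auto simp: first_jump_def fun_eq_iff indicator_def intro!: nn_integral_cong)
  finally show ?thesis .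
qed

text \<open>The parameter \<open>p\<close> is needed because \<open>f\<close> will itself depend on
  a time over which one integrates, as in \<open>S k (H (t - s)) s z\<close>.\<close>

lemma S_measurable_triple:
  assumes [measurable]: "(\<lambda>(p, z). f p z) \<in> borel_measurable (M \<Otimes>\<^sub>M borel)"
  shows "(\<lambda>(p, t, z). S k (f p) t z) \<in> borel_measurable (M \<Otimes>\<^sub>M borel \<Otimes>\<^sub>M borel)"
proof (induction k)
  case 0
  have "(\<lambda>(p, t, z). f p (flow t z)) \<in> borel_measurable (M \<Otimes>\<^sub>M borel \<Otimes>\<^sub>M borel)"
    using measurable_compose[of "\<lambda>(p, t, z). (p, flow t z)" "M \<Otimes>\<^sub>M borel \<Otimes>\<^sub>M borel" "M \<Otimes>\<^sub>M borel" "\<lambda>(p, z). f p z"]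
    by (simp add: split_beta')
  then show ?case by (simp add: split_beta')
next
  case (Suc k)
  then show ?case using first_jump_measurable[of "\<lambda>p. S k (f p)" M] by simp
qed

lemma S_measurable [measurable (raw)]:
  assumes "(\<lambda>(p, z). f p z) \<in> borel_measurable (M \<Otimes>\<^sub>M borel)" "a \<in> borel_measurable M" "b \<in> M \<rightarrow>\<^sub>M borel"
  shows "(\<lambda>p. S k (f p) (a p) (b p)) \<in> borel_measurable M"
proof -
  have "(\<lambda>p. (p, a p, b p)) \<in> M \<rightarrow>\<^sub>M (M \<Otimes>\<^sub>M borel \<Otimes>\<^sub>M borel)"
    using assms by measurable
  from measurable_compose[OF this S_measurable_triple[OF assms(1), of k]] show ?thesis by simp
qed

lemma Pt_measurable [measurable (raw)]:
  assumes "(\<lambda>(p, z). f p z) \<in> borel_measurable (M \<Otimes>\<^sub>M borel)" "a \<in> borel_measurable M" "b \<in> M \<rightarrow>\<^sub>M borel"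
  shows "(\<lambda>p. Pt (f p) (a p) (b p)) \<in> borel_measurable M"
  unfolding Pt_def using S_measurable[OF assms] by measurable

end

lemma AE_lborel_neq: "AE x in lborel. x \<noteq> (c::real)"
  by (rule AE_I[of _ _ "{c}"]) auto

lemma nn_integral_lborel_shift:
  fixes f :: "real \<Rightarrow> ennreal"
  assumes "f \<in> borel_measurable borel"
  shows "(\<integral>\<^sup>+x. f x \<partial>lborel) = (\<integral>\<^sup>+x. f (c + x) \<partial>lborel)"
  using nn_integral_real_affine[of f 1 c] assms by simp

context pdmp begin

lemma measurable_fun2:
  assumes "(\<lambda>(t, z). h t z) \<in> borel_measurable (borel \<Otimes>\<^sub>M borel)" "a \<in> borel_measurable M" "b \<in> M \<rightarrow>\<^sub>M borel"
  shows "(\<lambda>p. h (a p :: real) (b p :: 'z) :: ennreal) \<in> borel_measurable M"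
  using measurable_compose[OF measurable_Pair[OF assms(2,3)] assms(1)] by simp

lemma first_jump_measurable' [measurable (raw)]:
  assumes h: "(\<lambda>(t, z). h t z) \<in> borel_measurable (borel \<Otimes>\<^sub>M borel)" and "a \<in> borel_measurable M" "b \<in> M \<rightarrow>\<^sub>M borel"
  shows "(\<lambda>p. first_jump h (a p) (b p)) \<in> borel_measurable M"
proof -
  have "(\<lambda>(p, t, z). h t z) \<in> borel_measurable (borel \<Otimes>\<^sub>M borel \<Otimes>\<^sub>M borel)"
    using h by measurable
  from first_jump_measurable[OF this]
  have 1: "(\<lambda>(p::'z, t, z). first_jump h t z) \<in> borel_measurable (borel \<Otimes>\<^sub>M borel \<Otimes>\<^sub>M borel)" .
  have "(\<lambda>p. (b p, a p, b p)) \<in> M \<rightarrow>\<^sub>M (borel \<Otimes>\<^sub>M borel \<Otimes>\<^sub>M borel)" using assms by measurable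
  from measurable_compose[OF this 1] show ?thesis by simp
qed

lemma J_mono: "(\<And>z. f z \<le> g z) \<Longrightarrow> J f z \<le> J g z"
  unfolding J_def by (intro mult_left_mono nn_integral_mono) auto

lemma J_add:
  assumes [measurable]: "f \<in> borel_measurable borel" "g \<in> borel_measurable borel"
  shows "J (\<lambda>z. f z + g z) y = J f y + J g y"
  unfolding J_def by (subst nn_integral_add) (auto simp: distrib_left)

lemma J_cmult:
  assumes [measurable]: "f \<in> borel_measurable borel"
  shows "J (\<lambda>z. c * f z) y = c * J f y"
  unfolding J_def by (subst nn_integral_cmult) (auto simp: ac_simps)

lemma J_multc:
  assumes [measurable]: "f \<in> borel_measurable borel"
  shows "J (\<lambda>z. f z * c) y = J f y * c"
  using J_cmult[OF assms, of c y] by (simp add: mult.commute)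

lemma J_one: "J (\<lambda>_. 1) y = ennreal (rate y)"
  by (simp add: J_def N.emeasure_space_1)

lemma J_nn_integral:
  assumes M: "sigma_finite_measure M" and [measurable]: "(\<lambda>(p, z). f p z) \<in> borel_measurable (M \<Otimes>\<^sub>M borel)"
  shows "J (\<lambda>z. \<integral>\<^sup>+p. f p z \<partial>M) y = (\<integral>\<^sup>+p. J (f p) y \<partial>M)"
proof -
  interpret M: sigma_finite_measure M by fact
  interpret pair_sigma_finite N M by unfold_locales
  have [measurable]: "(\<lambda>(\<xi>, p). f p (jump y \<xi>)) \<in> borel_measurable (N \<Otimes>\<^sub>M M)"
    using measurable_compose[of "\<lambda>(\<xi>, p). (p, jump y \<xi>)" "N \<Otimes>\<^sub>M M" "M \<Otimes>\<^sub>M borel" "\<lambda>(p, z). f p z"]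
    by (simp add: split_beta')
  have "(\<integral>\<^sup>+\<xi>. \<integral>\<^sup>+p. f p (jump y \<xi>) \<partial>M \<partial>N) = (\<integral>\<^sup>+p. \<integral>\<^sup>+\<xi>. f p (jump y \<xi>) \<partial>N \<partial>M)"
    by (rule Fubini'[symmetric]) simp
  moreover have [measurable]: "(\<lambda>p. \<integral>\<^sup>+\<xi>. f p (jump y \<xi>) \<partial>N) \<in> borel_measurable M"
    using measurable_compose[of "\<lambda>(p, \<xi>). (p, jump y \<xi>)" "M \<Otimes>\<^sub>M N" "M \<Otimes>\<^sub>M borel" "\<lambda>(p, z). f p z"]
    by (intro N.borel_measurable_nn_integral) (simp add: split_beta')
  ultimately show ?thesis unfolding J_def by (simp add: nn_integral_cmult)
qed

lemma first_jump_mono: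
  assumes "\<And>s z. 0 \<le> s \<Longrightarrow> s \<le> t \<Longrightarrow> h s z \<le> k s z"
  shows "first_jump h t z \<le> first_jump k t z"
  unfolding first_jump_def
  by (intro nn_integral_mono) (auto simp: indicator_def intro!: mult_left_mono J_mono assms)

lemma first_jump_cong:
  assumes "\<And>s z. 0 \<le> s \<Longrightarrow> s \<le> t \<Longrightarrow> h s z = k s z"
  shows "first_jump h t z = first_jump k t z"
  using assms by (intro antisym first_jump_mono) auto

lemma first_jump_add:
  assumes [measurable]: "(\<lambda>(t, z). h t z) \<in> borel_measurable (borel \<Otimes>\<^sub>M borel)"
    "(\<lambda>(t, z). k t z) \<in> borel_measurable (borel \<Otimes>\<^sub>M borel)"
  shows "first_jump (\<lambda>t z. h t z + k t z) t z = first_jump h t z + first_jump k t z"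
proof -
  note [measurable (raw)] = measurable_fun2[OF assms(1)] measurable_fun2[OF assms(2)]
  have [measurable]: "\<And>t. h t \<in> borel_measurable borel" "\<And>t. k t \<in> borel_measurable borel" by measurable
  show ?thesis
    unfolding first_jump_def
    by (subst nn_integral_add[symmetric]) (auto simp: J_add distrib_left distrib_right)
qed

lemma first_jump_cmult:
  assumes [measurable]: "(\<lambda>(t, z). h t z) \<in> borel_measurable (borel \<Otimes>\<^sub>M borel)"
  shows "first_jump (\<lambda>t z. c * h t z) t z = c * first_jump h t z"
proof -
  note [measurable (raw)] = measurable_fun2[OF assms(1)]
  have [measurable]: "\<And>t. h t \<in> borel_measurable borel" by measurable
  show ?thesis
    unfolding first_jump_def
    by (subst nn_integral_cmult[symmetric]) (auto simp: J_cmult ac_simps)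
qed

lemma first_jump_nn_integral:
  assumes M: "sigma_finite_measure M"
    and [measurable]: "(\<lambda>(p, t, z). h p t z) \<in> borel_measurable (M \<Otimes>\<^sub>M borel \<Otimes>\<^sub>M borel)"
  shows "first_jump (\<lambda>t z. \<integral>\<^sup>+p. h p t z \<partial>M) t z = (\<integral>\<^sup>+p. first_jump (h p) t z \<partial>M)"
proof -
  interpret M: sigma_finite_measure M by fact
  interpret pair_sigma_finite lborel M by unfold_locales
  have m1: "(\<lambda>(p, z). h p s z) \<in> borel_measurable (M \<Otimes>\<^sub>M borel)" for s
    using measurable_compose[of "\<lambda>(p, z). (p, s, z)" "M \<Otimes>\<^sub>M borel" "M \<Otimes>\<^sub>M borel \<Otimes>\<^sub>M borel" "\<lambda>(p, t, z). h p t z", OF _ assms(2)]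
    by (simp add: split_beta')
  have [measurable]: "(\<lambda>(s, p). J (h p (t - s)) (flow s z)) \<in> borel_measurable (lborel \<Otimes>\<^sub>M M)"
    using J_measurable[where f="\<lambda>(s, p) z. h p (t - s) z" and g="\<lambda>(s, p). flow s z" and M="lborel \<Otimes>\<^sub>M M"]
      measurable_compose[of "\<lambda>((s, p), z). (p, t - s, z)" "(lborel \<Otimes>\<^sub>M M) \<Otimes>\<^sub>M borel" "M \<Otimes>\<^sub>M borel \<Otimes>\<^sub>M borel" "\<lambda>(p, t, z). h p t z", OF _ assms(2)]
    by (simp add: split_beta')
  have "first_jump (\<lambda>t z. \<integral>\<^sup>+p. h p t z \<partial>M) t z
     = (\<integral>\<^sup>+s. \<integral>\<^sup>+p. ennreal (exp (- cum s z)) * J (h p (t - s)) (flow s z) * indicator {0..t} s \<partial>M \<partial>lborel)"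
    unfolding first_jump_def J_nn_integral[OF M m1]
    by (intro nn_integral_cong) (simp add: nn_integral_cmult nn_integral_multc)
  also have "\<dots> = (\<integral>\<^sup>+p. \<integral>\<^sup>+s. ennreal (exp (- cum s z)) * J (h p (t - s)) (flow s z) * indicator {0..t} s \<partial>lborel \<partial>M)"
    by (rule Fubini'[symmetric]) simp
  finally show ?thesis unfolding first_jump_def .
qed

lemma S_mono: "(\<And>z. f z \<le> g z) \<Longrightarrow> S k f t z \<le> S k g t z"
  by (induction k arbitrary: t z) (auto intro!: mult_left_mono first_jump_mono)

lemma S_cmult:
  assumes [measurable]: "f \<in> borel_measurable borel"
  shows "S k (\<lambda>z. c * f z) t z = c * S k f t z"
proof (induction k arbitrary: t z)
  case (Suc k)
  then have "S k (\<lambda>z. c * f z) = (\<lambda>t z. c * S k f t z)" by auto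
  then show ?case by (simp add: first_jump_cmult)
qed (simp add: ac_simps)

lemma S_nn_integral:
  assumes M: "sigma_finite_measure M" and [measurable]: "(\<lambda>(p, z). f p z) \<in> borel_measurable (M \<Otimes>\<^sub>M borel)"
  shows "S k (\<lambda>z. \<integral>\<^sup>+p. f p z \<partial>M) t z = (\<integral>\<^sup>+p. S k (f p) t z \<partial>M)"
proof (induction k arbitrary: t z)
  case 0
  have "(\<lambda>p. f p (flow t z)) \<in> borel_measurable M" by measurable
  then show ?case by (simp add: nn_integral_cmult)
next
  case (Suc k)
  then have "S k (\<lambda>z. \<integral>\<^sup>+p. f p z \<partial>M) = (\<lambda>t z. \<integral>\<^sup>+p. S k (f p) t z \<partial>M)" by auto
  then show ?case using first_jump_nn_integral[OF M S_measurable_triple[OF assms(2), of k]] by simp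
qed

text \<open>A countable sum is an integral over the counting measure, so the Tonelli statement
  \<open>S_nn_integral\<close> applies.\<close>

lemma S_suminf:
  assumes [measurable]: "\<And>n. f n \<in> borel_measurable borel"
  shows "S k (\<lambda>z. \<Sum>n. f n z) t z = (\<Sum>n. S k (f n) t z)"
proof -
  have "(\<lambda>(n, z). f n z) \<in> borel_measurable (count_space UNIV \<Otimes>\<^sub>M borel)"
    by (rule measurable_pair_measure_countable1) auto
  from S_nn_integral[OF sigma_finite_measure_count_space this, of k t z]
  show ?thesis by (simp add: nn_integral_count_space_nat)
qed

lemma exp_cum_add:
  "0 \<le> s \<Longrightarrow> 0 \<le> t \<Longrightarrow> ennreal (exp (- cum (s + t) z)) = ennreal (exp (- cum s z)) * ennreal (exp (- cum t (flow s z)))"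
  by (simp add: cum_add ennreal_mult'[symmetric] flip: exp_add)

text \<open>A first jump after time \<open>s\<close> requires survival up to \<open>s\<close>, and
  this factor splits off by additivity of \<open>cum\<close>; what remains restarts from
  \<open>flow s z\<close>.\<close>

lemma first_jump_split:
  assumes [measurable]: "(\<lambda>(t, z). h t z) \<in> borel_measurable (borel \<Otimes>\<^sub>M borel)" and "0 \<le> s" "0 \<le> t"
  shows "first_jump h (s + t) z =
     (\<integral>\<^sup>+r. ennreal (exp (- cum r z)) * J (h (s + t - r)) (flow r z) * indicator {0..s} r \<partial>lborel)
     + ennreal (exp (- cum s z)) * first_jump h t (flow s z)"
proof -
  note [measurable (raw)] = measurable_fun2[OF assms(1)]
  let ?F = "\<lambda>r. ennreal (exp (- cum r z)) * J (h (s + t - r)) (flow r z)"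
  have [measurable]: "?F \<in> borel_measurable borel" by measurable
  have "first_jump h (s + t) z = (\<integral>\<^sup>+r. ?F r * indicator {0..s} r + ?F r * indicator {s<..s+t} r \<partial>lborel)"
    unfolding first_jump_def using assms by (intro nn_integral_cong) (auto simp: indicator_def)
  also have "\<dots> = (\<integral>\<^sup>+r. ?F r * indicator {0..s} r \<partial>lborel) + (\<integral>\<^sup>+r. ?F r * indicator {s<..s+t} r \<partial>lborel)"
    by (rule nn_integral_add) auto
  also have "(\<integral>\<^sup>+r. ?F r * indicator {s<..s+t} r \<partial>lborel) = (\<integral>\<^sup>+q. ?F (s + q) * indicator {s<..s+t} (s + q) \<partial>lborel)"
    by (rule nn_integral_lborel_shift) simp
  also have "\<dots> = (\<integral>\<^sup>+q. ennreal (exp (- cum s z)) * (ennreal (exp (- cum q (flow s z))) * J (h (t - q)) (flow q (flow s z)) * indicator {0..t} q) \<partial>lborel)"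
    \<comment> \<open>The shifted indicator excludes \<open>q = 0\<close> while
      \<open>{0..t}\<close> contains it; a single point is a null set.\<close>
    using AE_lborel_neq[of 0]
    by (intro nn_integral_cong_AE, eventually_elim)
      (auto simp: indicator_def exp_cum_add assms flow_add mult_ac)
  also have "\<dots> = ennreal (exp (- cum s z)) * first_jump h t (flow s z)"
    unfolding first_jump_def by (rule nn_integral_cmult) simp
  finally show ?thesis .
qed

text \<open>Markov property sorted by jumps: \<open>j\<close> of the \<open>k\<close> jumps fall
  into the initial interval of length \<open>t\<close>. In the induction, a first jump before
  \<open>t\<close> is followed by the hypothesis, and a first jump after \<open>t\<close> gives the
  term \<open>j = 0\<close>.\<close>

lemma S_semigroup:
  assumes [measurable]: "f \<in> borel_measurable borel" and "0 \<le> s" "0 \<le> t"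
  shows "S k f (t + s) z = (\<Sum>j\<le>k. S j (S (k - j) f s) t z)"
  using assms(3)
proof (induction k arbitrary: t z)
  case 0
  then show ?case using assms by (simp add: exp_cum_add flow_add mult_ac)
next
  case (Suc k)
  have "S (Suc k) f (t + s) z = (\<integral>\<^sup>+r. ennreal (exp (- cum r z)) * J (S k f (t + s - r)) (flow r z) * indicator {0..t} r \<partial>lborel)
     + S 0 (S (Suc k) f s) t z"
    using first_jump_split[of "S k f" t s z] assms Suc.prems by simp
  also have "(\<integral>\<^sup>+r. ennreal (exp (- cum r z)) * J (S k f (t + s - r)) (flow r z) * indicator {0..t} r \<partial>lborel)
     = first_jump (\<lambda>t z. \<Sum>j\<le>k. S j (S (k - j) f s) t z) t z"
    unfolding first_jump_def
    by (intro nn_integral_cong) (auto simp: indicator_def Suc.IH[symmetric] algebra_simps)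
  also have "\<dots> = (\<Sum>j\<le>k. S (Suc j) (S (k - j) f s) t z)"
  proof -
    have "first_jump (\<lambda>t z. \<Sum>j\<in>A. S j (S (k - j) f s) t z) t z = (\<Sum>j\<in>A. S (Suc j) (S (k - j) f s) t z)"
      if "finite A" for A using that
    proof induction
      case empty
      show ?case by (simp add: first_jump_def J_def)
    next
      case (insert j A)
      then show ?case by (simp add: first_jump_add del: S.simps) (simp)
    qed
    then show ?thesis by simp
  qed
  also have "(\<Sum>j\<le>k. S (Suc j) (S (k - j) f s) t z) + S 0 (S (Suc k) f s) t z = (\<Sum>j\<le>Suc k. S j (S (Suc k - j) f s) t z)"
    by (subst sum.atMost_Suc_shift) (simp add: add.commute del: S.simps)
  finally show ?case .
qed

lemma suminf_ennreal_swap: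
  fixes f :: "nat \<Rightarrow> nat \<Rightarrow> ennreal"
  shows "(\<Sum>i. \<Sum>j. f i j) = (\<Sum>j. \<Sum>i. f i j)"
proof -
  have "(\<Sum>i. \<Sum>j. f i j) = (\<integral>\<^sup>+i. (\<Sum>j. f i j) \<partial>count_space UNIV)"
    by (simp add: nn_integral_count_space_nat)
  also have "\<dots> = (\<Sum>j. \<integral>\<^sup>+i. f i j \<partial>count_space UNIV)" by (rule nn_integral_suminf) simp
  finally show ?thesis by (simp add: nn_integral_count_space_nat)
qed

lemma suminf_ennreal_cauchy:
  fixes g :: "nat \<Rightarrow> nat \<Rightarrow> ennreal"
  shows "(\<Sum>k. \<Sum>j\<le>k. g j (k - j)) = (\<Sum>j. \<Sum>i. g j i)"
proof -
  have "(\<Sum>k. \<Sum>j\<le>k. g j (k - j)) = (\<Sum>k. \<Sum>j. if j \<le> k then g j (k - j) else 0)"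
    by (intro suminf_cong, subst suminf_finite[of "{.._}"]) auto
  also have "\<dots> = (\<Sum>j. \<Sum>k. if j \<le> k then g j (k - j) else 0)" by (rule suminf_ennreal_swap)
  also have "\<dots> = (\<Sum>j. \<Sum>i. g j i)"
  proof -
    have "(\<Sum>k. if j \<le> k then g j (k - j) else 0) = (\<Sum>i. g j i)" for j
      using suminf_offset[of "\<lambda>k. if j \<le> k then g j (k - j) else 0" j] by simp
    then show ?thesis by simp
  qed
  finally show ?thesis .
qed

lemma Pt_semigroup:
  assumes [measurable]: "f \<in> borel_measurable borel" and "0 \<le> s" "0 \<le> t"
  shows "Pt f (t + s) z = Pt (Pt f s) t z"
proof -
  have "Pt f (t + s) z = (\<Sum>k. \<Sum>j\<le>k. S j (S (k - j) f s) t z)"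
    unfolding Pt_def by (simp add: S_semigroup assms)
  also have "\<dots> = (\<Sum>j. \<Sum>i. S j (S i f s) t z)" by (rule suminf_ennreal_cauchy)
  also have "\<dots> = (\<Sum>j. S j (Pt f s) t z)"
    unfolding Pt_def by (subst S_suminf) auto
  finally show ?thesis unfolding Pt_def .
qed

text \<open>Renewal equation: either there is no jump before \<open>t\<close>, or the process starts
  afresh at the first one.\<close>

lemma Pt_restart:
  assumes [measurable]: "f \<in> borel_measurable borel" and "0 \<le> t"
  shows "Pt f t z = ennreal (exp (- cum t z)) * f (flow t z) + first_jump (Pt f) t z"
proof -
  have m: "(\<lambda>(n, t, z). S n f t z) \<in> borel_measurable (count_space UNIV \<Otimes>\<^sub>M borel \<Otimes>\<^sub>M borel)"
    by (rule measurable_pair_measure_countable1) auto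
  have "first_jump (\<lambda>t z. \<Sum>n. S n f t z) t z = (\<Sum>n. first_jump (S n f) t z)"
    using first_jump_nn_integral[OF sigma_finite_measure_count_space m, of t z]
    by (simp add: nn_integral_count_space_nat)
  moreover have "Pt f t z = S 0 f t z + (\<Sum>n. S (Suc n) f t z)"
    unfolding Pt_def using suminf_offset[of "\<lambda>n. S n f t z" 1] by simp
  ultimately show ?thesis by (simp add: Pt_def[abs_def])
qed

text \<open>The recursion defining \<open>S\<close> peels off the first jump. Time reversal
  exchanges first and last jump, so the duality needs this second recursion. Tonelli on the simplex
  \<open>0 \<le> r \<le> q \<le> t\<close> of first and last jump times converts one into the
  other.\<close>

lemma S_last_jump:
  assumes [measurable]: "f \<in> borel_measurable borel" and "0 \<le> t"
  shows "S (Suc k) f t z = (\<integral>\<^sup>+r. S k (J (S 0 f (t - r))) r z * indicator {0..t} r \<partial>lborel)"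
  using assms(2)
proof (induction k arbitrary: t z)
  case 0
  show ?case by (simp add: first_jump_def)
next
  case (Suc k)
  define K where "K r q = J (S k (J (S 0 f (t - q))) (q - r)) (flow r z)" for r q
  have [measurable]: "(\<lambda>(r, q). K r q) \<in> borel_measurable (borel \<Otimes>\<^sub>M borel)"
    unfolding K_def by measurable
  define W where "W r q = (if 0 \<le> r \<and> r \<le> q \<and> q \<le> t then ennreal (exp (- cum r z)) * K r q else 0)" for r q
  have [measurable]: "(\<lambda>(r, q). W r q) \<in> borel_measurable (borel \<Otimes>\<^sub>M borel)"
    unfolding W_def by measurable
  have "S (Suc (Suc k)) f t z
     = (\<integral>\<^sup>+r. ennreal (exp (- cum r z)) * J (S (Suc k) f (t - r)) (flow r z) * indicator {0..t} r \<partial>lborel)"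
    by (simp add: first_jump_def)
  also have "\<dots> = (\<integral>\<^sup>+r. \<integral>\<^sup>+q. W r q \<partial>lborel \<partial>lborel)"
  proof (intro nn_integral_cong)
    fix r :: real
    show "ennreal (exp (- cum r z)) * J (S (Suc k) f (t - r)) (flow r z) * indicator {0..t} r = (\<integral>\<^sup>+q. W r q \<partial>lborel)"
    proof (cases "0 \<le> r \<and> r \<le> t")
      case True
      have "J (S (Suc k) f (t - r)) (flow r z)
          = J (\<lambda>z. \<integral>\<^sup>+q. S k (J (S 0 f (t - r - q))) q z * indicator {0..t - r} q \<partial>lborel) (flow r z)"
        using Suc.IH[of "t - r"] True by (intro arg_cong[where f="\<lambda>h. J h (flow r z)"] ext) auto
      also have "\<dots> = (\<integral>\<^sup>+q. J (\<lambda>z. S k (J (S 0 f (t - r - q))) q z * indicator {0..t - r} q) (flow r z) \<partial>lborel)"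
      proof (rule J_nn_integral[OF lborel.sigma_finite_measure_axioms])
        have "(\<lambda>(q, z). S k (J (S 0 f (t - r - q))) q z) \<in> borel_measurable (borel \<Otimes>\<^sub>M borel)"
          by measurable
        then show "(\<lambda>(q, z). S k (J (S 0 f (t - r - q))) q z * indicator {0..t - r} q) \<in> borel_measurable (lborel \<Otimes>\<^sub>M borel)"
          by (simp add: split_beta')
      qed
      also have "\<dots> = (\<integral>\<^sup>+q. K r (r + q) * indicator {0..t - r} q \<partial>lborel)"
        unfolding K_def by (intro nn_integral_cong) (subst J_multc; simp add: diff_diff_eq del: S.simps)
      also have "\<dots> = (\<integral>\<^sup>+q. K r (r + q) * indicator {r..t} (r + q) \<partial>lborel)"
        by (intro nn_integral_cong) (auto simp: indicator_def)
      also have "\<dots> = (\<integral>\<^sup>+q. K r q * indicator {r..t} q \<partial>lborel)"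
        by (rule nn_integral_lborel_shift[symmetric]) measurable
      finally have "ennreal (exp (- cum r z)) * J (S (Suc k) f (t - r)) (flow r z)
         = (\<integral>\<^sup>+q. ennreal (exp (- cum r z)) * (K r q * indicator {r..t} q) \<partial>lborel)"
        by (subst nn_integral_cmult) auto
      then show ?thesis using True
        by (auto intro!: nn_integral_cong simp: indicator_def W_def)
    next
      case False
      then have "W r q = 0" for q by (auto simp: W_def)
      then show ?thesis using False by (auto simp: indicator_def)
    qed
  qed
  also have "\<dots> = (\<integral>\<^sup>+q. \<integral>\<^sup>+r. W r q \<partial>lborel \<partial>lborel)"
    by (rule lborel_pair.Fubini') simp
  also have "\<dots> = (\<integral>\<^sup>+q. S (Suc k) (J (S 0 f (t - q))) q z * indicator {0..t} q \<partial>lborel)"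
  proof (intro nn_integral_cong)
    fix q :: real
    show "(\<integral>\<^sup>+r. W r q \<partial>lborel) = S (Suc k) (J (S 0 f (t - q))) q z * indicator {0..t} q"
    proof (cases "0 \<le> q \<and> q \<le> t")
      case True
      then show ?thesis
        by (auto simp: first_jump_def K_def W_def indicator_def simp del: S.simps(1) intro!: nn_integral_cong)
    next
      case False
      then have "W r q = 0" for r by (auto simp: W_def)
      then show ?thesis using False by (auto simp: indicator_def simp del: S.simps)
    qed
  qed
  finally show ?case .
qed


section \<open>Non-explosion\<close>

lemma first_jump_one:
  assumes "0 \<le> t"
  shows "ennreal (exp (- cum t z)) + first_jump (\<lambda>_ _. 1) t z = 1"
    and "first_jump (\<lambda>_ _. 1) t z = ennreal (1 - exp (- cum t z))"
proof -
  have "first_jump (\<lambda>_ _. 1) t z = (\<integral>\<^sup>+s. ennreal (exp (- cum s z) * rate (flow s z)) * indicator {0..t} s \<partial>lborel)"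
    unfolding first_jump_def J_one by (simp add: ennreal_mult' rate_nonneg)
  also have "\<dots> = ennreal (1 - exp (- cum t z))" by (rule nn_integral_first_jump_density[OF assms])
  finally show *: "first_jump (\<lambda>_ _. 1) t z = ennreal (1 - exp (- cum t z))" .
  show "ennreal (exp (- cum t z)) + first_jump (\<lambda>_ _. 1) t z = 1"
    unfolding * using cum_nonneg[OF assms, of z] by (subst ennreal_plus[symmetric]) auto
qed

text \<open>The probability of at least \<open>k\<close> jumps before \<open>t\<close>.\<close>

primrec late :: "nat \<Rightarrow> real \<Rightarrow> 'z \<Rightarrow> ennreal" where
  "late 0 = (\<lambda>_ _. 1)"
| "late (Suc k) = first_jump (late k)"

lemma late_measurable [measurable]: "(\<lambda>(t, z). late k t z) \<in> borel_measurable (borel \<Otimes>\<^sub>M borel)"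
  by (induction k) (simp_all add: split_beta')

text \<open>For fixed \<open>k\<close> this is exact and needs no control of the number of jumps;
  mass can escape only in the limit of large \<open>k\<close>, through \<open>late\<close>.\<close>

lemma sum_S_late:
  assumes "0 \<le> t"
  shows "(\<Sum>j<k. S j (\<lambda>_. 1) t z) + late k t z = 1"
  using assms
proof (induction k arbitrary: t z)
  case (Suc k)
  have "first_jump (\<lambda>t z. \<Sum>j\<in>A. S j (\<lambda>_. 1) t z) t z = (\<Sum>j\<in>A. S (Suc j) (\<lambda>_. 1) t z)"
      if "finite A" for A using that
  proof induction
    case empty
    show ?case by (simp add: first_jump_def J_def)
  next
    case (insert j A)
    then show ?case by (simp add: first_jump_add del: S.simps) simp
  qed
  then have "(\<Sum>j<Suc k. S j (\<lambda>_. 1) t z) + late (Suc k) t z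
     = S 0 (\<lambda>_. 1) t z + (first_jump (\<lambda>t z. \<Sum>j<k. S j (\<lambda>_. 1) t z) t z + first_jump (late k) t z)"
    by (subst sum.lessThan_Suc_shift) (simp add: add.assoc)
  also have "first_jump (\<lambda>t z. \<Sum>j<k. S j (\<lambda>_. 1) t z) t z + first_jump (late k) t z
      = first_jump (\<lambda>t z. (\<Sum>j<k. S j (\<lambda>_. 1) t z) + late k t z) t z"
    by (rule first_jump_add[symmetric]) measurable
  also have "\<dots> = first_jump (\<lambda>_ _. 1) t z"
    by (rule first_jump_cong) (simp add: Suc.IH)
  finally show ?case using first_jump_one(1)[OF Suc.prems, of z] by simp
qed simp

text \<open>Since \<open>V\<close> is constant along the flow, the first jump contributes at most
  \<open>exp (c * t) * V z\<close> times the integral of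
  \<open>(rate + c) * exp (- cum - c * s)\<close>. This is an exact derivative whose integral is at
  most one.\<close>

lemma first_jump_exp_supersolution:
  assumes [measurable]: "V \<in> borel_measurable borel" and V0: "\<And>z. 0 \<le> V z" and Vflow: "\<And>s z. V (flow s z) = V z"
    and JV: "\<And>z. J (\<lambda>z. ennreal (V z)) z \<le> ennreal ((rate z + c) * V z)" and c: "0 \<le> c" and t: "0 \<le> t"
  shows "first_jump (\<lambda>t z. ennreal (exp (c * t) * V z)) t z \<le> ennreal (exp (c * t) * V z)"
proof -
  obtain H where H: "\<And>t. (H has_real_derivative rate (flow t z)) (at t)" "\<And>t. 0 \<le> t \<Longrightarrow> cum t z = H t" "H 0 = 0"
    by (rule cum_primitive[of z]) blast
  have [measurable]: "H \<in> borel_measurable borel"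
    using H(1) by (intro borel_measurable_continuous_onI) (meson DERIV_isCont continuous_at_imp_continuous_on)
  have "first_jump (\<lambda>t z. ennreal (exp (c * t) * V z)) t z
     \<le> (\<integral>\<^sup>+s. ennreal (exp (c * t) * V z) * (ennreal ((rate (flow s z) + c) * exp (- H s - c * s)) * indicator {0..t} s) \<partial>lborel)"
    unfolding first_jump_def
  proof (intro nn_integral_mono)
    fix s :: real
    show "ennreal (exp (- cum s z)) * J (\<lambda>z. ennreal (exp (c * (t - s)) * V z)) (flow s z) * indicator {0..t} s
       \<le> ennreal (exp (c * t) * V z) * (ennreal ((rate (flow s z) + c) * exp (- H s - c * s)) * indicator {0..t} s)"
    proof (cases "s \<in> {0..t}")
      case True
      have "J (\<lambda>z. ennreal (exp (c * (t - s)) * V z)) (flow s z) = ennreal (exp (c * (t - s))) * J (\<lambda>z. ennreal (V z)) (flow s z)"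
        by (simp add: ennreal_mult' J_cmult)
      also have "\<dots> \<le> ennreal (exp (c * (t - s))) * ennreal ((rate (flow s z) + c) * V z)"
        using JV[of "flow s z"] by (intro mult_left_mono) (auto simp: Vflow)
      finally have "ennreal (exp (- cum s z)) * J (\<lambda>z. ennreal (exp (c * (t - s)) * V z)) (flow s z)
        \<le> ennreal (exp (- cum s z)) * (ennreal (exp (c * (t - s))) * ennreal ((rate (flow s z) + c) * V z))"
        by (intro mult_left_mono) auto
      also have "\<dots> = ennreal (exp (c * t) * V z * ((rate (flow s z) + c) * exp (- H s - c * s)))"
      proof -
        have "exp (- cum s z) * (exp (c * (t - s)) * ((rate (flow s z) + c) * V z))
           = exp (c * t) * V z * ((rate (flow s z) + c) * exp (- H s - c * s))"
          using True by (simp add: H(2) exp_diff exp_minus right_diff_distrib field_simps)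
        then show ?thesis by (metis ennreal_mult' exp_ge_zero)
      qed
      also have "\<dots> = ennreal (exp (c * t) * V z) * ennreal ((rate (flow s z) + c) * exp (- H s - c * s))"
        using V0[of z] by (intro ennreal_mult') auto
      finally show ?thesis using True by simp
    qed simp
  qed
  also have "\<dots> = ennreal (exp (c * t) * V z) * (\<integral>\<^sup>+s. ennreal ((rate (flow s z) + c) * exp (- H s - c * s)) * indicator {0..t} s \<partial>lborel)"
    by (rule nn_integral_cmult) measurable
  also have "(\<integral>\<^sup>+s. ennreal ((rate (flow s z) + c) * exp (- H s - c * s)) * indicator {0..t} s \<partial>lborel)
      = ennreal (- exp (- H t - c * t) - (- exp (- H 0 - c * 0)))"
    by (rule nn_integral_FTC_Icc[OF _ _ _ t])
      (auto intro!: derivative_eq_intros H(1) simp: rate_nonneg c algebra_simps)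
  also have "ennreal (exp (c * t) * V z) * \<dots> \<le> ennreal (exp (c * t) * V z) * 1"
    by (intro mult_left_mono) (simp_all add: H(3))
  finally show ?thesis by simp
qed

text \<open>Until the next jump the rate is bounded by \<open>C * V\<close>, which the flow does not
  change. While \<open>V \<le> M\<close>, each further jump before time \<open>t\<close> costs a
  factor \<open>q < 1\<close>; excursions above \<open>M\<close> are paid for by the supersolution
  divided by \<open>M\<close>, as in Markov's inequality.\<close>

lemma Pt_one:
  assumes [measurable]: "V \<in> borel_measurable borel" and V0: "\<And>z. 0 \<le> V z" and Vflow: "\<And>s z. V (flow s z) = V z"
    and JV: "\<And>z. J (\<lambda>z. ennreal (V z)) z \<le> ennreal ((rate z + c) * V z)" and c: "0 \<le> c"
    and rate_le: "\<And>z. rate z \<le> C * V z" and t: "0 \<le> t"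
  shows "Pt (\<lambda>_. 1) t z = 1"
proof (rule antisym)
  have "(\<Sum>j<k. S j (\<lambda>_. 1) t z) \<le> 1" for k
    using sum_S_late[OF t, where k=k and z=z] by (metis le_iff_add)
  then show "Pt (\<lambda>_. 1) t z \<le> 1" unfolding Pt_def by (intro suminf_le_const) auto
  have C: "0 < C"
    using rate_pos[of z] rate_le[of z] V0[of z] by (metis linorder_not_le mult_nonpos_nonneg order_trans)
  show "1 \<le> Pt (\<lambda>_. 1) t z"
  proof (rule ennreal_le_epsilon)
    fix e :: real assume e: "0 < e"
    \<comment> \<open>Makes the second error term at the starting point at most
      \<open>e / 2\<close>; the summand 1 keeps \<open>M\<close> positive even if
      \<open>V z = 0\<close>.\<close>
    define M where "M = 2 * (exp (c * t) * V z + 1) / e"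
    have M: "0 < M" using e V0[of z] by (simp add: M_def add_nonneg_pos)
    \<comment> \<open>Bounds the probability of a jump before \<open>t\<close> from a state with
      \<open>V \<le> M\<close>, where the rate is at most \<open>C * M\<close>.\<close>
    define q where "q = 1 - exp (- (C * M * t))"
    have q: "0 \<le> q" "q < 1" using C M t by (auto simp: q_def)
    have late: "late k s y \<le> ennreal (q ^ k) + ennreal (exp (c * s) * V y / M)" if "0 \<le> s" "s \<le> t" for k s y
      using that
    proof (induction k arbitrary: s y)
      case (Suc k)
      show ?case
      proof (cases "V y \<le> M")
        case True
        have m: "(\<lambda>(s, y). ennreal (exp (c * s) * V y / M)) \<in> borel_measurable (borel \<Otimes>\<^sub>M borel)" by measurable
        have "late (Suc k) s y \<le> first_jump (\<lambda>s y. ennreal (q ^ k) * 1 + ennreal (1 / M) * ennreal (exp (c * s) * V y)) s y"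
          using Suc by (auto intro!: first_jump_mono simp: ennreal_mult'[symmetric] M less_imp_le)
        also have "\<dots> = ennreal (q ^ k) * first_jump (\<lambda>_ _. 1) s y + ennreal (1 / M) * first_jump (\<lambda>s y. ennreal (exp (c * s) * V y)) s y"
          by (subst first_jump_add first_jump_cmult; measurable)+
        also have "\<dots> \<le> ennreal (q ^ k) * ennreal q + ennreal (1 / M) * ennreal (exp (c * s) * V y)"
        proof (intro add_mono mult_left_mono)
          have "rate (flow r y) \<le> C * M" for r
            by (rule order_trans[OF rate_le]) (use True C in \<open>simp add: Vflow\<close>)
          then have "cum s y \<le> (C * M) * s"
            using cum_bounds(2)[of s y "C * M"] Suc.prems by blast
          also have "\<dots> \<le> C * M * t" using Suc.prems C M by (intro mult_left_mono) auto
          finally show "first_jump (\<lambda>_ _. 1) s y \<le> ennreal q"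
            using first_jump_one(2)[OF Suc.prems(1), of y] by (auto simp: q_def intro!: ennreal_leI)
          show "first_jump (\<lambda>s y. ennreal (exp (c * s) * V y)) s y \<le> ennreal (exp (c * s) * V y)"
            by (rule first_jump_exp_supersolution) (use assms Suc.prems in auto)
        qed auto
        also have "\<dots> = ennreal (q ^ Suc k) + ennreal (exp (c * s) * V y / M)"
          using q M V0[of y] by (simp add: ennreal_mult'[symmetric] mult.commute)
        finally show ?thesis .
      next
        case False
        have "late (Suc k) s y \<le> 1"
          using sum_S_late[OF Suc.prems(1), where k="Suc k" and z=y] by (metis le_iff_add add.commute)
        also have "1 \<le> ennreal (exp (c * s) * V y / M)"
        proof -
          have "1 * M \<le> exp (c * s) * V y"
            using False M c Suc.prems by (intro mult_mono) auto
          then show ?thesis using M by (simp add: field_simps)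
        qed
        finally show ?thesis by (simp add: add_increasing)
      qed
    qed simp
    obtain k where k: "q ^ k < e / 2"
      using real_arch_pow_inv[of "e / 2" q] e q by auto
    have "exp (c * t) * V z / M \<le> e / 2"
      using e M by (simp add: pos_divide_le_eq) (simp add: M_def)
    then have "q ^ k + exp (c * t) * V z / M \<le> e" using k by linarith
    then have "late k t z \<le> ennreal e"
      using late[OF t order_refl, of k z] q V0[of z] M
      by (simp add: ennreal_plus[symmetric] del: ennreal_plus) (meson ennreal_leI order_trans)
    moreover have "(\<Sum>j<k. S j (\<lambda>_. 1) t z) \<le> Pt (\<lambda>_. 1) t z"
      unfolding Pt_def by (rule sum_le_suminf) auto
    ultimately show "1 \<le> Pt (\<lambda>_. 1) t z + ennreal e"
      using sum_S_late[OF t, where k=k and z=z] by (metis add_mono)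
  qed
qed

section \<open>Realisation of the semigroup by paths with independent inputs\<close>

definition waiting :: "'z \<Rightarrow> real \<Rightarrow> real" where
  "waiting z e = Inf {t. 0 \<le> t \<and> e \<le> cum t z}"

primrec chain :: "'z \<Rightarrow> (nat \<Rightarrow> real \<times> 'n) \<Rightarrow> nat \<Rightarrow> real \<times> 'z" where
  "chain z \<omega> 0 = (0, z)"
| "chain z \<omega> (Suc k) = (let (s, y) = chain z \<omega> k; (e, \<xi>) = \<omega> k; t = waiting y e in (s + t, jump (flow t y) \<xi>))"

definition path :: "'z \<Rightarrow> (nat \<Rightarrow> real \<times> 'n) \<Rightarrow> real \<Rightarrow> 'z" where
  "path z \<omega> t =
     (if \<exists>k. t < fst (chain z \<omega> (Suc k))
      then let k = (LEAST k. t < fst (chain z \<omega> (Suc k))); (s, y) = chain z \<omega> k in flow (t - s) y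
      else z)"

definition inputs :: "(nat \<Rightarrow> real \<times> 'n) measure" where
  "inputs = (\<Pi>\<^sub>M k\<in>UNIV. density lborel (exponential_density 1) \<Otimes>\<^sub>M N)"

text \<open>The random variable whose expectation will be \<open>S k f t z\<close>.\<close>

definition seg :: "nat \<Rightarrow> ('z \<Rightarrow> ennreal) \<Rightarrow> real \<Rightarrow> 'z \<Rightarrow> (nat \<Rightarrow> real \<times> 'n) \<Rightarrow> ennreal" where
  "seg k f t z \<omega> = (if fst (chain z \<omega> k) \<le> t \<and> t < fst (chain z \<omega> (Suc k))
     then f (flow (t - fst (chain z \<omega> k)) (snd (chain z \<omega> k))) else 0)"

text \<open>Continuity of \<open>cum\<close> and its growth at speed at least \<open>lam\<close>
  make the set under the infimum a closed half-line, so the infimum is attained and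
  \<open>waiting z\<close> is a generalised inverse of \<open>cum\<close>.\<close>

lemma waiting_le_iff:
  assumes "0 \<le> t"
  shows "waiting z e \<le> t \<longleftrightarrow> e \<le> cum t z"
proof -
  have "\<exists>\<tau>\<ge>0. {t. 0 \<le> t \<and> e \<le> cum t z} = {\<tau>..}"
  proof (cases "e \<le> 0")
    case True
    then have "{t. 0 \<le> t \<and> e \<le> cum t z} = {0..}" using cum_nonneg order_trans by fastforce
    then show ?thesis by blast
  next
    case False
    obtain H where H: "\<And>t. (H has_real_derivative rate (flow t z)) (at t)" "\<And>t. 0 \<le> t \<Longrightarrow> cum t z = H t" "H 0 = 0"
      by (rule cum_primitive[of z]) blast
    have "e \<le> H (e / lam)" using cum_bounds(1)[of "e / lam" z] lam_pos False H(2)[of "e / lam"] by simp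
    moreover have "\<forall>x. 0 \<le> x \<and> x \<le> e / lam \<longrightarrow> isCont H x" using H(1) DERIV_isCont by blast
    ultimately obtain \<tau> where \<tau>: "0 \<le> \<tau>" "H \<tau> = e"
      using IVT[of H 0 e "e / lam"] False H(3) lam_pos by auto
    then have "cum \<tau> z = e" by (simp add: H(2))
    then have "{t. 0 \<le> t \<and> e \<le> cum t z} = {\<tau>..}"
      using \<tau> cum_mono[of \<tau> _ z] cum_strict_mono[of _ \<tau> z] by (fastforce simp: not_le[symmetric])
    then show ?thesis using \<tau> by blast
  qed
  then obtain \<tau> where "0 \<le> \<tau>" and \<tau>: "{t. 0 \<le> t \<and> e \<le> cum t z} = {\<tau>..}" by blast
  then have "waiting z e = \<tau>" by (simp add: waiting_def)
  then show ?thesis using \<tau> assms by auto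
qed

lemma waiting_nonneg: "0 \<le> waiting z e"
  using waiting_le_iff[of 0 z "max e 1"] waiting_le_iff
proof -
  obtain t where "0 \<le> t" "e \<le> cum t z"
    using cum_bounds(1)[of "\<bar>e\<bar> / lam" z] lam_pos by (auto intro!: that[of "\<bar>e\<bar> / lam"])
  then show ?thesis unfolding waiting_def by (intro cInf_greatest) auto
qed

lemma waiting_cum: "0 \<le> s \<Longrightarrow> waiting z (cum s z) = s"
  using waiting_le_iff[of s z "cum s z"] waiting_le_iff[of "waiting z (cum s z)" z "cum s z"]
    cum_strict_mono[of "waiting z (cum s z)" s z] waiting_nonneg[of z "cum s z"] by fastforce

lemma waiting_measurable [measurable (raw)]:
  assumes [measurable]: "a \<in> M \<rightarrow>\<^sub>M borel" "b \<in> borel_measurable M"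
  shows "(\<lambda>x. waiting (a x) (b x)) \<in> borel_measurable M"
proof (rule borel_measurableI_le)
  fix y
  show "{x \<in> space M. waiting (a x) (b x) \<le> y} \<in> sets M"
  proof (cases "0 \<le> y")
    case True
    then show ?thesis by (simp add: waiting_le_iff)
  next
    case False
    then have "\<not> waiting (a x) (b x) \<le> y" for x using waiting_nonneg[of "a x" "b x"] by linarith
    then show ?thesis by simp
  qed
qed

lemma chain_measurable_pair:
  "(\<lambda>(z, \<omega>). chain z \<omega> k) \<in> borel \<Otimes>\<^sub>M inputs \<rightarrow>\<^sub>M borel \<Otimes>\<^sub>M borel"
proof (induction k)
  case (Suc k)
  note [measurable] = Suc
  have [measurable]: "(\<lambda>(z, \<omega>). fst (\<omega> k)) \<in> borel_measurable (borel \<Otimes>\<^sub>M inputs)"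
     "(\<lambda>(z, \<omega>). snd (\<omega> k)) \<in> borel \<Otimes>\<^sub>M inputs \<rightarrow>\<^sub>M N"
    unfolding inputs_def by measurable
  have 1: "(\<lambda>p. fst (chain (fst p) (snd p) k)) \<in> borel_measurable (borel \<Otimes>\<^sub>M inputs)"
       "(\<lambda>p. snd (chain (fst p) (snd p) k)) \<in> borel \<Otimes>\<^sub>M inputs \<rightarrow>\<^sub>M borel"
    using measurable_compose[OF Suc measurable_fst] measurable_compose[OF Suc measurable_snd]
    by (simp_all add: split_beta')
  note [measurable] = 1
  show ?case by (simp add: split_beta' Let_def)
qed simp

lemma chain_measurable [measurable (raw)]:
  assumes "a \<in> M \<rightarrow>\<^sub>M borel" "b \<in> M \<rightarrow>\<^sub>M inputs"
  shows "(\<lambda>x. chain (a x) (b x) k) \<in> M \<rightarrow>\<^sub>M borel \<Otimes>\<^sub>M borel"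
  using measurable_compose[OF measurable_Pair[OF assms] chain_measurable_pair[of k]] by simp

lemma path_measurable [measurable (raw)]:
  assumes [measurable]: "a \<in> M \<rightarrow>\<^sub>M borel" "b \<in> M \<rightarrow>\<^sub>M inputs" "c \<in> borel_measurable M"
  shows "(\<lambda>x. path (a x) (b x) (c x)) \<in> M \<rightarrow>\<^sub>M borel"
proof -
  have [measurable]: "(\<lambda>x. LEAST k. c x < fst (chain (a x) (b x) (Suc k))) \<in> M \<rightarrow>\<^sub>M count_space UNIV"
    by measurable
  have "(\<lambda>x. (\<lambda>k x. flow (c x - fst (chain (a x) (b x) k)) (snd (chain (a x) (b x) k)))
       (LEAST k. c x < fst (chain (a x) (b x) (Suc k))) x) \<in> M \<rightarrow>\<^sub>M borel"
    by (rule measurable_compose_countable) measurable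
  then show ?thesis unfolding path_def Let_def split_beta' by measurable
qed

text \<open>The first input only changes the starting point: the remaining chain is driven by the
  shifted inputs. This matches the recursion of \<open>S\<close> at the first jump.\<close>

lemma chain_case_nat:
  "chain z (case_nat x \<omega>) (Suc k) =
     (waiting z (fst x) + fst (chain (jump (flow (waiting z (fst x)) z) (snd x)) \<omega> k),
      snd (chain (jump (flow (waiting z (fst x)) z) (snd x)) \<omega> k))"
  by (induction k) (simp_all add: Let_def split_beta')

lemma chain_mono: "fst (chain z \<omega> k) \<le> fst (chain z \<omega> (Suc k))"
  using waiting_nonneg by (simp add: Let_def split_beta')

lemma chain_mono': "k \<le> l \<Longrightarrow> fst (chain z \<omega> k) \<le> fst (chain z \<omega> l)"
  by (rule lift_Suc_mono_le[where f="\<lambda>k. fst (chain z \<omega> k)"]) (rule chain_mono)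

lemma prob_space_exp: "prob_space (density lborel (exponential_density 1))"
  by (rule prob_space_exponential_density) simp

lemma sequence_space_inputs: "sequence_space (density lborel (exponential_density 1) \<Otimes>\<^sub>M N)"
  by (intro sequence_space.intro product_prob_space.intro product_sigma_finite.intro
      product_prob_space_axioms.intro prob_space_imp_sigma_finite prob_space_pair prob_space_exp N.prob_space_axioms)

lemma prob_space_inputs: "prob_space inputs"
  unfolding inputs_def
  by (intro prob_space_PiM prob_space_pair prob_space_exp N.prob_space_axioms)

lemma seg_measurable [measurable (raw)]:
  assumes [measurable]: "f \<in> borel_measurable borel" "a \<in> borel_measurable M" "b \<in> M \<rightarrow>\<^sub>M borel" "c \<in> M \<rightarrow>\<^sub>M inputs"
  shows "(\<lambda>x. seg k f (a x) (b x) (c x)) \<in> borel_measurable M"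
  unfolding seg_def by measurable

text \<open>The law of the inputs is the image of one input times an independent copy of the whole
  sequence, so integrating out the first input reproduces the recursion of \<open>S\<close>. The
  substitution \<open>e = cum s z\<close> turns the exponential law into the density
  \<open>exp (- cum s z) * rate (flow s z)\<close>.\<close>

lemma nn_integral_seg:
  assumes [measurable]: "f \<in> borel_measurable borel"
  shows "(\<integral>\<^sup>+\<omega>. seg k f t z \<omega> \<partial>inputs) = (if 0 \<le> t then S k f t z else 0)"
proof (induction k arbitrary: t z)
  case 0
  interpret seq: sequence_space "density lborel (exponential_density 1) \<Otimes>\<^sub>M N" by (rule sequence_space_inputs)
  interpret I: prob_space inputs by (rule prob_space_inputs)
  interpret E: prob_space "density lborel (exponential_density 1)" by (rule prob_space_exp)
  show ?case
  proof (cases "0 \<le> t")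
    case True
    let ?c = "cum t z"
    have "(\<integral>\<^sup>+\<omega>. seg 0 f t z \<omega> \<partial>inputs) = (\<integral>\<^sup>+\<omega>. f (flow t z) * indicator {?c<..} (fst (\<omega> 0)) \<partial>inputs)"
      using True waiting_le_iff[of t z]
      by (intro nn_integral_cong) (auto simp: seg_def Let_def split_beta' not_le[symmetric] indicator_def)
    also have "\<dots> = (\<integral>\<^sup>+x. f (flow t z) * indicator {?c<..} (fst x) \<partial>distr inputs (density lborel (exponential_density 1) \<Otimes>\<^sub>M N) (\<lambda>\<omega>. \<omega> 0))"
      by (subst nn_integral_distr) (auto simp: inputs_def)
    also have "distr inputs (density lborel (exponential_density 1) \<Otimes>\<^sub>M N) (\<lambda>\<omega>. \<omega> 0) = density lborel (exponential_density 1) \<Otimes>\<^sub>M N"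
      unfolding inputs_def by (rule seq.PiM_component) simp
    also have "(\<integral>\<^sup>+x. f (flow t z) * indicator {?c<..} (fst x) \<partial>(density lborel (exponential_density 1) \<Otimes>\<^sub>M N))
      = (\<integral>\<^sup>+e. f (flow t z) * indicator {?c<..} e \<partial>density lborel (exponential_density 1))"
      by (subst N.nn_integral_fst[symmetric]) (auto simp: N.emeasure_space_1)
    also have "\<dots> = f (flow t z) * (\<integral>\<^sup>+e. indicator {?c<..} e \<partial>density lborel (exponential_density 1))"
      by (rule nn_integral_cmult) simp
    also have "(\<integral>\<^sup>+e. indicator {?c<..} e \<partial>density lborel (exponential_density 1))
       = (\<integral>\<^sup>+e. ennreal (exp (- e)) * indicator {?c..} e \<partial>lborel)"
    proof -
      have "(\<integral>\<^sup>+e. indicator {?c<..} e \<partial>density lborel (exponential_density 1))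
         = (\<integral>\<^sup>+e. ennreal (exponential_density 1 e) * indicator {?c<..} e \<partial>lborel)"
        by (rule nn_integral_density) auto
      also have "\<dots> = (\<integral>\<^sup>+e. ennreal (exp (- e)) * indicator {?c..} e \<partial>lborel)"
        using cum_nonneg[OF True, of z]
        by (intro nn_integral_cong_AE eventually_mono[OF AE_lborel_neq[of ?c]])
           (auto simp: exponential_density_def indicator_def)
      finally show ?thesis .
    qed
    also have "\<dots> = ennreal (0 - (- exp (- ?c)))"
    proof (rule nn_integral_FTC_atLeast)
      have "((\<lambda>x::real. - exp (- x)) \<longlongrightarrow> - 0) at_top"
        by (intro tendsto_minus filterlim_compose[OF exp_at_bot] filterlim_uminus_at_bot_at_top)
      then show "((\<lambda>x::real. - exp (- x)) \<longlongrightarrow> 0) at_top" by simp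
    qed (auto intro!: derivative_eq_intros)
    finally show ?thesis using True by (simp add: mult.commute)
  next
    case False
    then show ?thesis by (simp add: seg_def)
  qed
next
  case (Suc k)
  interpret seq: sequence_space "density lborel (exponential_density 1) \<Otimes>\<^sub>M N" by (rule sequence_space_inputs)
  interpret I: prob_space inputs by (rule prob_space_inputs)
  let ?E = "density lborel (exponential_density 1)"
  have [measurable]: "(\<lambda>(x, \<omega>). case_nat x \<omega>) \<in> (?E \<Otimes>\<^sub>M N) \<Otimes>\<^sub>M inputs \<rightarrow>\<^sub>M inputs"
    unfolding inputs_def by measurable
  have seg: "seg (Suc k) f t z (case_nat x \<omega>) = seg k f (t - waiting z (fst x)) (jump (flow (waiting z (fst x)) z) (snd x)) \<omega>" for x \<omega>
    unfolding seg_def chain_case_nat by (auto simp: algebra_simps less_diff_eq)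
  have "(\<integral>\<^sup>+\<omega>. seg (Suc k) f t z \<omega> \<partial>inputs)
      = (\<integral>\<^sup>+\<omega>. seg (Suc k) f t z \<omega> \<partial>distr ((?E \<Otimes>\<^sub>M N) \<Otimes>\<^sub>M inputs) inputs (\<lambda>(x, \<omega>). case_nat x \<omega>))"
    using seq.PiM_iter by (simp add: inputs_def)
  also have "\<dots> = (\<integral>\<^sup>+p. seg (Suc k) f t z (case_nat (fst p) (snd p)) \<partial>((?E \<Otimes>\<^sub>M N) \<Otimes>\<^sub>M inputs))"
    by (subst nn_integral_distr) (auto simp: split_beta')
  also have "\<dots> = (\<integral>\<^sup>+x. \<integral>\<^sup>+\<omega>. seg k f (t - waiting z (fst x)) (jump (flow (waiting z (fst x)) z) (snd x)) \<omega> \<partial>inputs \<partial>(?E \<Otimes>\<^sub>M N))"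
    unfolding seg by (subst I.nn_integral_fst[symmetric]) (auto simp: split_beta')
  also have "\<dots> = (\<integral>\<^sup>+x. (if waiting z (fst x) \<le> t then S k f (t - waiting z (fst x)) (jump (flow (waiting z (fst x)) z) (snd x)) else 0) \<partial>(?E \<Otimes>\<^sub>M N))"
    by (simp add: Suc.IH)
  also have "\<dots> = (\<integral>\<^sup>+e. \<integral>\<^sup>+\<xi>. (if waiting z e \<le> t then S k f (t - waiting z e) (jump (flow (waiting z e) z) \<xi>) else 0) \<partial>N \<partial>?E)"
    by (subst N.nn_integral_fst[symmetric]) (auto simp: split_beta' cong: if_cong)
  also have "\<dots> = (if 0 \<le> t then S (Suc k) f t z else 0)"
  proof (cases "0 \<le> t")
    case True
    obtain H where H: "\<And>t. (H has_real_derivative rate (flow t z)) (at t)" "\<And>t. 0 \<le> t \<Longrightarrow> cum t z = H t" "H 0 = 0"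
      by (rule cum_primitive[of z]) blast
    define g where "g e = (\<integral>\<^sup>+\<xi>. S k f (t - waiting z e) (jump (flow (waiting z e) z) \<xi>) \<partial>N)" for e
    have [measurable]: "g \<in> borel_measurable borel" unfolding g_def by measurable
    have "(\<integral>\<^sup>+e. \<integral>\<^sup>+\<xi>. (if waiting z e \<le> t then S k f (t - waiting z e) (jump (flow (waiting z e) z) \<xi>) else 0) \<partial>N \<partial>?E)
       = (\<integral>\<^sup>+e. (if waiting z e \<le> t then g e else 0) \<partial>?E)"
      by (intro nn_integral_cong) (auto simp: g_def)
    also have "\<dots> = (\<integral>\<^sup>+e. ennreal (exponential_density 1 e) * (if waiting z e \<le> t then g e else 0) \<partial>lborel)"
      by (rule nn_integral_density) auto
    also have "\<dots> = (\<integral>\<^sup>+e. (ennreal (exp (- e)) * g e) * indicator {H 0..H t} e \<partial>lborel)"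
      by (intro nn_integral_cong)
         (auto simp: waiting_le_iff[OF True] exponential_density_def indicator_def H(3) H(2)[OF True, symmetric])
    also have "\<dots> = (\<integral>\<^sup>+s. (ennreal (exp (- H s)) * g (H s)) * rate (flow s z) * indicator {0..t} s \<partial>lborel)"
    \<comment> \<open>The substitution rule requires a nondegenerate interval; for
      \<open>t = 0\<close> both sides are integrals over one point.\<close>
    proof (cases "t = 0")
      case True
      have "(\<integral>\<^sup>+e. h e * indicator {c} e \<partial>lborel) = 0" for h :: "real \<Rightarrow> ennreal" and c
        by (intro nn_integral_zero' eventually_mono[OF AE_lborel_neq[of c]]) (auto simp: indicator_def)
      from this[of _ 0] show ?thesis using True H(3) by simp
    next
      case False
      show ?thesis
        by (rule nn_integral_substitution_aux)
          (use False True H(1) rate_cont[of z] in \<open>auto simp: rate_nonneg intro: continuous_on_subset\<close>)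
    qed
    also have "\<dots> = S (Suc k) f t z"
      unfolding S.simps(2) first_jump_def J_def
      by (intro nn_integral_cong)
        (auto simp: indicator_def H(2)[symmetric] g_def waiting_cum mult_ac)
    finally show ?thesis using True by simp
  next
    case False
    then have "\<not> waiting z e \<le> t" for e using waiting_nonneg[of z e] by auto
    then show ?thesis using False by simp
  qed
  finally show ?case .
qed

text \<open>The intervals between successive jump times are disjoint, so at most one term is
  nonzero. If no jump time exceeds \<open>t\<close>, every term vanishes, whatever default value
  \<open>path\<close> takes.\<close>

lemma suminf_seg:
  assumes "0 \<le> t"
  shows "(\<Sum>k. seg k f t z \<omega>) = (if \<exists>k. t < fst (chain z \<omega> (Suc k)) then f (path z \<omega> t) else 0)"
proof (cases "\<exists>k. t < fst (chain z \<omega> (Suc k))")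
  case True
  define m where "m = (LEAST k. t < fst (chain z \<omega> (Suc k)))"
  have m: "t < fst (chain z \<omega> (Suc m))" unfolding m_def by (rule LeastI_ex[OF True])
  have less: "k < m \<Longrightarrow> fst (chain z \<omega> (Suc k)) \<le> t" for k
    unfolding m_def using not_less_Least by (metis not_le)
  have mle: "fst (chain z \<omega> m) \<le> t"
  proof (cases m)
    case 0
    then show ?thesis using assms by simp
  next
    case (Suc l)
    then show ?thesis using less[of l] by simp
  qed
  have "seg k f t z \<omega> = 0" if "k \<noteq> m" for k
  proof (cases "k < m")
    case True
    then show ?thesis using less[of k] by (auto simp: seg_def)
  next
    case False
    then have "fst (chain z \<omega> (Suc m)) \<le> fst (chain z \<omega> k)" using that by (intro chain_mono') simp
    then show ?thesis using m by (auto simp: seg_def)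
  qed
  then have "(\<Sum>k. seg k f t z \<omega>) = (\<Sum>k\<in>{m}. seg k f t z \<omega>)" by (intro suminf_finite) auto
  also have "\<dots> = f (path z \<omega> t)"
    using m mle True by (simp add: seg_def path_def m_def[symmetric] split_beta' Let_def del: chain.simps)
  finally show ?thesis using True by simp
next
  case False
  then show ?thesis by (auto simp: seg_def simp del: chain.simps)
qed

text \<open>The case \<open>f = 1\<close> shows that almost every path has a jump time beyond
  \<open>t\<close>, so the default branch of \<open>path\<close> concerns a null set.\<close>

theorem nn_integral_path:
  assumes [measurable]: "f \<in> borel_measurable borel" and t: "0 \<le> t" and one: "Pt (\<lambda>_. 1) t z = 1"
  shows "(\<integral>\<^sup>+\<omega>. f (path z \<omega> t) \<partial>inputs) = Pt f t z"
proof -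
  interpret I: prob_space inputs by (rule prob_space_inputs)
  have *: "(\<integral>\<^sup>+\<omega>. (\<Sum>k. seg k f t z \<omega>) \<partial>inputs) = Pt f t z" if [measurable]: "f \<in> borel_measurable borel" for f
    unfolding Pt_def using t by (subst nn_integral_suminf) (auto simp: nn_integral_seg)
  let ?A = "{\<omega>\<in>space inputs. \<exists>k. t < fst (chain z \<omega> (Suc k))}"
  have [measurable]: "?A \<in> sets inputs" by measurable
  have "emeasure inputs ?A = (\<integral>\<^sup>+\<omega>. indicator ?A \<omega> \<partial>inputs)" by (simp del: chain.simps)
  also have "\<dots> = (\<integral>\<^sup>+\<omega>. (\<Sum>k. seg k (\<lambda>_. 1) t z \<omega>) \<partial>inputs)"
    using t by (intro nn_integral_cong) (auto simp: suminf_seg indicator_def simp del: chain.simps)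
  also have "\<dots> = 1" using *[of "\<lambda>_. 1"] one by simp
  finally have "AE \<omega> in inputs. \<omega> \<in> ?A" by (intro I.AE_prob_1) (simp add: measure_def del: chain.simps)
  then have "(\<integral>\<^sup>+\<omega>. f (path z \<omega> t) \<partial>inputs) = (\<integral>\<^sup>+\<omega>. (\<Sum>k. seg k f t z \<omega>) \<partial>inputs)"
    by (intro nn_integral_cong_AE, eventually_elim) (auto simp: suminf_seg[OF t] simp del: chain.simps)
  then show ?thesis by (simp add: *)
qed

end

section \<open>Centred Gaussian measures\<close>

text \<open>The weighted measure is normalised and pushed to the line by \<open>X\<close>. Its
  characteristic function can be read off from the hypothesis: \<open>c = 0\<close> gives the real
  part, \<open>c = - pi / 2\<close> the imaginary part. The weight \<open>d\<close> will carry the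
  conditions already imposed in other directions.\<close>

lemma Levy_uniqueness_weighted:
  fixes X d :: "'b \<Rightarrow> real"
  assumes M: "finite_measure M" and N: "finite_measure N" and sets: "sets M = sets N"
    and X [measurable]: "X \<in> borel_measurable N" and d [measurable]: "d \<in> borel_measurable N"
    and d0: "\<And>x. 0 \<le> d x" and dB: "\<And>x. d x \<le> B"
    and eq: "\<And>u c. (\<integral>x. d x * cos (u * X x + c) \<partial>M) = (\<integral>x. d x * cos (u * X x + c) \<partial>N)"
    and A [measurable]: "A \<in> sets borel"
  shows "(\<integral>x. d x * indicator A (X x) \<partial>M) = (\<integral>x. d x * indicator A (X x) \<partial>N)"
proof -
  interpret M: finite_measure M by fact
  interpret N: finite_measure N by fact
  note [measurable_cong] = sets
  have int: "integrable K d" if "finite_measure K" "d \<in> borel_measurable K" for K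
    using that d0 dB by (intro finite_measure.integrable_const_bound[of K _ B]) (auto simp: abs_of_nonneg)
  have intM: "integrable M d" and intN: "integrable N d" by (auto intro!: int assms)
  define m where "m = (\<integral>x. d x \<partial>N)"
  have mM: "(\<integral>x. d x \<partial>M) = m" using eq[of 0 0] by (simp add: m_def)
  have m0: "0 \<le> m" unfolding m_def by (intro integral_nonneg_AE) (auto simp: d0)
  show ?thesis
  proof (cases "m = 0")
    case True
    have "AE x in M. d x = 0" "AE x in N. d x = 0"
      using integral_nonneg_eq_0_iff_AE[OF intM] integral_nonneg_eq_0_iff_AE[OF intN] d0 True mM m_def by auto
    then have "AE x in M. d x * indicator A (X x) = 0" "AE x in N. d x * indicator A (X x) = 0"
      by (auto elim!: eventually_mono)
    then show ?thesis by (simp add: integral_eq_zero_AE)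
  next
    case False
    then have m: "0 < m" using m0 by simp
    define Q where "Q K = distr (density K (\<lambda>x. ennreal (d x / m))) borel X" for K
    have dist: "real_distribution (Q K)" and char: "char (Q K) t = (\<integral>x. d x * cos (t * X x + 0) \<partial>K) / m + \<i> * ((\<integral>x. d x * cos (t * X x + (- pi / 2)) \<partial>K) / m)"
      and ind: "measure (Q K) A * m = (\<integral>x. d x * indicator A (X x) \<partial>K)"
      if K: "finite_measure K" "sets K = sets N" "(\<integral>x. d x \<partial>K) = m" for K t
    proof -
      note [measurable_cong] = K(2)
      interpret K: finite_measure K by (rule K(1))
      have intK: "integrable K d" by (auto intro!: int K(1))
      have "emeasure (density K (\<lambda>x. ennreal (d x / m))) (space K) = (\<integral>\<^sup>+x. ennreal (d x / m) \<partial>K)"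
        by (subst emeasure_density) (auto intro!: nn_integral_cong)
      also have "\<dots> = ennreal (\<integral>x. d x / m \<partial>K)"
        using intK d0 m by (intro nn_integral_eq_integral) auto
      finally have "prob_space (density K (\<lambda>x. ennreal (d x / m)))"
        using K(3) m by (intro prob_spaceI) simp
      then show D: "real_distribution (Q K)"
        unfolding Q_def by (intro prob_space.real_distribution_distr) auto
      interpret Q: real_distribution "Q K" by fact
      have Qint: "(\<integral>x. g x \<partial>Q K) = (\<integral>x. d x * g (X x) \<partial>K) / m" if [measurable]: "g \<in> borel_measurable borel" for g :: "real \<Rightarrow> real"
        unfolding Q_def using d0 m
        by (subst integral_distr, simp, simp, subst integral_density) (auto simp: divide_inverse mult_ac)
      have ii: "integrable (Q K) (\<lambda>x. iexp (t * x))"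
        by (rule Q.integrable_const_bound[of _ 1]) auto
      have "Re (char (Q K) t) = (\<integral>x. cos (t * x + 0) \<partial>Q K)"
        unfolding char_def integral_Re[OF ii, symmetric] by (simp add: Re_exp)
      moreover have "Im (char (Q K) t) = (\<integral>x. cos (t * x + (- pi / 2)) \<partial>Q K)"
        unfolding char_def integral_Im[OF ii, symmetric] by (simp add: Im_exp cos_diff)
      ultimately show "char (Q K) t = (\<integral>x. d x * cos (t * X x + 0) \<partial>K) / m + \<i> * ((\<integral>x. d x * cos (t * X x + (- pi / 2)) \<partial>K) / m)"
        by (simp add: complex_eq_iff Qint[of "\<lambda>x. cos (t * x)"] Qint[of "\<lambda>x. cos (t * x - pi / 2)"])
      have "measure (Q K) A = (\<integral>x. indicator A x \<partial>Q K)" by (simp add: Q_def)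
      then show "measure (Q K) A * m = (\<integral>x. d x * indicator A (X x) \<partial>K)"
        using Qint[of "indicator A"] m by simp
    qed
    have "char (Q M) = char (Q N)"
      unfolding fun_eq_iff char[OF M sets mM] char[OF N refl m_def[symmetric]] eq by simp
    then have "Q M = Q N"
      using dist[OF M sets mM] dist[OF N refl m_def[symmetric]] by (intro Levy_uniqueness)
    then show ?thesis using ind[OF M sets mM] ind[OF N refl m_def[symmetric]] by simp
  qed
qed

definition cylinder :: "('a::real_inner \<times> real set) list \<Rightarrow> 'a set" where
  "cylinder l = {x. \<forall>(q, A)\<in>set l. q \<bullet> x \<in> A}"

lemma cylinder_simps: "cylinder [] = UNIV" "cylinder ((q, A) # l) = {x. q \<bullet> x \<in> A} \<inter> cylinder l"
  "cylinder l \<inter> cylinder l' = cylinder (l @ l')"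
  by (auto simp: cylinder_def)

text \<open>A closed ball is the intersection of its supporting half-spaces, and by continuity in
  the normal a countable dense set of normals suffices. Open sets are then countable unions of
  closed balls.\<close>

lemma sets_borel_eq_cylinders:
  "sets (borel :: 'a::{real_inner,second_countable_topology} measure)
     = sigma_sets UNIV {cylinder l |l. \<forall>(q, A)\<in>set l. A \<in> sets borel}" (is "_ = sigma_sets UNIV ?E")
proof
  have "cylinder l \<in> sets borel" if "\<forall>(q :: 'a, A)\<in>set l. A \<in> sets borel" for l
    using that
  proof (induction l)
    case (Cons a l)
    then have "{x. fst a \<bullet> x \<in> snd a} \<in> sets borel" by (cases a) auto
    with Cons show ?case by (cases a) (auto simp: cylinder_simps intro!: sets.Int)
  qed (simp add: cylinder_simps)
  then show "sigma_sets UNIV ?E \<subseteq> sets borel"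
    using sets.sigma_sets_subset[of ?E borel] by auto
  interpret E: sigma_algebra UNIV "sigma_sets UNIV ?E" by (rule sigma_algebra_sigma_sets) auto
  obtain D :: "'a set" where D: "countable D" "\<And>X. open X \<Longrightarrow> X \<noteq> {} \<Longrightarrow> \<exists>d\<in>D. d \<in> X"
    using countable_dense_exists by blast
  have cb: "cball a r \<in> sigma_sets UNIV ?E" for a :: 'a and r
  proof (cases "0 \<le> r")
    case True
    have "cball a r = (\<Inter>d\<in>D. cylinder [(d, {.. r * norm d + d \<bullet> a})])"
    proof (intro set_eqI iffI)
      fix x assume "x \<in> cball a r"
      then have "norm (x - a) \<le> r" by (simp add: dist_norm norm_minus_commute)
      then have "d \<bullet> (x - a) \<le> r * norm d" for d
        using norm_cauchy_schwarz[of d "x - a"] mult_right_mono[of "norm (x - a)" r "norm d"] by (simp add: mult.commute)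
      then show "x \<in> (\<Inter>d\<in>D. cylinder [(d, {.. r * norm d + d \<bullet> a})])"
        by (auto simp: cylinder_def inner_diff_right algebra_simps)
    next
      fix x assume x: "x \<in> (\<Inter>d\<in>D. cylinder [(d, {.. r * norm d + d \<bullet> a})])"
      show "x \<in> cball a r"
      proof (rule ccontr)
        assume "x \<notin> cball a r"
        then have gt: "r < norm (x - a)" by (simp add: dist_norm norm_minus_commute)
        have "open {d. r * norm d < d \<bullet> (x - a)}" by (intro open_Collect_less continuous_intros)
        moreover have "x - a \<in> {d. r * norm d < d \<bullet> (x - a)}"
          using mult_strict_right_mono[OF gt, of "norm (x - a)"] le_less_trans[OF True gt] by (auto simp: power2_norm_eq_inner[symmetric] power2_eq_square)
        ultimately obtain d where "d \<in> D" "r * norm d < d \<bullet> (x - a)" using D(2) by blast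
        then show False using x by (auto simp: cylinder_def inner_diff_right)
      qed
    qed
    also have "\<dots> \<in> sigma_sets UNIV ?E"
    proof (cases "D = {}")
      case False
      then show ?thesis
        using D(1) by (intro E.countable_INT') (auto intro!: sigma_sets.Basic exI[of _ "[(_, _)]"])
    qed (simp add: sigma_sets_top)
    finally show ?thesis .
  qed (simp add: sigma_sets.Empty)
  have "U \<in> sigma_sets UNIV ?E" if "open U" for U :: "'a set"
  proof -
    have "U = (\<Union>d\<in>D. \<Union>n::nat. if cball d (1 / Suc n) \<subseteq> U then cball d (1 / Suc n) else {})" (is "_ = ?V")
    proof
      show "U \<subseteq> ?V"
      proof
        fix x assume "x \<in> U"
        then obtain e where e: "0 < e" "cball x e \<subseteq> U" using \<open>open U\<close> open_contains_cball by blast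
        then obtain n where n: "1 / Suc n < e / 2" using nat_approx_posE[of "e / 2"] by auto
        obtain d where d: "d \<in> D" "d \<in> ball x (1 / Suc n)" using D(2)[of "ball x (1 / Suc n)"] by auto
        have "cball d (1 / Suc n) \<subseteq> cball x e"
        proof
          fix y assume "y \<in> cball d (1 / Suc n)"
          then show "y \<in> cball x e" using d n dist_triangle[of x y d] by (auto simp: mem_ball)
        qed
        then have "x \<in> (if cball d (1 / Suc n) \<subseteq> U then cball d (1 / Suc n) else {})"
          using d e by (auto simp: dist_commute)
        then show "x \<in> ?V" using d by blast
      qed
    qed (auto split: if_splits)
    also have "\<dots> \<in> sigma_sets UNIV ?E"
      using D(1) cb by (intro E.countable_UN' E.countable_UN) (auto simp: sigma_sets.Empty)
    finally show ?thesis .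
  qed
  then have "sigma_sets UNIV {S :: 'a set. open S} \<subseteq> sigma_sets UNIV ?E"
    by (intro sigma_sets_mono) auto
  moreover have "sets (borel :: 'a measure) = sigma_sets UNIV {S. open S}" by (simp add: borel_def)
  ultimately show "sets borel \<subseteq> sigma_sets UNIV ?E" by simp
qed

text \<open>The conditions of a cylinder are imposed one at a time, each by uniqueness of
  characteristic functions on the line. The induction keeps a free factor
  \<open>cos (p \<bullet> x + b)\<close>, which absorbs the phase produced by the next
  direction.\<close>

theorem measure_eqI_cos:
  fixes M N :: "'a::{real_inner,second_countable_topology} measure"
  assumes M: "finite_measure M" and N: "finite_measure N" and sM: "sets M = sets borel" and sN: "sets N = sets borel"
    and eq: "\<And>p b. (\<integral>x. cos (p \<bullet> x + b) \<partial>M) = (\<integral>x. cos (p \<bullet> x + b) \<partial>N)"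
  shows "M = N"
proof -
  interpret M: finite_measure M by fact
  interpret N: finite_measure N by fact
  note [measurable_cong] = sM sN
  have *: "(\<integral>x. indicator (cylinder l) x * cos (p \<bullet> x + b) \<partial>M) = (\<integral>x. indicator (cylinder l) x * cos (p \<bullet> x + b) \<partial>N)"
    if "\<forall>(q, A)\<in>set l. A \<in> sets borel" for l p b
    using that
  proof (induction l arbitrary: p b)
    case Nil
    then show ?case by (simp add: cylinder_simps eq)
  next
    case (Cons qA l)
    obtain q A where qA: "qA = (q, A)" by (cases qA)
    let ?I = "indicator (cylinder l) :: 'a \<Rightarrow> real"
    have A [measurable]: "A \<in> sets borel" using Cons.prems qA by auto
    have [measurable]: "cylinder l \<in> sets borel"
      using Cons.prems sets_borel_eq_cylinders by (auto intro!: sigma_sets.Basic)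
    have iM: "integrable M (\<lambda>x. ?I x * cos (p \<bullet> x + b))" for p b
      by (rule M.integrable_const_bound[of _ 1]) (auto simp: indicator_def)
    have iN: "integrable N (\<lambda>x. ?I x * cos (p \<bullet> x + b))" for p b
      by (rule N.integrable_const_bound[of _ 1]) (auto simp: indicator_def)
    have IH: "(\<integral>x. ?I x * cos (p \<bullet> x + b) \<partial>M) = (\<integral>x. ?I x * cos (p \<bullet> x + b) \<partial>N)" for p b
      using Cons by auto
    \<comment> \<open>A cosine is signed and cannot serve as a weight, so \<open>1 + cos\<close> is
      used; the product formula for cosines keeps all integrals within the induction
      hypothesis.\<close>
    have w: "(\<integral>x. (?I x * (1 + cos (p \<bullet> x + b))) * indicator A (q \<bullet> x) \<partial>M) = (\<integral>x. (?I x * (1 + cos (p \<bullet> x + b))) * indicator A (q \<bullet> x) \<partial>N)" for p b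
    proof (rule Levy_uniqueness_weighted[OF M N, where B=2])
      fix u c
      have prod: "(?I x * (1 + cos (p \<bullet> x + b))) * cos (u * (q \<bullet> x) + c)
         = ?I x * cos ((u *\<^sub>R q) \<bullet> x + c) + (?I x * cos ((p + u *\<^sub>R q) \<bullet> x + (b + c)) + ?I x * cos ((p - u *\<^sub>R q) \<bullet> x + (b - c))) / 2" for x
        using cos_times_cos[of "p \<bullet> x + b" "u * (q \<bullet> x) + c"]
        by (cases "x \<in> cylinder l") (simp_all add: inner_add_left inner_diff_left algebra_simps add_divide_distrib[symmetric])
      show "(\<integral>x. (?I x * (1 + cos (p \<bullet> x + b))) * cos (u * (q \<bullet> x) + c) \<partial>M) = (\<integral>x. (?I x * (1 + cos (p \<bullet> x + b))) * cos (u * (q \<bullet> x) + c) \<partial>N)"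
        unfolding prod by (simp add: iM iN IH del: inner_scaleR_left)
    next
      fix x
      have "1 + cos (p \<bullet> x + b) \<le> 2" "0 \<le> 1 + cos (p \<bullet> x + b)" using cos_ge_minus_one[of "p \<bullet> x + b"] cos_le_one[of "p \<bullet> x + b"] by linarith+
      then show "0 \<le> ?I x * (1 + cos (p \<bullet> x + b))" "?I x * (1 + cos (p \<bullet> x + b)) \<le> 2" by (auto simp: indicator_def)
    qed (auto simp: sM sN)
    let ?J = "\<lambda>x. ?I x * indicator A (q \<bullet> x) :: real"
    have jM: "integrable M (\<lambda>x. ?J x * cos (p \<bullet> x + b))" "integrable M ?J" for p b
      by (rule M.integrable_const_bound[of _ 1]; auto simp: indicator_def)+
    have jN: "integrable N (\<lambda>x. ?J x * cos (p \<bullet> x + b))" "integrable N ?J" for p b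
      by (rule N.integrable_const_bound[of _ 1]; auto simp: indicator_def)+
    have split: "(?I x * (1 + cos (p \<bullet> x + b))) * indicator A (q \<bullet> x) = ?J x + ?J x * cos (p \<bullet> x + b)" for x p b
      by (simp add: algebra_simps)
    \<comment> \<open>With zero phase the weight is the constant 2, which settles the summand 1 of
      \<open>1 + cos\<close> and leaves the cosine.\<close>
    have "(\<integral>x. ?J x \<partial>M) = (\<integral>x. ?J x \<partial>N)"
      using w[of 0 0] unfolding split by (simp add: jM jN)
    then have "(\<integral>x. ?J x * cos (p \<bullet> x + b) \<partial>M) = (\<integral>x. ?J x * cos (p \<bullet> x + b) \<partial>N)"
      using w[of p b] unfolding split by (simp add: jM jN)
    moreover have "indicator ({x. q \<bullet> x \<in> A} \<inter> cylinder l) x = ?J x" for x by (auto simp: indicator_def)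
    ultimately show ?case unfolding qA cylinder_simps by simp
  qed
  show ?thesis
  proof (rule measure_eqI_generator_eq[where \<Omega>=UNIV and E="{cylinder l |l. \<forall>(q :: 'a, A)\<in>set l. A \<in> sets borel}" and A="\<lambda>_. UNIV"])
    show "Int_stable {cylinder l |l. \<forall>(q :: 'a, A)\<in>set l. A \<in> sets borel}"
    proof (rule Int_stableI)
      fix a b :: "'a set"
      assume "a \<in> {cylinder l |l. \<forall>(q, A)\<in>set l. A \<in> sets borel}"
      then obtain l where l: "a = cylinder l" "\<forall>(q, A)\<in>set l. A \<in> sets borel" by blast
      assume "b \<in> {cylinder l |l. \<forall>(q, A)\<in>set l. A \<in> sets borel}"
      then obtain l' where l': "b = cylinder l'" "\<forall>(q, A)\<in>set l'. A \<in> sets borel" by blast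
      have "a \<inter> b = cylinder (l @ l')" "\<forall>(q, A)\<in>set (l @ l'). A \<in> sets borel"
        using l l' by (auto simp: cylinder_simps)
      then show "a \<inter> b \<in> {cylinder l |l. \<forall>(q, A)\<in>set l. A \<in> sets borel}" by blast
    qed
    fix X :: "'a set" assume "X \<in> {cylinder l |l. \<forall>(q, A)\<in>set l. A \<in> sets borel}"
    then obtain l where l: "X = cylinder l" "\<forall>(q, A)\<in>set l. A \<in> sets borel" by auto
    then have "X \<in> sets borel" using sets_borel_eq_cylinders by auto
    then show "emeasure M X = emeasure N X"
      using *[OF l(2), of 0 0] l by (simp add: M.emeasure_eq_measure N.emeasure_eq_measure sM sN)
  next
    have "(UNIV :: 'a set) \<in> {cylinder l |l. \<forall>(q :: 'a, A)\<in>set l. A \<in> sets borel}"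
      by (rule CollectI, rule exI[of _ "[]"]) (simp add: cylinder_simps)
    then show "range (\<lambda>_::nat. UNIV) \<subseteq> {cylinder l |l. \<forall>(q :: 'a, A)\<in>set l. A \<in> sets borel}" by blast
    show "emeasure M UNIV \<noteq> \<infinity>" by simp
    show "sets M = sigma_sets UNIV {cylinder l |l. \<forall>(q :: 'a, A)\<in>set l. A \<in> sets borel}"
      by (rule trans[OF sM sets_borel_eq_cylinders])
    show "sets N = sigma_sets UNIV {cylinder l |l. \<forall>(q :: 'a, A)\<in>set l. A \<in> sets borel}"
      by (rule trans[OF sN sets_borel_eq_cylinders])
  qed simp_all
qed

lemma normal_cos:
  assumes "0 < \<sigma>"
  shows "(\<integral>y. normal_density 0 \<sigma> y * cos (y + b) \<partial>lborel) = exp (- \<sigma>\<^sup>2 / 2) * cos b"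
proof -
  interpret real_distribution std_normal_distribution by (rule real_dist_normal_dist)
  have ii: "integrable std_normal_distribution (\<lambda>x. iexp (\<sigma> * x))"
    by (rule integrable_const_bound[of _ 1]) auto
  have "(\<integral>y. normal_density 0 \<sigma> y * cos (y + b) \<partial>lborel) = \<bar>\<sigma>\<bar> *\<^sub>R (\<integral>x. normal_density 0 \<sigma> (0 + \<sigma> * x) * cos ((0 + \<sigma> * x) + b) \<partial>lborel)"
    using assms by (intro lborel_integral_real_affine) auto
  also have "\<dots> = (\<integral>x. std_normal_density x * cos (\<sigma> * x + b) \<partial>lborel)"
  proof -
    have "normal_density 0 \<sigma> (0 + \<sigma> * x) = std_normal_density x / \<sigma>" for x
      using assms by (simp add: normal_density_def real_sqrt_mult power_mult_distrib)
    then show ?thesis using assms by simp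
  qed
  also have "\<dots> = (\<integral>x. cos (\<sigma> * x + b) \<partial>std_normal_distribution)"
    by (subst integral_density) auto
  also have "\<dots> = (\<integral>x. Re (cis b * iexp (\<sigma> * x)) \<partial>std_normal_distribution)"
    by (simp add: Re_exp Im_exp cos_add algebra_simps)
  also have "\<dots> = Re (\<integral>x. cis b * iexp (\<sigma> * x) \<partial>std_normal_distribution)"
    using ii by (intro integral_Re) auto
  also have "\<dots> = Re (cis b * char std_normal_distribution \<sigma>)"
    unfolding char_def by simp
  also have "\<dots> = exp (- \<sigma>\<^sup>2 / 2) * cos b"
    unfolding char_std_normal_distribution by simp
  finally show ?thesis .
qed

text \<open>The direction \<open>q = 0\<close> is separate because \<open>centered_gaussian\<close>
  prescribes a density only for \<open>q \<noteq> 0\<close>.\<close>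

lemma centered_gaussian_cos:
  fixes \<Sigma> :: "'a::{real_inner,second_countable_topology} \<Rightarrow> 'a"
  assumes "centered_gaussian \<Sigma> M" "pos_definite \<Sigma>" "linear \<Sigma>"
  shows "(\<integral>x. cos (q \<bullet> x + b) \<partial>M) = exp (- (\<Sigma> q \<bullet> q) / 2) * cos b"
proof (cases "q = 0")
  case True
  interpret prob_space M using assms by (simp add: centered_gaussian_def)
  show ?thesis using True by (simp add: prob_space linear_0[OF assms(3)])
next
  case False
  then have \<sigma>: "0 < \<Sigma> q \<bullet> q" using assms by (simp add: pos_definite_def)
  have "distributed M lborel (\<lambda>x. q \<bullet> x) (\<lambda>x. ennreal (normal_density 0 (sqrt (\<Sigma> q \<bullet> q)) x))"
    using assms False by (simp add: centered_gaussian_def)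
  from distributed_integral[OF this, of "\<lambda>y. cos (y + b)"]
  have "(\<integral>x. cos (q \<bullet> x + b) \<partial>M) = (\<integral>y. normal_density 0 (sqrt (\<Sigma> q \<bullet> q)) y * cos (y + b) \<partial>lborel)"
    by simp
  then show ?thesis using normal_cos[of "sqrt (\<Sigma> q \<bullet> q)" b] \<sigma> by simp
qed

text \<open>\<open>T'\<close> plays the part of the adjoint of \<open>T\<close>: the cosine
  integrals see the covariance only through \<open>\<Sigma> q \<bullet> q\<close>.\<close>

lemma centered_gaussian_invariant:
  fixes \<Sigma> T :: "'a::{real_inner,second_countable_topology} \<Rightarrow> 'a"
  assumes G: "centered_gaussian \<Sigma> M" "pos_definite \<Sigma>" "linear \<Sigma>"
    and T [measurable]: "T \<in> borel_measurable borel"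
    and adj: "\<And>q x. q \<bullet> T x = T' q \<bullet> x" and inv: "\<And>q. \<Sigma> (T' q) \<bullet> T' q = \<Sigma> q \<bullet> q"
  shows "distr M borel T = M"
proof (rule measure_eqI_cos)
  interpret prob_space M using G by (simp add: centered_gaussian_def)
  have sM [measurable_cong]: "sets M = sets borel" using G by (simp add: centered_gaussian_def)
  show "finite_measure M" by unfold_locales
  show "finite_measure (distr M borel T)" by (rule finite_measure_distr) simp
  show "(\<integral>x. cos (p \<bullet> x + b) \<partial>distr M borel T) = (\<integral>x. cos (p \<bullet> x + b) \<partial>M)" for p b
    by (subst integral_distr) (auto simp: adj centered_gaussian_cos[OF G] inv)
qed (use G in \<open>auto simp: centered_gaussian_def\<close>)

lemma centered_gaussian_pair_cos:
  fixes \<Sigma> :: "'a::{real_inner,second_countable_topology} \<Rightarrow> 'a"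
  assumes G: "centered_gaussian \<Sigma> M" "pos_definite \<Sigma>" "linear \<Sigma>"
  shows "(\<integral>z. cos (p \<bullet> z + b) \<partial>(M \<Otimes>\<^sub>M M)) = exp (- (\<Sigma> (fst p) \<bullet> fst p + \<Sigma> (snd p) \<bullet> snd p) / 2) * cos b"
proof -
  interpret prob_space M using G by (simp add: centered_gaussian_def)
  interpret P: pair_prob_space M M ..
  have sM [measurable_cong]: "sets M = sets borel" using G by (simp add: centered_gaussian_def)
  have "integrable (M \<Otimes>\<^sub>M M) (\<lambda>(x, v). cos (fst p \<bullet> x + (snd p \<bullet> v + b)))"
    by (rule P.P.integrable_const_bound[of _ 1]) (auto simp: split_beta')
  from P.integral_fst'[OF this]
  have "(\<integral>z. cos (p \<bullet> z + b) \<partial>(M \<Otimes>\<^sub>M M)) = (\<integral>x. \<integral>v. cos (snd p \<bullet> v + (fst p \<bullet> x + b)) \<partial>M \<partial>M)"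
    by (simp add: split_beta' inner_prod_def algebra_simps)
  then show ?thesis
    by (simp add: centered_gaussian_cos[OF G] exp_add[symmetric] add_divide_distrib)
qed

lemma boomerang_flow_measurable [measurable (raw)]:
  fixes g :: "'m \<Rightarrow> ('a::{real_inner,second_countable_topology}) \<times> 'a"
  assumes [measurable]: "f \<in> borel_measurable M" "g \<in> borel_measurable M"
  shows "(\<lambda>x. boomerang_flow (f x) (g x)) \<in> borel_measurable M"
proof -
  have [measurable]: "(\<lambda>x. fst (g x)) \<in> borel_measurable M" "(\<lambda>x. snd (g x)) \<in> borel_measurable M"
    using measurable_compose[OF assms(2), of fst borel] measurable_compose[OF assms(2), of snd borel]
    by (auto simp: borel_prod[symmetric])
  show ?thesis unfolding boomerang_flow_def by (simp add: split_beta')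
qed

lemma boomerang_flow_add: "boomerang_flow (s + t) z = boomerang_flow t (boomerang_flow s z)"
  by (cases z) (simp add: boomerang_flow_def sin_add cos_add algebra_simps)

lemma norm_boomerang_flow [simp]: "norm (boomerang_flow t z) = norm z"
proof -
  obtain x v where z: "z = (x, v)" by (cases z)
  have "(norm (c *\<^sub>R x + s *\<^sub>R v))\<^sup>2 + (norm (- s *\<^sub>R x + c *\<^sub>R v))\<^sup>2 = (c\<^sup>2 + s\<^sup>2) * ((norm x)\<^sup>2 + (norm v)\<^sup>2)" for c s
    unfolding power2_norm_eq_inner
    by (simp add: inner_add_left inner_add_right inner_commute[of v x] algebra_simps power2_eq_square)
  from this[of "cos t" "sin t"] show ?thesis by (simp add: z boomerang_flow_def norm_Pair)
qed

text \<open>Moved to the frequency \<open>p\<close>, the rotation leaves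
  \<open>\<Sigma> a \<bullet> a + \<Sigma> d \<bullet> d\<close> unchanged, because position and
  velocity have the same covariance.\<close>

lemma gaussian_rotation:
  fixes \<Sigma> :: "'a::{real_inner,second_countable_topology} \<Rightarrow> 'a"
  assumes G: "centered_gaussian \<Sigma> M" "pos_definite \<Sigma>" "linear \<Sigma>"
  shows "distr (M \<Otimes>\<^sub>M M) (M \<Otimes>\<^sub>M M) (boomerang_flow t) = M \<Otimes>\<^sub>M M"
proof -
  interpret prob_space M using G by (simp add: centered_gaussian_def)
  interpret P: pair_prob_space M M ..
  have sM: "sets M = sets borel" using G by (simp add: centered_gaussian_def)
  have sMM [measurable_cong]: "sets (M \<Otimes>\<^sub>M M) = sets borel"
    using sets_pair_measure_cong[OF sM sM] by (simp add: borel_prod[symmetric])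
  have cosz [measurable]: "(\<lambda>z. cos (p \<bullet> z + b)) \<in> borel_measurable (borel :: ('a \<times> 'a) measure)" for p b
    by (intro borel_measurable_continuous_onI continuous_intros)
  show ?thesis
  proof (rule measure_eqI_cos)
    show "finite_measure (M \<Otimes>\<^sub>M M)" by unfold_locales
    show "finite_measure (distr (M \<Otimes>\<^sub>M M) (M \<Otimes>\<^sub>M M) (boomerang_flow t))" by (rule P.P.finite_measure_distr) measurable
    fix p :: "'a \<times> 'a" and b
    let ?p = "(cos t *\<^sub>R fst p - sin t *\<^sub>R snd p, sin t *\<^sub>R fst p + cos t *\<^sub>R snd p)"
    have "p \<bullet> boomerang_flow t z = ?p \<bullet> z" for z
      by (cases z) (simp add: boomerang_flow_def inner_prod_def inner_simps algebra_simps)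
    moreover have rot: "\<Sigma> (c *\<^sub>R a - s *\<^sub>R d) \<bullet> (c *\<^sub>R a - s *\<^sub>R d) + \<Sigma> (s *\<^sub>R a + c *\<^sub>R d) \<bullet> (s *\<^sub>R a + c *\<^sub>R d)
        = (c\<^sup>2 + s\<^sup>2) * (\<Sigma> a \<bullet> a + \<Sigma> d \<bullet> d)" for c s a d
      using G(3) by (simp add: linear_add linear_diff linear_scale inner_simps algebra_simps power2_eq_square)
    then have "\<Sigma> (fst ?p) \<bullet> fst ?p + \<Sigma> (snd ?p) \<bullet> snd ?p = \<Sigma> (fst p) \<bullet> fst p + \<Sigma> (snd p) \<bullet> snd p"
      by (simp add: rot[of "cos t" "fst p" "sin t" "snd p"])
    ultimately show "(\<integral>z. cos (p \<bullet> z + b) \<partial>distr (M \<Otimes>\<^sub>M M) (M \<Otimes>\<^sub>M M) (boomerang_flow t)) = (\<integral>z. cos (p \<bullet> z + b) \<partial>(M \<Otimes>\<^sub>M M))"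
      by (subst integral_distr) (simp_all add: centered_gaussian_pair_cos[OF G])
  qed (auto simp: sMM)
qed

text \<open>Fernique's argument: after rotation by 45 degrees, a small sum and a large difference of
  two independent copies force both copies to have large norm.\<close>

lemma gaussian_norm_tail:
  fixes \<Sigma> :: "'a::{real_inner,second_countable_topology} \<Rightarrow> 'a"
  assumes G: "centered_gaussian \<Sigma> M" "pos_definite \<Sigma>" "linear \<Sigma>"
  shows "measure M {x. norm x \<le> \<tau>} * measure M {x. t < norm x} \<le> (measure M {x. (t - \<tau>) / sqrt 2 < norm x})\<^sup>2"
proof -
  interpret prob_space M using G by (simp add: centered_gaussian_def)
  interpret P: pair_prob_space M M ..
  have sM [measurable_cong]: "sets M = sets borel" using G by (simp add: centered_gaussian_def)
  have sMM [measurable_cong]: "sets (M \<Otimes>\<^sub>M M) = sets borel"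
    using sets_pair_measure_cong[OF sM sM] by (simp add: borel_prod[symmetric])
  have sp [simp]: "space M = UNIV" using sets_eq_imp_space_eq[OF sM] by simp
  have sp2 [simp]: "space (M \<Otimes>\<^sub>M M) = UNIV" by (simp add: space_pair_measure)
  let ?\<phi> = "boomerang_flow (pi / 4) :: 'a \<times> 'a \<Rightarrow> 'a \<times> 'a"
  have prod: "P.prob (A \<times> B) = prob A * prob B" if "A \<in> sets borel" "B \<in> sets borel" for A B
    using that by (simp add: measure_def emeasure_pair_measure_Times sM enn2real_mult)
  have m [measurable]: "{x::'a. norm x \<le> \<tau>} \<in> sets borel" "\<And>t. {x::'a. t < norm x} \<in> sets borel" by measurable
  have "prob {x. norm x \<le> \<tau>} * prob {x. t < norm x} = P.prob ({x. norm x \<le> \<tau>} \<times> {x. t < norm x})"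
    by (rule prod[symmetric]) measurable
  also have "\<dots> = measure (distr (M \<Otimes>\<^sub>M M) (M \<Otimes>\<^sub>M M) ?\<phi>) ({x. norm x \<le> \<tau>} \<times> {x. t < norm x})"
    by (simp add: gaussian_rotation[OF G])
  also have "\<dots> = P.prob (?\<phi> -` ({x. norm x \<le> \<tau>} \<times> {x. t < norm x}))"
    by (subst measure_distr) (auto simp: sM)
  also have "\<dots> \<le> P.prob ({x. (t - \<tau>) / sqrt 2 < norm x} \<times> {x. (t - \<tau>) / sqrt 2 < norm x})"
  proof (rule P.P.finite_measure_mono)
    show "?\<phi> -` ({x. norm x \<le> \<tau>} \<times> {x. t < norm x}) \<subseteq> {x. (t - \<tau>) / sqrt 2 < norm x} \<times> {x. (t - \<tau>) / sqrt 2 < norm x}"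
    proof
      fix z assume z: "z \<in> ?\<phi> -` ({x. norm x \<le> \<tau>} \<times> {x. t < norm x})"
      obtain x v where xv: "z = (x, v)" by (cases z)
      have s2: "sqrt 2 * sqrt 2 = 2" "0 < sqrt 2" by simp_all
      have fl: "?\<phi> z = ((sqrt 2 / 2) *\<^sub>R (x + v), (sqrt 2 / 2) *\<^sub>R (v - x))"
        by (simp add: xv boomerang_flow_def cos_45 sin_45 algebra_simps)
      have 1: "(sqrt 2 / 2) * norm (x + v) \<le> \<tau>" and 2: "t < (sqrt 2 / 2) * norm (v - x)"
        using z by (simp_all add: fl)
      have "norm (v - x) - norm (x + v) \<le> 2 * norm x" "norm (v - x) - norm (x + v) \<le> 2 * norm v"
        using norm_triangle_ineq4[of "v - x" "x + v"] norm_triangle_ineq[of "v - x" "x + v"]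
          norm_triangle_sub[of "v - x" "x + v"] norm_triangle_sub[of "v - x" "-(x + v)"]
        by (simp_all add: norm_minus_commute flip: scaleR_2)
           (simp_all add: algebra_simps flip: scaleR_2)
      then have "(sqrt 2 / 2) * (norm (v - x) - norm (x + v)) \<le> (sqrt 2 / 2) * (2 * norm x)"
        "(sqrt 2 / 2) * (norm (v - x) - norm (x + v)) \<le> (sqrt 2 / 2) * (2 * norm v)"
        by (intro mult_left_mono; simp)+
      with 1 2 have "t - \<tau> < sqrt 2 * norm x" "t - \<tau> < sqrt 2 * norm v" by (simp_all add: algebra_simps)
      then show "z \<in> {x. (t - \<tau>) / sqrt 2 < norm x} \<times> {x. (t - \<tau>) / sqrt 2 < norm x}"
        by (simp add: xv pos_divide_less_eq mult.commute)
    qed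
  qed (simp add: sM)
  also have "\<dots> = (prob {x. (t - \<tau>) / sqrt 2 < norm x})\<^sup>2"
    by (subst prod) (auto simp: power2_eq_square)
  finally show ?thesis .
qed

text \<open>Each application of the tail bound squares the tail while the threshold grows by a
  factor of about \<open>sqrt 2\<close>. Thus the tail at \<open>t k\<close> is at most
  \<open>(1/3) ^ (2 ^ k)\<close> while \<open>(t k)\<^sup>2\<close> is of order
  \<open>2 ^ k\<close>, and the two exponents match.\<close>

theorem fernique:
  fixes \<Sigma> :: "'a::{real_inner,second_countable_topology} \<Rightarrow> 'a"
  assumes G: "centered_gaussian \<Sigma> M" "pos_definite \<Sigma>" "linear \<Sigma>"
  obtains \<alpha> where "0 < \<alpha>" "integrable M (\<lambda>x. exp (\<alpha> * (norm x)\<^sup>2))"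
proof -
  interpret prob_space M using G by (simp add: centered_gaussian_def)
  have sM [measurable_cong]: "sets M = sets borel" using G by (simp add: centered_gaussian_def)
  have sp [simp]: "space M = UNIV" using sets_eq_imp_space_eq[OF sM] by simp
  have m [measurable]: "{x::'a. norm x \<le> \<tau>} \<in> sets borel" "\<And>t. {x::'a. t < norm x} \<in> sets borel" for \<tau> by measurable
  define T where "T t = prob {x. t < norm x}" for t
  have compl: "prob {x. norm x \<le> \<tau>} = 1 - T \<tau>" for \<tau>
    using prob_compl[of "{x. \<tau> < norm x}"] by (simp add: T_def sM Compl_eq_Diff_UNIV[symmetric] set_eq_iff not_less Collect_neg_eq[symmetric])
  have "(\<lambda>n. T (real n)) \<longlonglongrightarrow> prob (\<Inter>n. {x. real n < norm x})"
    unfolding T_def by (rule finite_Lim_measure_decseq) (auto simp: decseq_def sM)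
  moreover have "(\<Inter>n. {x::'a. real n < norm x}) = {}"
  proof -
    have "x \<notin> (\<Inter>n. {x::'a. real n < norm x})" for x
      using real_arch_simple[of "norm x"] by (auto simp: not_less)
    then show ?thesis by blast
  qed
  ultimately have "(\<lambda>n. T (real n)) \<longlonglongrightarrow> 0" by simp
  then have "\<forall>\<^sub>F n in sequentially. T (real n) < 1/4" by (rule order_tendstoD) simp
  then obtain n where n: "\<And>k. n \<le> k \<Longrightarrow> T (real k) < 1/4" by (auto simp: eventually_sequentially)
  \<comment> \<open>\<open>T \<tau> < 1/4\<close> makes \<open>T \<tau> / a\<close> less than
    \<open>1/3\<close>, where \<open>a\<close> is the mass of the ball of radius
    \<open>\<tau>\<close>; \<open>Suc n\<close> instead of \<open>n\<close> keeps the radius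
    positive.\<close>
  define \<tau> where "\<tau> = real (Suc n)"
  have \<tau>: "0 < \<tau>" "T \<tau> < 1/4" using n[of "Suc n"] by (simp_all add: \<tau>_def)
  define a where "a = 1 - T \<tau>"
  have a: "3/4 < a" using \<tau> by (simp add: a_def)
  \<comment> \<open>Chosen so that \<open>(t (Suc k) - \<tau>) / sqrt 2 = t k\<close>, the relation
    in \<open>gaussian_norm_tail\<close>.\<close>
  define t where "t k = rec_nat \<tau> (\<lambda>_ s. sqrt 2 * s + \<tau>) k" for k :: nat
  have t_0: "t 0 = \<tau>" and t_Suc: "t (Suc k) = sqrt 2 * t k + \<tau>" for k by (simp_all add: t_def)
  have s2: "1.4 < sqrt 2"
    by (rule real_less_rsqrt) (simp add: power2_eq_square)
  have t_ub: "t k + 3 * \<tau> \<le> 4 * \<tau> * sqrt 2 ^ k" for k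
  proof (induction k)
    case (Suc k)
    have "t (Suc k) + 3 * \<tau> \<le> sqrt 2 * (t k + 3 * \<tau>)"
      using s2 \<tau> mult_right_mono[of "4/3" "sqrt 2" "3 * \<tau>"] by (simp add: t_Suc algebra_simps)
    also have "\<dots> \<le> sqrt 2 * (4 * \<tau> * sqrt 2 ^ k)" using Suc by (intro mult_left_mono) auto
    finally show ?case by (simp add: mult_ac)
  qed (simp add: t_0)
  have t_lb: "\<tau> + k * (\<tau> / 4) \<le> t k" for k
  proof (induction k)
    case (Suc k)
    have "0 \<le> t k" using Suc \<tau> by (smt (verit) divide_nonneg_nonneg mult_nonneg_nonneg of_nat_0_le_iff)
    then have "t k \<le> sqrt 2 * t k" using s2 by (simp add: mult_le_cancel_right1)
    then show ?case using Suc \<tau> by (simp add: t_Suc algebra_simps)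
  qed (simp add: t_0)
  have t_pos: "0 < t k" for k using t_lb[of k] \<tau> by (smt (verit) divide_nonneg_nonneg mult_nonneg_nonneg of_nat_0_le_iff)
  have tail: "T (t k) \<le> a * (1/3) ^ (2 ^ k)" for k
  proof (induction k)
    case 0
    then show ?case using \<tau> a by (simp add: t_0)
  next
    case (Suc k)
    have "a * T (t (Suc k)) \<le> (T (t k))\<^sup>2"
      using gaussian_norm_tail[OF G, of \<tau> "t (Suc k)"] by (simp add: T_def[symmetric] compl a_def t_Suc)
    also have "\<dots> \<le> (a * (1/3) ^ (2 ^ k))\<^sup>2"
      using Suc by (intro power_mono) (auto simp: T_def)
    also have "\<dots> = a * (a * (1/3) ^ (2 ^ Suc k))" by (simp add: power2_eq_square power_mult_distrib mult_ac mult_2 power_add)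
    finally show ?case using a by (simp add: mult_le_cancel_left)
  qed
  \<comment> \<open>Since \<open>(t (Suc k))\<^sup>2 \<le> 32 * \<tau>\<^sup>2 * 2 ^ k\<close>, the
    exponential on a layer is at most \<open>(3/2) ^ (2 ^ k)\<close>; against the tail
    \<open>(1/3) ^ (2 ^ k)\<close> this leaves \<open>(1/2) ^ (2 ^ k)\<close>.\<close>
  define \<alpha> where "\<alpha> = ln (3/2) / (32 * \<tau>\<^sup>2)"
  have \<alpha>: "0 < \<alpha>" using \<tau> by (simp add: \<alpha>_def)
  have step: "exp (\<alpha> * (t (Suc k))\<^sup>2) * T (t k) \<le> (1/2) ^ k" for k
  proof -
    have "(t (Suc k))\<^sup>2 \<le> (4 * \<tau> * sqrt 2 ^ Suc k)\<^sup>2"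
      using t_ub[of "Suc k"] t_pos[of "Suc k"] \<tau> by (intro power_mono) auto
    also have "\<dots> = 32 * \<tau>\<^sup>2 * 2 ^ k" by (simp add: power_mult_distrib power_mult[symmetric] mult.commute[of _ 2] power_mult flip: power2_eq_square)
    finally have "\<alpha> * (t (Suc k))\<^sup>2 \<le> \<alpha> * (32 * \<tau>\<^sup>2 * 2 ^ k)" using \<alpha> by (intro mult_left_mono) auto
    also have "\<dots> = 2 ^ k * ln (3/2)" using \<tau> by (simp add: \<alpha>_def)
    finally have "exp (\<alpha> * (t (Suc k))\<^sup>2) \<le> exp (2 ^ k * ln (3/2))" by simp
    also have "\<dots> = (3/2) ^ (2 ^ k)" using exp_of_nat_mult[of "2 ^ k" "ln (3/2) :: real"] by simp
    finally have e: "exp (\<alpha> * (t (Suc k))\<^sup>2) \<le> (3/2) ^ (2 ^ k)" .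
    have T0: "0 \<le> T s" for s by (simp add: T_def)
    have "T (t k) \<le> 1 * (1/3) ^ (2 ^ k)"
      using T0[of \<tau>] by (intro order_trans[OF tail] mult_right_mono) (simp_all add: a_def)
    with e T0 have "exp (\<alpha> * (t (Suc k))\<^sup>2) * T (t k) \<le> (3/2) ^ (2 ^ k) * (1 * (1/3) ^ (2 ^ k))"
      by (intro mult_mono) simp_all
    also have "\<dots> = (1/2) ^ (2 ^ k)" by (simp flip: power_mult_distrib)
    also have "\<dots> \<le> (1/2) ^ k" by (rule power_decreasing) (auto intro: less_imp_le)
    finally show ?thesis .
  qed
  have "(\<integral>\<^sup>+x. ennreal (exp (\<alpha> * (norm x)\<^sup>2)) \<partial>M)
      \<le> (\<integral>\<^sup>+x. ennreal (exp (\<alpha> * \<tau>\<^sup>2)) + (\<Sum>k. ennreal (exp (\<alpha> * (t (Suc k))\<^sup>2)) * indicator {x. t k < norm x} x) \<partial>M)"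
  proof (intro nn_integral_mono)
    fix x :: 'a
    show "ennreal (exp (\<alpha> * (norm x)\<^sup>2)) \<le> ennreal (exp (\<alpha> * \<tau>\<^sup>2)) + (\<Sum>k. ennreal (exp (\<alpha> * (t (Suc k))\<^sup>2)) * indicator {x. t k < norm x} x)"
    proof (cases "norm x \<le> \<tau>")
      case True
      then have "exp (\<alpha> * (norm x)\<^sup>2) \<le> exp (\<alpha> * \<tau>\<^sup>2)" using \<alpha> by (auto intro!: mult_left_mono power_mono)
      then show ?thesis by (meson add_increasing2 ennreal_leI zero_le)
    next
      case False
      obtain k0 where "norm x / (\<tau> / 4) \<le> real k0" using real_arch_simple by blast
      then have "norm x \<le> t k0" using t_lb[of k0] \<tau> by (simp add: field_simps)
      then have ex: "\<exists>k. norm x \<le> t k" by blast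
      define k where "k = (LEAST k. norm x \<le> t k)"
      have k: "norm x \<le> t k" unfolding k_def by (rule LeastI_ex[OF ex])
      then have "k \<noteq> 0" using False by (auto simp: t_0 intro: gr0I)
      then obtain j where j: "k = Suc j" using not0_implies_Suc by blast
      have "t j < norm x" using not_less_Least[of j "\<lambda>k. norm x \<le> t k"] j by (auto simp: k_def)
      moreover have "exp (\<alpha> * (norm x)\<^sup>2) \<le> exp (\<alpha> * (t (Suc j))\<^sup>2)"
        using k j \<alpha> by (auto intro!: mult_left_mono power_mono)
      ultimately have "ennreal (exp (\<alpha> * (norm x)\<^sup>2)) \<le> ennreal (exp (\<alpha> * (t (Suc j))\<^sup>2)) * indicator {x. t j < norm x} x"
        by (auto intro: ennreal_leI)
      also have "\<dots> \<le> (\<Sum>k. ennreal (exp (\<alpha> * (t (Suc k))\<^sup>2)) * indicator {x. t k < norm x} x)"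
      proof -
        have "f j \<le> suminf f" for f :: "nat \<Rightarrow> ennreal"
          using sum_le_suminf[of f "{j}"] by simp
        then show ?thesis by fast
      qed
      finally show ?thesis by (simp add: add_increasing)
    qed
  qed
  also have "\<dots> = ennreal (exp (\<alpha> * \<tau>\<^sup>2)) + (\<Sum>k. ennreal (exp (\<alpha> * (t (Suc k))\<^sup>2)) * emeasure M {x. t k < norm x})"
    by (subst nn_integral_add, simp, simp, subst nn_integral_suminf)
      (simp_all add: emeasure_space_1[simplified] nn_integral_cmult sM)
  also have "\<dots> \<le> ennreal (exp (\<alpha> * \<tau>\<^sup>2)) + (\<Sum>k. ennreal ((1/2) ^ k))"
    by (intro add_left_mono suminf_le)
      (auto simp: emeasure_eq_measure T_def[symmetric] ennreal_mult'[symmetric] intro!: ennreal_leI step)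
  also have "(\<Sum>k. ennreal ((1/2) ^ k)) = ennreal (\<Sum>k. (1/2) ^ k)"
    by (rule suminf_ennreal2) auto
  also have "ennreal (exp (\<alpha> * \<tau>\<^sup>2)) + \<dots> < \<infinity>" by simp
  finally have "(\<integral>\<^sup>+x. ennreal (exp (\<alpha> * (norm x)\<^sup>2)) \<partial>M) < \<infinity>" .
  then have "integrable M (\<lambda>x. exp (\<alpha> * (norm x)\<^sup>2))"
    by (intro integrableI_nonneg) auto
  with \<alpha> show ?thesis by (rule that)
qed

section \<open>The jump mechanism of the Boomerang Sampler\<close>

lemma measurable_fst_borel [measurable (raw)]:
  fixes f :: "'m \<Rightarrow> 'a::second_countable_topology \<times> 'b::second_countable_topology"
  shows "f \<in> borel_measurable M \<Longrightarrow> (\<lambda>x. fst (f x)) \<in> borel_measurable M"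
  by (rule measurable_compose[where g=fst], assumption) (simp add: borel_prod[symmetric])

lemma measurable_snd_borel [measurable (raw)]:
  fixes f :: "'m \<Rightarrow> 'a::second_countable_topology \<times> 'b::second_countable_topology"
  shows "f \<in> borel_measurable M \<Longrightarrow> (\<lambda>x. snd (f x)) \<in> borel_measurable M"
  by (rule measurable_compose[where g=snd], assumption) (simp add: borel_prod[symmetric])

locale boomerang =
  fixes \<Sigma> :: "'a::{real_inner,polish_space} \<Rightarrow> 'a" and R :: "nat \<Rightarrow> 'a \<Rightarrow> 'a"
    and \<Phi> :: "'a \<Rightarrow> real" and lam :: real and \<nu> :: "'a measure" and K :: real
  assumes gauss: "centered_gaussian \<Sigma> \<nu>" and Sigma_pos: "pos_definite \<Sigma>" and Sigma_linear: "linear \<Sigma>"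
    and refl: "boomerang_reflections \<Sigma> R" and lam_pos: "0 < lam"
    and Phi_gderiv: "GDERIV \<Phi> x :> gradient \<Phi> x" and Phi_nonneg: "0 \<le> \<Phi> x"
    and grad_le: "norm (gradient \<Phi> x) \<le> K * (1 + norm x)"
    and grad_cont: "continuous_on UNIV (gradient \<Phi>)"
begin

sublocale nu: prob_space \<nu> using gauss by (simp add: centered_gaussian_def)

lemma sets_nu [measurable_cong, simp]: "sets \<nu> = sets borel" using gauss by (simp add: centered_gaussian_def)
lemma space_nu [simp]: "space \<nu> = UNIV" using sets_eq_imp_space_eq[OF sets_nu] by simp

lemma R_linear: "linear (R n)" and R_R [simp]: "R n (R n v) = v" and norm_R [simp]: "norm (R n v) = norm v"
  and R_sums: "(\<lambda>n. (norm (v - R n v))\<^sup>2) sums (4 * (norm v)\<^sup>2)" "(\<lambda>n. v - R n v) sums (2 *\<^sub>R v)"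
  using refl by (auto simp: boomerang_reflections_def)

lemma R_diff: "R n (v - w) = R n v - R n w" and R_minus: "R n (- v) = - R n v"
  using R_linear[of n] by (simp_all add: linear_diff linear_neg)

lemma R_bounded_linear: "bounded_linear (R n)"
  using R_linear[of n] by (intro bounded_linear_intro[where K=1]) (auto simp: linear_add linear_scale)

lemma R_measurable [measurable]: "R n \<in> borel_measurable borel"
  by (intro borel_measurable_continuous_onI linear_continuous_on R_bounded_linear)

section \<open>Summability of the bounce rates\<close>

lemma R_inner: "R n p \<bullet> R n v = p \<bullet> v"
proof -
  have "R n p \<bullet> R n v = ((norm (R n p + R n v))\<^sup>2 - (norm (R n p - R n v))\<^sup>2) / 4"
    by (simp add: power2_norm_eq_inner inner_simps inner_commute)
  also have "\<dots> = ((norm (p + v))\<^sup>2 - (norm (p - v))\<^sup>2) / 4"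
    by (simp flip: linear_add[OF R_linear] R_diff)
  also have "\<dots> = p \<bullet> v" by (simp add: power2_norm_eq_inner inner_simps inner_commute)
  finally show ?thesis .
qed

lemma R_sym: "p \<bullet> R n v = R n p \<bullet> v"
  using R_inner[of n "R n p" v] by simp

text \<open>\<open>R n\<close> is an orthogonal involution, hence self-adjoint, and half of
  \<open>1 - R n\<close> is an orthogonal projection. The symmetric form in \<open>p\<close> and
  \<open>v\<close> permits Cauchy-Schwarz term by term.\<close>

lemma inner_reflection: "p \<bullet> (v - R n v) = (p - R n p) \<bullet> (v - R n v) / 2"
  by (simp add: inner_diff_left inner_diff_right R_inner R_sym[symmetric])

text \<open>The signed series has the known sum \<open>2 * (p \<bullet> v)\<close> by the assumption
  on the reflections; the absolute series is the remaining part of the total rate.\<close>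

definition refl_abs :: "'a \<Rightarrow> 'a \<Rightarrow> real" where
  "refl_abs p v = (\<Sum>n. \<bar>p \<bullet> (v - R n v)\<bar>)"

text \<open>Termwise Cauchy-Schwarz and a weighted inequality of arithmetic and geometric means
  reduce the series to those of \<open>(norm (p - R n p))\<^sup>2\<close> and
  \<open>(norm (v - R n v))\<^sup>2\<close>, whose sums are prescribed.\<close>

lemma refl_abs_aux: "summable (\<lambda>n. \<bar>p \<bullet> (v - R n v)\<bar>) \<and> refl_abs p v \<le> 2 * norm p * norm v"
proof (cases "p = 0 \<or> v = 0")
  case True
  then show ?thesis by (auto simp: refl_abs_def linear_0[OF R_linear])
next
  case False
  then have pos: "0 < norm p" "0 < norm v" by auto
  \<comment> \<open>This weight balances the two series and yields exactly
    \<open>2 * norm p * norm v\<close>.\<close>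
  define c where "c = norm v / norm p"
  have c: "0 < c" using pos by (simp add: c_def)
  have b: "\<bar>p \<bullet> (v - R n v)\<bar> \<le> (c * (norm (p - R n p))\<^sup>2 + (norm (v - R n v))\<^sup>2 / c) / 4" for n
  proof -
    have "\<bar>p \<bullet> (v - R n v)\<bar> \<le> norm (p - R n p) * norm (v - R n v) / 2"
      unfolding inner_reflection[of p v n] using Cauchy_Schwarz_ineq2[of "p - R n p" "v - R n v"] by simp
    also have "norm (p - R n p) * norm (v - R n v) = (sqrt c * norm (p - R n p)) * (norm (v - R n v) / sqrt c)"
      using c by simp
    also have "\<dots> \<le> ((sqrt c * norm (p - R n p))\<^sup>2 + (norm (v - R n v) / sqrt c)\<^sup>2) / 2"
      using sum_squares_bound[of "sqrt c * norm (p - R n p)" "norm (v - R n v) / sqrt c"] c by (simp add: mult.assoc)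
    finally show ?thesis using c by (simp add: power_mult_distrib power_divide)
  qed
  have s: "(\<lambda>n. (c * (norm (p - R n p))\<^sup>2 + (norm (v - R n v))\<^sup>2 / c) / 4) sums ((c * (4 * (norm p)\<^sup>2) + 4 * (norm v)\<^sup>2 / c) / 4)"
    by (intro sums_divide sums_add sums_mult R_sums)
  have "summable (\<lambda>n. \<bar>p \<bullet> (v - R n v)\<bar>)"
    using b by (intro summable_comparison_test'[OF sums_summable[OF s], of 0]) auto
  moreover have "refl_abs p v \<le> (c * (4 * (norm p)\<^sup>2) + 4 * (norm v)\<^sup>2 / c) / 4"
    unfolding refl_abs_def sums_unique[OF s] using b calculation by (intro suminf_le sums_summable[OF s]) auto
  moreover have "(c * (4 * (norm p)\<^sup>2) + 4 * (norm v)\<^sup>2 / c) / 4 = 2 * norm p * norm v"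
    using pos by (simp add: c_def power2_eq_square)
  ultimately show ?thesis by simp
qed

lemmas refl_abs_summable = refl_abs_aux[THEN conjunct1]
lemmas refl_abs_le = refl_abs_aux[THEN conjunct2]

lemma refl_abs_add1: "refl_abs (p + q) v \<le> refl_abs p v + refl_abs q v"
  unfolding refl_abs_def
  by (subst suminf_add[OF refl_abs_summable refl_abs_summable])
    (intro suminf_le refl_abs_summable summable_add, simp add: inner_add_left)

lemma refl_abs_add2: "refl_abs p (v + w) \<le> refl_abs p v + refl_abs p w"
proof -
  have "\<bar>p \<bullet> (v + w - R n (v + w))\<bar> \<le> \<bar>p \<bullet> (v - R n v)\<bar> + \<bar>p \<bullet> (w - R n w)\<bar>" for n
    by (simp add: inner_diff_right inner_add_right linear_add[OF R_linear])
  then show ?thesis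
    unfolding refl_abs_def
    by (subst suminf_add[OF refl_abs_summable refl_abs_summable]) (intro suminf_le refl_abs_summable summable_add)
qed

lemma refl_abs_minus [simp]: "refl_abs p (- v) = refl_abs p v"
  unfolding refl_abs_def by (simp add: R_minus inner_diff_right abs_minus_commute)

lemma refl_abs_diff: "\<bar>refl_abs p v - refl_abs p' v'\<bar> \<le> 2 * norm (p - p') * norm v + 2 * norm p' * norm (v - v')"
  using refl_abs_add1[of p' "p - p'" v] refl_abs_add1[of p "p' - p" v] refl_abs_add2[of p' v' "v - v'"] refl_abs_add2[of p' v "v' - v"]
    refl_abs_le[of "p - p'" v] refl_abs_le[of "p' - p" v] refl_abs_le[of p' "v - v'"] refl_abs_le[of p' "v' - v"]
  by (simp add: norm_minus_commute)

lemma continuous_refl_abs: "continuous_on UNIV (\<lambda>(p, v). refl_abs p v)"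
proof (clarsimp simp: continuous_on_eq_continuous_at isCont_def)
  fix p v :: 'a
  have "((\<lambda>q. 2 * norm (fst q - p) * norm (snd q) + 2 * norm p * norm (snd q - v)) \<longlongrightarrow> 0) (at (p, v))"
    by (auto intro!: tendsto_eq_intros)
  then have "((\<lambda>q. refl_abs (fst q) (snd q) - refl_abs p v) \<longlongrightarrow> 0) (at (p, v))"
    by (rule Lim_null_comparison[rotated]) (auto intro!: always_eventually refl_abs_diff)
  then show "((\<lambda>(p, v). refl_abs p v) \<longlongrightarrow> refl_abs p v) (at (p, v))"
    by (subst Lim_null) (simp add: split_beta')
qed

abbreviation "rate \<equiv> total_rate lam \<Phi> R"

lemma event_rate_nonneg: "0 \<le> event_rate \<Phi> R n z"
  by (simp add: event_rate_def split_beta')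

text \<open>A positive part is half the sum of the value and its absolute value, so the series
  splits into the signed one and \<open>refl_abs\<close>.\<close>

lemma event_rate_sums:
  "(\<lambda>n. event_rate \<Phi> R n z) sums (gradient \<Phi> (fst z) \<bullet> snd z / 2 + refl_abs (gradient \<Phi> (fst z)) (snd z) / 4)"
proof -
  obtain x v where z: "z = (x, v)" by (cases z)
  have "(\<lambda>n. (gradient \<Phi> x \<bullet> (v - R n v)) / 4 + \<bar>gradient \<Phi> x \<bullet> (v - R n v)\<bar> / 4)
     sums ((gradient \<Phi> x \<bullet> (2 *\<^sub>R v)) / 4 + refl_abs (gradient \<Phi> x) v / 4)"
    unfolding refl_abs_def
    by (intro sums_add sums_divide summable_sums refl_abs_summable bounded_linear.sums[OF bounded_linear_inner_right] R_sums)
  moreover have "gradient \<Phi> x \<bullet> (v - R n v) / 4 + \<bar>gradient \<Phi> x \<bullet> (v - R n v)\<bar> / 4 = event_rate \<Phi> R n z" for n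
    by (simp add: event_rate_def z max_def)
  ultimately show ?thesis by (simp add: z)
qed

lemma rate_eq: "rate z = lam + gradient \<Phi> (fst z) \<bullet> snd z / 2 + refl_abs (gradient \<Phi> (fst z)) (snd z) / 4"
  unfolding total_rate_def sums_unique[OF event_rate_sums[of z], symmetric] by simp

lemma rate_ge_lam: "lam \<le> rate z"
  unfolding total_rate_def by (auto intro!: suminf_nonneg sums_summable[OF event_rate_sums] event_rate_nonneg)

lemma rate_le: "rate z \<le> lam + norm (gradient \<Phi> (fst z)) * norm (snd z)"
  using refl_abs_le[of "gradient \<Phi> (fst z)" "snd z"] norm_cauchy_schwarz[of "gradient \<Phi> (fst z)" "snd z"]
  unfolding rate_eq by simp

lemma continuous_rate: "continuous_on UNIV rate"
proof -
  have g: "continuous_on UNIV (\<lambda>z::'a \<times> 'a. gradient \<Phi> (fst z))"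
    by (rule continuous_on_compose2[OF grad_cont]) (auto intro: continuous_intros)
  have "continuous_on UNIV (\<lambda>z::'a \<times> 'a. refl_abs (gradient \<Phi> (fst z)) (snd z))"
    using continuous_on_compose2[OF continuous_refl_abs continuous_on_Pair[OF g continuous_on_snd[OF continuous_on_id]]]
    by simp
  then show ?thesis unfolding rate_eq[abs_def] by (intro continuous_intros g) auto
qed

lemma gradient_measurable [measurable]: "gradient \<Phi> \<in> borel_measurable borel"
  by (rule borel_measurable_continuous_onI[OF grad_cont])

lemma event_rate_measurable [measurable]: "event_rate \<Phi> R n \<in> borel_measurable borel"
proof -
  have "(\<lambda>z. max 0 (gradient \<Phi> (fst z) \<bullet> (snd z - R n (snd z))) / 2) \<in> borel_measurable borel" by measurable
  then show ?thesis by (simp add: event_rate_def[abs_def] split_beta')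
qed

lemma rate_measurable' [measurable]: "rate \<in> borel_measurable borel"
  by (rule borel_measurable_continuous_onI[OF continuous_rate])

section \<open>The sampler as a piecewise deterministic process\<close>

abbreviation "marks \<equiv> uniform_measure lborel {0..<1::real} \<Otimes>\<^sub>M \<nu>"
abbreviation "jump z \<xi> \<equiv> post_jump lam \<Phi> R z (fst \<xi>) (snd \<xi>)"

lemma prob_space_uniform: "prob_space (uniform_measure lborel {0..<1::real})"
  by (rule prob_space_uniform_measure) auto

lemma post_jump_measurable:
  "(\<lambda>(z, \<xi>). jump z \<xi>) \<in> borel \<Otimes>\<^sub>M marks \<rightarrow>\<^sub>M borel"
proof -
  let ?M = "borel \<Otimes>\<^sub>M marks :: (('a \<times> 'a) \<times> real \<times> 'a) measure"
  let ?L = "\<lambda>p. LEAST n. fst (snd p) * rate (fst p) < lam + (\<Sum>i\<le>n. event_rate \<Phi> R i (fst p))"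
  have "(\<lambda>p. fst (snd p)) \<in> ?M \<rightarrow>\<^sub>M uniform_measure lborel {0..<1}" by measurable
  then have [measurable]: "(\<lambda>p. fst (snd p)) \<in> borel_measurable ?M" by simp
  have "(\<lambda>p. snd (snd p)) \<in> ?M \<rightarrow>\<^sub>M \<nu>" by measurable
  then have [measurable]: "(\<lambda>p. snd (snd p)) \<in> borel_measurable ?M" by simp
  have [measurable]: "?L \<in> ?M \<rightarrow>\<^sub>M count_space UNIV" by measurable
  have "(\<lambda>p. (\<lambda>n p. (fst (fst p), R n (snd (fst p)))) (?L p) p) \<in> ?M \<rightarrow>\<^sub>M borel"
    by (rule measurable_compose_countable) measurable
  then show ?thesis unfolding post_jump_def split_beta' by measurable
qed

sublocale pdmp marks boomerang_flow rate "\<lambda>z \<xi>. jump z \<xi>" lam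
proof (intro pdmp.intro pdmp_axioms.intro)
  show "prob_space marks" by (intro prob_space_pair prob_space_uniform nu.prob_space_axioms)
  show "continuous_on UNIV (\<lambda>t. rate (boomerang_flow t z))" for z
    by (rule continuous_on_compose2[OF continuous_rate])
      (auto simp: boomerang_flow_def split_beta' intro!: continuous_intros)
  show "(\<lambda>(t, z). boomerang_flow t z) \<in> borel \<Otimes>\<^sub>M borel \<rightarrow>\<^sub>M (borel :: ('a \<times> 'a) measure)" by measurable
qed (auto simp: boomerang_flow_0 boomerang_flow_add rate_ge_lam lam_pos post_jump_measurable)

lemma jump_chain_eq: "jump_chain lam \<Phi> R z \<omega> k = chain z \<omega> k"
  by (induction k)
    (auto simp: Let_def split_beta' waiting_time_def waiting_def cum_def)

lemma boomerang_path_eq: "boomerang_path lam \<Phi> R z \<omega> t = path z \<omega> t"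
  unfolding boomerang_path_def path_def jump_chain_eq ..

lemma noise_eq: "noise \<nu> = inputs" by (simp add: noise_def inputs_def)

text \<open>The unit interval of the uniform variable is cut at the points
  \<open>c n / ?\<Lambda>\<close>. Since \<open>c n\<close> tends to \<open>?\<Lambda>\<close>,
  every \<open>u < 1\<close> falls into exactly one piece, and \<open>LEAST\<close> in
  \<open>post_jump\<close> picks its index.\<close>

lemma jump_mean:
  assumes [measurable]: "h \<in> borel_measurable borel"
  shows "(\<integral>\<^sup>+\<xi>. h (jump z \<xi>) \<partial>marks) =
     ennreal (lam / rate z) * (\<integral>\<^sup>+w. h (fst z, w) \<partial>\<nu>) + (\<Sum>n. ennreal (event_rate \<Phi> R n z / rate z) * h (fst z, R n (snd z)))"
proof -
  let ?U = "uniform_measure lborel {0..<1::real}"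
  let ?\<Lambda> = "rate z"
  define c where "c n = lam + (\<Sum>i<n. event_rate \<Phi> R i z)" for n
  have L: "0 < ?\<Lambda>" using rate_ge_lam[of z] lam_pos by simp
  have c0: "c 0 = lam" by (simp add: c_def)
  have c_mono: "c n \<le> c (Suc n)" for n using event_rate_nonneg[of n z] by (simp add: c_def)
  then have c_mono': "m \<le> n \<Longrightarrow> c m \<le> c n" for m n by (rule lift_Suc_mono_le)
  have c_le: "c n \<le> ?\<Lambda>" for n
    unfolding c_def total_rate_def
    by (intro add_left_mono sum_le_suminf sums_summable[OF event_rate_sums]) (auto simp: event_rate_nonneg)
  have c_lim: "c \<longlonglongrightarrow> ?\<Lambda>"
    unfolding c_def total_rate_def
    by (intro tendsto_intros summable_LIMSEQ sums_summable[OF event_rate_sums])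
  have c_pos: "0 < c n" for n using c_mono'[of 0 n] c0 lam_pos by simp
  have lebesgue: "(\<integral>\<^sup>+u. indicator {a / ?\<Lambda>..<b / ?\<Lambda>} u \<partial>?U) = ennreal ((b - a) / ?\<Lambda>)"
    if "0 \<le> a" "a \<le> b" "b \<le> ?\<Lambda>" for a b
  proof -
    have "{0..<1} \<inter> {a / ?\<Lambda>..<b / ?\<Lambda>} = {a / ?\<Lambda>..<b / ?\<Lambda>}" using that L by (auto simp: field_simps)
    moreover have "a / ?\<Lambda> \<le> b / ?\<Lambda>" using that L by (simp add: divide_right_mono)
    ultimately show ?thesis using divide_ennreal[of "b / ?\<Lambda> - a / ?\<Lambda>" 1] by (simp add: diff_divide_distrib)
  qed
  have val: "(\<integral>\<^sup>+w. h (jump z (u, w)) \<partial>\<nu>) = indicator {0 / ?\<Lambda>..<lam / ?\<Lambda>} u * (\<integral>\<^sup>+w. h (fst z, w) \<partial>\<nu>)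
      + (\<Sum>n. indicator {c n / ?\<Lambda>..<c (Suc n) / ?\<Lambda>} u * h (fst z, R n (snd z)))" if u: "u \<in> {0..<1}" for u
  proof -
    have iv: "(u \<in> {a / ?\<Lambda>..<b / ?\<Lambda>}) \<longleftrightarrow> a \<le> u * ?\<Lambda> \<and> u * ?\<Lambda> < b" for a b
      using L by (auto simp: field_simps)
    show ?thesis
    proof (cases "u * ?\<Lambda> < lam")
      case True
      then have "u \<notin> {c n / ?\<Lambda>..<c (Suc n) / ?\<Lambda>}" for n
        unfolding iv using c_mono'[of 0 n] c0 by auto
      moreover have "u \<in> {0 / ?\<Lambda>..<lam / ?\<Lambda>}" unfolding iv using True u L by simp
      then have ind: "indicator {0 / ?\<Lambda>..<lam / ?\<Lambda>} u = (1::ennreal)" by (rule indicator_simps)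
      ultimately show ?thesis unfolding ind using True by (simp add: post_jump_def)
    next
      case False
      have "u * ?\<Lambda> < ?\<Lambda>" using u L by simp
      then have "\<forall>\<^sub>F n in sequentially. u * ?\<Lambda> < c n" using order_tendstoD(1)[OF c_lim] by simp
      then obtain n0 where "u * ?\<Lambda> < c (Suc n0)" unfolding eventually_sequentially by (metis le_SucI le_refl)
      then have ex: "\<exists>n. u * ?\<Lambda> < c (Suc n)" by blast
      define m where "m = (LEAST n. u * ?\<Lambda> < c (Suc n))"
      have m: "u * ?\<Lambda> < c (Suc m)" unfolding m_def by (rule LeastI_ex[OF ex])
      have mle: "c m \<le> u * ?\<Lambda>"
      proof (cases m)
        case 0
        then show ?thesis using False c0 by simp
      next
        case (Suc l)
        then have "\<not> u * ?\<Lambda> < c (Suc l)" unfolding m_def by (intro not_less_Least) simp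
        then show ?thesis using Suc by simp
      qed
      have "u \<in> {c n / ?\<Lambda>..<c (Suc n) / ?\<Lambda>} \<longleftrightarrow> n = m" for n
        unfolding iv using m mle c_mono'[of "Suc n" m] c_mono'[of "Suc m" n]
        by (cases n m rule: linorder_cases) auto
      then have ind: "indicator {c n / ?\<Lambda>..<c (Suc n) / ?\<Lambda>} u = (if n = m then 1 else 0 :: ennreal)" for n
        by (simp add: indicator_def)
      have "(\<Sum>n. indicator {c n / ?\<Lambda>..<c (Suc n) / ?\<Lambda>} u * h (fst z, R n (snd z))) = (\<Sum>n\<in>{m}. (if n = m then 1 else 0) * h (fst z, R n (snd z)))"
        unfolding ind by (intro suminf_finite) auto
      then have "(\<Sum>n. indicator {c n / ?\<Lambda>..<c (Suc n) / ?\<Lambda>} u * h (fst z, R n (snd z))) = h (fst z, R m (snd z))"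
        by simp
      moreover have "jump z (u, w) = (fst z, R m (snd z))" for w
        using False by (simp add: post_jump_def m_def c_def lessThan_Suc_atMost)
      moreover have "u \<notin> {0 / ?\<Lambda>..<lam / ?\<Lambda>}" unfolding iv using False by simp
      ultimately show ?thesis by (simp add: nu.emeasure_space_1[simplified])
    qed
  qed
  have "(\<integral>\<^sup>+\<xi>. h (jump z \<xi>) \<partial>marks) = (\<integral>\<^sup>+u. \<integral>\<^sup>+w. h (jump z (u, w)) \<partial>\<nu> \<partial>?U)"
    by (rule nu.nn_integral_fst[symmetric]) measurable
  also have "\<dots> = (\<integral>\<^sup>+u. indicator {0 / ?\<Lambda>..<lam / ?\<Lambda>} u * (\<integral>\<^sup>+w. h (fst z, w) \<partial>\<nu>)
      + (\<Sum>n. indicator {c n / ?\<Lambda>..<c (Suc n) / ?\<Lambda>} u * h (fst z, R n (snd z))) \<partial>?U)"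
    by (intro nn_integral_cong_AE AE_uniform_measureI AE_I2 impI) (use val in simp_all)
  also have "\<dots> = (\<integral>\<^sup>+u. indicator {0 / ?\<Lambda>..<lam / ?\<Lambda>} u * (\<integral>\<^sup>+w. h (fst z, w) \<partial>\<nu>) \<partial>?U)
      + (\<Sum>n. \<integral>\<^sup>+u. indicator {c n / ?\<Lambda>..<c (Suc n) / ?\<Lambda>} u * h (fst z, R n (snd z)) \<partial>?U)"
    by (subst nn_integral_add) (auto simp: nn_integral_suminf)
  also have "(\<integral>\<^sup>+u. indicator {0 / ?\<Lambda>..<lam / ?\<Lambda>} u * (\<integral>\<^sup>+w. h (fst z, w) \<partial>\<nu>) \<partial>?U) = ennreal (lam / ?\<Lambda>) * (\<integral>\<^sup>+w. h (fst z, w) \<partial>\<nu>)"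
    using lebesgue[of 0 lam] lam_pos rate_ge_lam[of z] by (subst nn_integral_multc) auto
  also have "(\<lambda>n. \<integral>\<^sup>+u. indicator {c n / ?\<Lambda>..<c (Suc n) / ?\<Lambda>} u * h (fst z, R n (snd z)) \<partial>?U) = (\<lambda>n. ennreal (event_rate \<Phi> R n z / ?\<Lambda>) * h (fst z, R n (snd z)))"
  proof
    fix n
    have "c (Suc n) - c n = event_rate \<Phi> R n z" by (simp add: c_def)
    then show "(\<integral>\<^sup>+u. indicator {c n / ?\<Lambda>..<c (Suc n) / ?\<Lambda>} u * h (fst z, R n (snd z)) \<partial>?U) = ennreal (event_rate \<Phi> R n z / ?\<Lambda>) * h (fst z, R n (snd z))"
      using lebesgue[of "c n" "c (Suc n)"] c_pos[of n] c_mono[of n] c_le[of "Suc n"] by (subst nn_integral_multc) auto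
  qed
  finally show ?thesis .
qed

lemma J_eq:
  assumes [measurable]: "h \<in> borel_measurable borel"
  shows "J h z = ennreal lam * (\<integral>\<^sup>+w. h (fst z, w) \<partial>\<nu>) + (\<Sum>n. ennreal (event_rate \<Phi> R n z) * h (fst z, R n (snd z)))"
proof -
  have L: "0 < rate z" by (rule rate_pos)
  have "ennreal (rate z) * (ennreal (event_rate \<Phi> R n z / rate z) * h (fst z, R n (snd z))) = ennreal (event_rate \<Phi> R n z) * h (fst z, R n (snd z))" for n
    unfolding mult.assoc[symmetric] using L event_rate_nonneg[of n z] by (simp add: ennreal_mult'[symmetric])
  moreover have "ennreal (rate z) * (ennreal (lam / rate z) * (\<integral>\<^sup>+w. h (fst z, w) \<partial>\<nu>)) = ennreal lam * (\<integral>\<^sup>+w. h (fst z, w) \<partial>\<nu>)"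
    unfolding mult.assoc[symmetric] using L lam_pos by (simp add: ennreal_mult'[symmetric])
  ultimately show ?thesis
    unfolding J_def jump_mean[OF assms] by (simp add: distrib_left ennreal_suminf_cmult[symmetric])
qed


section \<open>Velocity flip and invariance\<close>

lemma K_nonneg: "0 \<le> K" using order_trans[OF norm_ge_zero grad_le[of 0]] by simp

lemma nu_prob_UNIV [simp]: "measure \<nu> UNIV = 1" using nu.prob_space by simp

text \<open>\<open>R n\<close> is its own adjoint, so the assumed identity for
  \<open>R n \<circ> \<Sigma> \<circ> adjoint (R n)\<close> says that the covariance is
  invariant.\<close>

lemma nu_invariant_R: "distr \<nu> borel (R n) = \<nu>"
proof (rule centered_gaussian_invariant[OF gauss Sigma_pos Sigma_linear, where T'="R n"])
  have "adjoint (R n) = R n" by (rule adjoint_unique) (simp add: R_sym)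
  then have "\<Sigma> q \<bullet> q = R n (\<Sigma> (R n q)) \<bullet> q" for q
    using refl unfolding boomerang_reflections_def by metis
  then show "\<Sigma> (R n q) \<bullet> R n q = \<Sigma> q \<bullet> q" for q by (simp add: R_sym)
qed (auto simp: R_sym)

lemma nu_invariant_minus: "distr \<nu> borel uminus = \<nu>"
  by (rule centered_gaussian_invariant[OF gauss Sigma_pos Sigma_linear, where T'=uminus])
    (auto simp: linear_neg[OF Sigma_linear])

lemma integrable_norm_sq: "integrable \<nu> (\<lambda>x. (norm x)\<^sup>2)"
proof -
  obtain \<alpha> where \<alpha>: "0 < \<alpha>" "integrable \<nu> (\<lambda>x. exp (\<alpha> * (norm x)\<^sup>2))"
    using fernique[OF gauss Sigma_pos Sigma_linear] .
  show ?thesis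
  proof (rule Bochner_Integration.integrable_bound)
    show "integrable \<nu> (\<lambda>x. exp (\<alpha> * (norm x)\<^sup>2) / \<alpha>)" using \<alpha> by simp
    have "(norm x)\<^sup>2 \<le> exp (\<alpha> * (norm x)\<^sup>2) / \<alpha>" for x :: 'a
    proof -
      have "\<alpha> * (norm x)\<^sup>2 \<le> exp (\<alpha> * (norm x)\<^sup>2)" using exp_ge_add_one_self[of "\<alpha> * (norm x)\<^sup>2"] by linarith
      then show ?thesis using \<alpha>(1) by (simp add: pos_le_divide_eq mult.commute)
    qed
    then show "AE x in \<nu>. norm ((norm x)\<^sup>2) \<le> norm (exp (\<alpha> * (norm x)\<^sup>2) / \<alpha>)" using \<alpha>(1) by simp
  qed simp
qed

lemma norm_fst_le': "norm (fst z) \<le> norm (z :: 'a \<times> 'a)" and norm_snd_le': "norm (snd z) \<le> norm (z :: 'a \<times> 'a)"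
  by (cases z, simp add: norm_fst_le norm_snd_le)+

text \<open>Flow and bounces preserve \<open>1 + (norm z)\<^sup>2\<close>, and a refreshment raises
  its mean by at most the second moment of \<open>\<nu>\<close>. Linear growth of the gradient makes
  the rate at most quadratic, so this function serves as \<open>V\<close>.\<close>

lemma Pt_one_boomerang:
  assumes "0 \<le> t" shows "Pt (\<lambda>_. 1) t z = 1"
proof (rule Pt_one[where V="\<lambda>z. 1 + (norm z)\<^sup>2" and c="lam * (\<integral>w. (norm w)\<^sup>2 \<partial>\<nu>)" and C="lam + 2 * K", OF _ _ _ _ _ _ assms])
  let ?m = "\<integral>w. (norm w)\<^sup>2 \<partial>\<nu>"
  have m: "0 \<le> ?m" by simp
  fix z :: "'a \<times> 'a"
  obtain x v where z: "z = (x, v)" by (cases z)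
  have "(\<integral>\<^sup>+w. ennreal (1 + (norm (x, w))\<^sup>2) \<partial>\<nu>) = (\<integral>\<^sup>+w. ennreal (1 + (norm x)\<^sup>2 + (norm w)\<^sup>2) \<partial>\<nu>)"
    by (simp add: norm_Pair add.assoc)
  also have "\<dots> = ennreal (\<integral>w. 1 + (norm x)\<^sup>2 + (norm w)\<^sup>2 \<partial>\<nu>)"
    using integrable_norm_sq by (intro nn_integral_eq_integral) auto
  also have "(\<integral>w. 1 + (norm x)\<^sup>2 + (norm w)\<^sup>2 \<partial>\<nu>) = 1 + (norm x)\<^sup>2 + ?m"
    using integrable_norm_sq by (simp add: nu.prob_space)
  finally have r: "(\<integral>\<^sup>+w. ennreal (1 + (norm (x, w))\<^sup>2) \<partial>\<nu>) = ennreal (1 + (norm x)\<^sup>2 + ?m)" .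
  have "(\<Sum>n. ennreal (event_rate \<Phi> R n z) * ennreal (1 + (norm (x, R n v))\<^sup>2)) = (\<Sum>n. ennreal (event_rate \<Phi> R n z)) * ennreal (1 + (norm z)\<^sup>2)"
    by (simp add: norm_Pair z)
  also have "(\<Sum>n. ennreal (event_rate \<Phi> R n z)) = ennreal (rate z - lam)"
    unfolding total_rate_def by (simp add: suminf_ennreal2 event_rate_nonneg sums_summable[OF event_rate_sums])
  finally have "J (\<lambda>z. ennreal (1 + (norm z)\<^sup>2)) z = ennreal lam * ennreal (1 + (norm x)\<^sup>2 + ?m) + ennreal (rate z - lam) * ennreal (1 + (norm z)\<^sup>2)"
    by (subst J_eq) (simp_all only: z r fst_conv snd_conv, measurable)
  also have "\<dots> = ennreal (lam * (1 + (norm x)\<^sup>2 + ?m) + (rate z - lam) * (1 + (norm z)\<^sup>2))"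
    using lam_pos rate_ge_lam[of z] m by (simp add: ennreal_mult'[symmetric] ennreal_plus[symmetric] del: ennreal_plus)
  also have "\<dots> \<le> ennreal ((rate z + lam * ?m) * (1 + (norm z)\<^sup>2))"
  proof (rule ennreal_leI)
    have "lam * (norm x)\<^sup>2 \<le> lam * (norm z)\<^sup>2" using lam_pos by (simp add: z norm_Pair)
    moreover have "0 \<le> lam * ?m * (norm z)\<^sup>2" using lam_pos m by (intro mult_nonneg_nonneg) auto
    ultimately show "lam * (1 + (norm x)\<^sup>2 + ?m) + (rate z - lam) * (1 + (norm z)\<^sup>2) \<le> (rate z + lam * ?m) * (1 + (norm z)\<^sup>2)"
      by (simp add: algebra_simps)
  qed
  finally show "J (\<lambda>z. ennreal (1 + (norm z)\<^sup>2)) z \<le> ennreal ((rate z + lam * ?m) * (1 + (norm z)\<^sup>2))" .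
  have "rate z \<le> lam + norm (gradient \<Phi> (fst z)) * norm (snd z)" by (rule rate_le)
  also have "norm (gradient \<Phi> (fst z)) * norm (snd z) \<le> (K * (1 + norm z)) * norm z"
    using grad_le[of "fst z"] norm_fst_le'[of z] norm_snd_le'[of z] K_nonneg
    by (intro mult_mono order_trans[OF grad_le mult_left_mono]) auto
  also have "lam + \<dots> \<le> (lam + 2 * K) * (1 + (norm z)\<^sup>2)"
  proof -
    have "0 \<le> (norm z - 1)\<^sup>2" by simp
    then have "2 * norm z \<le> 1 + norm z * norm z" by (simp add: power2_eq_square algebra_simps)
    moreover have "n + q \<le> 2 * (1 + q)" if "2 * n \<le> 1 + q" "0 \<le> n" for n q :: real using that by simp
    ultimately have "norm z + norm z * norm z \<le> 2 * (1 + norm z * norm z)" using norm_ge_zero[of z] by blast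
    then have "(1 + norm z) * norm z \<le> 2 * (1 + (norm z)\<^sup>2)" by (simp add: power2_eq_square algebra_simps)
    then have "K * ((1 + norm z) * norm z) \<le> K * (2 * (1 + (norm z)\<^sup>2))" using K_nonneg by (rule mult_left_mono)
    moreover have "0 \<le> lam * (norm z)\<^sup>2" using lam_pos by simp
    ultimately show ?thesis by (simp add: algebra_simps)
  qed
  finally show "rate z \<le> (lam + 2 * K) * (1 + (norm z)\<^sup>2)" by simp
qed (use lam_pos in auto)

lemma nn_integral_boomerang_path:
  assumes "f \<in> borel_measurable borel" "0 \<le> t"
  shows "(\<integral>\<^sup>+\<omega>. f (boomerang_path lam \<Phi> R z \<omega> t) \<partial>noise \<nu>) = Pt f t z"
  unfolding boomerang_path_eq noise_eq
  by (rule nn_integral_path[OF assms Pt_one_boomerang[OF assms(2)]])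

definition flip :: "'a \<times> 'a \<Rightarrow> 'a \<times> 'a" where "flip z = (fst z, - snd z)"

lemma flip_simps [simp]: "flip (flip z) = z" "fst (flip z) = fst z" "snd (flip z) = - snd z" "norm (flip z) = norm z"
  by (auto simp: flip_def norm_Pair norm_prod_def)

lemma flip_measurable [measurable (raw)]: "f \<in> borel_measurable M \<Longrightarrow> (\<lambda>x. flip (f x)) \<in> borel_measurable M"
  unfolding flip_def
  by (intro borel_measurable_Pair borel_measurable_uminus measurable_fst_borel measurable_snd_borel)

lemma flow_flip: "boomerang_flow t (flip z) = flip (boomerang_flow (- t) z)"
  by (simp add: flip_def boomerang_flow_def split_beta')

lemma flow_flow_flip: "boomerang_flow s (flip (boomerang_flow t z)) = flip (boomerang_flow (t - s) z)"
  by (simp add: flow_flip flip: boomerang_flow_add)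

section \<open>Symmetries of the product Gaussian\<close>

abbreviation "\<gamma> \<equiv> \<nu> \<Otimes>\<^sub>M \<nu>"

lemma sets_gamma [measurable_cong]: "sets \<gamma> = sets borel"
  using sets_pair_measure_cong[OF sets_nu sets_nu] by (simp add: borel_prod[symmetric])

sublocale gamma: pair_prob_space \<nu> \<nu> ..

lemma gamma_flow:
  assumes [measurable]: "h \<in> borel_measurable borel"
  shows "(\<integral>\<^sup>+z. h (boomerang_flow t z) \<partial>\<gamma>) = (\<integral>\<^sup>+z. h z \<partial>\<gamma>)"
proof -
  have "(\<integral>\<^sup>+z. h z \<partial>\<gamma>) = (\<integral>\<^sup>+z. h z \<partial>distr \<gamma> \<gamma> (boomerang_flow t))"
    by (simp add: gaussian_rotation[OF gauss Sigma_pos Sigma_linear])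
  also have "\<dots> = (\<integral>\<^sup>+z. h (boomerang_flow t z) \<partial>\<gamma>)" by (rule nn_integral_distr) auto
  finally show ?thesis by simp
qed

lemma gamma_snd:
  assumes [measurable]: "h \<in> borel_measurable borel" "T \<in> borel_measurable borel" and inv: "distr \<nu> borel T = \<nu>"
  shows "(\<integral>\<^sup>+z. h (fst z, T (snd z)) \<partial>\<gamma>) = (\<integral>\<^sup>+z. h z \<partial>\<gamma>)"
proof -
  have "(\<integral>\<^sup>+v. h (x, v) \<partial>\<nu>) = (\<integral>\<^sup>+v. h (x, T v) \<partial>\<nu>)" for x
  proof -
    have "(\<integral>\<^sup>+v. h (x, v) \<partial>\<nu>) = (\<integral>\<^sup>+v. h (x, v) \<partial>distr \<nu> borel T)" by (simp add: inv)
    also have "\<dots> = (\<integral>\<^sup>+v. h (x, T v) \<partial>\<nu>)" by (rule nn_integral_distr) auto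
    finally show ?thesis .
  qed
  then show ?thesis by (subst (1 2) nu.nn_integral_fst[symmetric]) auto
qed

lemma gamma_flip: "h \<in> borel_measurable borel \<Longrightarrow> (\<integral>\<^sup>+z. h (flip z) \<partial>\<gamma>) = (\<integral>\<^sup>+z. h z \<partial>\<gamma>)"
  unfolding flip_def by (rule gamma_snd) (auto simp: nu_invariant_minus)

lemma gamma_R: "h \<in> borel_measurable borel \<Longrightarrow> (\<integral>\<^sup>+z. h (fst z, R n (snd z)) \<partial>\<gamma>) = (\<integral>\<^sup>+z. h z \<partial>\<gamma>)"
  by (rule gamma_snd) (auto simp: nu_invariant_R)

lemma Phi_flow_deriv:
  "((\<lambda>s. \<Phi> (fst (boomerang_flow s z))) has_real_derivative gradient \<Phi> (fst (boomerang_flow t z)) \<bullet> snd (boomerang_flow t z)) (at t)"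
proof -
  have "((\<lambda>s. fst (boomerang_flow s z)) has_vector_derivative snd (boomerang_flow t z)) (at t)"
    unfolding boomerang_flow_def split_beta'
    by (auto intro!: derivative_eq_intros simp: algebra_simps)
  then have "((\<lambda>s. \<Phi> (fst (boomerang_flow s z))) has_derivative (\<lambda>h. (h *\<^sub>R snd (boomerang_flow t z)) \<bullet> gradient \<Phi> (fst (boomerang_flow t z)))) (at t)"
    unfolding has_vector_derivative_def
    by (rule has_derivative_compose[OF _ Phi_gderiv[unfolded gderiv_def]])
  then show ?thesis by (simp add: has_field_derivative_def inner_commute mult_commute_abs)
qed

lemma Phi_continuous: "continuous_on UNIV \<Phi>"
  using Phi_gderiv by (auto intro!: has_derivative_continuous_on simp: gderiv_def)

lemma Phi_measurable [measurable]: "\<Phi> \<in> borel_measurable borel"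
  by (rule borel_measurable_continuous_onI[OF Phi_continuous])

text \<open>\<open>refl_abs\<close> is even in the velocity, so the flip changes only the signed
  part. The difference of the two rates is the derivative of \<open>\<Phi>\<close> along the
  flow.\<close>

lemma rate_flip: "rate (flip z) = rate z - gradient \<Phi> (fst z) \<bullet> snd z"
  unfolding rate_eq by simp

text \<open>At each point of the reversed arc the rate is the original one minus the derivative of
  \<open>\<Phi>\<close> along the flow. Integration leaves only the end values of
  \<open>\<Phi>\<close>, which the weight \<open>exp (- \<Phi>)\<close> compensates.\<close>

lemma cum_flip:
  assumes "0 \<le> t"
  shows "cum t (flip (boomerang_flow t z)) = cum t z - \<Phi> (fst (boomerang_flow t z)) + \<Phi> (fst z)"
proof -
  let ?y = "flip (boomerang_flow t z)"
  obtain H where H: "\<And>t. (H has_real_derivative rate (boomerang_flow t z)) (at t)" "\<And>t. 0 \<le> t \<Longrightarrow> cum t z = H t" "H 0 = 0"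
    by (rule cum_primitive[of z]) blast
  obtain H' where H': "\<And>t. (H' has_real_derivative rate (boomerang_flow t ?y)) (at t)" "\<And>t. 0 \<le> t \<Longrightarrow> cum t ?y = H' t" "H' 0 = 0"
    by (rule cum_primitive[of ?y]) blast
  have "((\<lambda>s. - H' (t - s) - H s + \<Phi> (fst (boomerang_flow s z))) has_real_derivative 0) (at s)" for s
  proof -
    have "((\<lambda>s. H' (t - s)) has_real_derivative rate (boomerang_flow (t - s) ?y) * (-1)) (at s)"
      by (rule DERIV_chain2[OF H'(1)]) (auto intro!: derivative_eq_intros)
    moreover have "rate (boomerang_flow (t - s) ?y) = rate (boomerang_flow s z) - gradient \<Phi> (fst (boomerang_flow s z)) \<bullet> snd (boomerang_flow s z)"
      by (simp add: flow_flow_flip rate_flip)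
    ultimately show ?thesis
      by (auto intro!: derivative_eq_intros Phi_flow_deriv H(1))
  qed
  then have "- H' (t - t) - H t + \<Phi> (fst (boomerang_flow t z)) = - H' (t - 0) - H 0 + \<Phi> (fst (boomerang_flow 0 z))"
    using DERIV_isconst_all[of "\<lambda>s. - H' (t - s) - H s + \<Phi> (fst (boomerang_flow s z))"] by blast
  then show ?thesis using H H' assms by simp
qed

section \<open>Duality up to the velocity flip\<close>

definition wt :: "'a \<times> 'a \<Rightarrow> ennreal" where "wt z = ennreal (exp (- \<Phi> (fst z)))"

lemma wt_measurable [measurable]: "wt \<in> borel_measurable borel" unfolding wt_def by measurable
lemma wt_flip [simp]: "wt (flip z) = wt z" and wt_pair [simp]: "wt (fst z, v) = wt z" by (simp_all add: wt_def)

definition wint :: "('a \<times> 'a \<Rightarrow> ennreal) \<Rightarrow> ennreal" where "wint h = (\<integral>\<^sup>+z. h z * wt z \<partial>\<gamma>)"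

lemma wint_flip: "h \<in> borel_measurable borel \<Longrightarrow> wint (\<lambda>z. h (flip z)) = wint h"
  unfolding wint_def using gamma_flip[of "\<lambda>z. h z * wt z"] by simp

lemma wint_mono: "(\<And>z. f z \<le> g z) \<Longrightarrow> wint f \<le> wint g"
  unfolding wint_def by (intro nn_integral_mono mult_right_mono) auto

text \<open>Flip and flow are substituted one after the other, both preserving
  \<open>\<gamma>\<close>; \<open>cum_flip\<close> trades the survival on the reversed arc for the
  ratio of the weights at its ends.\<close>

lemma S0_dual:
  assumes [measurable]: "f \<in> borel_measurable borel" "g \<in> borel_measurable borel" and t: "0 \<le> t"
  shows "wint (\<lambda>z. g z * S 0 f t z) = wint (\<lambda>z. S 0 (\<lambda>z. g (flip z)) t z * f (flip z))"
proof -
  have "wint (\<lambda>z. g z * S 0 f t z) = (\<integral>\<^sup>+z. (g z * S 0 f t z) * wt z \<partial>\<gamma>)" by (simp add: wint_def)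
  also have "\<dots> = (\<integral>\<^sup>+z. (g (flip z) * S 0 f t (flip z)) * wt (flip z) \<partial>\<gamma>)"
    by (rule gamma_flip[symmetric]) measurable
  also have "\<dots> = (\<integral>\<^sup>+z. (g (flip (boomerang_flow t z)) * S 0 f t (flip (boomerang_flow t z))) * wt (flip (boomerang_flow t z)) \<partial>\<gamma>)"
    by (rule gamma_flow[symmetric]) measurable
  also have "\<dots> = (\<integral>\<^sup>+z. (S 0 (\<lambda>z. g (flip z)) t z * f (flip z)) * wt z \<partial>\<gamma>)"
  proof (intro nn_integral_cong)
    fix z
    have "ennreal (exp (- cum t (flip (boomerang_flow t z)))) * wt (flip (boomerang_flow t z)) = ennreal (exp (- cum t z)) * wt z"
      unfolding cum_flip[OF t] wt_def by (simp add: ennreal_mult'[symmetric] flip: exp_add)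
    then show "(g (flip (boomerang_flow t z)) * S 0 f t (flip (boomerang_flow t z))) * wt (flip (boomerang_flow t z))
       = (S 0 (\<lambda>z. g (flip z)) t z * f (flip z)) * wt z"
      by (simp add: flow_flow_flip boomerang_flow_0 mult_ac) (metis mult.commute mult.left_commute)
  qed
  finally show ?thesis by (simp add: wint_def)
qed

text \<open>Refreshments are symmetric since the old and the new velocity are independent with the
  same law. For bounces one substitutes \<open>R n v\<close> for \<open>v\<close>: the states
  \<open>(x, - R n v)\<close> and \<open>(x, v)\<close> have the same rate of type
  \<open>n\<close>.\<close>

lemma J_dual:
  assumes [measurable]: "f \<in> borel_measurable borel" "g \<in> borel_measurable borel"
  shows "wint (\<lambda>z. g z * J f z) = wint (\<lambda>z. J (\<lambda>z. g (flip z)) z * f (flip z))"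
proof -
  have [measurable]: "(\<lambda>z::'a \<times> 'a. \<integral>\<^sup>+w. h (fst z, w) \<partial>\<nu>) \<in> borel_measurable borel" if [measurable]: "h \<in> borel_measurable borel" for h :: "'a \<times> 'a \<Rightarrow> ennreal"
  proof -
    have m: "(\<lambda>x. \<integral>\<^sup>+w. h (x, w) \<partial>\<nu>) \<in> borel_measurable borel" by measurable
    have "fst \<in> (borel :: ('a \<times> 'a) measure) \<rightarrow>\<^sub>M borel"
      by (rule measurable_fst_borel[where f="\<lambda>z. z"]) simp
    then show ?thesis by (rule measurable_compose[OF _ m])
  qed
  have split: "wint (\<lambda>z. a z * J b z) = (\<integral>\<^sup>+z. ennreal lam * (a z * (\<integral>\<^sup>+w. b (fst z, w) \<partial>\<nu>) * wt z) \<partial>\<gamma>)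
      + (\<Sum>n. \<integral>\<^sup>+z. ennreal (event_rate \<Phi> R n z) * (a z * b (fst z, R n (snd z)) * wt z) \<partial>\<gamma>)"
    if [measurable]: "a \<in> borel_measurable borel" "b \<in> borel_measurable borel" for a b
  proof -
    have "a z * J b z * wt z = ennreal lam * (a z * (\<integral>\<^sup>+w. b (fst z, w) \<partial>\<nu>) * wt z)
        + (\<Sum>n. ennreal (event_rate \<Phi> R n z) * (a z * b (fst z, R n (snd z)) * wt z))" for z
      by (simp add: J_eq distrib_left distrib_right mult_ac flip: ennreal_suminf_cmult ennreal_suminf_multc)
    then show ?thesis unfolding wint_def by (simp add: nn_integral_add nn_integral_suminf)
  qed
  have refresh: "(\<integral>\<^sup>+z. ennreal lam * (g z * (\<integral>\<^sup>+w. f (fst z, w) \<partial>\<nu>) * wt z) \<partial>\<gamma>)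
     = (\<integral>\<^sup>+z. ennreal lam * (f (flip z) * (\<integral>\<^sup>+w. g (flip (fst z, w)) \<partial>\<nu>) * wt z) \<partial>\<gamma>)" (is "?L = ?R")
  proof -
    have gm: "(\<integral>\<^sup>+w. g (flip (x, w)) \<partial>\<nu>) = (\<integral>\<^sup>+w. g (x, w) \<partial>\<nu>)" for x
    proof -
      have "(\<integral>\<^sup>+v. g (x, v) \<partial>\<nu>) = (\<integral>\<^sup>+v. g (x, v) \<partial>distr \<nu> borel uminus)" by (simp add: nu_invariant_minus)
      also have "\<dots> = (\<integral>\<^sup>+v. g (x, - v) \<partial>\<nu>)" by (rule nn_integral_distr) auto
      finally show ?thesis by (simp add: flip_def)
    qed
    have "?R = (\<integral>\<^sup>+z. ennreal lam * (f z * (\<integral>\<^sup>+w. g (fst z, w) \<partial>\<nu>) * wt z) \<partial>\<gamma>)"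
      using gamma_flip[of "\<lambda>z. ennreal lam * (f z * (\<integral>\<^sup>+w. g (fst z, w) \<partial>\<nu>) * wt z)"] by (simp add: gm)
    also have "\<dots> = (\<integral>\<^sup>+x. \<integral>\<^sup>+v. ennreal lam * (f (x, v) * (\<integral>\<^sup>+w. g (x, w) \<partial>\<nu>) * wt (x, 0)) \<partial>\<nu> \<partial>\<nu>)"
      by (subst nu.nn_integral_fst[symmetric]) (auto simp: wt_def)
    also have "\<dots> = (\<integral>\<^sup>+x. \<integral>\<^sup>+v. ennreal lam * (g (x, v) * (\<integral>\<^sup>+w. f (x, w) \<partial>\<nu>) * wt (x, 0)) \<partial>\<nu> \<partial>\<nu>)"
      by (rule nn_integral_cong) (simp add: nn_integral_cmult nn_integral_multc mult_ac)
    also have "\<dots> = ?L"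
      by (subst nu.nn_integral_fst[symmetric]) (auto simp: wt_def)
    finally show ?thesis by simp
  qed
  have bounce: "(\<integral>\<^sup>+z. ennreal (event_rate \<Phi> R n z) * (g z * f (fst z, R n (snd z)) * wt z) \<partial>\<gamma>)
     = (\<integral>\<^sup>+z. ennreal (event_rate \<Phi> R n z) * (f (flip z) * g (flip (fst z, R n (snd z))) * wt z) \<partial>\<gamma>)" (is "?L = ?R") for n
  proof -
    let ?h = "\<lambda>z. ennreal (event_rate \<Phi> R n (flip z)) * (f z * g (fst z, R n (snd z)) * wt z)"
    have "?R = (\<integral>\<^sup>+z. ?h (flip z) \<partial>\<gamma>)" by (simp add: flip_def R_minus wt_def)
    also have "\<dots> = (\<integral>\<^sup>+z. ?h z \<partial>\<gamma>)" by (rule gamma_flip) measurable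
    also have "\<dots> = (\<integral>\<^sup>+z. ?h (fst z, R n (snd z)) \<partial>\<gamma>)" by (rule gamma_R[symmetric]) measurable
    also have "\<dots> = ?L"
    proof (intro nn_integral_cong)
      fix z
      have "event_rate \<Phi> R n (flip (fst z, R n (snd z))) = event_rate \<Phi> R n z"
        by (simp add: flip_def event_rate_def split_beta' R_minus)
      then show "?h (fst z, R n (snd z)) = ennreal (event_rate \<Phi> R n z) * (g z * f (fst z, R n (snd z)) * wt z)"
        by (simp add: mult_ac)
    qed
    finally show ?thesis by simp
  qed
  have "wint (\<lambda>z. f (flip z) * J (\<lambda>z. g (flip z)) z) = wint (\<lambda>z. g z * J f z)"
    by (simp add: split refresh bounce)
  then show ?thesis by (simp add: mult.commute)
qed

lemma wint_nn_integral:
  assumes [measurable]: "(\<lambda>(r, z). h r z) \<in> borel_measurable (borel \<Otimes>\<^sub>M borel)"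
  shows "wint (\<lambda>z. \<integral>\<^sup>+r. h r z \<partial>lborel) = (\<integral>\<^sup>+r. wint (h r) \<partial>lborel)"
proof -
  interpret pair_sigma_finite \<gamma> lborel by unfold_locales
  have [measurable]: "(\<lambda>(z, r). h r z * wt z) \<in> borel_measurable (\<gamma> \<Otimes>\<^sub>M lborel)"
    using measurable_compose[OF _ assms, of "\<lambda>(z, r). (r, z)" "\<gamma> \<Otimes>\<^sub>M lborel"] by (simp add: split_beta')
  have [measurable]: "(\<lambda>r. h r z) \<in> borel_measurable borel" for z
    using measurable_compose[OF _ assms, of "\<lambda>r. (r, z)"] by simp
  have "wint (\<lambda>z. \<integral>\<^sup>+r. h r z \<partial>lborel) = (\<integral>\<^sup>+z. \<integral>\<^sup>+r. h r z * wt z \<partial>lborel \<partial>\<gamma>)"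
    unfolding wint_def by (intro nn_integral_cong) (simp add: nn_integral_multc)
  also have "\<dots> = (\<integral>\<^sup>+r. \<integral>\<^sup>+z. h r z * wt z \<partial>\<gamma> \<partial>lborel)"
    by (rule Fubini'[symmetric]) simp
  finally show ?thesis by (simp add: wint_def)
qed

text \<open>Reversal makes the first jump of the left-hand side the last jump of the right-hand
  side. The induction removes one flow segment and one jump by \<open>S0_dual\<close> and
  \<open>J_dual\<close>, with flips in between, and reassembles the result by
  \<open>S_last_jump\<close>.\<close>

lemma S_dual:
  assumes "f \<in> borel_measurable borel" "g \<in> borel_measurable borel" "0 \<le> t"
  shows "wint (\<lambda>z. g z * S k f t z) = wint (\<lambda>z. S k (\<lambda>z. g (flip z)) t z * f (flip z))"
  using assms
proof (induction k arbitrary: t f g)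
  case 0
  then show ?case by (rule S0_dual)
next
  case (Suc k)
  note [measurable] = Suc.prems(1,2)
  let ?g = "\<lambda>z. g (flip z)"
  have "wint (\<lambda>z. g z * S (Suc k) f t z) = wint (\<lambda>z. \<integral>\<^sup>+r. g z * (S 0 (J (S k f (t - r))) r z * indicator {0..t} r) \<partial>lborel)"
    by (simp add: first_jump_def nn_integral_cmult)
  also have "\<dots> = (\<integral>\<^sup>+r. wint (\<lambda>z. g z * (S 0 (J (S k f (t - r))) r z * indicator {0..t} r)) \<partial>lborel)"
    by (rule wint_nn_integral) measurable
  also have "\<dots> = (\<integral>\<^sup>+r. wint (\<lambda>z. S k (J (S 0 ?g r)) (t - r) z * f (flip z) * indicator {0..t} r) \<partial>lborel)"
  proof (intro nn_integral_cong)
    fix r :: real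
    show "wint (\<lambda>z. g z * (S 0 (J (S k f (t - r))) r z * indicator {0..t} r)) = wint (\<lambda>z. S k (J (S 0 ?g r)) (t - r) z * f (flip z) * indicator {0..t} r)"
    proof (cases "r \<in> {0..t}")
      case True
      then have r: "0 \<le> r" "0 \<le> t - r" by auto
      let ?h = "S k f (t - r)"
      have "wint (\<lambda>z. g z * S 0 (J ?h) r z) = wint (\<lambda>z. S 0 ?g r z * J ?h (flip z))"
        by (rule S0_dual) (use r in measurable)
      also have "\<dots> = wint (\<lambda>z. S 0 ?g r (flip z) * J ?h z)"
        using wint_flip[of "\<lambda>z. S 0 ?g r (flip z) * J ?h z"] by simp
      also have "\<dots> = wint (\<lambda>z. J (S 0 ?g r) z * ?h (flip z))"
        using J_dual[of ?h "\<lambda>z. S 0 ?g r (flip z)"] by simp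
      also have "\<dots> = wint (\<lambda>z. J (S 0 ?g r) (flip z) * ?h z)"
        using wint_flip[of "\<lambda>z. J (S 0 ?g r) (flip z) * ?h z"] by simp
      also have "\<dots> = wint (\<lambda>z. S k (J (S 0 ?g r)) (t - r) z * f (flip z))"
        using Suc.IH[of f "\<lambda>z. J (S 0 ?g r) (flip z)" "t - r"] r by simp
      finally show ?thesis using True by simp
    qed simp
  qed
  also have "\<dots> = wint (\<lambda>z. \<integral>\<^sup>+r. S k (J (S 0 ?g r)) (t - r) z * f (flip z) * indicator {0..t} r \<partial>lborel)"
    by (rule wint_nn_integral[symmetric]) measurable
  also have "\<dots> = wint (\<lambda>z. S (Suc k) ?g t z * f (flip z))"
  proof (intro arg_cong[where f=wint] ext)
    fix z
    have "(\<integral>\<^sup>+r. S k (J (S 0 ?g r)) (t - r) z * f (flip z) * indicator {0..t} r \<partial>lborel)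
        = (\<integral>\<^sup>+r. S k (J (S 0 ?g (t + (-1) * r))) (t - (t + (-1) * r)) z * f (flip z) * indicator {0..t} (t + (-1) * r) \<partial>lborel)"
      by (subst nn_integral_real_affine[where c="-1" and t=t]) (auto simp del: S.simps)
    also have "\<dots> = (\<integral>\<^sup>+r. (S k (J (S 0 ?g (t - r))) r z * indicator {0..t} r) * f (flip z) \<partial>lborel)"
      by (intro nn_integral_cong) (auto simp: indicator_def mult_ac simp del: S.simps)
    also have "\<dots> = S (Suc k) ?g t z * f (flip z)"
      by (subst S_last_jump) (use Suc.prems in \<open>auto intro!: nn_integral_multc simp del: S.simps\<close>)
    finally show "(\<integral>\<^sup>+r. S k (J (S 0 ?g r)) (t - r) z * f (flip z) * indicator {0..t} r \<partial>lborel) = S (Suc k) ?g t z * f (flip z)" .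
  qed
  finally show ?case .
qed

text \<open>Duality against \<open>g = 1\<close> moves the semigroup onto the constant function,
  which non-explosion evaluates.\<close>

theorem Pt_invariant:
  assumes [measurable]: "f \<in> borel_measurable borel" and t: "0 \<le> t"
  shows "wint (Pt f t) = wint f"
proof -
  have "wint (Pt f t) = (\<Sum>k. wint (\<lambda>z. 1 * S k f t z))"
    unfolding Pt_def wint_def by (simp flip: ennreal_suminf_multc add: nn_integral_suminf)
  also have "\<dots> = (\<Sum>k. wint (\<lambda>z. S k (\<lambda>_. 1) t z * f (flip z)))"
    by (intro suminf_cong S_dual) (use t in auto)
  also have "\<dots> = (\<Sum>k. \<integral>\<^sup>+z. S k (\<lambda>_. 1) t z * f (flip z) * wt z \<partial>\<gamma>)" by (simp add: wint_def)
  also have "\<dots> = (\<integral>\<^sup>+z. (\<Sum>k. S k (\<lambda>_. 1) t z * f (flip z) * wt z) \<partial>\<gamma>)"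
    by (rule nn_integral_suminf[symmetric]) measurable
  also have "\<dots> = (\<integral>\<^sup>+z. Pt (\<lambda>_. 1) t z * f (flip z) * wt z \<partial>\<gamma>)"
    by (simp add: Pt_def ennreal_suminf_multc)
  also have "\<dots> = wint (\<lambda>z. f (flip z))"
    by (simp add: wint_def Pt_one_boomerang[OF t])
  finally show ?thesis by (simp add: wint_flip)
qed

end

section \<open>Dissipation by refreshments\<close>

text \<open>Replaces the expansion of \<open>(m - a)\<^sup>2\<close>, since subtraction in
  \<open>ennreal\<close> is truncated. Jensen's inequality below always arises by taking
  \<open>m\<close> as the mean, integrating in \<open>a\<close>, and cancelling one copy of
  \<open>m\<^sup>2\<close> with \<open>ennreal_double_le\<close>.\<close>

lemma ennreal_AM_GM: "2 * m * a \<le> m\<^sup>2 + (a::ennreal)\<^sup>2"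
proof (cases "m = \<top> \<or> a = \<top>")
  case True
  then show ?thesis by (auto simp: power2_eq_square ennreal_top_mult)
next
  case False
  then obtain x y where xy: "m = ennreal x" "a = ennreal y" "0 \<le> x" "0 \<le> y"
    by (metis ennreal_cases)
  have "2 * x * y \<le> x\<^sup>2 + y\<^sup>2" using sum_squares_bound[of x y] by simp
  then have "ennreal (2 * x * y) \<le> ennreal (x\<^sup>2 + y\<^sup>2)" by (rule ennreal_leI)
  then show ?thesis using xy by (simp add: ennreal_mult ennreal_power)
qed

lemma ennreal_double_le: "(x::ennreal) + x \<le> x + y \<Longrightarrow> x < \<top> \<Longrightarrow> x \<le> y"
  by (auto simp: ennreal_add_left_cancel_le)

lemma ennreal_power2_less_top: "(x::ennreal) < \<top> \<Longrightarrow> x\<^sup>2 < \<top>"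
  by (simp add: power2_eq_square ennreal_mult_less_top)

lemma (in prob_space) nn_integral_power2_le:
  assumes [measurable]: "f \<in> borel_measurable M" and fin: "(\<integral>\<^sup>+x. f x \<partial>M) < \<top>"
  shows "(\<integral>\<^sup>+x. f x \<partial>M)\<^sup>2 \<le> (\<integral>\<^sup>+x. (f x)\<^sup>2 \<partial>M)"
proof -
  let ?m = "\<integral>\<^sup>+x. f x \<partial>M"
  have "?m\<^sup>2 + ?m\<^sup>2 = (\<integral>\<^sup>+x. 2 * ?m * f x \<partial>M)"
    by (subst nn_integral_cmult) (auto simp: power2_eq_square mult_2 distrib_right)
  also have "\<dots> \<le> (\<integral>\<^sup>+x. ?m\<^sup>2 + (f x)\<^sup>2 \<partial>M)" by (intro nn_integral_mono ennreal_AM_GM)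
  also have "\<dots> = ?m\<^sup>2 + (\<integral>\<^sup>+x. (f x)\<^sup>2 \<partial>M)"
    by (subst nn_integral_add) (auto simp: emeasure_space_1)
  finally show ?thesis by (rule ennreal_double_le[OF _ ennreal_power2_less_top[OF fin]])
qed

context pdmp begin

lemma Pt_mono: "(\<And>z. f z \<le> g z) \<Longrightarrow> Pt f t z \<le> Pt g t z"
  unfolding Pt_def by (intro suminf_le S_mono) auto

lemma Pt_cmult:
  assumes [measurable]: "f \<in> borel_measurable borel"
  shows "Pt (\<lambda>z. c * f z) t z = c * Pt f t z"
  unfolding Pt_def by (simp add: S_cmult)

text \<open>Only the paths without a jump before \<open>s\<close> are kept.\<close>

lemma Pt_flow_le:
  assumes [measurable]: "f \<in> borel_measurable borel" and "0 \<le> s" "s \<le> t"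
  shows "ennreal (exp (- cum s z)) * Pt f (t - s) (flow s z) \<le> Pt f t z"
proof -
  have t: "s + (t - s) = t" "0 \<le> t - s" "0 \<le> t" using assms by auto
  have m: "(\<lambda>(t, z). Pt f t z) \<in> borel_measurable (borel \<Otimes>\<^sub>M borel)" by measurable
  have "ennreal (exp (- cum s z)) * Pt f (t - s) (flow s z)
     = ennreal (exp (- cum s z)) * (ennreal (exp (- cum (t - s) (flow s z))) * f (flow (t - s) (flow s z)))
       + ennreal (exp (- cum s z)) * first_jump (Pt f) (t - s) (flow s z)"
    by (subst Pt_restart) (simp_all add: t assms distrib_left)
  also have "ennreal (exp (- cum s z)) * (ennreal (exp (- cum (t - s) (flow s z))) * f (flow (t - s) (flow s z)))
     = ennreal (exp (- cum t z)) * f (flow t z)"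
    using exp_cum_add[OF assms(2) t(2), of z] flow_add[of s "t - s" z] by (simp add: t mult.assoc)
  also have "ennreal (exp (- cum t z)) * f (flow t z) + ennreal (exp (- cum s z)) * first_jump (Pt f) (t - s) (flow s z)
     \<le> ennreal (exp (- cum t z)) * f (flow t z) + first_jump (Pt f) (s + (t - s)) z"
    by (subst first_jump_split[OF m assms(2) t(2)]) (intro add_left_mono, simp)
  also have "\<dots> = Pt f t z" by (simp add: t Pt_restart[OF assms(1) t(3)])
  finally show ?thesis .
qed

text \<open>Expected running cost over the times \<open>s\<close> that are preceded by exactly
  \<open>k\<close> jumps, where the cost depends on the remaining time.\<close>

definition accum :: "(real \<Rightarrow> 'z \<Rightarrow> ennreal) \<Rightarrow> nat \<Rightarrow> real \<Rightarrow> 'z \<Rightarrow> ennreal" where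
  "accum H k t z = (\<integral>\<^sup>+s. S k (H (t - s)) s z * indicator {0..t} s \<partial>lborel)"

lemma accum_measurable:
  assumes H: "(\<lambda>(t, z). H t z) \<in> borel_measurable (borel \<Otimes>\<^sub>M borel)"
  shows "(\<lambda>(t, z). accum H k t z) \<in> borel_measurable (borel \<Otimes>\<^sub>M borel)"
proof -
  note [measurable (raw)] = measurable_fun2[OF H]
  have "(\<lambda>p. \<integral>\<^sup>+s. S k (H (fst p - s)) s (snd p) * (if 0 \<le> s \<and> s \<le> fst p then 1 else 0) \<partial>lborel)
     \<in> borel_measurable (borel \<Otimes>\<^sub>M borel)" by measurable
  also have "(\<lambda>p. \<integral>\<^sup>+s. S k (H (fst p - s)) s (snd p) * (if 0 \<le> s \<and> s \<le> fst p then 1 else 0) \<partial>lborel) = (\<lambda>(t, z). accum H k t z)"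
    by (auto simp: accum_def fun_eq_iff indicator_def intro!: nn_integral_cong)
  finally show ?thesis .
qed

text \<open>Tonelli exchanges the time at which the cost is charged with the time of the first
  jump.\<close>

lemma accum_Suc:
  assumes H: "(\<lambda>(t, z). H t z) \<in> borel_measurable (borel \<Otimes>\<^sub>M borel)"
  shows "accum H (Suc k) t z = first_jump (accum H k) t z"
proof -
  note [measurable (raw)] = measurable_fun2[OF H]
  define L where "L r q = J (S k (H (t - r - q)) q) (flow r z)" for r q
  have [measurable]: "(\<lambda>(r, q). L r q) \<in> borel_measurable (borel \<Otimes>\<^sub>M borel)"
    unfolding L_def by measurable
  define W where "W r s = (if 0 \<le> r \<and> r \<le> s \<and> s \<le> t then ennreal (exp (- cum r z)) * L r (s - r) else 0)" for r s
  have [measurable]: "(\<lambda>(r, s). W r s) \<in> borel_measurable (borel \<Otimes>\<^sub>M borel)"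
    unfolding W_def by measurable
  have "accum H (Suc k) t z = (\<integral>\<^sup>+s. \<integral>\<^sup>+r. W r s \<partial>lborel \<partial>lborel)"
    unfolding accum_def
  proof (intro nn_integral_cong)
    fix s :: real
    show "S (Suc k) (H (t - s)) s z * indicator {0..t} s = (\<integral>\<^sup>+r. W r s \<partial>lborel)"
    proof (cases "0 \<le> s \<and> s \<le> t")
      case True
      then show ?thesis
        by (auto simp: first_jump_def L_def W_def indicator_def simp del: S.simps(1) intro!: nn_integral_cong)
    next
      case False
      then have "W r s = 0" for r by (auto simp: W_def)
      then show ?thesis using False by (auto simp: indicator_def simp del: S.simps)
    qed
  qed
  also have "\<dots> = (\<integral>\<^sup>+r. \<integral>\<^sup>+s. W r s \<partial>lborel \<partial>lborel)"
    by (rule lborel_pair.Fubini'[symmetric]) simp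
  also have "\<dots> = (\<integral>\<^sup>+r. ennreal (exp (- cum r z)) * J (accum H k (t - r)) (flow r z) * indicator {0..t} r \<partial>lborel)"
  proof (intro nn_integral_cong)
    fix r :: real
    show "(\<integral>\<^sup>+s. W r s \<partial>lborel) = ennreal (exp (- cum r z)) * J (accum H k (t - r)) (flow r z) * indicator {0..t} r"
    proof (cases "0 \<le> r \<and> r \<le> t")
      case True
      have "J (accum H k (t - r)) (flow r z) = J (\<lambda>z. \<integral>\<^sup>+q. S k (H (t - r - q)) q z * indicator {0..t - r} q \<partial>lborel) (flow r z)"
        by (simp add: accum_def[abs_def])
      also have "\<dots> = (\<integral>\<^sup>+q. J (\<lambda>z. S k (H (t - r - q)) q z * indicator {0..t - r} q) (flow r z) \<partial>lborel)"
      proof (rule J_nn_integral[OF lborel.sigma_finite_measure_axioms])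
        have "(\<lambda>(q, z). S k (H (t - r - q)) q z) \<in> borel_measurable (borel \<Otimes>\<^sub>M borel)"
          by measurable
        then show "(\<lambda>(q, z). S k (H (t - r - q)) q z * indicator {0..t - r} q) \<in> borel_measurable (lborel \<Otimes>\<^sub>M borel)"
          by (simp add: split_beta')
      qed
      also have "\<dots> = (\<integral>\<^sup>+q. L r (r + q - r) * indicator {r..t} (r + q) \<partial>lborel)"
        unfolding L_def by (intro nn_integral_cong) (subst J_multc, measurable, auto simp: indicator_def simp del: S.simps)
      also have "\<dots> = (\<integral>\<^sup>+s. L r (s - r) * indicator {r..t} s \<partial>lborel)"
        by (rule nn_integral_lborel_shift[symmetric]) measurable
      finally have "ennreal (exp (- cum r z)) * J (accum H k (t - r)) (flow r z)
         = (\<integral>\<^sup>+s. ennreal (exp (- cum r z)) * (L r (s - r) * indicator {r..t} s) \<partial>lborel)"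
        by (subst nn_integral_cmult) auto
      then show ?thesis using True
        by (auto intro!: nn_integral_cong simp: indicator_def W_def)
    next
      case False
      then have "W r s = 0" for s by (auto simp: W_def)
      then show ?thesis using False by (auto simp: indicator_def)
    qed
  qed
  finally show ?thesis by (simp add: first_jump_def)
qed

lemma suminf_accum:
  assumes H: "(\<lambda>(t, z). H t z) \<in> borel_measurable (borel \<Otimes>\<^sub>M borel)"
  shows "(\<Sum>k. accum H k t z) = (\<integral>\<^sup>+s. Pt (H (t - s)) s z * indicator {0..t} s \<partial>lborel)"
proof -
  note [measurable (raw)] = measurable_fun2[OF H]
  show ?thesis unfolding accum_def Pt_def
    by (subst nn_integral_suminf[symmetric]) (auto simp del: S.simps intro!: nn_integral_cong)
qed

end

context boomerang begin

lemma Pt_le_const: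
  assumes "\<And>z. f z \<le> c" "f \<in> borel_measurable borel" "0 \<le> t"
  shows "Pt f t z \<le> c"
proof -
  have "Pt f t z \<le> Pt (\<lambda>_. c * 1) t z" by (rule Pt_mono) (simp add: assms)
  also have "\<dots> = c" by (subst Pt_cmult) (simp_all add: Pt_one_boomerang assms)
  finally show ?thesis .
qed

lemma Pt_power2_le:
  assumes [measurable]: "f \<in> borel_measurable borel" and t: "0 \<le> t" and fin: "Pt f t z < \<top>"
  shows "(Pt f t z)\<^sup>2 \<le> Pt (\<lambda>z. (f z)\<^sup>2) t z"
proof -
  interpret I: prob_space inputs by (rule prob_space_inputs)
  show ?thesis
    using I.nn_integral_power2_le[of "\<lambda>\<omega>. f (path z \<omega> t)"] fin
      nn_integral_path[OF _ t Pt_one_boomerang[OF t], of f z] nn_integral_path[OF _ t Pt_one_boomerang[OF t], of "\<lambda>z. (f z)\<^sup>2" z]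
    by simp
qed

definition vmean :: "('a \<times> 'a \<Rightarrow> ennreal) \<Rightarrow> 'a \<Rightarrow> ennreal" where "vmean h x = (\<integral>\<^sup>+w. h (x, w) \<partial>\<nu>)"

text \<open>Variance in the velocity at a fixed position. For bounded \<open>h\<close> the truncated
  subtraction is exact, because the mean of the square dominates the square of the mean.\<close>

definition vvar :: "('a \<times> 'a \<Rightarrow> ennreal) \<Rightarrow> 'a \<times> 'a \<Rightarrow> ennreal" where
  "vvar h z = vmean (\<lambda>z. (h z)\<^sup>2) (fst z) - (vmean h (fst z))\<^sup>2"

lemma vmean_measurable2:
  assumes [measurable]: "(\<lambda>(p, z). h p z) \<in> borel_measurable (M \<Otimes>\<^sub>M borel)" "a \<in> borel_measurable M"
  shows "(\<lambda>p. vmean (h p) (a p)) \<in> borel_measurable M"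
proof -
  have "(\<lambda>q. (fst q, (a (fst q), snd q))) \<in> M \<Otimes>\<^sub>M \<nu> \<rightarrow>\<^sub>M M \<Otimes>\<^sub>M borel"
    by (intro measurable_Pair borel_measurable_Pair) measurable
  from measurable_compose[OF this assms(1)]
  have "(\<lambda>(p, w). h p (a p, w)) \<in> borel_measurable (M \<Otimes>\<^sub>M \<nu>)" by (simp add: split_beta')
  then show ?thesis unfolding vmean_def by measurable
qed

lemma vvar_measurable2:
  assumes [measurable]: "(\<lambda>(p, z). h p z) \<in> borel_measurable (M \<Otimes>\<^sub>M borel)" "a \<in> borel_measurable M"
  shows "(\<lambda>p. vvar (h p) (a p)) \<in> borel_measurable M"
proof -
  have [measurable]: "(\<lambda>p. fst (a p)) \<in> borel_measurable M" by (rule measurable_fst_borel) simp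
  have 1: "(\<lambda>(p, z). (h p z)\<^sup>2) \<in> borel_measurable (M \<Otimes>\<^sub>M borel)" using assms(1) by (simp add: split_beta')
  note [measurable] = vmean_measurable2[OF assms(1), of "\<lambda>p. fst (a p)"] vmean_measurable2[OF 1, of "\<lambda>p. fst (a p)"]
  show ?thesis unfolding vvar_def by measurable
qed

text \<open>Jensen's inequality for the jump kernel, applied to refreshments as if they produced the
  velocity mean itself. The square of that mean falls short of the mean of the square by
  \<open>vvar\<close>, and this deficit is the surplus on the left.\<close>

lemma jump_power2:
  assumes [measurable]: "h \<in> borel_measurable borel" and b: "\<And>z. h z \<le> ennreal b"
  shows "ennreal (rate z) * (\<integral>\<^sup>+\<xi>. h (jump z \<xi>) \<partial>marks)\<^sup>2 + ennreal lam * vvar h z \<le> J (\<lambda>z. (h z)\<^sup>2) z"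
proof -
  define m where "m = (\<integral>\<^sup>+\<xi>. h (jump z \<xi>) \<partial>marks)"
  have "m \<le> (\<integral>\<^sup>+\<xi>. ennreal b \<partial>marks)" unfolding m_def by (intro nn_integral_mono b)
  then have mfin: "m < \<top>" by (simp add: N.emeasure_space_1) (meson ennreal_less_top order_le_less_trans)
  let ?e = "\<lambda>n. ennreal (event_rate \<Phi> R n z)"
  let ?h = "\<lambda>n. h (fst z, R n (snd z))"
  let ?a = "vmean h (fst z)"
  have rate: "ennreal (rate z) = ennreal lam + (\<Sum>n. ?e n)"
    using lam_pos unfolding total_rate_def
    by (simp add: suminf_ennreal2 event_rate_nonneg sums_summable[OF event_rate_sums] suminf_nonneg)
  have Jh: "ennreal (rate z) * m = ennreal lam * ?a + (\<Sum>n. ?e n * ?h n)"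
    using J_eq[of h z] by (simp add: m_def J_def vmean_def)
  have "ennreal (rate z) * m\<^sup>2 + ennreal (rate z) * m\<^sup>2 = 2 * m * (ennreal (rate z) * m)"
    by (simp add: power2_eq_square mult_2 mult_ac distrib_left)
  also have "\<dots> = ennreal lam * (2 * m * ?a) + (\<Sum>n. ?e n * (2 * m * ?h n))"
    unfolding Jh by (simp add: distrib_left mult_ac flip: ennreal_suminf_cmult)
  also have "\<dots> \<le> ennreal lam * (m\<^sup>2 + ?a\<^sup>2) + (\<Sum>n. ?e n * (m\<^sup>2 + (?h n)\<^sup>2))"
    by (intro add_mono mult_left_mono ennreal_AM_GM suminf_le) auto
  also have "\<dots> = ennreal (rate z) * m\<^sup>2 + (ennreal lam * ?a\<^sup>2 + (\<Sum>n. ?e n * (?h n)\<^sup>2))"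
    unfolding rate by (simp add: distrib_left distrib_right suminf_add[symmetric] ennreal_suminf_multc ac_simps)
  finally have "ennreal (rate z) * m\<^sup>2 \<le> ennreal lam * ?a\<^sup>2 + (\<Sum>n. ?e n * (?h n)\<^sup>2)"
    by (rule ennreal_double_le) (simp add: ennreal_mult_less_top ennreal_power2_less_top[OF mfin])
  then have "ennreal (rate z) * m\<^sup>2 + ennreal lam * vvar h z \<le> (ennreal lam * ?a\<^sup>2 + (\<Sum>n. ?e n * (?h n)\<^sup>2)) + ennreal lam * vvar h z"
    by (rule add_right_mono)
  also have "\<dots> = ennreal lam * (?a\<^sup>2 + vvar h z) + (\<Sum>n. ?e n * (?h n)\<^sup>2)"
    by (simp add: distrib_left ac_simps)
  also have "?a\<^sup>2 + vvar h z = vmean (\<lambda>z. (h z)\<^sup>2) (fst z)"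
  proof -
    have "?a \<le> (\<integral>\<^sup>+w. ennreal b \<partial>\<nu>)" unfolding vmean_def by (intro nn_integral_mono b)
    then have "?a < \<top>" by (simp add: nu.emeasure_space_1[simplified]) (meson ennreal_less_top order_le_less_trans)
    then have "?a\<^sup>2 \<le> vmean (\<lambda>z. (h z)\<^sup>2) (fst z)"
      unfolding vmean_def by (intro nu.nn_integral_power2_le) auto
    then show ?thesis by (simp add: vvar_def add_diff_inverse_ennreal)
  qed
  also have "ennreal lam * vmean (\<lambda>z. (h z)\<^sup>2) (fst z) + (\<Sum>n. ?e n * (?h n)\<^sup>2) = J (\<lambda>z. (h z)\<^sup>2) z"
    by (subst J_eq) (simp_all add: vmean_def)
  finally show ?thesis by (simp add: m_def)
qed

lemma vvar_Pt_measurable: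
  assumes [measurable]: "f \<in> borel_measurable borel"
  shows "(\<lambda>(t, z). ennreal lam * vvar (Pt f t) z) \<in> borel_measurable (borel \<Otimes>\<^sub>M borel)"
proof -
  have "(\<lambda>(p, z). Pt f (fst p) z) \<in> borel_measurable ((borel \<Otimes>\<^sub>M borel) \<Otimes>\<^sub>M borel)" by measurable
  from vvar_measurable2[OF this, of snd] show ?thesis by (simp add: split_beta')
qed

text \<open>Survival up to \<open>t\<close> and the density of the first jump time are weights of
  total mass one, so Jensen's inequality applies to the restart equation; \<open>jump_power2\<close>
  at the first jump supplies \<open>accum H 0\<close>.\<close>

lemma dissipation_first_jump:
  assumes f [measurable]: "f \<in> borel_measurable borel" and b: "\<And>z. f z \<le> ennreal b" and t: "0 \<le> t"
  defines "H \<equiv> \<lambda>t z. ennreal lam * vvar (Pt f t) z"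
  shows "(Pt f t z)\<^sup>2 + accum H 0 t z \<le> ennreal (exp (- cum t z)) * (f (boomerang_flow t z))\<^sup>2 + first_jump (\<lambda>t z. (Pt f t z)\<^sup>2) t z"
proof -
  let ?p = "ennreal (exp (- cum t z))" and ?y = "boomerang_flow t z" and ?F = "Pt f t z"
  have H [measurable]: "(\<lambda>(t, z). H t z) \<in> borel_measurable (borel \<Otimes>\<^sub>M borel)"
    unfolding H_def by (rule vvar_Pt_measurable[OF f])
  note [measurable (raw)] = measurable_fun2[OF H]
  define m where "m s = (\<integral>\<^sup>+\<xi>. Pt f (t - s) (jump (boomerang_flow s z) \<xi>) \<partial>marks)" for s
  have [measurable]: "m \<in> borel_measurable borel" unfolding m_def by measurable
  define w where "w s = ennreal (exp (- cum s z)) * ennreal (rate (boomerang_flow s z)) * indicator {0..t} s" for s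
  have [measurable]: "w \<in> borel_measurable borel" unfolding w_def by measurable
  have F: "?F = ?p * f ?y + (\<integral>\<^sup>+s. w s * m s \<partial>lborel)"
  proof -
    have "first_jump (Pt f) t z = (\<integral>\<^sup>+s. w s * m s \<partial>lborel)"
      unfolding first_jump_def J_def m_def w_def by (rule nn_integral_cong) (simp add: mult_ac)
    then show ?thesis using Pt_restart[OF f t, of z] by simp
  qed
  have one: "1 = ?p + (\<integral>\<^sup>+s. w s \<partial>lborel)"
    using first_jump_one(1)[OF t, of z] unfolding first_jump_def J_one w_def by simp
  have Ffin: "?F < \<top>"
    using Pt_le_const[OF b f t, of z] by (meson ennreal_less_top order_le_less_trans)
  have "?F\<^sup>2 + ?F\<^sup>2 = 2 * ?F * ?F" by (simp add: power2_eq_square mult_2 distrib_right)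
  also have "\<dots> = ?p * (2 * ?F * f ?y) + (\<integral>\<^sup>+s. w s * (2 * ?F * m s) \<partial>lborel)"
  proof -
    have "(\<integral>\<^sup>+s. w s * (2 * ?F * m s) \<partial>lborel) = 2 * ?F * (\<integral>\<^sup>+s. w s * m s \<partial>lborel)"
      by (subst nn_integral_cmult[symmetric]) (auto simp: mult_ac intro!: nn_integral_cong)
    then show ?thesis by (subst (2) F) (simp add: distrib_left distrib_right mult_ac)
  qed
  also have "\<dots> \<le> ?p * (?F\<^sup>2 + (f ?y)\<^sup>2) + (\<integral>\<^sup>+s. w s * (?F\<^sup>2 + (m s)\<^sup>2) \<partial>lborel)"
    by (intro add_mono mult_left_mono nn_integral_mono ennreal_AM_GM) auto
  also have "\<dots> = ?F\<^sup>2 + (?p * (f ?y)\<^sup>2 + (\<integral>\<^sup>+s. w s * (m s)\<^sup>2 \<partial>lborel))"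
  proof -
    have e1: "(\<integral>\<^sup>+s. w s * (?F\<^sup>2 + (m s)\<^sup>2) \<partial>lborel) = (\<integral>\<^sup>+s. w s \<partial>lborel) * ?F\<^sup>2 + (\<integral>\<^sup>+s. w s * (m s)\<^sup>2 \<partial>lborel)"
      by (simp add: distrib_left nn_integral_add nn_integral_multc)
    have e2: "?p * (?F\<^sup>2 + (f ?y)\<^sup>2) + (c * ?F\<^sup>2 + d) = (?p * ?F\<^sup>2 + c * ?F\<^sup>2) + (?p * (f ?y)\<^sup>2 + d)" for c d
      by (simp add: distrib_left ac_simps)
    have e3: "?p * ?F\<^sup>2 + (\<integral>\<^sup>+s. w s \<partial>lborel) * ?F\<^sup>2 = ?F\<^sup>2"
      by (subst distrib_right[symmetric], subst one[symmetric]) simp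
    show ?thesis by (simp only: e1 e2 e3)
  qed
  finally have main: "?F\<^sup>2 \<le> ?p * (f ?y)\<^sup>2 + (\<integral>\<^sup>+s. w s * (m s)\<^sup>2 \<partial>lborel)"
    by (rule ennreal_double_le[OF _ ennreal_power2_less_top[OF Ffin]])
  have "accum H 0 t z = (\<integral>\<^sup>+s. ennreal (exp (- cum s z)) * H (t - s) (boomerang_flow s z) * indicator {0..t} s \<partial>lborel)"
    by (simp add: accum_def)
  then have "?F\<^sup>2 + accum H 0 t z \<le> ?p * (f ?y)\<^sup>2 + ((\<integral>\<^sup>+s. w s * (m s)\<^sup>2 \<partial>lborel)
      + (\<integral>\<^sup>+s. ennreal (exp (- cum s z)) * H (t - s) (boomerang_flow s z) * indicator {0..t} s \<partial>lborel))"
    using add_right_mono[OF main] by (simp add: add.assoc)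
  also have "\<dots> \<le> ?p * (f ?y)\<^sup>2 + first_jump (\<lambda>t z. (Pt f t z)\<^sup>2) t z"
  proof (rule add_left_mono)
  have "(\<integral>\<^sup>+s. w s * (m s)\<^sup>2 \<partial>lborel) + (\<integral>\<^sup>+s. ennreal (exp (- cum s z)) * H (t - s) (boomerang_flow s z) * indicator {0..t} s \<partial>lborel)
      = (\<integral>\<^sup>+s. w s * (m s)\<^sup>2 + ennreal (exp (- cum s z)) * H (t - s) (boomerang_flow s z) * indicator {0..t} s \<partial>lborel)"
    by (rule nn_integral_add[symmetric]) auto
  also have "\<dots> \<le> first_jump (\<lambda>t z. (Pt f t z)\<^sup>2) t z"
    unfolding first_jump_def
  proof (intro nn_integral_mono)
    fix s
    show "w s * (m s)\<^sup>2 + ennreal (exp (- cum s z)) * H (t - s) (boomerang_flow s z) * indicator {0..t} s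
        \<le> ennreal (exp (- cum s z)) * J (\<lambda>z. (Pt f (t - s) z)\<^sup>2) (boomerang_flow s z) * indicator {0..t} s"
    proof (cases "s \<in> {0..t}")
      case True
      have "ennreal (rate (boomerang_flow s z)) * (m s)\<^sup>2 + H (t - s) (boomerang_flow s z) \<le> J (\<lambda>z. (Pt f (t - s) z)\<^sup>2) (boomerang_flow s z)"
        unfolding m_def H_def by (rule jump_power2[where b=b]) (use True b in \<open>auto intro!: Pt_le_const\<close>)
      from mult_left_mono[OF this, of "ennreal (exp (- cum s z))"] show ?thesis
        using True by (simp add: w_def distrib_left mult.assoc)
    qed (simp add: w_def)
  qed
  finally show "(\<integral>\<^sup>+s. w s * (m s)\<^sup>2 \<partial>lborel) + (\<integral>\<^sup>+s. ennreal (exp (- cum s z)) * H (t - s) (boomerang_flow s z) * indicator {0..t} s \<partial>lborel)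
     \<le> first_jump (\<lambda>t z. (Pt f t z)\<^sup>2) t z" .
  qed
  finally show ?thesis .
qed

text \<open>Each induction step collects the velocity variance along one more flow segment. The
  restart equation for the evolution of \<open>(f z)\<^sup>2\<close> closes the step.\<close>

lemma dissipation_accum:
  assumes f [measurable]: "f \<in> borel_measurable borel" and b: "\<And>z. f z \<le> ennreal b" and t: "0 \<le> t"
  defines "H \<equiv> \<lambda>t z. ennreal lam * vvar (Pt f t) z"
  shows "(Pt f t z)\<^sup>2 + (\<Sum>k<n. accum H k t z) \<le> Pt (\<lambda>z. (f z)\<^sup>2) t z"
  using t
proof (induction n arbitrary: t z)
  case 0
  have "Pt f t z < \<top>"
    using Pt_le_const[OF b f 0, of z] by (meson ennreal_less_top order_le_less_trans)
  then show ?case using Pt_power2_le[OF f 0] by simp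
next
  case (Suc n)
  have H: "(\<lambda>(t, z). H t z) \<in> borel_measurable (borel \<Otimes>\<^sub>M borel)"
    unfolding H_def by (rule vvar_Pt_measurable[OF f])
  note [measurable] = accum_measurable[OF H]
  have sum: "first_jump (\<lambda>t z. \<Sum>k\<in>A. accum H k t z) t z = (\<Sum>k\<in>A. accum H (Suc k) t z)" if "finite A" for A using that
  proof induction
    case empty
    show ?case by (simp add: first_jump_def J_def)
  next
    case (insert j A)
    then show ?case by (simp add: first_jump_add accum_Suc[OF H])
  qed
  have "(Pt f t z)\<^sup>2 + (\<Sum>k<Suc n. accum H k t z) = ((Pt f t z)\<^sup>2 + accum H 0 t z) + (\<Sum>k<n. accum H (Suc k) t z)"
    by (subst sum.lessThan_Suc_shift) (simp add: add.assoc)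
  also have "\<dots> \<le> (ennreal (exp (- cum t z)) * (f (boomerang_flow t z))\<^sup>2 + first_jump (\<lambda>t z. (Pt f t z)\<^sup>2) t z) + first_jump (\<lambda>t z. \<Sum>k<n. accum H k t z) t z"
    unfolding sum[OF finite_lessThan] unfolding H_def by (intro add_right_mono dissipation_first_jump[OF f b Suc.prems])
  also have "\<dots> = ennreal (exp (- cum t z)) * (f (boomerang_flow t z))\<^sup>2 + first_jump (\<lambda>t z. (Pt f t z)\<^sup>2 + (\<Sum>k<n. accum H k t z)) t z"
    by (subst first_jump_add) (simp_all add: add.assoc)
  also have "\<dots> \<le> ennreal (exp (- cum t z)) * (f (boomerang_flow t z))\<^sup>2 + first_jump (Pt (\<lambda>z. (f z)\<^sup>2)) t z"
    by (intro add_left_mono first_jump_mono Suc.IH)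
  also have "\<dots> = Pt (\<lambda>z. (f z)\<^sup>2) t z" by (rule Pt_restart[symmetric]) (use Suc.prems in auto)
  finally show ?case .
qed

text \<open>Integrated against the invariant weight, the propagators in front of the collected
  variances disappear. The reflection of \<open>s\<close> to \<open>t - s\<close> turns remaining
  time into elapsed time.\<close>

theorem dissipation_refresh:
  assumes f [measurable]: "f \<in> borel_measurable borel" and b: "\<And>z. f z \<le> ennreal b" and t: "0 \<le> t"
  shows "wint (\<lambda>z. (Pt f t z)\<^sup>2) + (\<integral>\<^sup>+s. ennreal lam * wint (vvar (Pt f s)) * indicator {0..t} s \<partial>lborel) \<le> wint (\<lambda>z. (f z)\<^sup>2)"
proof -
  define H where "H = (\<lambda>t z. ennreal lam * vvar (Pt f t) z)"
  have H: "(\<lambda>(t, z). H t z) \<in> borel_measurable (borel \<Otimes>\<^sub>M borel)"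
    unfolding H_def by (rule vvar_Pt_measurable[OF f])
  note [measurable (raw)] = measurable_fun2[OF H]
  have "(Pt f t z)\<^sup>2 + (\<Sum>k. accum H k t z) \<le> Pt (\<lambda>z. (f z)\<^sup>2) t z" for z
  proof -
    have "(\<lambda>n. (Pt f t z)\<^sup>2 + (\<Sum>k<n. accum H k t z)) \<longlonglongrightarrow> (Pt f t z)\<^sup>2 + (\<Sum>k. accum H k t z)"
      by (intro tendsto_intros summable_LIMSEQ) auto
    then show ?thesis
      using dissipation_accum[OF f b t, of z] unfolding H_def[symmetric] by (intro LIMSEQ_le_const2) blast+
  qed
  then have "wint (\<lambda>z. (Pt f t z)\<^sup>2 + (\<integral>\<^sup>+s. Pt (H (t - s)) s z * indicator {0..t} s \<partial>lborel)) \<le> wint (Pt (\<lambda>z. (f z)\<^sup>2) t)"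
    unfolding suminf_accum[OF H] by (rule wint_mono)
  also have "\<dots> = wint (\<lambda>z. (f z)\<^sup>2)" by (rule Pt_invariant[OF _ t]) measurable
  also have "wint (\<lambda>z. (Pt f t z)\<^sup>2 + (\<integral>\<^sup>+s. Pt (H (t - s)) s z * indicator {0..t} s \<partial>lborel))
     = wint (\<lambda>z. (Pt f t z)\<^sup>2) + wint (\<lambda>z. \<integral>\<^sup>+s. Pt (H (t - s)) s z * indicator {0..t} s \<partial>lborel)"
    unfolding wint_def by (simp add: distrib_right nn_integral_add)
  also have "wint (\<lambda>z. \<integral>\<^sup>+s. Pt (H (t - s)) s z * indicator {0..t} s \<partial>lborel) = (\<integral>\<^sup>+s. wint (\<lambda>z. Pt (H (t - s)) s z * indicator {0..t} s) \<partial>lborel)"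
    by (rule wint_nn_integral) measurable
  also have "\<dots> = (\<integral>\<^sup>+s. wint (H (t - s)) * indicator {0..t} s \<partial>lborel)"
  proof (rule nn_integral_cong)
    fix s :: real
    have "wint (\<lambda>_. 0) = 0" by (simp add: wint_def)
    then show "wint (\<lambda>z. Pt (H (t - s)) s z * indicator {0..t} s) = wint (H (t - s)) * indicator {0..t} s"
      by (cases "s \<in> {0..t}") (simp_all add: Pt_invariant)
  qed
  also have "\<dots> = (\<integral>\<^sup>+s. wint (H (t - (t + (-1) * s))) * indicator {0..t} (t + (-1) * s) \<partial>lborel)"
    by (subst nn_integral_real_affine[where c="-1" and t=t]) (auto simp: wint_def)
  also have "\<dots> = (\<integral>\<^sup>+s. ennreal lam * wint (vvar (Pt f s)) * indicator {0..t} s \<partial>lborel)"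
  proof (intro nn_integral_cong)
    fix s
    have "(\<lambda>(p, z). Pt f s z) \<in> borel_measurable (borel \<Otimes>\<^sub>M borel)" by measurable
    from vvar_measurable2[OF this, of "\<lambda>z. z"] have [measurable]: "vvar (Pt f s) \<in> borel_measurable borel" by simp
    have "wint (H s) = ennreal lam * wint (vvar (Pt f s))"
      unfolding wint_def H_def by (simp add: mult.assoc nn_integral_cmult)
    then show "wint (H (t - (t + (-1) * s))) * indicator {0..t} (t + (-1) * s) = ennreal lam * wint (vvar (Pt f s)) * indicator {0..t} s"
      by (auto simp: indicator_def)
  qed
  finally show ?thesis .
qed


section \<open>Rotations by a shell-dependent angle\<close>

text \<open>The angle of rotation depends on \<open>z\<close> through a function that is invariant under the flow, so that the
  rotations still preserve the Gaussian measure.\<close>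

definition shell :: "'a \<times> 'a \<Rightarrow> nat" where "shell z = nat \<lfloor>norm z\<rfloor>"

lemma shell_flow [simp]: "shell (boomerang_flow t z) = shell z" and shell_flip [simp]: "shell (flip z) = shell z"
  by (simp_all add: shell_def)

lemma shell_measurable [measurable]: "shell \<in> borel \<rightarrow>\<^sub>M count_space UNIV"
  unfolding shell_def by measurable

lemma norm_less_shell: "norm z < real (shell z) + 1" and shell_le_norm: "real (shell z) \<le> norm z"
  unfolding shell_def using norm_ge_zero[of z] by linarith+

text \<open>On each shell the angle is constant and the shell is carried to itself, so the claim is
  a sum of instances of \<open>gamma_flow\<close>. The norm is rounded precisely to have countably
  many shells.\<close>

lemma gamma_shell_flow:
  assumes [measurable]: "h \<in> borel_measurable borel"
  shows "(\<integral>\<^sup>+z. h (boomerang_flow (c (shell z)) z) \<partial>\<gamma>) = (\<integral>\<^sup>+z. h z \<partial>\<gamma>)"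
proof -
  have [measurable]: "(\<lambda>z. indicator {k} (shell z) :: ennreal) \<in> borel_measurable borel" for k
    by (rule measurable_compose[OF shell_measurable]) simp
  have split: "g (shell z) z = (\<Sum>k. indicator {k} (shell z) * g k z)" for g :: "nat \<Rightarrow> 'a \<times> 'a \<Rightarrow> ennreal" and z
  proof -
    have "(\<Sum>k. indicator {k} (shell z) * g k z) = (\<Sum>k\<in>{shell z}. indicator {k} (shell z) * g k z)"
      by (intro suminf_finite) auto
    then show ?thesis by simp
  qed
  have "(\<integral>\<^sup>+z. h (boomerang_flow (c (shell z)) z) \<partial>\<gamma>) = (\<integral>\<^sup>+z. (\<Sum>k. indicator {k} (shell z) * h (boomerang_flow (c k) z)) \<partial>\<gamma>)"
    using split[of "\<lambda>k z. h (boomerang_flow (c k) z)"] by simp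
  also have "\<dots> = (\<Sum>k. \<integral>\<^sup>+z. indicator {k} (shell z) * h (boomerang_flow (c k) z) \<partial>\<gamma>)"
    by (rule nn_integral_suminf) measurable
  also have "\<dots> = (\<Sum>k. \<integral>\<^sup>+z. indicator {k} (shell z) * h z \<partial>\<gamma>)"
  proof (rule arg_cong[where f=suminf], rule ext)
    fix k
    show "(\<integral>\<^sup>+z. indicator {k} (shell z) * h (boomerang_flow (c k) z) \<partial>\<gamma>) = (\<integral>\<^sup>+z. indicator {k} (shell z) * h z \<partial>\<gamma>)"
      using gamma_flow[of "\<lambda>z. indicator {k} (shell z) * h z" "c k"] by simp
  qed
  also have "\<dots> = (\<integral>\<^sup>+z. (\<Sum>k. indicator {k} (shell z) * h z) \<partial>\<gamma>)"
    by (rule nn_integral_suminf[symmetric]) measurable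
  also have "\<dots> = (\<integral>\<^sup>+z. h z \<partial>\<gamma>)"
    using split[of "\<lambda>k z. h z"] by simp
  finally show ?thesis .
qed

text \<open>Two requirements fix the form: \<open>angle z * (1 + norm z)\<close> stays between
  positive constants, and a quarter turn consists of the whole number
  \<open>2 * (shell z + 1)\<close> of turns.\<close>

definition angle :: "'a \<times> 'a \<Rightarrow> real" where "angle z = pi / 4 / (real (shell z) + 1)"

definition turn :: "'a \<times> 'a \<Rightarrow> 'a \<times> 'a" where "turn z = boomerang_flow (angle z) z"

text \<open>Sends a state to the state from which the same arc is run through backwards. As an
  involution preserving \<open>\<gamma>\<close> it provides the detailed balance of the chain of
  positions.\<close>

definition turn_back :: "'a \<times> 'a \<Rightarrow> 'a \<times> 'a" where "turn_back z = flip (turn z)"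

lemma angle_flow [simp]: "angle (boomerang_flow t z) = angle z" and angle_flip [simp]: "angle (flip z) = angle z"
  by (simp_all add: angle_def)

lemma angle_measurable [measurable]: "angle \<in> borel_measurable borel"
  unfolding angle_def by measurable

lemma turn_measurable [measurable]: "turn \<in> borel_measurable borel"
  unfolding turn_def by measurable

lemma turn_back_measurable [measurable]: "turn_back \<in> borel_measurable borel"
  unfolding turn_back_def by measurable

lemma turn_back_turn_back [simp]: "turn_back (turn_back z) = z"
  by (simp add: turn_back_def turn_def flow_flow_flip boomerang_flow_0)

lemma fst_turn_back [simp]: "fst (turn_back z) = fst (turn z)" and norm_snd_turn_back [simp]: "norm (snd (turn_back z)) = norm (snd (turn z))"
  by (simp_all add: turn_back_def)

lemma fst_turn_turn_back: "fst (turn (turn_back z)) = fst z"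
  by (metis fst_turn_back turn_back_turn_back)

lemma norm_snd_turn_turn_back: "norm (snd (turn (turn_back z))) = norm (snd z)"
  by (metis norm_snd_turn_back turn_back_turn_back)

lemma gamma_turn_back:
  assumes [measurable]: "h \<in> borel_measurable borel"
  shows "(\<integral>\<^sup>+z. h (turn_back z) \<partial>\<gamma>) = (\<integral>\<^sup>+z. h z \<partial>\<gamma>)"
  using gamma_shell_flow[of "\<lambda>z. h (flip z)" "\<lambda>k. pi / 4 / (real k + 1)"] gamma_flip[OF assms]
  by (simp add: turn_back_def turn_def angle_def)

lemma pi_bounds: "3 < pi" "pi < 4"
  using pi_gt3 pi_less_4 by auto

lemma angle_bounds: "0 < angle z" "angle z < 1" "angle z * norm z < 1" "angle z * (1 + norm z) \<le> 2"
  "pi / 4 \<le> angle z * (1 + norm z)"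
proof -
  let ?k = "real (shell z) + 1"
  have k: "0 < ?k" "norm z < ?k" "?k \<le> 1 + norm z" "1 \<le> ?k" using norm_less_shell[of z] shell_le_norm[of z] by auto
  have "pi / 4 / c * c = pi / 4" if "0 < c" for c :: real using that by simp
  from this[OF k(1)] have ak: "angle z * ?k = pi / 4" by (simp only: angle_def)
  show pos: "0 < angle z" using k by (simp add: angle_def)
  show "angle z < 1" using mult_left_mono[OF k(4), of "angle z"] pos pi_bounds ak by simp
  show "angle z * norm z < 1" using mult_strict_left_mono[OF k(2) pos] pi_bounds ak by simp
  have "1 + norm z \<le> 2 * ?k" using k by simp
  from mult_left_mono[OF this less_imp_le[OF pos]] have "angle z * (1 + norm z) \<le> 2 * (angle z * ?k)" by (simp add: mult_ac)
  then show "angle z * (1 + norm z) \<le> 2" unfolding ak using pi_bounds by simp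
  show "pi / 4 \<le> angle z * (1 + norm z)" using mult_left_mono[OF k(3), of "angle z"] ak pos by simp
qed

lemma norm_snd_flow_le:
  assumes "0 \<le> s" "s \<le> angle z"
  shows "norm (snd (boomerang_flow s z)) \<le> norm (snd z) + 1"
proof -
  have "norm (snd (boomerang_flow s z)) \<le> \<bar>sin s\<bar> * norm (fst z) + \<bar>cos s\<bar> * norm (snd z)"
    unfolding boomerang_flow_def split_beta' snd_conv
    using norm_triangle_ineq[of "- sin s *\<^sub>R fst z" "cos s *\<^sub>R snd z"] by simp
  also have "\<dots> \<le> angle z * norm z + 1 * norm (snd z)"
  proof (intro add_mono mult_mono)
    show "\<bar>sin s\<bar> \<le> angle z" using abs_sin_x_le_abs_x[of s] assms by simp
    show "norm (fst z) \<le> norm z" by (rule norm_fst_le')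
  qed (use angle_bounds(1)[of z] in auto)
  finally show ?thesis using angle_bounds(3)[of z] by simp
qed

lemma gradient_flow_le:
  assumes "0 \<le> s" "s \<le> angle z"
  shows "norm (gradient \<Phi> (fst (boomerang_flow s z))) * norm (snd (boomerang_flow s z)) \<le> K * (1 + norm z) * (norm (snd z) + 1)"
proof (rule mult_mono)
  have "norm (fst (boomerang_flow s z)) \<le> norm z" using norm_fst_le'[of "boomerang_flow s z"] by simp
  then have "K * (1 + norm (fst (boomerang_flow s z))) \<le> K * (1 + norm z)" using K_nonneg by (intro mult_left_mono) auto
  then show "norm (gradient \<Phi> (fst (boomerang_flow s z))) \<le> K * (1 + norm z)"
    using grad_le[of "fst (boomerang_flow s z)"] by simp
  show "norm (snd (boomerang_flow s z)) \<le> norm (snd z) + 1" by (rule norm_snd_flow_le[OF assms])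
qed (use K_nonneg in auto)

text \<open>The gradient grows linearly in \<open>norm z\<close> and the duration of the arc decays
  like its inverse, so the two cancel in the mean value theorem and only the velocity
  remains.\<close>

lemma Phi_flow_osc:
  assumes "0 \<le> s" "s \<le> angle z"
  shows "\<bar>\<Phi> (fst (boomerang_flow s z)) - \<Phi> (fst z)\<bar> \<le> 2 * K * (norm (snd z) + 1)"
proof (cases "s = 0")
  case True
  then show ?thesis using K_nonneg by (simp add: boomerang_flow_0)
next
  case False
  then have s: "0 < s" using assms by simp
  obtain r where r: "0 < r" "r < s" and eq: "\<Phi> (fst (boomerang_flow s z)) - \<Phi> (fst (boomerang_flow 0 z)) = (s - 0) * (gradient \<Phi> (fst (boomerang_flow r z)) \<bullet> snd (boomerang_flow r z))"
    using MVT2[OF s, of "\<lambda>s. \<Phi> (fst (boomerang_flow s z))" "\<lambda>r. gradient \<Phi> (fst (boomerang_flow r z)) \<bullet> snd (boomerang_flow r z)"] Phi_flow_deriv by blast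
  have "\<bar>gradient \<Phi> (fst (boomerang_flow r z)) \<bullet> snd (boomerang_flow r z)\<bar> \<le> K * (1 + norm z) * (norm (snd z) + 1)"
    using Cauchy_Schwarz_ineq2 gradient_flow_le[of r z] r assms by (meson less_imp_le order_trans)
  then have "s * \<bar>gradient \<Phi> (fst (boomerang_flow r z)) \<bullet> snd (boomerang_flow r z)\<bar> \<le> angle z * (K * (1 + norm z) * (norm (snd z) + 1))"
    using assms angle_bounds(1)[of z] by (intro mult_mono) auto
  also have "\<dots> = (angle z * (1 + norm z)) * (K * (norm (snd z) + 1))" by (simp add: mult_ac)
  also have "\<dots> \<le> 2 * (K * (norm (snd z) + 1))" using angle_bounds(4)[of z] K_nonneg by (intro mult_right_mono) auto
  finally show ?thesis using eq s by (simp add: boomerang_flow_0 abs_mult)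
qed

lemma cum_le:
  assumes "0 \<le> s" "s \<le> angle z"
  shows "cum s z \<le> lam + 2 * K * (norm (snd z) + 1)"
proof -
  have "cum s z \<le> (lam + K * (1 + norm z) * (norm (snd z) + 1)) * s"
  proof (rule cum_bounds(2)[OF assms(1)])
    fix r assume "0 \<le> r" "r \<le> s"
    then show "rate (boomerang_flow r z) \<le> lam + K * (1 + norm z) * (norm (snd z) + 1)"
      using rate_le[of "boomerang_flow r z"] gradient_flow_le[of r z] assms by simp
  qed
  also have "\<dots> \<le> (lam + K * (1 + norm z) * (norm (snd z) + 1)) * angle z"
    using assms lam_pos K_nonneg by (intro mult_left_mono) auto
  also have "\<dots> = lam * angle z + (angle z * (1 + norm z)) * (K * (norm (snd z) + 1))" by (simp add: algebra_simps)
  also have "\<dots> \<le> lam * 1 + 2 * (K * (norm (snd z) + 1))"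
    using angle_bounds[of z] K_nonneg lam_pos by (intro add_mono mult_mono) auto
  finally show ?thesis by simp
qed

end

text \<open>Quadratic bounds of both exponentials suffice for \<open>t \<le> 1\<close>; beyond 1
  already \<open>exp t \<le> exp (t\<^sup>2)\<close>. It serves to average an exponential of a term
  odd in the velocity.\<close>

lemma cosh_le_exp_square: "(exp t + exp (- t)) / 2 \<le> exp (t\<^sup>2)" for t :: real
proof -
  have *: "(exp t + exp (- t)) / 2 \<le> exp (t\<^sup>2)" if t: "0 \<le> t" for t :: real
  proof (cases "t \<le> 1")
    case True
    have 1: "exp t \<le> 1 + t + t\<^sup>2" by (rule exp_bound[OF t True])
    have "1 \<le> (1 - t + t\<^sup>2) * (1 + t + t\<^sup>2 / 2)"
    proof -
      have "(1 - t + t\<^sup>2) * (1 + t + t\<^sup>2 / 2) = 1 + (t\<^sup>2 + t ^ 3 + t ^ 4) / 2"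
        by (simp add: power2_eq_square power3_eq_cube power4_eq_xxxx field_simps)
      then show ?thesis using t by simp
    qed
    also have "\<dots> \<le> (1 - t + t\<^sup>2) * exp t"
      using exp_lower_Taylor_quadratic[OF t] True t by (intro mult_left_mono) (auto simp: add_nonneg_nonneg)
    finally have 2: "exp (- t) \<le> 1 - t + t\<^sup>2" by (simp add: exp_minus field_simps)
    have "(exp t + exp (- t)) / 2 \<le> 1 + t\<^sup>2" using 1 2 by simp
    then show ?thesis using exp_ge_add_one_self[of "t\<^sup>2"] by linarith
  next
    case False
    then have "t \<le> t\<^sup>2" by (simp add: power2_eq_square)
    then have 1: "exp t \<le> exp (t\<^sup>2)" by simp
    have 2: "exp (- t) \<le> exp t" using t by simp
    have "exp t + exp (- t) \<le> exp (t\<^sup>2) + exp (t\<^sup>2)" by (rule add_mono[OF 1 order_trans[OF 2 1]])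
    then show ?thesis by simp
  qed
  show ?thesis using *[of t] *[of "- t"] by (cases "0 \<le> t") (auto simp: add.commute)
qed

lemma exp_minus_le_inverse_square: "0 < y \<Longrightarrow> exp (- y) \<le> 2 / y\<^sup>2" for y :: real
  using exp_lower_Taylor_quadratic[of y] by (simp add: exp_minus field_simps)

lemma sin_ge_half: "0 \<le> s \<Longrightarrow> s \<le> 1 \<Longrightarrow> s / 2 \<le> sin (s::real)"
proof (cases "s = 0")
  case False
  assume s: "0 \<le> s" "s \<le> 1"
  then obtain r where r: "0 < r" "r < s" "sin s - sin 0 = (s - 0) * cos r"
    using MVT2[of 0 s sin cos] False by (auto intro: derivative_eq_intros)
  have "cos (pi / 3) \<le> cos r" using r s pi_gt3 by (intro cos_monotone_0_pi_le) auto
  then have "s * (1 / 2) \<le> s * cos r" using s by (intro mult_left_mono) (auto simp: cos_60)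
  then show ?thesis using r by simp
qed simp

lemma exists_small_tail:
  fixes f :: "'a::real_normed_vector \<Rightarrow> real"
  assumes sets: "sets M = sets borel" and f: "integrable M f" and e: "0 < e"
  obtains m0 where "\<And>m. m0 \<le> m \<Longrightarrow> (\<integral>x. indicator {x. m < norm x} x * \<bar>f x\<bar> \<partial>M) \<le> e"
proof -
  note [measurable_cong] = sets
  have [measurable]: "f \<in> borel_measurable M" using f by auto
  have sp: "space M = UNIV" using sets_eq_imp_space_eq[OF sets] by simp
  have [measurable]: "{x::'a. m < norm x} \<in> sets M" for m
    unfolding sets by (intro borel_open open_Collect_less continuous_intros)
  have int: "integrable M (\<lambda>x. indicator {x. m < norm x} x * \<bar>f x\<bar>)" for m
    using f by (intro integrable_mult_indicator[where 'b=real, simplified] integrable_abs) auto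
  have "(\<lambda>n. \<integral>x. indicator {x. real n < norm x} x * \<bar>f x\<bar> \<partial>M) \<longlonglongrightarrow> (\<integral>x. 0 \<partial>M)"
  proof (rule integral_dominated_convergence)
    show "integrable M (\<lambda>x. \<bar>f x\<bar>)" using f by auto
    show "AE x in M. (\<lambda>n. indicator {x. real n < norm x} x * \<bar>f x\<bar>) \<longlonglongrightarrow> 0"
    proof (rule AE_I2)
      fix x :: 'a
      obtain N where "norm x \<le> real N" using real_arch_simple by blast
      then have "\<forall>\<^sub>F n in sequentially. indicator {x. real n < norm x} x * \<bar>f x\<bar> = 0"
        by (intro eventually_sequentiallyI[of N]) (auto simp: indicator_def)
      then show "(\<lambda>n. indicator {x. real n < norm x} x * \<bar>f x\<bar>) \<longlonglongrightarrow> 0" by (rule tendsto_eventually)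
    qed
    show "AE x in M. norm (indicator {x. real n < norm x} x * \<bar>f x\<bar>) \<le> \<bar>f x\<bar>" for n
      by (rule AE_I2) (auto simp: indicator_def)
  qed (use int in auto)
  then have "\<forall>\<^sub>F n in sequentially. (\<integral>x. indicator {x. real n < norm x} x * \<bar>f x\<bar> \<partial>M) < e"
    using e by (intro order_tendstoD) auto
  then obtain n where n: "(\<integral>x. indicator {x. real n < norm x} x * \<bar>f x\<bar> \<partial>M) < e" by (auto simp: eventually_sequentially)
  show ?thesis
  proof (rule that[of "real n"])
    fix m assume "real n \<le> m"
    then have "(\<integral>x. indicator {x. m < norm x} x * \<bar>f x\<bar> \<partial>M) \<le> (\<integral>x. indicator {x. real n < norm x} x * \<bar>f x\<bar> \<partial>M)"
      by (intro integral_mono int) (auto simp: indicator_def)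
    then show "(\<integral>x. indicator {x. m < norm x} x * \<bar>f x\<bar> \<partial>M) \<le> e" using n by simp
  qed
qed

section \<open>Poincare inequality for the position chain\<close>

lemma exp_minus_le: "0 \<le> w \<Longrightarrow> w \<le> 1 \<Longrightarrow> exp (- w) \<le> 1 - w / 2" for w :: real
proof -
  assume w: "0 \<le> w" "w \<le> 1"
  have "1 \<le> (1 + w) * (1 - w / 2)" using mult_left_mono[OF w(2) w(1)] by (simp add: algebra_simps)
  also have "\<dots> \<le> exp w * (1 - w / 2)" using w exp_ge_add_one_self[of w] by (intro mult_right_mono) auto
  finally show ?thesis by (simp add: exp_minus field_simps)
qed

text \<open>The regularity of the convex part is recorded as a bound on second differences, the form
  in which the sum over \<open>v\<close> and \<open>- v\<close> uses it. Working with
  \<open>\<Phi>\<^sub>1\<close> instead of \<open>\<Phi>\<close> costs constant factors that are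
  powers of \<open>exp D\<close>.\<close>

locale boomerang_convex = boomerang +
  fixes \<Phi>\<^sub>1 :: "'a \<Rightarrow> real" and L D :: real
  assumes Phi1_near: "\<bar>\<Phi> x - \<Phi>\<^sub>1 x\<bar> \<le> D" and Phi1_convex: "convex_on UNIV \<Phi>\<^sub>1"
    and Phi1_second: "\<Phi>\<^sub>1 (p + h) + \<Phi>\<^sub>1 (p - h) - 2 * \<Phi>\<^sub>1 p \<le> L * (norm h)\<^sup>2"
    and Phi1_measurable [measurable]: "\<Phi>\<^sub>1 \<in> borel_measurable borel" and L_nonneg: "0 \<le> L"
    and Phi_le: "\<Phi> x \<le> K * (1 + (norm x)\<^sup>2)"
begin

lemma D_nonneg: "0 \<le> D" using Phi1_near[of 0] by linarith

lemma Phi1_ge: "- D \<le> \<Phi>\<^sub>1 x" using Phi1_near[of x] Phi_nonneg[of x] by linarith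

text \<open>\<open>exp (dl z)\<close> is the symmetrizing weight of the step from \<open>x\<close> to the rotated position \<open>y\<close>, and \<open>rho a z\<close> is
  the ratio of the Lyapunov function \<open>exp (a \<parallel>x\<parallel>\<^sup>2 / 2)\<close> at \<open>y\<close> and at \<open>x\<close>.\<close>

definition dl :: "'a \<times> 'a \<Rightarrow> real" where "dl z = (\<Phi>\<^sub>1 (fst z) - \<Phi>\<^sub>1 (fst (turn z))) / 2"

definition rho :: "real \<Rightarrow> 'a \<times> 'a \<Rightarrow> real" where
  "rho a z = exp (a / 2 * ((norm (fst (turn z)))\<^sup>2 - (norm (fst z))\<^sup>2))"

text \<open>The velocities at both ends of the arc are restricted, so that the cutoff is invariant
  under \<open>turn_back\<close>.\<close>

definition cutoff :: "real \<Rightarrow> 'a \<times> 'a \<Rightarrow> real" where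
  "cutoff m z = of_bool (norm (snd z) \<le> m \<and> norm (snd (turn z)) \<le> m)"

lemma fst_turn_measurable [measurable]: "(\<lambda>z. fst (turn z)) \<in> borel_measurable borel"
  "(\<lambda>z. snd (turn z)) \<in> borel_measurable borel"
  by (intro measurable_fst_borel measurable_snd_borel turn_measurable)+

lemma fst_snd_measurable [measurable]: "fst \<in> borel_measurable (borel :: ('a \<times> 'a) measure)" "snd \<in> borel_measurable (borel :: ('a \<times> 'a) measure)"
  using measurable_fst_borel[of "\<lambda>z. z" borel] measurable_snd_borel[of "\<lambda>z. z" borel] by auto

lemma dl_measurable [measurable]: "dl \<in> borel_measurable borel"
  and rho_measurable [measurable]: "rho a \<in> borel_measurable borel"
  and cutoff_measurable [measurable]: "cutoff m \<in> borel_measurable borel"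
  unfolding dl_def rho_def cutoff_def by measurable

lemma turn_eq: "turn (x, v) = (cos (angle (x, v)) *\<^sub>R x + sin (angle (x, v)) *\<^sub>R v, - sin (angle (x, v)) *\<^sub>R x + cos (angle (x, v)) *\<^sub>R v)"
  by (simp add: turn_def boomerang_flow_def)

lemma angle_minus: "angle (x, - v) = angle (x, v)"
  using angle_flip[of "(x, v)"] by (simp add: flip_def)

lemma norm_turn_diff:
  "(norm (fst (turn (x, v))))\<^sup>2 - (norm x)\<^sup>2 = (sin (angle (x, v)))\<^sup>2 * ((norm v)\<^sup>2 - (norm x)\<^sup>2) + 2 * cos (angle (x, v)) * sin (angle (x, v)) * (x \<bullet> v)"
proof -
  have "(norm (c *\<^sub>R x + s *\<^sub>R v))\<^sup>2 = c\<^sup>2 * (norm x)\<^sup>2 + s\<^sup>2 * (norm v)\<^sup>2 + 2 * c * s * (x \<bullet> v)" for c s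
    unfolding power2_norm_eq_inner by (simp add: inner_simps inner_commute[of v x] power2_eq_square algebra_simps)
  then show ?thesis by (simp add: turn_eq cos_squared_eq algebra_simps)
qed

lemma sin_angle: "0 \<le> sin (angle z)" "sin (angle z) \<le> angle z" "angle z / 2 \<le> sin (angle z)"
  using angle_bounds(1,2)[of z] sin_ge_half[of "angle z"] sin_x_le_x[of "angle z"] by auto

lemma sin_angle_norm: "sin (angle (x, v)) * norm x \<le> 1" "sin (angle (x, v)) * norm v \<le> 1"
proof -
  have "sin (angle (x, v)) * norm x \<le> angle (x, v) * norm (x, v)"
    "sin (angle (x, v)) * norm v \<le> angle (x, v) * norm (x, v)"
    using norm_fst_le[of x v] norm_snd_le[of v x] sin_angle[of "(x, v)"] angle_bounds(1)[of "(x, v)"]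
    by (intro mult_mono; simp)+
  then show "sin (angle (x, v)) * norm x \<le> 1" "sin (angle (x, v)) * norm v \<le> 1"
    using angle_bounds(3)[of "(x, v)"] by linarith+
qed

lemma dl_bound: "\<bar>dl z\<bar> \<le> K * (norm (snd z) + 1) + D"
proof -
  have "\<bar>\<Phi> (fst (turn z)) - \<Phi> (fst z)\<bar> \<le> 2 * K * (norm (snd z) + 1)"
    unfolding turn_def using angle_bounds(1)[of z] by (intro Phi_flow_osc) auto
  then show ?thesis
    using Phi1_near[of "fst z"] Phi1_near[of "fst (turn z)"] unfolding dl_def by (simp add: abs_le_iff)
qed

lemma rho_le:
  assumes a: "0 \<le> a" "a \<le> 1"
  shows "rho a (x, v) \<le> exp (1 + norm v)"
proof -
  let ?s = "sin (angle (x, v))" and ?c = "cos (angle (x, v))"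
  have "?s\<^sup>2 * ((norm v)\<^sup>2 - (norm x)\<^sup>2) \<le> (?s * norm v)\<^sup>2"
    by (simp add: power_mult_distrib algebra_simps)
  also have "\<dots> \<le> 1" using sin_angle_norm(2)[of x v] sin_angle(1)[of "(x, v)"] by (intro power_le_one) auto
  finally have 1: "?s\<^sup>2 * ((norm v)\<^sup>2 - (norm x)\<^sup>2) \<le> 1" .
  have "?c * ?s * (x \<bullet> v) \<le> \<bar>?c\<bar> * (?s * norm x) * norm v"
  proof -
    have "?c * ?s * (x \<bullet> v) \<le> \<bar>?c * ?s * (x \<bullet> v)\<bar>" by simp
    also have "\<dots> \<le> \<bar>?c\<bar> * ?s * (norm x * norm v)"
      using sin_angle(1)[of "(x, v)"] by (simp add: abs_mult mult_left_mono Cauchy_Schwarz_ineq2)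
    finally show ?thesis by (simp add: mult.assoc)
  qed
  also have "\<dots> \<le> 1 * 1 * norm v"
    using sin_angle_norm(1)[of x v] sin_angle(1)[of "(x, v)"] by (intro mult_mono) auto
  finally have "(norm (fst (turn (x, v))))\<^sup>2 - (norm x)\<^sup>2 \<le> 1 + 2 * norm v"
    unfolding norm_turn_diff using 1 by simp
  then have "a / 2 * ((norm (fst (turn (x, v))))\<^sup>2 - (norm x)\<^sup>2) \<le> a / 2 * (1 + 2 * norm v)"
    using a by (intro mult_left_mono) auto
  also have "\<dots> \<le> 1 / 2 * (1 + 2 * norm v)" using a by (intro mult_right_mono) auto
  finally show ?thesis unfolding rho_def by simp
qed

text \<open>Convexity of \<open>\<Phi>\<^sub>1\<close> is used only here. A single rotation may move \<open>x\<close> to larger values of \<open>\<Phi>\<^sub>1\<close>; the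
  sum over \<open>v\<close> and \<open>- v\<close> cannot, up to second differences.\<close>

lemma dl_sym:
  assumes x: "x \<noteq> 0"
  shows "- (\<Phi>\<^sub>1 0 + D + L * (norm v)\<^sup>2) / (2 * (norm x)\<^sup>2) \<le> dl (x, v) + dl (x, - v)"
proof -
  let ?\<sigma> = "angle (x, v)"
  let ?s = "sin ?\<sigma>" and ?c = "cos ?\<sigma>"
  have "(sin (?\<sigma> / 2))\<^sup>2 \<le> (?\<sigma> / 2)\<^sup>2"
    unfolding abs_le_square_iff[symmetric] by (rule abs_sin_x_le_abs_x)
  moreover have "?c = 1 - 2 * (sin (?\<sigma> / 2))\<^sup>2" using cos_double_sin[of "?\<sigma> / 2"] by simp
  moreover have c0: "0 \<le> ?c" using angle_bounds(1,2)[of "(x, v)"] pi_bounds by (intro cos_ge_zero) auto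
  ultimately have "1 - ?c \<le> ?\<sigma>\<^sup>2 / 2" by (simp add: power_divide)
  with c0 have c: "0 \<le> ?c" "1 - ?c \<le> ?\<sigma>\<^sup>2 / 2" .
  \<comment> \<open>The point \<open>cos ?\<sigma> *\<^sub>R x\<close> lies between \<open>0\<close>
    and \<open>x\<close> and is the midpoint of the two rotated positions: convexity compares it
    with \<open>x\<close>, the second difference compares it with those positions.\<close>
  have conv: "\<Phi>\<^sub>1 (?c *\<^sub>R x) \<le> ?c * \<Phi>\<^sub>1 x + (1 - ?c) * \<Phi>\<^sub>1 0"
    using convex_onD[OF Phi1_convex, of "1 - ?c" x 0] c by simp
  have "2 * (dl (x, v) + dl (x, - v)) = 2 * \<Phi>\<^sub>1 x - \<Phi>\<^sub>1 (?c *\<^sub>R x + ?s *\<^sub>R v) - \<Phi>\<^sub>1 (?c *\<^sub>R x - ?s *\<^sub>R v)"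
    by (simp add: dl_def turn_eq angle_minus field_simps)
  also have "\<dots> \<ge> 2 * (\<Phi>\<^sub>1 x - \<Phi>\<^sub>1 (?c *\<^sub>R x)) - L * (?s * norm v)\<^sup>2"
    using Phi1_second[of "?c *\<^sub>R x" "?s *\<^sub>R v"] by (simp add: power_mult_distrib)
  finally have 1: "2 * (dl (x, v) + dl (x, - v)) \<ge> 2 * (\<Phi>\<^sub>1 x - \<Phi>\<^sub>1 (?c *\<^sub>R x)) - L * (?s * norm v)\<^sup>2" .
  have 2: "(1 - ?c) * (\<Phi>\<^sub>1 x - \<Phi>\<^sub>1 0) \<le> \<Phi>\<^sub>1 x - \<Phi>\<^sub>1 (?c *\<^sub>R x)"
    using conv by (simp add: algebra_simps)
  have "- ((1 - ?c) * (\<Phi>\<^sub>1 0 + D)) \<le> (1 - ?c) * (\<Phi>\<^sub>1 x - \<Phi>\<^sub>1 0)"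
    using mult_left_mono[of "- (\<Phi>\<^sub>1 0 + D)" "\<Phi>\<^sub>1 x - \<Phi>\<^sub>1 0" "1 - ?c"] Phi1_ge[of x] by (simp add: algebra_simps)
  moreover have "(1 - ?c) * (\<Phi>\<^sub>1 0 + D) \<le> ?\<sigma>\<^sup>2 / 2 * (\<Phi>\<^sub>1 0 + D)"
    using c Phi1_ge[of 0] by (intro mult_right_mono) auto
  ultimately have 3: "- (?\<sigma>\<^sup>2 / 2 * (\<Phi>\<^sub>1 0 + D)) \<le> \<Phi>\<^sub>1 x - \<Phi>\<^sub>1 (?c *\<^sub>R x)" using 2 by linarith
  have "(?s * norm v)\<^sup>2 \<le> (?\<sigma> * norm v)\<^sup>2"
    using sin_angle[of "(x, v)"] by (intro power_mono mult_right_mono mult_nonneg_nonneg) auto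
  then have 4: "L * (?s * norm v)\<^sup>2 \<le> L * (?\<sigma>\<^sup>2 * (norm v)\<^sup>2)" using L_nonneg by (auto simp: power_mult_distrib intro!: mult_left_mono)
  have 5: "2 * w - q' \<le> u" if "w \<le> b" "q \<le> q'" "2 * b - q \<le> u" for w b q q' u :: real using that by simp
  have 6: "2 * (- (?\<sigma>\<^sup>2 / 2 * (\<Phi>\<^sub>1 0 + D))) - L * (?\<sigma>\<^sup>2 * (norm v)\<^sup>2) = - ?\<sigma>\<^sup>2 * (\<Phi>\<^sub>1 0 + D + L * (norm v)\<^sup>2)"
    by (simp add: algebra_simps)
  have "- ?\<sigma>\<^sup>2 * (\<Phi>\<^sub>1 0 + D + L * (norm v)\<^sup>2) \<le> 2 * (dl (x, v) + dl (x, - v))"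
    using 5[OF 3 4 1] unfolding 6 .
  moreover have "?\<sigma>\<^sup>2 * (\<Phi>\<^sub>1 0 + D + L * (norm v)\<^sup>2) \<le> (1 / norm x)\<^sup>2 * (\<Phi>\<^sub>1 0 + D + L * (norm v)\<^sup>2)"
  proof (intro mult_right_mono power_mono)
    have "?\<sigma> * norm x \<le> ?\<sigma> * norm (x, v)" using norm_fst_le[of x v] angle_bounds(1)[of "(x, v)"] by simp
    then show "?\<sigma> \<le> 1 / norm x" using angle_bounds(3)[of "(x, v)"] x by (simp add: field_simps)
  qed (use angle_bounds(1)[of "(x, v)"] Phi1_ge[of 0] L_nonneg in auto)
  moreover have "- (\<Phi>\<^sub>1 0 + D + L * (norm v)\<^sup>2) / (2 * (norm x)\<^sup>2) = - ((1 / norm x)\<^sup>2 * (\<Phi>\<^sub>1 0 + D + L * (norm v)\<^sup>2)) / 2"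
    using x by (simp add: power_divide field_simps)
  ultimately show ?thesis by simp
qed

text \<open>In the increment of \<open>(norm x)\<^sup>2\<close> the term with
  \<open>x \<bullet> v\<close> is odd in \<open>v\<close>; averaging turns it into an exponent of
  order \<open>a\<^sup>2\<close>, which the radial loss of order \<open>a\<close> dominates as long
  as \<open>2 * a * (norm v)\<^sup>2 \<le> 1 / 4\<close>. Larger velocities go into the indicator
  term.\<close>

lemma rho_sym:
  assumes a: "0 < a" "a \<le> 1" and x: "2 \<le> norm x" "1 / (2 * a) \<le> (norm x)\<^sup>2"
  shows "(rho a (x, v) + rho a (x, - v)) / 2 \<le> 1 - a / 256 + indicator {v. 1 / (8 * a) < (norm v)\<^sup>2} v * exp (1 + a\<^sup>2 * (norm v)\<^sup>2)"
proof -
  let ?\<sigma> = "angle (x, v)"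
  let ?s = "sin ?\<sigma>" and ?c = "cos ?\<sigma>" and ?X = "norm x" and ?Y = "norm v"
  let ?e = "a / 2 * (?s\<^sup>2 * (?Y\<^sup>2 - ?X\<^sup>2))" and ?t = "a * ?c * ?s * (x \<bullet> v)"
  have "rho a (x, v) = exp ?e * exp ?t" "rho a (x, - v) = exp ?e * exp (- ?t)"
    unfolding rho_def fst_conv norm_turn_diff by (simp_all add: angle_minus algebra_simps flip: exp_add)
  then have "(rho a (x, v) + rho a (x, - v)) / 2 = exp ?e * ((exp ?t + exp (- ?t)) / 2)"
    by (simp add: algebra_simps)
  also have "\<dots> \<le> exp ?e * exp (?t\<^sup>2)" by (intro mult_left_mono cosh_le_exp_square) auto
  also have "\<dots> \<le> exp (?e + a\<^sup>2 * (?s\<^sup>2 * (?X\<^sup>2 * ?Y\<^sup>2)))"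
  proof -
    have "(x \<bullet> v)\<^sup>2 \<le> (?X * ?Y)\<^sup>2" using Cauchy_Schwarz_ineq2[of x v] by (simp add: abs_le_square_iff[symmetric] abs_mult)
    moreover have "?c\<^sup>2 \<le> 1" by (simp add: abs_square_le_1)
    ultimately have "?c\<^sup>2 * (x \<bullet> v)\<^sup>2 \<le> 1 * (?X * ?Y)\<^sup>2" by (intro mult_mono) auto
    then have "a\<^sup>2 * ?s\<^sup>2 * (?c\<^sup>2 * (x \<bullet> v)\<^sup>2) \<le> a\<^sup>2 * ?s\<^sup>2 * (1 * (?X * ?Y)\<^sup>2)" by (intro mult_left_mono) auto
    then show ?thesis by (simp add: exp_add[symmetric] power_mult_distrib mult_ac)
  qed
  finally have main: "(rho a (x, v) + rho a (x, - v)) / 2 \<le> exp (?e + a\<^sup>2 * (?s\<^sup>2 * (?X\<^sup>2 * ?Y\<^sup>2)))" .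
  have sX: "?s\<^sup>2 * ?X\<^sup>2 \<le> 1" "?s\<^sup>2 * ?Y\<^sup>2 \<le> 1"
    unfolding power_mult_distrib[symmetric] using sin_angle_norm[of x v] sin_angle(1)[of "(x, v)"] by (intro power_le_one; simp)+
  show ?thesis
  proof (cases "1 / (8 * a) < ?Y\<^sup>2")
    case True
    have "?s\<^sup>2 * (?Y\<^sup>2 - ?X\<^sup>2) \<le> ?s\<^sup>2 * ?Y\<^sup>2" by (intro mult_left_mono) auto
    then have "?e \<le> a / 2 * 1" using sX a by (intro mult_left_mono) auto
    moreover have "a\<^sup>2 * (?s\<^sup>2 * (?X\<^sup>2 * ?Y\<^sup>2)) \<le> a\<^sup>2 * ?Y\<^sup>2"
      using mult_right_mono[OF sX(1), of "?Y\<^sup>2"] by (intro mult_left_mono) (auto simp: mult_ac)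
    ultimately have "?e + a\<^sup>2 * (?s\<^sup>2 * (?X\<^sup>2 * ?Y\<^sup>2)) \<le> 1 + a\<^sup>2 * ?Y\<^sup>2" using a by linarith
    then have "exp (?e + a\<^sup>2 * (?s\<^sup>2 * (?X\<^sup>2 * ?Y\<^sup>2))) \<le> exp (1 + a\<^sup>2 * ?Y\<^sup>2)" by simp
    with main have "(rho a (x, v) + rho a (x, - v)) / 2 \<le> exp (1 + a\<^sup>2 * ?Y\<^sup>2)" by (rule order_trans)
    moreover have "1 - a / 256 + indicator {v. 1 / (8 * a) < (norm v)\<^sup>2} v * exp (1 + a\<^sup>2 * ?Y\<^sup>2) = 1 - a / 256 + exp (1 + a\<^sup>2 * ?Y\<^sup>2)"
      using True by simp
    ultimately show ?thesis using a by linarith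
  next
    case False
    then have Y: "?Y\<^sup>2 \<le> 1 / (8 * a)" by simp
    also have "1 / (8 * a) = (1 / (2 * a)) / 4" by simp
    also have "\<dots> \<le> ?X\<^sup>2 / 4" using x(2) by simp
    finally have YX: "?Y\<^sup>2 \<le> ?X\<^sup>2 / 4" .
    then have "?Y\<^sup>2 \<le> (?X / 2)\<^sup>2" by (simp add: power_divide)
    then have YX': "?Y \<le> ?X / 2" by (rule power2_le_imp_le) simp
    have aY: "2 * a * ?Y\<^sup>2 \<le> 1 / 4" using Y a by (simp add: field_simps)
    have "?e + a\<^sup>2 * (?s\<^sup>2 * (?X\<^sup>2 * ?Y\<^sup>2)) = a / 2 * ?s\<^sup>2 * (?Y\<^sup>2 - ?X\<^sup>2 + (2 * a * ?Y\<^sup>2) * ?X\<^sup>2)"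
      by (simp add: power2_eq_square algebra_simps)
    also have "\<dots> \<le> a / 2 * ?s\<^sup>2 * (?X\<^sup>2 / 4 - ?X\<^sup>2 + 1 / 4 * ?X\<^sup>2)"
      using a aY YX by (intro mult_left_mono add_mono diff_right_mono mult_right_mono) auto
    also have "\<dots> = - (a / 4) * (?s * ?X)\<^sup>2" by (simp add: power_mult_distrib)
    \<comment> \<open>The lower bound on \<open>angle z * (1 + norm z)\<close> gives
      \<open>3 / 16 \<le> sin ?\<sigma> * norm x\<close>, and \<open>9 / 256\<close> exceeds
      \<open>1 / 32\<close>.\<close>
    also have "\<dots> \<le> - (a / 4) * (1 / 32)"
    proof -
      have "norm (x, v) \<le> ?X + ?Y" using norm_Pair_le[of x v] by simp
      then have "1 + norm (x, v) \<le> 2 * ?X" using YX' x(1) by linarith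
      then have "?\<sigma> * (1 + norm (x, v)) \<le> ?\<sigma> * (2 * ?X)" using angle_bounds(1)[of "(x, v)"] by (intro mult_left_mono) auto
      then have "pi / 8 \<le> ?\<sigma> * ?X" using angle_bounds(5)[of "(x, v)"] by simp
      moreover have "?\<sigma> / 2 * ?X \<le> ?s * ?X" using sin_angle(3)[of "(x, v)"] by (intro mult_right_mono) auto
      ultimately have "3 / 16 \<le> ?s * ?X" using pi_bounds by simp
      then have "(3 / 16)\<^sup>2 \<le> (?s * ?X)\<^sup>2" by (intro power_mono) auto
      then have "1 / 32 \<le> (?s * ?X)\<^sup>2" by (simp add: power2_eq_square)
      then show ?thesis using a by simp
    qed
    finally have "exp (?e + a\<^sup>2 * (?s\<^sup>2 * (?X\<^sup>2 * ?Y\<^sup>2))) \<le> exp (- (a / 128))" by simp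
    also have "\<dots> \<le> 1 - a / 128 / 2" using a by (intro exp_minus_le) auto
    finally have "(rho a (x, v) + rho a (x, - v)) / 2 \<le> 1 - a / 128 / 2" by (rule order_trans[OF main])
    then show ?thesis using False by simp
  qed
qed

text \<open>The gain in \<open>rho_sym\<close> is linear in \<open>a\<close>, while the velocities
  beyond \<open>1 / (8 * a)\<close> contribute only of order
  \<open>exp (- (\<alpha> / (16 * a)))\<close> by Fernique, which is below a multiple of
  \<open>a\<^sup>2\<close>.\<close>

lemma small_parameter:
  obtains a where "0 < a" "a \<le> 1" "integrable \<nu> (\<lambda>v. indicator {v. 1 / (8 * a) < (norm v)\<^sup>2} v * exp (1 + a\<^sup>2 * (norm v)\<^sup>2))"
    "(\<integral>v. indicator {v. 1 / (8 * a) < (norm v)\<^sup>2} v * exp (1 + a\<^sup>2 * (norm v)\<^sup>2) \<partial>\<nu>) \<le> a / 1024"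
proof -
  obtain \<alpha> where \<alpha>: "0 < \<alpha>" "integrable \<nu> (\<lambda>x. exp (\<alpha> * (norm x)\<^sup>2))"
    using fernique[OF gauss Sigma_pos Sigma_linear] .
  define E where "E = (\<integral>x. exp (\<alpha> * (norm x)\<^sup>2) \<partial>\<nu>)"
  have "(\<integral>x. 1 \<partial>\<nu>) \<le> E" unfolding E_def using \<alpha> by (intro integral_mono) auto
  then have E: "1 \<le> E" by simp
  \<comment> \<open>The first two entries give \<open>a\<^sup>2 \<le> \<alpha> / 2\<close>; the
    third makes the tail bound \<open>512 * exp 1 * E / \<alpha>\<^sup>2 * a\<^sup>2\<close> at most
    \<open>a / 1024\<close>.\<close>
  define a where "a = min 1 (min (\<alpha> / 2) (\<alpha>\<^sup>2 / (2 ^ 19 * exp 1 * E)))"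
  have a: "0 < a" "a \<le> 1" "a \<le> \<alpha> / 2" "a \<le> \<alpha>\<^sup>2 / (2 ^ 19 * exp 1 * E)"
    using \<alpha> E by (auto simp: a_def)
  have "a\<^sup>2 \<le> a" using a by (simp add: power2_eq_square mult_left_le)
  then have a2: "a\<^sup>2 \<le> \<alpha> / 2" using a by simp
  have pt: "indicator {v. 1 / (8 * a) < (norm v)\<^sup>2} v * exp (1 + a\<^sup>2 * (norm v)\<^sup>2) \<le> exp 1 * exp (- (\<alpha> / (16 * a))) * exp (\<alpha> * (norm v)\<^sup>2)" for v :: 'a
  proof (cases "1 / (8 * a) < (norm v)\<^sup>2")
    case True
    have "\<alpha> / 2 * (1 / (8 * a)) \<le> (\<alpha> - a\<^sup>2) * (norm v)\<^sup>2"
      using True a2 \<alpha> a by (intro mult_mono) auto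
    then have "1 + a\<^sup>2 * (norm v)\<^sup>2 \<le> 1 + (- (\<alpha> / (16 * a))) + \<alpha> * (norm v)\<^sup>2" by (simp add: algebra_simps)
    then have "exp (1 + a\<^sup>2 * (norm v)\<^sup>2) \<le> exp (1 + (- (\<alpha> / (16 * a))) + \<alpha> * (norm v)\<^sup>2)" by simp
    then show ?thesis using True by (simp only: exp_add) simp
  qed simp
  have [measurable]: "{v::'a. 1 / (8 * a) < (norm v)\<^sup>2} \<in> sets borel" by measurable
  have int: "integrable \<nu> (\<lambda>v. exp 1 * exp (- (\<alpha> / (16 * a))) * exp (\<alpha> * (norm v)\<^sup>2))"
    using \<alpha> by simp
  have int': "integrable \<nu> (\<lambda>v. indicator {v. 1 / (8 * a) < (norm v)\<^sup>2} v * exp (1 + a\<^sup>2 * (norm v)\<^sup>2))"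
    using pt by (intro Bochner_Integration.integrable_bound[OF int]) auto
  have "(\<integral>v. indicator {v. 1 / (8 * a) < (norm v)\<^sup>2} v * exp (1 + a\<^sup>2 * (norm v)\<^sup>2) \<partial>\<nu>)
     \<le> (\<integral>v. exp 1 * exp (- (\<alpha> / (16 * a))) * exp (\<alpha> * (norm v)\<^sup>2) \<partial>\<nu>)"
    by (intro integral_mono int int' pt)
  also have "\<dots> = exp 1 * exp (- (\<alpha> / (16 * a))) * E" by (simp add: E_def)
  also have "\<dots> \<le> exp 1 * (2 / (\<alpha> / (16 * a))\<^sup>2) * E"
    using \<alpha> a E by (intro mult_right_mono mult_left_mono exp_minus_le_inverse_square) auto
  also have "\<dots> = a * (512 * exp 1 * E / \<alpha>\<^sup>2) * a"
    using a \<alpha> by (simp add: power2_eq_square field_simps)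
  also have "\<dots> \<le> a * (512 * exp 1 * E / \<alpha>\<^sup>2) * (\<alpha>\<^sup>2 / (2 ^ 19 * exp 1 * E))"
    using a \<alpha> E by (intro mult_left_mono) auto
  also have "\<dots> = a / 1024" using \<alpha> E by simp
  finally show ?thesis using a int' by (intro that)
qed


lemma integrable_exp_norm: "integrable \<nu> (\<lambda>v. exp (1 + norm v))"
proof -
  obtain \<alpha> where \<alpha>: "0 < \<alpha>" "integrable \<nu> (\<lambda>x. exp (\<alpha> * (norm x)\<^sup>2))"
    using fernique[OF gauss Sigma_pos Sigma_linear] .
  show ?thesis
  proof (rule Bochner_Integration.integrable_bound)
    show "integrable \<nu> (\<lambda>x. exp (1 + 1 / \<alpha>) * exp (\<alpha> * (norm x)\<^sup>2))" using \<alpha> by simp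
    have "exp (1 + norm x) \<le> exp (1 + 1 / \<alpha>) * exp (\<alpha> * (norm x)\<^sup>2)" for x :: 'a
    proof -
      have "2 * (sqrt \<alpha> * norm x) * (1 / sqrt \<alpha>) \<le> (sqrt \<alpha> * norm x)\<^sup>2 + (1 / sqrt \<alpha>)\<^sup>2" by (rule sum_squares_bound)
      then have "2 * norm x \<le> \<alpha> * (norm x)\<^sup>2 + 1 / \<alpha>" using \<alpha>(1) by (simp add: power_mult_distrib power_divide)
      then have "norm x \<le> \<alpha> * (norm x)\<^sup>2 + 1 / \<alpha>" using norm_ge_zero[of x] by linarith
      then show ?thesis by (simp flip: exp_add)
    qed
    then show "AE x in \<nu>. norm (exp (1 + norm x)) \<le> norm (exp (1 + 1 / \<alpha>) * exp (\<alpha> * (norm x)\<^sup>2))" by simp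
  qed simp
qed

lemma integrable_norm: "integrable \<nu> norm"
  by (rule Bochner_Integration.integrable_bound[OF integrable_exp_norm])
    (auto intro!: AE_I2 order_trans[OF _ exp_ge_add_one_self])

lemma nu_minus:
  fixes h :: "'a \<Rightarrow> real"
  assumes [measurable]: "h \<in> borel_measurable borel"
  shows "(\<integral>v. h (- v) \<partial>\<nu>) = (\<integral>v. h v \<partial>\<nu>)" and "integrable \<nu> h \<Longrightarrow> integrable \<nu> (\<lambda>v. h (- v))"
proof -
  show "(\<integral>v. h (- v) \<partial>\<nu>) = (\<integral>v. h v \<partial>\<nu>)"
    using integral_distr[of uminus \<nu> borel h] by (simp add: nu_invariant_minus)
  show "integrable \<nu> h \<Longrightarrow> integrable \<nu> (\<lambda>v. h (- v))"
    using integrable_distr_eq[of uminus \<nu> borel h] by (simp add: nu_invariant_minus)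
qed

section \<open>Drift outside a ball\<close>

lemma integrable_dl: "integrable \<nu> (\<lambda>v. dl (x, v))"
proof (rule Bochner_Integration.integrable_bound)
  show "integrable \<nu> (\<lambda>v. K * (norm v + 1) + D)" using integrable_norm by simp
  show "AE v in \<nu>. norm (dl (x, v)) \<le> norm (K * (norm v + 1) + D)"
    using dl_bound[of "(x, _)"] by (auto intro!: AE_I2 order_trans[OF _ abs_ge_self])
qed measurable

lemma integrable_rho:
  assumes "0 \<le> a" "a \<le> 1" shows "integrable \<nu> (\<lambda>v. rho a (x, v))"
proof (rule Bochner_Integration.integrable_bound[OF integrable_exp_norm])
  show "AE v in \<nu>. norm (rho a (x, v)) \<le> norm (exp (1 + norm v))"
    using rho_le[OF assms, of x] by (auto intro!: AE_I2 simp: rho_def)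
qed measurable

lemma cutoff_cases: "cutoff m z = 0 \<or> cutoff m z = 1 \<and> norm (snd z) \<le> m \<and> norm (snd (turn z)) \<le> m"
  by (simp add: cutoff_def)

lemma cutoff_eq_1: "norm (snd z) \<le> m - 1 \<Longrightarrow> cutoff m z = 1"
  using norm_snd_flow_le[of "angle z" z] angle_bounds(1)[of z] by (simp add: cutoff_def turn_def)

lemma integrable_drift:
  assumes "0 \<le> a" "a \<le> 1"
  shows "integrable \<nu> (\<lambda>v. cutoff m (x, v) * (exp (dl (x, v)) - rho a (x, v)))"
proof (rule nu.integrable_const_bound)
  show "AE v in \<nu>. norm (cutoff m (x, v) * (exp (dl (x, v)) - rho a (x, v))) \<le> exp (K * (m + 1) + D) + exp (1 + m)"
  proof (rule AE_I2)
    fix v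
    show "norm (cutoff m (x, v) * (exp (dl (x, v)) - rho a (x, v))) \<le> exp (K * (m + 1) + D) + exp (1 + m)"
    proof (cases "norm v \<le> m")
      case True
      have "K * (norm v + 1) \<le> K * (m + 1)" using True K_nonneg by (intro mult_left_mono) auto
      then have "exp (dl (x, v)) \<le> exp (K * (m + 1) + D)" using dl_bound[of "(x, v)"] by simp
      moreover have "rho a (x, v) \<le> exp (1 + m)" using rho_le[OF assms, of x v] True by (meson add_left_mono exp_le_cancel_iff order_trans)
      moreover have "0 < exp (dl (x, v))" "0 < rho a (x, v)" by (simp_all add: rho_def)
      ultimately have "\<bar>exp (dl (x, v)) - rho a (x, v)\<bar> \<le> exp (K * (m + 1) + D) + exp (1 + m)" by linarith
      then show ?thesis by (auto simp: cutoff_def)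
    qed (auto simp: cutoff_def add_nonneg_nonneg)
  qed
qed measurable

text \<open>By \<open>exp (dl z) \<ge> 1 + dl z\<close> and \<open>dl_sym\<close>, the mean of
  \<open>exp (dl z)\<close> is almost at least one far from the origin, while the mean of
  \<open>rho\<close> stays below one by nearly \<open>a / 256\<close>. The free bound
  \<open>M1\<close> lets the radius be enlarged later.\<close>

lemma lyapunov_drift:
  obtains a M m0 where "0 < a" "a \<le> 1" "2 \<le> M" "M1 \<le> M"
    "\<And>m x. m0 \<le> m \<Longrightarrow> M \<le> norm x \<Longrightarrow> a / 1024 \<le> (\<integral>v. cutoff m (x, v) * (exp (dl (x, v)) - rho a (x, v)) \<partial>\<nu>)"
proof -
  let ?I = "\<lambda>a v. indicator {v. 1 / (8 * a) < (norm v)\<^sup>2} v * exp (1 + a\<^sup>2 * (norm v)\<^sup>2) :: real"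
  obtain a where a: "0 < a" "a \<le> 1" and Iint: "integrable \<nu> (?I a)" and Ile: "(\<integral>v. ?I a v \<partial>\<nu>) \<le> a / 1024"
    using small_parameter by blast
  let ?f = "\<lambda>v. 1 + (K * (norm v + 1) + D)"
  have f: "integrable \<nu> ?f" "\<And>v. 0 \<le> ?f v"
    using integrable_norm K_nonneg D_nonneg by (auto intro!: add_nonneg_nonneg)
  obtain m1 where m1: "\<And>m. m1 \<le> m \<Longrightarrow> (\<integral>x. indicator {x. m < norm x} x * \<bar>?f x\<bar> \<partial>\<nu>) \<le> a / 4096"
    using exists_small_tail[OF sets_nu f(1), of "a / 4096"] a by auto
  define C where "C = (\<integral>v. \<Phi>\<^sub>1 0 + D + L * (norm v)\<^sup>2 \<partial>\<nu>)"
  have Cint: "integrable \<nu> (\<lambda>v. \<Phi>\<^sub>1 0 + D + L * (norm v)\<^sup>2)" using integrable_norm_sq by simp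
  have C: "0 \<le> C" unfolding C_def using Phi1_ge[of 0] L_nonneg by (intro integral_nonneg_AE AE_I2) auto
  \<comment> \<open>The entry \<open>1 / (2 * a)\<close> meets the hypothesis of
    \<open>rho_sym\<close>; the entry with \<open>C\<close> makes the loss in \<open>dl_sym\<close>,
    which is of order \<open>C / (norm x)\<^sup>2\<close>, at most \<open>a / 4096\<close>.\<close>
  define M where "M = max M1 (2 + 1 / (2 * a) + 1024 * C / a)"
  have M: "2 \<le> M" "M1 \<le> M" "1 / (2 * a) \<le> M" "1024 * C / a \<le> M"
    using a C by (auto simp: M_def intro!: max.coboundedI2 add_nonneg_nonneg)
  show ?thesis
  proof (rule that[OF a M(1,2), of "m1 + 1"])
    fix m :: real and x :: 'a
    assume m: "m1 + 1 \<le> m" and x: "M \<le> norm x"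
    have x2: "2 \<le> norm x" "x \<noteq> 0" using x M by auto
    have "norm x \<le> (norm x)\<^sup>2" using x2 by (simp add: power2_eq_square)
    then have xsq: "1 / (2 * a) \<le> (norm x)\<^sup>2" "1024 * C / a \<le> (norm x)\<^sup>2" using M x by linarith+
    let ?d = "\<lambda>v. dl (x, v)" and ?r = "\<lambda>v. rho a (x, v)"
    have dI: "integrable \<nu> ?d" by (rule integrable_dl)
    have rI: "integrable \<nu> ?r" using a by (intro integrable_rho) auto
    have dm: "(\<integral>v. ?d (- v) \<partial>\<nu>) = (\<integral>v. ?d v \<partial>\<nu>)" "integrable \<nu> (\<lambda>v. ?d (- v))"
      using nu_minus[of ?d] dI by auto
    have rm: "(\<integral>v. ?r (- v) \<partial>\<nu>) = (\<integral>v. ?r v \<partial>\<nu>)" "integrable \<nu> (\<lambda>v. ?r (- v))"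
      using nu_minus[of ?r] rI by auto
    have "- (C / (2 * (norm x)\<^sup>2)) = (\<integral>v. (- 1 / (2 * (norm x)\<^sup>2)) * (\<Phi>\<^sub>1 0 + D + L * (norm v)\<^sup>2) \<partial>\<nu>)"
      unfolding C_def integral_mult_right_zero by simp
    also have "\<dots> \<le> (\<integral>v. ?d v + ?d (- v) \<partial>\<nu>)"
    proof (rule integral_mono)
      show "(- 1 / (2 * (norm x)\<^sup>2)) * (\<Phi>\<^sub>1 0 + D + L * (norm v)\<^sup>2) \<le> ?d v + ?d (- v)" for v
        using dl_sym[OF x2(2), of v] by (simp only: times_divide_eq_left mult_minus_left mult_1_left)
    qed (use Cint dI dm in auto)
    also have "\<dots> = 2 * (\<integral>v. ?d v \<partial>\<nu>)" using dI dm by simp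
    finally have i1: "- (a / 4096) \<le> (\<integral>v. ?d v \<partial>\<nu>)"
    proof -
      assume h: "- (C / (2 * (norm x)\<^sup>2)) \<le> 2 * (\<integral>v. ?d v \<partial>\<nu>)"
      have "C \<le> a / 1024 * (norm x)\<^sup>2" using xsq(2) a by (simp add: field_simps)
      then have "C / (2 * (norm x)\<^sup>2) \<le> a / 2048" using x2 by (simp add: field_simps)
      then show ?thesis using h by simp
    qed
    have "(\<integral>v. ?r v \<partial>\<nu>) = (\<integral>v. (?r v + ?r (- v)) / 2 \<partial>\<nu>)" using rI rm by simp
    also have "\<dots> \<le> (\<integral>v. 1 - a / 256 + ?I a v \<partial>\<nu>)"
      using rI rm Iint rho_sym[OF a x2(1) xsq(1)] by (intro integral_mono) auto
    also have "\<dots> = 1 - a / 256 + (\<integral>v. ?I a v \<partial>\<nu>)" using Iint by simp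
    finally have i2: "(\<integral>v. ?r v \<partial>\<nu>) \<le> 1 - a / 256 + a / 1024" using Ile by linarith
    let ?T = "\<lambda>v. indicator {v. m - 1 < norm v} v * \<bar>?f v\<bar>"
    have [measurable]: "{v::'a. m - 1 < norm v} \<in> sets borel" by measurable
    have TI: "integrable \<nu> ?T" using f(1) by (intro integrable_mult_indicator[where 'b=real, simplified] integrable_abs) auto
    have i3: "(\<integral>v. ?T v \<partial>\<nu>) \<le> a / 4096" using m by (intro m1) auto
    have "1 + (\<integral>v. ?d v \<partial>\<nu>) - (\<integral>v. ?T v \<partial>\<nu>) - (\<integral>v. ?r v \<partial>\<nu>) = (\<integral>v. 1 + ?d v - ?T v - ?r v \<partial>\<nu>)"
      using dI rI TI by simp
    also have "\<dots> \<le> (\<integral>v. cutoff m (x, v) * (exp (?d v) - ?r v) \<partial>\<nu>)"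
    proof (rule integral_mono)
      show "integrable \<nu> (\<lambda>v. 1 + ?d v - ?T v - ?r v)" using dI rI TI by simp
      show "integrable \<nu> (\<lambda>v. cutoff m (x, v) * (exp (?d v) - ?r v))" using a by (intro integrable_drift) auto
      fix v
      have r0: "0 < ?r v" by (simp add: rho_def)
      have T0: "0 \<le> ?T v" by simp
      \<comment> \<open>Where the cutoff vanishes, \<open>m - 1 < norm v\<close>, and there
        \<open>?T v\<close> dominates \<open>1 + ?d v\<close>: removing these velocities costs no
        more than a small tail.\<close>
      show "1 + ?d v - ?T v - ?r v \<le> cutoff m (x, v) * (exp (?d v) - ?r v)"
      proof (cases "cutoff m (x, v) = 1")
        case True
        show ?thesis unfolding True mult_1_left using exp_ge_add_one_self[of "?d v"] T0 by linarith
      next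
        case False
        then have "cutoff m (x, v) = 0" using cutoff_cases[of m "(x, v)"] by blast
        moreover have "m - 1 < norm v" using False cutoff_eq_1[of "(x, v)" m] by (cases "norm v \<le> m - 1") auto
        ultimately show ?thesis using dl_bound[of "(x, v)"] r0 f(2)[of v] by simp
      qed
    qed
    finally have "1 + (\<integral>v. ?d v \<partial>\<nu>) - (\<integral>v. ?T v \<partial>\<nu>) - (\<integral>v. ?r v \<partial>\<nu>) \<le> (\<integral>v. cutoff m (x, v) * (exp (?d v) - ?r v) \<partial>\<nu>)" .
    \<comment> \<open>Balance: \<open>a / 256\<close> is gained, \<open>a / 1024\<close> and twice
      \<open>a / 4096\<close> are lost.\<close>
    then show "a / 1024 \<le> (\<integral>v. cutoff m (x, v) * (exp (?d v) - ?r v) \<partial>\<nu>)"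
      using i1 i2 i3 a by linarith
  qed
qed

section \<open>From the drift to an energy bound\<close>

lemma distr_turn_back: "distr \<gamma> borel turn_back = \<gamma>"
proof (rule measure_eqI)
  fix A assume "A \<in> sets (distr \<gamma> borel turn_back)"
  then have [measurable]: "A \<in> sets borel" by simp
  have "emeasure (distr \<gamma> borel turn_back) A = (\<integral>\<^sup>+z. indicator A z \<partial>distr \<gamma> borel turn_back)" by simp
  also have "\<dots> = (\<integral>\<^sup>+z. indicator A (turn_back z) \<partial>\<gamma>)" by (rule nn_integral_distr) measurable
  also have "\<dots> = (\<integral>\<^sup>+z. indicator A z \<partial>\<gamma>)" by (rule gamma_turn_back) measurable
  also have "\<dots> = emeasure \<gamma> A" by (rule nn_integral_indicator) (unfold sets_gamma, measurable)
  finally show "emeasure (distr \<gamma> borel turn_back) A = emeasure \<gamma> A" .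
qed (simp only: sets_distr sets_gamma)

text \<open>The product of the first exponential with \<open>exp (dl z)\<close> is the geometric
  mean of \<open>exp (- \<Phi>\<^sub>1)\<close> at the two positions, hence the same from either end
  of the arc.\<close>

definition jump_energy :: "real \<Rightarrow> ('a \<Rightarrow> real) \<Rightarrow> 'a \<times> 'a \<Rightarrow> real" where
  "jump_energy m g z = cutoff m z * exp (- \<Phi>\<^sub>1 (fst z)) * exp (dl z) * (g (fst z) - g (fst (turn z)))\<^sup>2"

text \<open>The integrand is added to its image under \<open>turn_back\<close>. Since
  \<open>rho\<close> takes inverse values at the two ends, the square roots \<open>p\<close>,
  \<open>q\<close> of \<open>exp (- \<Phi>\<^sub>1) * rho\<close> multiply to the symmetric weight,
  and the claim becomes the pointwise fact
  \<open>(g x * p - g y * q)\<^sup>2 \<ge> 0\<close>.\<close>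

lemma lyapunov:
  assumes [measurable]: "g \<in> borel_measurable borel" and B: "\<And>x. \<bar>g x\<bar> \<le> B" and a: "0 \<le> a" "a \<le> 1"
  shows "2 * (\<integral>x. (g x)\<^sup>2 * exp (- \<Phi>\<^sub>1 x) * (\<integral>v. cutoff m (x, v) * (exp (dl (x, v)) - rho a (x, v)) \<partial>\<nu>) \<partial>\<nu>)
    \<le> (\<integral>z. jump_energy m g z \<partial>\<gamma>)" and "integrable \<gamma> (jump_energy m g)"
proof -
  let ?F = "\<lambda>z. cutoff m z * (exp (dl z) - rho a z)"
  let ?A = "\<lambda>z. (g (fst z))\<^sup>2 * exp (- \<Phi>\<^sub>1 (fst z)) * ?F z"
  have [measurable]: "?A \<in> borel_measurable borel" by measurable
  have B2: "(g x)\<^sup>2 \<le> B\<^sup>2" for x using B[of x] by (metis abs_ge_zero power2_abs power_mono)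
  have P: "exp (- \<Phi>\<^sub>1 x) \<le> exp D" for x using Phi1_ge[of x] by simp
  have dle: "exp (dl z) \<le> exp (K * (m + 1) + D)" and rle: "rho a z \<le> exp (1 + m)" if "norm (snd z) \<le> m" for z
  proof -
    have "K * (norm (snd z) + 1) \<le> K * (m + 1)" using that K_nonneg by (intro mult_left_mono) auto
    then show "exp (dl z) \<le> exp (K * (m + 1) + D)" using dl_bound[of z] by simp
    show "rho a z \<le> exp (1 + m)" using rho_le[OF a, of "fst z" "snd z"] that by (simp, meson add_left_mono exp_le_cancel_iff order_trans)
  qed
  have F: "\<bar>?F z\<bar> \<le> exp (K * (m + 1) + D) + exp (1 + m)" for z
  proof (cases "norm (snd z) \<le> m")
    case True
    have "0 < rho a z" by (simp add: rho_def)
    then have "\<bar>exp (dl z) - rho a z\<bar> \<le> exp (K * (m + 1) + D) + exp (1 + m)"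
      using dle[OF True] rle[OF True] exp_gt_zero[of "dl z"] by linarith
    then show ?thesis by (auto simp: cutoff_def)
  qed (auto simp: cutoff_def add_nonneg_nonneg)
  have Aint: "integrable \<gamma> ?A"
  proof (rule gamma.P.integrable_const_bound)
    show "AE z in \<gamma>. norm (?A z) \<le> B\<^sup>2 * exp D * (exp (K * (m + 1) + D) + exp (1 + m))"
    proof (rule AE_I2)
      fix z
      have "norm (?A z) = (g (fst z))\<^sup>2 * exp (- \<Phi>\<^sub>1 (fst z)) * \<bar>?F z\<bar>" by (simp add: abs_mult)
      also have "\<dots> \<le> B\<^sup>2 * exp D * (exp (K * (m + 1) + D) + exp (1 + m))"
        by (intro mult_mono B2 P F) auto
      finally show "norm (?A z) \<le> B\<^sup>2 * exp D * (exp (K * (m + 1) + D) + exp (1 + m))" .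
    qed
  qed measurable
  show Jint: "integrable \<gamma> (jump_energy m g)"
  proof (rule gamma.P.integrable_const_bound)
    show "AE z in \<gamma>. norm (jump_energy m g z) \<le> 1 * exp D * exp (K * (m + 1) + D) * (2 * B)\<^sup>2"
    proof (rule AE_I2)
      fix z
      have "\<bar>g (fst z) - g (fst (turn z))\<bar> \<le> 2 * B" using B[of "fst z"] B[of "fst (turn z)"] by linarith
      then have "(g (fst z) - g (fst (turn z)))\<^sup>2 \<le> (2 * B)\<^sup>2" by (metis abs_ge_zero power2_abs power_mono)
      then have "norm (jump_energy m g z) \<le> 1 * exp D * exp (K * (m + 1) + D) * (2 * B)\<^sup>2" if c: "cutoff m z = 1"
      proof -
        assume g: "(g (fst z) - g (fst (turn z)))\<^sup>2 \<le> (2 * B)\<^sup>2"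
        have "norm (jump_energy m g z) = 1 * exp (- \<Phi>\<^sub>1 (fst z)) * exp (dl z) * (g (fst z) - g (fst (turn z)))\<^sup>2"
          by (simp add: jump_energy_def c)
        also have "\<dots> \<le> 1 * exp D * exp (K * (m + 1) + D) * (2 * B)\<^sup>2"
          using c cutoff_cases[of m z] by (intro mult_mono g P dle) auto
        finally show ?thesis .
      qed
      then show "norm (jump_energy m g z) \<le> 1 * exp D * exp (K * (m + 1) + D) * (2 * B)\<^sup>2"
        using cutoff_cases[of m z] by (auto simp: jump_energy_def)
    qed
  qed (unfold jump_energy_def, measurable)
  have pt: "?A z + ?A (turn_back z) \<le> jump_energy m g z" for z
  proof -
    let ?x = "fst z" and ?y = "fst (turn z)"
    let ?l = "a / 2 * ((norm ?y)\<^sup>2 - (norm ?x)\<^sup>2)"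
    let ?p = "exp ((?l - \<Phi>\<^sub>1 ?x) / 2)" and ?q = "exp ((- ?l - \<Phi>\<^sub>1 ?y) / 2)" and ?w = "exp (- (\<Phi>\<^sub>1 ?x + \<Phi>\<^sub>1 ?y) / 2)"
    have c: "cutoff m (turn_back z) = cutoff m z"
      by (auto simp: cutoff_def norm_snd_turn_turn_back)
    have 1: "exp (- \<Phi>\<^sub>1 ?x) * exp (dl z) = ?w" "exp (- \<Phi>\<^sub>1 ?y) * exp (dl (turn_back z)) = ?w"
      by (simp_all add: dl_def fst_turn_turn_back diff_divide_distrib add_divide_distrib flip: exp_add)
    have 2: "exp (- \<Phi>\<^sub>1 ?x) * rho a z = ?p * ?p" "exp (- \<Phi>\<^sub>1 ?y) * rho a (turn_back z) = ?q * ?q"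
      by (simp_all add: rho_def fst_turn_turn_back field_simps flip: exp_add)
    have 3: "?p * ?q = ?w" by (simp add: field_simps flip: exp_add)
    have "?A z + ?A (turn_back z) = cutoff m z * ((g ?x)\<^sup>2 * (?w - ?p * ?p) + (g ?y)\<^sup>2 * (?w - ?q * ?q))"
    proof -
      have "?A z = cutoff m z * ((g ?x)\<^sup>2 * (?w - ?p * ?p))"
        unfolding 1(1)[symmetric] 2(1)[symmetric] by (simp add: algebra_simps)
      moreover have "?A (turn_back z) = cutoff m z * ((g ?y)\<^sup>2 * (?w - ?q * ?q))"
        unfolding 1(2)[symmetric] 2(2)[symmetric] by (simp add: c algebra_simps)
      ultimately show ?thesis by (simp only: distrib_left)
    qed
    also have "\<dots> \<le> cutoff m z * (?w * (g ?x - g ?y)\<^sup>2)"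
    proof (rule mult_left_mono)
      have "0 \<le> (g ?x * ?p - g ?y * ?q)\<^sup>2" by simp
      also have "\<dots> = (g ?x)\<^sup>2 * (?p * ?p) + (g ?y)\<^sup>2 * (?q * ?q) - 2 * (g ?x * g ?y) * (?p * ?q)"
        by (simp add: power2_eq_square algebra_simps)
      finally have "2 * (g ?x * g ?y) * ?w \<le> (g ?x)\<^sup>2 * (?p * ?p) + (g ?y)\<^sup>2 * (?q * ?q)" unfolding 3 by simp
      then show "(g ?x)\<^sup>2 * (?w - ?p * ?p) + (g ?y)\<^sup>2 * (?w - ?q * ?q) \<le> ?w * (g ?x - g ?y)\<^sup>2"
        by (simp add: power2_eq_square algebra_simps)
    qed (simp add: cutoff_def)
    finally show ?thesis unfolding jump_energy_def 1(1)[symmetric] by (simp add: mult.assoc)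
  qed
  have "(\<integral>z. ?A (turn_back z) \<partial>\<gamma>) = (\<integral>z. ?A z \<partial>\<gamma>)" "integrable \<gamma> (\<lambda>z. ?A (turn_back z))"
    using integral_distr[of turn_back \<gamma> borel ?A] integrable_distr_eq[of turn_back \<gamma> borel ?A] Aint
    by (simp_all add: distr_turn_back)
  then have "2 * (\<integral>z. ?A z \<partial>\<gamma>) = (\<integral>z. ?A z + ?A (turn_back z) \<partial>\<gamma>)"
    using Aint by (subst Bochner_Integration.integral_add) auto
  also have "\<dots> \<le> (\<integral>z. jump_energy m g z \<partial>\<gamma>)"
    using Aint Jint \<open>integrable \<gamma> (\<lambda>z. ?A (turn_back z))\<close> by (intro integral_mono pt) auto
  also have "(\<integral>z. ?A z \<partial>\<gamma>) = (\<integral>x. (g x)\<^sup>2 * exp (- \<Phi>\<^sub>1 x) * (\<integral>v. cutoff m (x, v) * (exp (dl (x, v)) - rho a (x, v)) \<partial>\<nu>) \<partial>\<nu>)"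
  proof -
    have "(\<integral>x. \<integral>v. ?A (x, v) \<partial>\<nu> \<partial>\<nu>) = (\<integral>z. ?A z \<partial>\<gamma>)"
      using gamma.integral_fst'[of ?A] Aint by simp
    then show ?thesis by simp
  qed
  finally show "2 * (\<integral>x. (g x)\<^sup>2 * exp (- \<Phi>\<^sub>1 x) * (\<integral>v. cutoff m (x, v) * (exp (dl (x, v)) - rho a (x, v)) \<partial>\<nu>) \<partial>\<nu>)
    \<le> (\<integral>z. jump_energy m g z \<partial>\<gamma>)" .
qed


section \<open>Variance inside a ball\<close>

lemma gamma_integral_bounded:
  fixes f :: "'a \<times> 'a \<Rightarrow> real"
  assumes [measurable]: "f \<in> borel_measurable borel" and "\<And>z. \<bar>f z\<bar> \<le> B"
  shows "integrable \<gamma> f"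
  by (rule gamma.P.integrable_const_bound[of _ B]) (use assms in auto)

lemma nu_integral_bounded:
  fixes f :: "'a \<Rightarrow> real"
  assumes [measurable]: "f \<in> borel_measurable borel" and "\<And>z. \<bar>f z\<bar> \<le> B"
  shows "integrable \<nu> f"
  by (rule nu.integrable_const_bound[of _ B]) (use assms in auto)

lemma diff_power2_bound: "\<bar>x\<bar> \<le> B \<Longrightarrow> \<bar>y\<bar> \<le> B \<Longrightarrow> (x - y)\<^sup>2 \<le> (2 * B)\<^sup>2" for x y B :: real
proof -
  assume "\<bar>x\<bar> \<le> B" "\<bar>y\<bar> \<le> B"
  then have "\<bar>x - y\<bar> \<le> 2 * B" by linarith
  then show ?thesis by (metis abs_ge_zero power2_abs power_mono)
qed

lemma ball_measurable [measurable]: "{z::'a \<times> 'a. norm z < M} \<in> sets borel"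
  by (intro borel_open open_Collect_less continuous_intros)+

text \<open>Rotating \<open>z = (x, y)\<close> by a quarter turn carries \<open>x\<close> to \<open>y\<close>; the shell of \<open>z\<close> does this in \<open>2 * (shell z + 1)\<close> turns.\<close>

lemma core_energy:
  fixes g :: "'a \<Rightarrow> real" and M B :: real
  assumes [measurable]: "g \<in> borel_measurable borel" and B: "\<And>x. \<bar>g x\<bar> \<le> B"
  defines "N \<equiv> 2 * (nat \<lceil>2 * M\<rceil> + 1)"
  shows "(\<integral>z. indicator {x. norm x < M} (fst z) * indicator {x. norm x < M} (snd z) * (g (fst z) - g (snd z))\<^sup>2 \<partial>\<gamma>)
    \<le> (real N)\<^sup>2 * (\<integral>z. indicator {z. norm z < 2 * M} z * (g (fst z) - g (fst (turn z)))\<^sup>2 \<partial>\<gamma>)"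
proof -
  define d where "d z = indicator {z. norm z < 2 * M} z * (g (fst z) - g (fst (turn z)))\<^sup>2" for z
  let ?P = "\<lambda>z. indicator {x. norm x < M} (fst z) * indicator {x. norm x < M} (snd z) * (g (fst z) - g (snd z))\<^sup>2 :: real"
  have [measurable]: "d \<in> borel_measurable borel" unfolding d_def by measurable
  have d0: "0 \<le> d z" for z by (simp add: d_def)
  have dint: "integrable \<gamma> d"
    using B diff_power2_bound by (intro gamma_integral_bounded[where B="(2 * B)\<^sup>2"]) (auto simp: d_def indicator_def)
  have Pint: "integrable \<gamma> ?P"
    using B diff_power2_bound by (intro gamma_integral_bounded[where B="(2 * B)\<^sup>2"]) (auto simp: indicator_def)
  have pt: "?P z \<le> real N * (\<Sum>j<N. d (boomerang_flow (real j * angle z) z))" for z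
  proof (cases "norm (fst z) < M \<and> norm (snd z) < M")
    case True
    obtain x y where z: "z = (x, y)" by (cases z)
    have nz: "norm z < 2 * M" using True norm_Pair_le[of x y] by (simp add: z)
    define k where "k = 2 * (shell z + 1)"
    \<comment> \<open>\<open>N\<close> is the number of turns for shell number
      \<open>nat \<lceil>2 * M\<rceil>\<close>, an upper bound for the shells in question; padding
      the sum to \<open>N\<close> terms frees it from \<open>z\<close>.\<close>
    have "real (shell z) < 2 * M" using shell_le_norm[of z] nz by linarith
    then have "int (shell z) \<le> \<lceil>2 * M\<rceil>" by linarith
    then have kN: "k \<le> N" unfolding k_def N_def by simp
    have ka: "real k * angle z = pi / 2" by (simp add: k_def angle_def field_simps)
    define h where "h j = g (fst (boomerang_flow (real j * angle z) z))" for j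
    have h0: "h 0 = g x" by (simp add: h_def z boomerang_flow_0)
    have hk: "h k = g y" unfolding h_def ka by (simp add: z boomerang_flow_def)
    have dh: "(h j - h (Suc j))\<^sup>2 = d (boomerang_flow (real j * angle z) z)" for j
    proof -
      have "turn (boomerang_flow (real j * angle z) z) = boomerang_flow (real (Suc j) * angle z) z"
        by (simp add: turn_def distrib_right add.commute flip: boomerang_flow_add)
      then show ?thesis using nz by (simp add: d_def h_def)
    qed
    have "g x - g y = (\<Sum>j<k. h j - h (Suc j))"
      using sum_lessThan_telescope'[of h k] by (simp add: h0 hk)
    \<comment> \<open>Cauchy-Schwarz over the \<open>k\<close> turns of the quarter turn.\<close>
    then have "(g x - g y)\<^sup>2 \<le> real k * (\<Sum>j<k. (h j - h (Suc j))\<^sup>2)"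
      using sum_squared_le_sum_of_squares[of "\<lambda>j. h j - h (Suc j)" "{..<k}"] by (simp add: mult.commute)
    also have "\<dots> \<le> real N * (\<Sum>j<N. d (boomerang_flow (real j * angle z) z))"
      unfolding dh using kN by (intro mult_mono sum_mono2) (auto simp: d0 intro!: sum_nonneg)
    finally show ?thesis using True by (simp add: z)
  qed (auto simp: indicator_def intro!: mult_nonneg_nonneg sum_nonneg d0)
  have flow: "(\<integral>z. d (boomerang_flow (real j * angle z) z) \<partial>\<gamma>) = (\<integral>z. d z \<partial>\<gamma>)"
    "integrable \<gamma> (\<lambda>z. d (boomerang_flow (real j * angle z) z))" for j
  proof -
    have nn: "(\<integral>\<^sup>+z. ennreal (d (boomerang_flow (real j * angle z) z)) \<partial>\<gamma>) = (\<integral>\<^sup>+z. ennreal (d z) \<partial>\<gamma>)"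
      using gamma_shell_flow[of "\<lambda>z. ennreal (d z)" "\<lambda>k. real j * (pi / 4 / (real k + 1))"] by (simp add: angle_def)
    show i: "integrable \<gamma> (\<lambda>z. d (boomerang_flow (real j * angle z) z))"
      using dint nn by (intro integrableI_nonneg) (auto simp: d0 integrable_iff_bounded)
    show "(\<integral>z. d (boomerang_flow (real j * angle z) z) \<partial>\<gamma>) = (\<integral>z. d z \<partial>\<gamma>)"
      using nn nn_integral_eq_integral[OF i] nn_integral_eq_integral[OF dint] d0
      by (simp add: integral_nonneg_AE)
  qed
  have "(\<integral>z. ?P z \<partial>\<gamma>) \<le> (\<integral>z. real N * (\<Sum>j<N. d (boomerang_flow (real j * angle z) z)) \<partial>\<gamma>)"
    using Pint flow(2) by (intro integral_mono pt) auto
  also have "\<dots> = real N * (\<Sum>j<N. \<integral>z. d z \<partial>\<gamma>)"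
    using flow by simp
  also have "\<dots> = (real N)\<^sup>2 * (\<integral>z. d z \<partial>\<gamma>)" by (simp add: power2_eq_square)
  finally show ?thesis unfolding d_def .
qed

text \<open>\<open>c\<close> is the mean of \<open>g\<close> over the ball; expanding the square
  around it shows that averaging \<open>(g x - g y)\<^sup>2\<close> over \<open>y\<close> can only
  exceed \<open>(g x - c)\<^sup>2\<close>.\<close>

lemma ball_mean:
  assumes [measurable]: "g \<in> borel_measurable borel" and B: "\<And>x. \<bar>g x\<bar> \<le> B" and p: "0 < measure \<nu> {x. norm x < M}"
  obtains c where "measure \<nu> {x. norm x < M} * (\<integral>x. indicator {x. norm x < M} x * (g x - c)\<^sup>2 \<partial>\<nu>)
    \<le> (\<integral>z. indicator {x. norm x < M} (fst z) * indicator {x. norm x < M} (snd z) * (g (fst z) - g (snd z))\<^sup>2 \<partial>\<gamma>)"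
    "\<bar>c\<bar> \<le> B"
proof -
  let ?p = "measure \<nu> {x. norm x < M}"
  let ?i = "\<lambda>x. indicator {x::'a. norm x < M} x :: real"
  define c where "c = (\<integral>y. ?i y * g y \<partial>\<nu>) / ?p"
  have ii: "integrable \<nu> ?i" "(\<integral>y. ?i y \<partial>\<nu>) = ?p"
    by (auto intro!: nu_integral_bounded[where B=1] simp: indicator_def)[1] simp
  have ig: "integrable \<nu> (\<lambda>y. ?i y * g y)"
    using B by (intro nu_integral_bounded[where B=B]) (auto simp: indicator_def intro: order_trans[OF abs_ge_zero])
  have "\<bar>\<integral>y. ?i y * g y \<partial>\<nu>\<bar> \<le> (\<integral>y. B * ?i y \<partial>\<nu>)"
    using B ii ig by (intro order_trans[OF integral_abs_bound] integral_mono) (auto simp: indicator_def)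
  then have cB: "\<bar>c\<bar> \<le> B" using p ii by (simp add: c_def field_simps)
  have Bp: "0 \<le> B" using B[of 0] by linarith
  have pt: "?p * (g x - c)\<^sup>2 \<le> (\<integral>y. ?i y * (g x - g y)\<^sup>2 \<partial>\<nu>)" for x
  proof -
    let ?m = "g x - c"
    have isq: "integrable \<nu> (\<lambda>y. ?i y * (g x - g y)\<^sup>2)"
      using B diff_power2_bound by (intro nu_integral_bounded[where B="(2 * B)\<^sup>2"]) (auto simp: indicator_def)
    have "(\<integral>y. ?i y * (g x - g y) \<partial>\<nu>) = (\<integral>y. g x * ?i y - ?i y * g y \<partial>\<nu>)" by (simp add: algebra_simps)
    also have "\<dots> = ?p * ?m" using ii ig p by (simp add: c_def field_simps)
    finally have m: "(\<integral>y. ?i y * (g x - g y) \<partial>\<nu>) = ?p * ?m" .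
    have idf: "integrable \<nu> (\<lambda>y. ?i y * (g x - g y))"
      using ii ig by (simp add: right_diff_distrib)
    have sq: "i * (u - m)\<^sup>2 = i * u\<^sup>2 - 2 * m * (i * u) + m\<^sup>2 * i" for i u m :: real
      by (simp add: power2_eq_square algebra_simps)
    have "0 \<le> (\<integral>y. ?i y * ((g x - g y) - ?m)\<^sup>2 \<partial>\<nu>)" by (intro integral_nonneg_AE) auto
    also have "\<dots> = (\<integral>y. ?i y * (g x - g y)\<^sup>2 - 2 * ?m * (?i y * (g x - g y)) + ?m\<^sup>2 * ?i y \<partial>\<nu>)"
      by (rule Bochner_Integration.integral_cong[OF HOL.refl]) (rule sq)
    also have "\<dots> = (\<integral>y. ?i y * (g x - g y)\<^sup>2 \<partial>\<nu>) - 2 * ?m * (?p * ?m) + ?m\<^sup>2 * ?p"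
      using isq idf ii by (simp add: m)
    finally show ?thesis by (simp add: power2_eq_square algebra_simps)
  qed
  let ?P = "\<lambda>z. ?i (fst z) * ?i (snd z) * (g (fst z) - g (snd z))\<^sup>2"
  have Pint: "integrable \<gamma> ?P"
    using B diff_power2_bound by (intro gamma_integral_bounded[where B="(2 * B)\<^sup>2"]) (auto simp: indicator_def)
  have "?p * (\<integral>x. ?i x * (g x - c)\<^sup>2 \<partial>\<nu>) = (\<integral>x. ?i x * (?p * (g x - c)\<^sup>2) \<partial>\<nu>)"
    unfolding integral_mult_right_zero[symmetric] by (rule Bochner_Integration.integral_cong[OF HOL.refl]) simp
  also have "\<dots> \<le> (\<integral>x. \<integral>v. ?P (x, v) \<partial>\<nu> \<partial>\<nu>)"
  proof (rule integral_mono)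
    have "\<bar>?i x * (?p * (g x - c)\<^sup>2)\<bar> \<le> 1 * (?p * (2 * B)\<^sup>2)" for x
      using diff_power2_bound[OF B cB, of x] p by (auto simp: indicator_def abs_mult)
    then show "integrable \<nu> (\<lambda>x. ?i x * (?p * (g x - c)\<^sup>2))"
      by (intro nu_integral_bounded[where B="1 * (?p * (2 * B)\<^sup>2)"]) auto
    show "integrable \<nu> (\<lambda>x. \<integral>v. ?P (x, v) \<partial>\<nu>)" using gamma.integrable_fst'[of ?P] Pint by simp
    show "?i x * (?p * (g x - c)\<^sup>2) \<le> (\<integral>v. ?P (x, v) \<partial>\<nu>)" for x
      using pt[of x] by (simp add: indicator_def)
  qed
  also have "\<dots> = (\<integral>z. ?P z \<partial>\<gamma>)" using gamma.integral_fst'[of ?P] Pint by simp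
  finally show ?thesis using cB by (intro that)
qed

text \<open>In contrast to \<open>jump_energy\<close>, it carries the weight of
  \<open>\<Phi>\<close> itself and restricts the initial velocity only, the form in which the
  dissipation of the semigroup bounds it.\<close>

definition turn_energy :: "real \<Rightarrow> ('a \<Rightarrow> real) \<Rightarrow> 'a \<times> 'a \<Rightarrow> real" where
  "turn_energy m g z = of_bool (norm (snd z) \<le> m) * (g (fst z) - g (fst (turn z)))\<^sup>2 * exp (- \<Phi> (fst z))"

lemma turn_energy_measurable [measurable]: "g \<in> borel_measurable borel \<Longrightarrow> turn_energy m g \<in> borel_measurable borel"
proof -
  assume [measurable]: "g \<in> borel_measurable borel"
  have "(\<lambda>z::'a \<times> 'a. \<Phi> (fst z)) \<in> borel_measurable borel" "(\<lambda>z::'a \<times> 'a. g (fst z) - g (fst (turn z))) \<in> borel_measurable borel"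
    "(\<lambda>z::'a \<times> 'a. norm (snd z)) \<in> borel_measurable borel"
    by measurable
  note [measurable] = this
  have "(\<lambda>z. of_bool (norm (snd z) \<le> m) * (g (fst z) - g (fst (turn z)))\<^sup>2 * exp (- \<Phi> (fst z))) \<in> borel_measurable borel"
    by measurable
  then show "turn_energy m g \<in> borel_measurable borel" by (simp add: turn_energy_def[abs_def])
qed

lemma turn_energy_integrable:
  assumes [measurable]: "g \<in> borel_measurable borel" and B: "\<And>x. \<bar>g x\<bar> \<le> B"
  shows "integrable \<gamma> (turn_energy m g)"
proof (rule gamma_integral_bounded)
  fix z
  have "\<bar>turn_energy m g z\<bar> = of_bool (norm (snd z) \<le> m) * (g (fst z) - g (fst (turn z)))\<^sup>2 * exp (- \<Phi> (fst z))"
    by (simp add: turn_energy_def)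
  also have "\<dots> \<le> 1 * (2 * B)\<^sup>2 * 1"
    using Phi_nonneg by (intro mult_mono diff_power2_bound B) auto
  finally show "\<bar>turn_energy m g z\<bar> \<le> 1 * (2 * B)\<^sup>2 * 1" .
qed measurable

text \<open>Outside the ball the drift bounds the weighted square of \<open>g - c\<close> by the
  energy plus a multiple \<open>b\<close> of the same quantity inside, where the drift has no sign.
  Inside, \<open>core_energy\<close> and \<open>ball_mean\<close> bound it, with \<open>c\<close>
  the mean over the ball: any constant will do for bounding a variance from above.\<close>

theorem position_poincare:
  obtains C m where "0 < C" "0 \<le> m"
    "\<And>g B. g \<in> borel_measurable borel \<Longrightarrow> (\<And>x. \<bar>g x\<bar> \<le> B) \<Longrightarrow>
      \<exists>c. \<bar>c\<bar> \<le> B \<and> (\<integral>x. (g x - c)\<^sup>2 * exp (- \<Phi> x) \<partial>\<nu>) \<le> C * (\<integral>z. turn_energy m g z \<partial>\<gamma>)"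
proof -
  obtain m1 where m1: "\<And>m. m1 \<le> m \<Longrightarrow> (\<integral>x. indicator {x. m < norm x} x * \<bar>1::real\<bar> \<partial>\<nu>) \<le> 1 / 2"
    using exists_small_tail[OF sets_nu, of "\<lambda>_. 1 :: real" "1 / 2"] by auto
  obtain a M m0 where a: "0 < a" "a \<le> 1" and M: "2 \<le> M" "m1 + 1 \<le> M"
    and drift: "\<And>m x. m0 \<le> m \<Longrightarrow> M \<le> norm x \<Longrightarrow> a / 1024 \<le> (\<integral>v. cutoff m (x, v) * (exp (dl (x, v)) - rho a (x, v)) \<partial>\<nu>)"
    using lyapunov_drift[of "m1 + 1"] by blast
  let ?B = "{x::'a. norm x < M}"
  let ?p = "measure \<nu> ?B"
  have p: "1 / 2 \<le> ?p"
  proof -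
    have s: "{x::'a. m1 < norm x} \<in> sets \<nu>" by simp
    have "measure \<nu> {x. m1 < norm x} \<le> 1 / 2"
      using m1[of m1] s by simp
    moreover have "measure \<nu> (UNIV - {x. m1 < norm x}) = 1 - measure \<nu> {x. m1 < norm x}"
      using nu.prob_compl[OF s] by simp
    moreover have "measure \<nu> (UNIV - {x. m1 < norm x}) \<le> ?p"
      using M by (intro nu.finite_measure_mono) auto
    ultimately show ?thesis by linarith
  qed
  \<comment> \<open>\<open>m0\<close> is demanded by the drift; with \<open>2 * M\<close> the
    velocity restriction in \<open>turn_energy\<close> is automatic on the ball of radius
    \<open>2 * M\<close> where \<open>core_energy\<close> works.\<close>
  define m where "m = max m0 (2 * M)"
  have m: "m0 \<le> m" "2 * M \<le> m" "0 \<le> m" using M by (auto simp: m_def)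
  define N where "N = 2 * (nat \<lceil>2 * M\<rceil> + 1)"
  \<comment> \<open>The factor 2 pays for \<open>?p \<ge> 1 / 2\<close>, \<open>N\<close> comes from
    the turns, and the exponential bounds \<open>exp \<Phi>\<close> on the ball of radius
    \<open>2 * M\<close>.\<close>
  define C1 where "C1 = 2 * (real N)\<^sup>2 * exp (K * (1 + (2 * M)\<^sup>2))"
  define C2 where "C2 = exp (2 * D + K * (m + 1))"
  define b where "b = exp (1 + m)"
  define c' where "c' = a / 1024"
  \<comment> \<open>The inside contributes \<open>C1\<close>; the outside is divided by the drift
    \<open>2 * c'\<close> and by \<open>exp (- D)\<close>, the price of returning from
    \<open>\<Phi>\<^sub>1\<close> to \<open>\<Phi>\<close>.\<close>
  define C where "C = C1 + (C2 + 2 * b * exp D * C1) / (2 * c' * exp (- D))"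
  have c': "0 < c'" using a by (simp add: c'_def)
  have C1: "0 < C1" by (simp add: C1_def N_def)
  have Cpos: "0 < C" unfolding C_def using C1 c' by (intro add_pos_nonneg divide_nonneg_pos add_nonneg_nonneg mult_nonneg_nonneg mult_pos_pos) (auto simp: C2_def b_def)
  show ?thesis
  proof (rule that[OF Cpos m(3)])
    fix g :: "'a \<Rightarrow> real" and B
    assume [measurable]: "g \<in> borel_measurable borel" and B: "\<And>x. \<bar>g x\<bar> \<le> B"
    define E where "E = (\<integral>z. turn_energy m g z \<partial>\<gamma>)"
    have Eint: "integrable \<gamma> (turn_energy m g)" using B by (intro turn_energy_integrable) auto
    obtain c where c: "?p * (\<integral>x. indicator ?B x * (g x - c)\<^sup>2 \<partial>\<nu>)
        \<le> (\<integral>z. indicator ?B (fst z) * indicator ?B (snd z) * (g (fst z) - g (snd z))\<^sup>2 \<partial>\<gamma>)" "\<bar>c\<bar> \<le> B"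
      using ball_mean[of g B M] B p by auto
    define g' where "g' x = g x - c" for x
    have [measurable]: "g' \<in> borel_measurable borel" unfolding g'_def by measurable
    have B': "\<bar>g' x\<bar> \<le> 2 * B" for x using B[of x] c(2) unfolding g'_def by linarith
    have sq: "(g' x)\<^sup>2 \<le> (2 * B)\<^sup>2" for x using B'[of x] by (metis abs_ge_zero power2_abs power_mono)
    have ball: "(\<integral>x. indicator ?B x * (g' x)\<^sup>2 \<partial>\<nu>) \<le> C1 * E"
    proof -
      have 0: "0 \<le> (\<integral>x. indicator ?B x * (g' x)\<^sup>2 \<partial>\<nu>)" by (intro integral_nonneg_AE) auto
      have "(\<integral>z. indicator {z. norm z < 2 * M} z * (g (fst z) - g (fst (turn z)))\<^sup>2 \<partial>\<gamma>) \<le> (\<integral>z. exp (K * (1 + (2 * M)\<^sup>2)) * turn_energy m g z \<partial>\<gamma>)"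
      proof (rule integral_mono)
        show "integrable \<gamma> (\<lambda>z. indicator {z. norm z < 2 * M} z * (g (fst z) - g (fst (turn z)))\<^sup>2)"
          using B diff_power2_bound by (intro gamma_integral_bounded[where B="(2 * B)\<^sup>2"]) (auto simp: indicator_def)
        fix z :: "'a \<times> 'a"
        show "indicator {z. norm z < 2 * M} z * (g (fst z) - g (fst (turn z)))\<^sup>2 \<le> exp (K * (1 + (2 * M)\<^sup>2)) * turn_energy m g z"
        proof (cases "norm z < 2 * M")
          case True
          then have n: "norm (fst z) \<le> 2 * M" "norm (snd z) \<le> m" using norm_fst_le'[of z] norm_snd_le'[of z] m by auto
          have "\<Phi> (fst z) \<le> K * (1 + (2 * M)\<^sup>2)"
            using n K_nonneg by (intro order_trans[OF Phi_le] mult_left_mono add_left_mono power_mono) auto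
          then have "1 \<le> exp (K * (1 + (2 * M)\<^sup>2)) * exp (- \<Phi> (fst z))" by (simp flip: exp_add)
          from mult_right_mono[OF this, of "(g (fst z) - g (fst (turn z)))\<^sup>2"]
          show ?thesis using True n by (simp add: turn_energy_def mult_ac)
        qed (simp add: turn_energy_def)
      qed (use Eint in simp)
      also have "\<dots> = exp (K * (1 + (2 * M)\<^sup>2)) * E" by (simp add: E_def)
      finally have 1: "(real N)\<^sup>2 * (\<integral>z. indicator {z. norm z < 2 * M} z * (g (fst z) - g (fst (turn z)))\<^sup>2 \<partial>\<gamma>) \<le> (real N)\<^sup>2 * (exp (K * (1 + (2 * M)\<^sup>2)) * E)"
        by (intro mult_left_mono) auto
      have "1 / 2 * (\<integral>x. indicator ?B x * (g' x)\<^sup>2 \<partial>\<nu>) \<le> ?p * (\<integral>x. indicator ?B x * (g' x)\<^sup>2 \<partial>\<nu>)"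
        using p 0 by (intro mult_right_mono) auto
      also have "\<dots> \<le> (real N)\<^sup>2 * (exp (K * (1 + (2 * M)\<^sup>2)) * E)"
        using c(1) core_energy[of g B M] B 1 unfolding g'_def N_def by (intro order_trans[OF c(1)] order_trans[OF core_energy 1[unfolded N_def]]) auto
      finally show ?thesis by (simp add: C1_def)
    qed
    let ?W = "\<lambda>x. (g' x)\<^sup>2 * exp (- \<Phi>\<^sub>1 x)"
    let ?G = "\<lambda>x. \<integral>v. cutoff m (x, v) * (exp (dl (x, v)) - rho a (x, v)) \<partial>\<nu>"
    let ?ic = "\<lambda>x. indicator (- ?B) x :: real" and ?i = "\<lambda>x. indicator ?B x :: real"
    have P: "exp (- \<Phi>\<^sub>1 x) \<le> exp D * exp (- \<Phi> x)" "exp (- D) * exp (- \<Phi> x) \<le> exp (- \<Phi>\<^sub>1 x)" for x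
      using Phi1_near[of x] by (auto simp flip: exp_add)
    have P1: "exp (- \<Phi> x) \<le> 1" for x using Phi_nonneg[of x] by simp
    have Wle: "?W x \<le> (2 * B)\<^sup>2 * exp D" for x
      using Phi1_ge[of x] by (intro mult_mono sq) auto
    have [measurable]: "?W \<in> borel_measurable borel" by measurable
    have Gm [measurable]: "?G \<in> borel_measurable borel" by measurable
    have Gub: "\<bar>?G x\<bar> \<le> exp (K * (m + 1) + D) + exp (1 + m)" for x
    proof -
      have "\<bar>cutoff m (x, v) * (exp (dl (x, v)) - rho a (x, v))\<bar> \<le> exp (K * (m + 1) + D) + exp (1 + m)" for v
      proof (cases "norm v \<le> m")
        case True
        have "K * (norm v + 1) \<le> K * (m + 1)" using True K_nonneg by (intro mult_left_mono) auto
        then have "exp (dl (x, v)) \<le> exp (K * (m + 1) + D)" using dl_bound[of "(x, v)"] by simp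
        moreover have "rho a (x, v) \<le> exp (1 + m)"
          using rho_le[of a x v] a True by (meson add_left_mono exp_le_cancel_iff order_trans less_imp_le)
        moreover have "0 < exp (dl (x, v))" "0 < rho a (x, v)" by (simp_all add: rho_def)
        ultimately have "\<bar>exp (dl (x, v)) - rho a (x, v)\<bar> \<le> exp (K * (m + 1) + D) + exp (1 + m)" by linarith
        then show ?thesis by (auto simp: cutoff_def)
      qed (auto simp: cutoff_def add_nonneg_nonneg)
      moreover have "integrable \<nu> (\<lambda>v. cutoff m (x, v) * (exp (dl (x, v)) - rho a (x, v)))"
        using a by (intro integrable_drift) auto
      ultimately show ?thesis
        using order_trans[OF integral_abs_bound integral_mono[of \<nu> "\<lambda>v. \<bar>cutoff m (x, v) * (exp (dl (x, v)) - rho a (x, v))\<bar>" "\<lambda>_. exp (K * (m + 1) + D) + exp (1 + m)"]]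
        by simp
    qed
    have *: "- b \<le> k * (e - r)" if "0 < e" "k = 1 \<Longrightarrow> r \<le> b" "k = 0 \<or> k = 1" "0 < b" for k e r :: real
      using that by auto
    \<comment> \<open>Inside the ball only the trivial bound of \<open>rho\<close> on the cutoff
      region is available.\<close>
    have Glb: "- b \<le> ?G x" for x
    proof -
      have "(\<integral>v. - b \<partial>\<nu>) \<le> ?G x"
      proof (rule integral_mono)
        fix v
        have "0 < exp (dl (x, v))" by simp
        moreover have "cutoff m (x, v) = 1 \<Longrightarrow> rho a (x, v) \<le> b"
          using rho_le[of a x v] a cutoff_cases[of m "(x, v)"] unfolding b_def
          by (auto intro: order_trans)
        moreover have "0 < b" by (simp add: b_def)
        ultimately show "- b \<le> cutoff m (x, v) * (exp (dl (x, v)) - rho a (x, v))"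
          using cutoff_cases[of m "(x, v)"] by (intro *) auto
      qed (use a in \<open>auto intro!: integrable_drift\<close>)
      then show ?thesis by simp
    qed
    have W0: "0 \<le> ?W x" for x by simp
    have Wi: "integrable \<nu> ?W" using Wle by (intro nu_integral_bounded[where B="(2 * B)\<^sup>2 * exp D"]) auto
    have Wii: "integrable \<nu> (\<lambda>x. ?i x * ?W x)" "integrable \<nu> (\<lambda>x. ?ic x * ?W x)"
      using Wi by (auto intro!: integrable_mult_indicator[where 'b=real, simplified])
    have WG: "integrable \<nu> (\<lambda>x. ?W x * ?G x)"
    proof (rule nu_integral_bounded)
      show "\<bar>?W x * ?G x\<bar> \<le> (2 * B)\<^sup>2 * exp D * (exp (K * (m + 1) + D) + exp (1 + m))" for x
        unfolding abs_mult[of "?W x" "?G x"] using Wle[of x] Gub[of x] by (intro mult_mono) auto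
    qed measurable
    have "c' * (\<integral>x. ?ic x * ?W x \<partial>\<nu>) - b * (\<integral>x. ?i x * ?W x \<partial>\<nu>) = (\<integral>x. c' * (?ic x * ?W x) - b * (?i x * ?W x) \<partial>\<nu>)"
      using Wii by simp
    also have "\<dots> \<le> (\<integral>x. ?W x * ?G x \<partial>\<nu>)"
    proof (rule integral_mono)
      fix x
      show "c' * (?ic x * ?W x) - b * (?i x * ?W x) \<le> ?W x * ?G x"
      proof (cases "norm x < M")
        case True
        then show ?thesis using mult_left_mono[OF Glb[of x] W0[of x]] by (simp add: mult.commute)
      next
        case False
        then show ?thesis using mult_left_mono[OF drift[OF m(1), of x] W0[of x]] by (simp add: c'_def mult.commute)
      qed
    qed (use Wii WG in auto)
    finally have "2 * (c' * (\<integral>x. ?ic x * ?W x \<partial>\<nu>) - b * (\<integral>x. ?i x * ?W x \<partial>\<nu>)) \<le> (\<integral>z. jump_energy m g' z \<partial>\<gamma>)"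
      using lyapunov(1)[of g' "2 * B" a m] B' a by simp
    also have "\<dots> \<le> (\<integral>z. C2 * turn_energy m g z \<partial>\<gamma>)"
    proof (rule integral_mono)
      show "integrable \<gamma> (jump_energy m g')" using lyapunov(2)[of g' "2 * B" a m] B' a by simp
      fix z
      show "jump_energy m g' z \<le> C2 * turn_energy m g z"
      proof (cases "cutoff m z = 1")
        case True
        then have n: "norm (snd z) \<le> m" using cutoff_cases[of m z] by auto
        have "K * (norm (snd z) + 1) \<le> K * (m + 1)" using n K_nonneg by (intro mult_left_mono) auto
        then have d: "exp (dl z) \<le> exp (K * (m + 1) + D)" using dl_bound[of z] by simp
        have "exp (- \<Phi>\<^sub>1 (fst z)) * exp (dl z) \<le> (exp D * exp (- \<Phi> (fst z))) * exp (K * (m + 1) + D)"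
          using P d by (intro mult_mono) auto
        also have "\<dots> = C2 * exp (- \<Phi> (fst z))" unfolding C2_def by (simp flip: exp_add add: algebra_simps)
        finally have "exp (- \<Phi>\<^sub>1 (fst z)) * exp (dl z) * (g (fst z) - g (fst (turn z)))\<^sup>2 \<le> C2 * exp (- \<Phi> (fst z)) * (g (fst z) - g (fst (turn z)))\<^sup>2"
          by (rule mult_right_mono) simp
        then show ?thesis using True n by (simp add: jump_energy_def turn_energy_def g'_def mult_ac)
      next
        case False
        then have "cutoff m z = 0" using cutoff_cases[of m z] by blast
        then show ?thesis by (simp add: jump_energy_def turn_energy_def C2_def)
      qed
    qed (use Eint in simp)
    also have "\<dots> = C2 * E" by (simp add: E_def)
    finally have lyap: "2 * (c' * (\<integral>x. ?ic x * ?W x \<partial>\<nu>) - b * (\<integral>x. ?i x * ?W x \<partial>\<nu>)) \<le> C2 * E" .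
    let ?V = "\<lambda>x. (g' x)\<^sup>2 * exp (- \<Phi> x)"
    have V1: "?V x \<le> (2 * B)\<^sup>2 * 1" for x by (intro mult_mono sq P1) auto
    have Vi: "integrable \<nu> ?V" using V1 by (intro nu_integral_bounded[where B="(2 * B)\<^sup>2 * 1"]) auto
    have Vii: "integrable \<nu> (\<lambda>x. ?i x * ?V x)" "integrable \<nu> (\<lambda>x. ?ic x * ?V x)"
      using Vi by (auto intro!: integrable_mult_indicator[where 'b=real, simplified])
    have tail: "exp (- D) * (\<integral>x. ?ic x * ?V x \<partial>\<nu>) \<le> (\<integral>x. ?ic x * ?W x \<partial>\<nu>)"
    proof -
      have "exp (- D) * (\<integral>x. ?ic x * ?V x \<partial>\<nu>) = (\<integral>x. exp (- D) * (?ic x * ?V x) \<partial>\<nu>)" by simp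
      also have "\<dots> \<le> (\<integral>x. ?ic x * ?W x \<partial>\<nu>)"
      proof (rule integral_mono)
        show "exp (- D) * (?ic x * ?V x) \<le> ?ic x * ?W x" for x
          using mult_left_mono[OF P(2)[of x], of "?ic x * (g' x)\<^sup>2"] by (simp add: mult_ac)
      qed (use Vii Wii in auto)
      finally show ?thesis .
    qed
    have isq: "integrable \<nu> (\<lambda>x. ?i x * (g' x)\<^sup>2)"
      using sq by (intro nu_integral_bounded[where B="(2 * B)\<^sup>2"]) (auto simp: indicator_def)
    have core: "(\<integral>x. ?i x * ?W x \<partial>\<nu>) \<le> exp D * (C1 * E)"
    proof -
      have "(\<integral>x. ?i x * ?W x \<partial>\<nu>) \<le> (\<integral>x. exp D * (?i x * (g' x)\<^sup>2) \<partial>\<nu>)"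
      proof (rule integral_mono)
        show "?i x * ?W x \<le> exp D * (?i x * (g' x)\<^sup>2)" for x
          using mult_left_mono[of "exp (- \<Phi>\<^sub>1 x)" "exp D" "?i x * (g' x)\<^sup>2"] Phi1_ge[of x] by (simp add: mult_ac)
      qed (use isq Wii in auto)
      also have "\<dots> \<le> exp D * (C1 * E)" using ball by simp
      finally show ?thesis .
    qed
    have core': "(\<integral>x. ?i x * ?V x \<partial>\<nu>) \<le> C1 * E"
    proof -
      have "(\<integral>x. ?i x * ?V x \<partial>\<nu>) \<le> (\<integral>x. ?i x * (g' x)\<^sup>2 \<partial>\<nu>)"
      proof (rule integral_mono)
        show "?i x * ?V x \<le> ?i x * (g' x)\<^sup>2" for x
          using mult_left_mono[OF P1[of x], of "?i x * (g' x)\<^sup>2"] by (simp add: mult_ac)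
      qed (use isq Vii in auto)
      then show ?thesis using ball by simp
    qed
    have "2 * c' * exp (- D) * (\<integral>x. ?ic x * ?V x \<partial>\<nu>) \<le> (C2 + 2 * b * exp D * C1) * E"
    proof -
      have "2 * c' * (exp (- D) * (\<integral>x. ?ic x * ?V x \<partial>\<nu>)) \<le> 2 * c' * (\<integral>x. ?ic x * ?W x \<partial>\<nu>)"
        using tail c' by (intro mult_left_mono) auto
      moreover have "2 * b * (\<integral>x. ?i x * ?W x \<partial>\<nu>) \<le> 2 * b * (exp D * (C1 * E))"
        using core by (intro mult_left_mono) (auto simp: b_def)
      ultimately show ?thesis using lyap by (simp add: algebra_simps)
    qed
    then have "(\<integral>x. ?ic x * ?V x \<partial>\<nu>) \<le> (C2 + 2 * b * exp D * C1) / (2 * c' * exp (- D)) * E"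
      using c' by (simp add: pos_le_divide_eq mult.commute)
    moreover have "(\<integral>x. ?V x \<partial>\<nu>) = (\<integral>x. ?i x * ?V x + ?ic x * ?V x \<partial>\<nu>)"
      by (intro Bochner_Integration.integral_cong HOL.refl) (auto simp: indicator_def)
    moreover have "\<dots> = (\<integral>x. ?i x * ?V x \<partial>\<nu>) + (\<integral>x. ?ic x * ?V x \<partial>\<nu>)"
      using Vii by simp
    ultimately have "(\<integral>x. ?V x \<partial>\<nu>) \<le> C * E" using core' by (simp add: C_def distrib_right)
    then show "\<exists>c. \<bar>c\<bar> \<le> B \<and> (\<integral>x. (g x - c)\<^sup>2 * exp (- \<Phi> x) \<partial>\<nu>) \<le> C * (\<integral>z. turn_energy m g z \<partial>\<gamma>)"
      using c(2) by (auto simp: g'_def E_def)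
  qed
qed


section \<open>Energy along the flow\<close>

abbreviation "Q \<equiv> boomerang_semigroup lam \<Phi> R \<nu>"

lemma path_random [measurable]: "(\<lambda>\<omega>. boomerang_path lam \<Phi> R z \<omega> t) \<in> noise \<nu> \<rightarrow>\<^sub>M borel"
  unfolding boomerang_path_eq noise_eq by measurable

lemma prob_space_noise: "prob_space (noise \<nu>)"
  unfolding noise_eq by (rule prob_space_inputs)

lemma path_integrable:
  fixes f :: "'a \<times> 'a \<Rightarrow> real"
  assumes [measurable]: "f \<in> borel_measurable borel" and "\<And>z. \<bar>f z\<bar> \<le> b"
  shows "integrable (noise \<nu>) (\<lambda>\<omega>. f (boomerang_path lam \<Phi> R z \<omega> t))"
proof -
  interpret prob_space "noise \<nu>" by (rule prob_space_noise)
  show ?thesis by (rule integrable_const_bound[of _ b]) (use assms(2) in auto)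
qed

lemma Q_square:
  fixes f :: "'a \<times> 'a \<Rightarrow> real"
  assumes [measurable]: "f \<in> borel_measurable borel" and b: "\<And>z. \<bar>f z\<bar> \<le> b"
  shows "Q t (\<lambda>z. (f z - c)\<^sup>2) z = Q t (\<lambda>z. (f z)\<^sup>2) z - 2 * c * Q t f z + c\<^sup>2"
proof -
  interpret prob_space "noise \<nu>" by (rule prob_space_noise)
  have "\<bar>(f z)\<^sup>2\<bar> \<le> b\<^sup>2" for z using b[of z] by (metis abs_ge_zero abs_power2 power2_abs power_mono)
  then have i: "integrable (noise \<nu>) (\<lambda>\<omega>. (f (boomerang_path lam \<Phi> R z \<omega> t))\<^sup>2)"
    by (intro path_integrable[where b="b\<^sup>2"]) auto
  note i' = path_integrable[of f, OF assms(1) b, of z t]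
  have "Q t (\<lambda>z. (f z - c)\<^sup>2) z = (\<integral>\<omega>. (f (boomerang_path lam \<Phi> R z \<omega> t))\<^sup>2 - 2 * c * f (boomerang_path lam \<Phi> R z \<omega> t) + c\<^sup>2 \<partial>noise \<nu>)"
    unfolding boomerang_semigroup_def
    by (rule Bochner_Integration.integral_cong[OF HOL.refl]) (simp add: power2_diff)
  then show ?thesis using i i' by (simp add: boomerang_semigroup_def prob_space)
qed

text \<open>Agrees with \<open>Q t f\<close> for bounded nonnegative \<open>f\<close> and
  \<open>t \<ge> 0\<close>; the detour through \<open>Pt\<close> brings joint measurability and the
  semigroup law.\<close>

definition evol :: "('a \<times> 'a \<Rightarrow> real) \<Rightarrow> real \<Rightarrow> 'a \<times> 'a \<Rightarrow> real" where
  "evol f t z = enn2real (Pt (\<lambda>z. ennreal (f z)) t z)"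

definition pmean :: "('a \<times> 'a \<Rightarrow> real) \<Rightarrow> real \<Rightarrow> 'a \<Rightarrow> real" where
  "pmean f t x = (\<integral>w. evol f t (x, w) \<partial>\<nu>)"

text \<open>Has the same weighted integral as \<open>vvar\<close>, but as a function of the full
  state it can be evaluated at points moved along an arc.\<close>

definition dev :: "('a \<times> 'a \<Rightarrow> real) \<Rightarrow> real \<Rightarrow> 'a \<times> 'a \<Rightarrow> ennreal" where
  "dev f t z = ennreal ((evol f t z - pmean f t (fst z))\<^sup>2)"

lemma evol_measurable [measurable (raw)]:
  assumes [measurable]: "f \<in> borel_measurable borel" "a \<in> borel_measurable M" "c \<in> M \<rightarrow>\<^sub>M borel"
  shows "(\<lambda>p. evol f (a p) (c p)) \<in> borel_measurable M"
  unfolding evol_def by measurable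

lemma evol_eq_Q:
  fixes f :: "'a \<times> 'a \<Rightarrow> real"
  assumes [measurable]: "f \<in> borel_measurable borel" and b: "\<And>z. 0 \<le> f z" "\<And>z. f z \<le> b" and t: "0 \<le> t"
  shows "evol f t z = Q t f z" "0 \<le> evol f t z" "evol f t z \<le> b"
    "ennreal (evol f t z) = Pt (\<lambda>z. ennreal (f z)) t z"
proof -
  have le: "Pt (\<lambda>z. ennreal (f z)) t z \<le> ennreal b"
    using b t by (intro Pt_le_const) (auto intro: ennreal_leI)
  have "0 \<le> b" using b[of z] by linarith
  then show "evol f t z \<le> b" "0 \<le> evol f t z"
    using enn2real_mono[OF le] by (simp_all add: evol_def)
  show e: "ennreal (evol f t z) = Pt (\<lambda>z. ennreal (f z)) t z"
    unfolding evol_def using order.strict_trans1[OF le ennreal_less_top] by (intro ennreal_enn2real) auto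
  have "ennreal (Q t f z) = (\<integral>\<^sup>+\<omega>. ennreal (f (boomerang_path lam \<Phi> R z \<omega> t)) \<partial>noise \<nu>)"
    unfolding boomerang_semigroup_def using b
    by (intro nn_integral_eq_integral[symmetric] path_integrable[where b=b]) auto
  also have "\<dots> = ennreal (evol f t z)" unfolding e using t by (intro nn_integral_boomerang_path) auto
  finally show "evol f t z = Q t f z"
    unfolding boomerang_semigroup_def using b \<open>0 \<le> evol f t z\<close> by (subst (asm) ennreal_inj) (auto intro!: integral_nonneg_AE)
qed

text \<open>\<open>Pt_flow_le\<close> for \<open>(f - c)\<^sup>2\<close>, where \<open>c\<close> is the value of \<open>P\<^sub>t f\<close> at \<open>z\<close>.\<close>

lemma flow_energy:
  fixes f :: "'a \<times> 'a \<Rightarrow> real"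
  assumes [measurable]: "f \<in> borel_measurable borel" and b: "\<And>z. 0 \<le> f z" "\<And>z. f z \<le> b" and s: "0 \<le> s" "s \<le> t"
  shows "(evol f t z)\<^sup>2 + exp (- cum s z) * (evol f t z - evol f (t - s) (boomerang_flow s z))\<^sup>2 \<le> evol (\<lambda>z. (f z)\<^sup>2) t z"
proof -
  define c where "c = evol f t z"
  have B: "\<bar>f z\<bar> \<le> b" for z using b[of z] by auto
  have b2: "(f z)\<^sup>2 \<le> b\<^sup>2" for z using b by (intro power_mono) auto
  have sq: "evol (\<lambda>z. (f z - d)\<^sup>2) u y = evol (\<lambda>z. (f z)\<^sup>2) u y - 2 * d * evol f u y + d\<^sup>2" if u: "0 \<le> u" for d u y
  proof -
    have "(f z - d)\<^sup>2 \<le> (b + \<bar>d\<bar>)\<^sup>2" for z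
    proof -
      have "\<bar>f z - d\<bar> \<le> b + \<bar>d\<bar>" using B[of z] by linarith
      then show ?thesis by (metis abs_ge_zero power2_abs power_mono)
    qed
    then have "evol (\<lambda>z. (f z - d)\<^sup>2) u y = Q u (\<lambda>z. (f z - d)\<^sup>2) y"
      using u by (intro evol_eq_Q[where b="(b + \<bar>d\<bar>)\<^sup>2"]) auto
    also have "\<dots> = Q u (\<lambda>z. (f z)\<^sup>2) y - 2 * d * Q u f y + d\<^sup>2" by (rule Q_square[OF _ B]) simp
    also have "Q u (\<lambda>z. (f z)\<^sup>2) y = evol (\<lambda>z. (f z)\<^sup>2) u y"
      using b2 u by (intro evol_eq_Q(1)[symmetric, where b="b\<^sup>2"]) auto
    also have "Q u f y = evol f u y" using b u by (intro evol_eq_Q(1)[symmetric, where b=b]) auto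
    finally show ?thesis .
  qed
  let ?h = "\<lambda>z. (f z - c)\<^sup>2" and ?y = "boomerang_flow s z"
  have c: "0 \<le> c" "c \<le> b" unfolding c_def using evol_eq_Q(2,3)[of f b t z] b s by auto
  have hb: "?h z \<le> b\<^sup>2" for z
  proof -
    have "\<bar>f z - c\<bar> \<le> b" using b[of z] c by linarith
    then show ?thesis by (metis abs_ge_zero power2_abs power_mono)
  qed
  have "ennreal (exp (- cum s z)) * ennreal (evol ?h (t - s) ?y) \<le> ennreal (evol ?h t z)"
    using Pt_flow_le[of "\<lambda>z. ennreal (?h z)" s t z] s hb
    by (subst (1 2) evol_eq_Q(4)[where b="b\<^sup>2"]) auto
  then have "exp (- cum s z) * evol ?h (t - s) ?y \<le> evol ?h t z"
    using evol_eq_Q(2)[of ?h "b\<^sup>2" t z] hb s by (simp add: ennreal_mult'[symmetric])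
  also have "evol ?h t z = evol (\<lambda>z. (f z)\<^sup>2) t z - c\<^sup>2"
    using sq[of t c z] s by (simp add: c_def power2_eq_square)
  finally have 1: "exp (- cum s z) * evol ?h (t - s) ?y \<le> evol (\<lambda>z. (f z)\<^sup>2) t z - c\<^sup>2" .
  \<comment> \<open>Jensen's inequality at \<open>?y\<close>, obtained as nonnegativity of a
    variance.\<close>
  have "0 \<le> evol (\<lambda>z. (f z - evol f (t - s) ?y)\<^sup>2) (t - s) ?y" by (simp add: evol_def)
  then have "(evol f (t - s) ?y)\<^sup>2 \<le> evol (\<lambda>z. (f z)\<^sup>2) (t - s) ?y"
    using sq[of "t - s" "evol f (t - s) ?y" ?y] s by (simp add: power2_eq_square)
  then have "(c - evol f (t - s) ?y)\<^sup>2 \<le> evol ?h (t - s) ?y"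
    using sq[of "t - s" c ?y] s by (simp add: power2_diff)
  then have "exp (- cum s z) * (c - evol f (t - s) ?y)\<^sup>2 \<le> exp (- cum s z) * evol ?h (t - s) ?y"
    by (intro mult_left_mono) auto
  then show ?thesis using 1 unfolding c_def by linarith
qed

lemma pmean_measurable [measurable (raw)]:
  assumes [measurable]: "f \<in> borel_measurable borel" "a \<in> borel_measurable M" "c \<in> M \<rightarrow>\<^sub>M borel"
  shows "(\<lambda>p. pmean f (a p) (c p)) \<in> borel_measurable M"
proof -
  have [measurable]: "(\<lambda>q. (c (fst q), snd q)) \<in> M \<Otimes>\<^sub>M \<nu> \<rightarrow>\<^sub>M borel"
    by (intro borel_measurable_Pair) measurable
  have "(\<lambda>(p, w). evol f (a p) (c p, w)) \<in> borel_measurable (M \<Otimes>\<^sub>M \<nu>)"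
    unfolding split_beta' by measurable
  then show ?thesis unfolding pmean_def by measurable
qed

lemma dev_measurable [measurable (raw)]:
  assumes [measurable]: "f \<in> borel_measurable borel" "a \<in> borel_measurable M" "c \<in> M \<rightarrow>\<^sub>M borel"
  shows "(\<lambda>p. dev f (a p) (c p)) \<in> borel_measurable M"
proof -
  have [measurable]: "(\<lambda>p. fst (c p)) \<in> borel_measurable M" by (rule measurable_fst_borel) simp
  show ?thesis unfolding dev_def by measurable
qed

lemma pmean_bounds:
  assumes [measurable]: "f \<in> borel_measurable borel" and b: "\<And>z. 0 \<le> f z" "\<And>z. f z \<le> b" and t: "0 \<le> t"
  shows "integrable \<nu> (\<lambda>w. evol f t (x, w))" "0 \<le> pmean f t x" "pmean f t x \<le> b"
proof -
  note e = evol_eq_Q(2,3)[OF assms(1) b t]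
  show i: "integrable \<nu> (\<lambda>w. evol f t (x, w))"
    using e by (intro nu_integral_bounded[where B=b]) auto
  show "0 \<le> pmean f t x" unfolding pmean_def using e by (intro integral_nonneg_AE) auto
  have "(\<integral>w. evol f t (x, w) \<partial>\<nu>) \<le> (\<integral>w. b \<partial>\<nu>)" using e by (intro integral_mono i) auto
  then show "pmean f t x \<le> b" by (simp add: pmean_def)
qed

lemma wint_iterated:
  assumes [measurable]: "h \<in> borel_measurable borel"
  shows "wint h = (\<integral>\<^sup>+x. (\<integral>\<^sup>+w. h (x, w) \<partial>\<nu>) * ennreal (exp (- \<Phi> x)) \<partial>\<nu>)"
  unfolding wint_def
  by (subst nu.nn_integral_fst[symmetric]) (auto simp: wt_def nn_integral_multc)

lemma wint_dev:
  fixes f :: "'a \<times> 'a \<Rightarrow> real"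
  assumes [measurable]: "f \<in> borel_measurable borel" and b: "\<And>z. 0 \<le> f z" "\<And>z. f z \<le> b" and t: "0 \<le> t"
  shows "wint (dev f t) = wint (vvar (Pt (\<lambda>z. ennreal (f z)) t))"
proof -
  note e = evol_eq_Q[OF assms(1) b t]
  have "(\<integral>\<^sup>+w. dev f t (x, w) \<partial>\<nu>) = vvar (Pt (\<lambda>z. ennreal (f z)) t) (x, v)" for x v
  proof -
    have b2: "\<bar>(evol f t z)\<^sup>2\<bar> \<le> b\<^sup>2" for z using e(2,3)[of z] by (auto intro: power_mono)
    have i: "integrable \<nu> (\<lambda>w. evol f t (x, w))" "integrable \<nu> (\<lambda>w. (evol f t (x, w))\<^sup>2)"
      using pmean_bounds(1)[OF assms(1) b t] b2 by (auto intro!: nu_integral_bounded[where B="b\<^sup>2"])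
    have "(\<integral>\<^sup>+w. dev f t (x, w) \<partial>\<nu>) = ennreal (\<integral>w. (evol f t (x, w) - pmean f t x)\<^sup>2 \<partial>\<nu>)"
      unfolding dev_def fst_conv using diff_power2_bound[of "evol f t (x, _)" b "pmean f t x"] e(2,3) pmean_bounds(2,3)[OF assms(1) b t]
      by (intro nn_integral_eq_integral nu_integral_bounded[where B="(2 * b)\<^sup>2"]) auto
    also have "(\<integral>w. (evol f t (x, w) - pmean f t x)\<^sup>2 \<partial>\<nu>) = (\<integral>w. (evol f t (x, w))\<^sup>2 \<partial>\<nu>) - (pmean f t x)\<^sup>2"
      unfolding pmean_def by (rule nu.variance_eq[OF i])
    also have "ennreal \<dots> = ennreal (\<integral>w. (evol f t (x, w))\<^sup>2 \<partial>\<nu>) - ennreal ((pmean f t x)\<^sup>2)"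
      by (rule ennreal_minus[symmetric]) simp
    also have "ennreal (\<integral>w. (evol f t (x, w))\<^sup>2 \<partial>\<nu>) = (\<integral>\<^sup>+w. ennreal ((evol f t (x, w))\<^sup>2) \<partial>\<nu>)"
      using i by (intro nn_integral_eq_integral[symmetric]) auto
    also have "\<dots> = vmean (\<lambda>z. (Pt (\<lambda>z. ennreal (f z)) t z)\<^sup>2) x"
      unfolding vmean_def by (simp add: e(4)[symmetric] e(2) ennreal_power)
    also have "ennreal ((pmean f t x)\<^sup>2) = (vmean (Pt (\<lambda>z. ennreal (f z)) t) x)\<^sup>2"
      unfolding vmean_def pmean_def e(4)[symmetric] using e(2) i
      by (subst nn_integral_eq_integral) (auto simp: ennreal_power intro!: integral_nonneg_AE)
    finally show ?thesis by (simp add: vvar_def)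
  qed
  moreover have "(\<lambda>(p, z). Pt (\<lambda>z. ennreal (f z)) t z) \<in> borel_measurable (borel \<Otimes>\<^sub>M borel)" by measurable
  from vvar_measurable2[OF this, of "\<lambda>z. z"] have [measurable]: "vvar (Pt (\<lambda>z. ennreal (f z)) t) \<in> borel_measurable borel" by simp
  moreover have "(\<integral>\<^sup>+w. vvar (Pt (\<lambda>z. ennreal (f z)) t) (x, w) \<partial>\<nu>) = vvar (Pt (\<lambda>z. ennreal (f z)) t) (x, 0)" for x
    by (simp add: vvar_def nu.emeasure_space_1[simplified])
  ultimately show ?thesis by (simp add: wint_iterated)
qed


text \<open>The loss of squared norm over time 2. This horizon accommodates the times in
  \<open>[1,2]\<close> together with delays \<open>angle z / 2\<close>, which are less than
  1.\<close>

definition diss :: "('a \<times> 'a \<Rightarrow> real) \<Rightarrow> ennreal" where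
  "diss f = wint (\<lambda>z. ennreal ((f z)\<^sup>2)) - wint (\<lambda>z. ennreal ((evol f 2 z)\<^sup>2))"

lemma wint_bounded:
  fixes f :: "'a \<times> 'a \<Rightarrow> real"
  assumes "\<And>z. f z \<le> b" shows "wint (\<lambda>z. ennreal (f z)) < \<top>"
proof -
  have "wint (\<lambda>z. ennreal (f z)) \<le> (\<integral>\<^sup>+z. ennreal b * 1 \<partial>\<gamma>)"
    unfolding wint_def wt_def using assms Phi_nonneg
    by (intro nn_integral_mono mult_mono ennreal_leI) (auto simp flip: ennreal_1 intro!: ennreal_leI)
  also have "\<dots> < \<top>" using gamma.P.emeasure_space_1 by (simp add: ennreal_mult_less_top)
  finally show ?thesis .
qed

context
  fixes f :: "'a \<times> 'a \<Rightarrow> real" and b :: real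
  assumes f [measurable]: "f \<in> borel_measurable borel" and b: "\<And>z. 0 \<le> f z" "\<And>z. f z \<le> b"
begin

lemma evol_square_bound: "0 \<le> t \<Longrightarrow> (evol f t z)\<^sup>2 \<le> b\<^sup>2"
  using evol_eq_Q(2,3)[OF f b, of t z] by (simp add: power_mono)

text \<open>Jensen's inequality for the path law over the time \<open>t - s\<close>, followed by
  invariance of the weight.\<close>

lemma wint_evol_mono:
  assumes "0 \<le> s" "s \<le> t"
  shows "wint (\<lambda>z. ennreal ((evol f t z)\<^sup>2)) \<le> wint (\<lambda>z. ennreal ((evol f s z)\<^sup>2))"
proof -
  let ?F = "\<lambda>z. ennreal (f z)"
  have e: "ennreal ((evol f t z)\<^sup>2) = (Pt ?F t z)\<^sup>2" if "0 \<le> t" for t z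
    using evol_eq_Q(2,4)[OF f b that] by (simp flip: ennreal_power)
  have "(Pt ?F t z)\<^sup>2 \<le> Pt (\<lambda>z. (Pt ?F s z)\<^sup>2) (t - s) z" for z
  proof -
    have eq: "Pt ?F t z = Pt (Pt ?F s) (t - s) z"
      using Pt_semigroup[of ?F s "t - s" z] assms by simp
    have "Pt ?F t z < \<top>" using evol_eq_Q(4)[OF f b, of t z, symmetric] assms by simp
    then show ?thesis unfolding eq using assms by (intro Pt_power2_le) auto
  qed
  then have "wint (\<lambda>z. (Pt ?F t z)\<^sup>2) \<le> wint (Pt (\<lambda>z. (Pt ?F s z)\<^sup>2) (t - s))" by (rule wint_mono)
  also have "\<dots> = wint (\<lambda>z. (Pt ?F s z)\<^sup>2)" using assms by (intro Pt_invariant) auto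
  finally show ?thesis using assms by (simp add: e)
qed

lemma dev_dissipation: "(\<integral>\<^sup>+t. wint (dev f t) * indicator {0..2} t \<partial>lborel) \<le> ennreal (1 / lam) * diss f"
proof -
  let ?F = "\<lambda>z. ennreal (f z)" and ?I = "\<integral>\<^sup>+t. wint (dev f t) * indicator {0..2} t \<partial>lborel"
  have m: "(\<lambda>t. wint (dev f t)) \<in> borel_measurable borel"
  proof -
    have "(\<lambda>(t, z). dev f t z * wt z) \<in> borel_measurable (borel \<Otimes>\<^sub>M \<gamma>)" by measurable
    then show ?thesis unfolding wint_def by measurable
  qed
  note [measurable] = m
  have "wint (\<lambda>z. (Pt ?F 2 z)\<^sup>2) + (\<integral>\<^sup>+s. ennreal lam * wint (vvar (Pt ?F s)) * indicator {0..2} s \<partial>lborel) \<le> wint (\<lambda>z. (?F z)\<^sup>2)"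
    using b by (intro dissipation_refresh[where b=b]) (auto intro: ennreal_leI)
  also have "(\<integral>\<^sup>+s. ennreal lam * wint (vvar (Pt ?F s)) * indicator {0..2} s \<partial>lborel) = (\<integral>\<^sup>+s. ennreal lam * (wint (dev f s) * indicator {0..2} s) \<partial>lborel)"
    by (rule nn_integral_cong) (auto simp: wint_dev[OF f b] indicator_def)
  also have "\<dots> = ennreal lam * ?I" by (rule nn_integral_cmult) measurable
  also have "(\<lambda>z. (Pt ?F 2 z)\<^sup>2) = (\<lambda>z. ennreal ((evol f 2 z)\<^sup>2))"
    using evol_eq_Q(2,4)[OF f b, of 2] by (simp flip: ennreal_power)
  also have "(\<lambda>z. (?F z)\<^sup>2) = (\<lambda>z. ennreal ((f z)\<^sup>2))" using b by (simp add: ennreal_power)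
  finally have "ennreal lam * ?I \<le> diss f"
    unfolding diss_def using wint_bounded[of "\<lambda>z. (evol f 2 z)\<^sup>2" "b\<^sup>2"] evol_square_bound[of 2]
    by (subst ennreal_le_minus_iff) (auto simp: add.commute)
  then have "ennreal (1 / lam) * (ennreal lam * ?I) \<le> ennreal (1 / lam) * diss f" by (rule mult_left_mono) simp
  then show ?thesis using lam_pos by (simp add: mult.assoc[symmetric] ennreal_mult'[symmetric])
qed

text \<open>\<open>flow_energy\<close> may be used with a delay depending on \<open>z\<close>, here
  up to the midpoint of the arc, since the right-hand side there does not contain the delay; then it
  is integrated against the invariant weight.\<close>

lemma flow_dissipation:
  assumes t: "1 \<le> t" "t \<le> 2"
  shows "wint (\<lambda>z. ennreal (exp (- cum (angle z / 2) z) * (evol f t z - evol f (t - angle z / 2) (boomerang_flow (angle z / 2) z))\<^sup>2)) \<le> diss f"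
    (is "wint ?X \<le> _")
proof -
  have b2: "(f z)\<^sup>2 \<le> b\<^sup>2" for z using b by (intro power_mono) auto
  have [measurable]: "?X \<in> borel_measurable borel" by measurable
  have "wint ?X + wint (\<lambda>z. ennreal ((evol f t z)\<^sup>2)) = wint (\<lambda>z. ?X z + ennreal ((evol f t z)\<^sup>2))"
    unfolding wint_def by (simp add: distrib_right nn_integral_add)
  also have "\<dots> \<le> wint (Pt (\<lambda>z. ennreal ((f z)\<^sup>2)) t)"
  proof (rule wint_mono)
    fix z
    have "(evol f t z)\<^sup>2 + exp (- cum (angle z / 2) z) * (evol f t z - evol f (t - angle z / 2) (boomerang_flow (angle z / 2) z))\<^sup>2
      \<le> evol (\<lambda>z. (f z)\<^sup>2) t z"
      using angle_bounds(1,2)[of z] t by (intro flow_energy[OF f b]) auto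
    then have "?X z + ennreal ((evol f t z)\<^sup>2) \<le> ennreal (evol (\<lambda>z. (f z)\<^sup>2) t z)"
      by (simp flip: ennreal_plus add: ennreal_leI add.commute)
    also have "\<dots> = Pt (\<lambda>z. ennreal ((f z)\<^sup>2)) t z"
      using t b2 by (intro evol_eq_Q(4)[where b="b\<^sup>2"]) auto
    finally show "?X z + ennreal ((evol f t z)\<^sup>2) \<le> Pt (\<lambda>z. ennreal ((f z)\<^sup>2)) t z" .
  qed
  also have "\<dots> = wint (\<lambda>z. ennreal ((f z)\<^sup>2))" using t by (intro Pt_invariant) auto
  finally have "wint ?X + wint (\<lambda>z. ennreal ((evol f 2 z)\<^sup>2)) \<le> wint (\<lambda>z. ennreal ((f z)\<^sup>2))"
    using wint_evol_mono[of t 2] t by (meson add_left_mono order_trans zero_le_one)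
  then show ?thesis
    unfolding diss_def using wint_bounded[of "\<lambda>z. (evol f 2 z)\<^sup>2" "b\<^sup>2"] evol_square_bound[of 2]
    by (subst ennreal_le_minus_iff) auto
qed

text \<open>The delay depends on \<open>z\<close>, so fixed times cannot be compared. After Tonelli
  the time integral is translated for each \<open>z\<close> separately, and \<open>[1,2]\<close>
  moved back by less than 1 remains inside \<open>[0,2]\<close>.\<close>

lemma dev_shift:
  "(\<integral>\<^sup>+t. wint (\<lambda>z. dev f (t - angle z / 2) z) * indicator {1..2} t \<partial>lborel) \<le> (\<integral>\<^sup>+t. wint (dev f t) * indicator {0..2} t \<partial>lborel)"
proof -
  have pull: "wint h * indicator A t = wint (\<lambda>z. h z * indicator A (t::real))" for h A t
    by (cases "t \<in> A") (simp_all add: wint_def)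
  have "(\<integral>\<^sup>+t. wint (\<lambda>z. dev f (t - angle z / 2) z) * indicator {1..2} t \<partial>lborel)
      = wint (\<lambda>z. \<integral>\<^sup>+t. dev f (t - angle z / 2) z * indicator {1..2} t \<partial>lborel)"
    unfolding pull by (rule wint_nn_integral[symmetric]) measurable
  also have "\<dots> \<le> wint (\<lambda>z. \<integral>\<^sup>+t. dev f t z * indicator {0..2} t \<partial>lborel)"
  proof (rule wint_mono)
    fix z
    have "(\<integral>\<^sup>+t. dev f (t - angle z / 2) z * indicator {1..2} t \<partial>lborel)
        = (\<integral>\<^sup>+t. dev f t z * indicator {1..2} (angle z / 2 + t) \<partial>lborel)"
      by (subst nn_integral_real_affine[where c=1 and t="angle z / 2"]) auto
    also have "\<dots> \<le> (\<integral>\<^sup>+t. dev f t z * indicator {0..2} t \<partial>lborel)"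
      using angle_bounds(1,2)[of z] by (intro nn_integral_mono mult_left_mono) (auto simp: indicator_def)
    finally show "(\<integral>\<^sup>+t. dev f (t - angle z / 2) z * indicator {1..2} t \<partial>lborel) \<le> (\<integral>\<^sup>+t. dev f t z * indicator {0..2} t \<partial>lborel)" .
  qed
  also have "\<dots> = (\<integral>\<^sup>+t. wint (dev f t) * indicator {0..2} t \<partial>lborel)"
    unfolding pull by (rule wint_nn_integral) measurable
  finally show ?thesis .
qed

text \<open>The values of \<open>pmean f t\<close> at both ends of an arc are compared with \<open>pmean f (t - angle z / 2)\<close> at its
  midpoint; \<open>turn_back\<close> traverses the arc from the other end.\<close>

lemma midpoint_turn_back: "fst (boomerang_flow (angle z / 2) (turn_back z)) = fst (boomerang_flow (angle z / 2) z)"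
  by (simp add: turn_back_def turn_def flow_flow_flip)

lemma turn_energy_le:
  assumes m: "0 \<le> m" and t: "1 \<le> t" "t \<le> 2"
  shows "(\<integral>\<^sup>+z. ennreal (turn_energy m (pmean f t) z) \<partial>\<gamma>) \<le> ennreal (6 * (1 + exp (2 * K * (m + 2))) * exp (lam + 2 * K * (m + 2)))
     * (wint (dev f t) + diss f + wint (\<lambda>z. dev f (t - angle z / 2) z))"
proof -
  \<comment> \<open>\<open>E\<close> bounds the change of the weight along an arc and
    \<open>E2\<close> the inverse of the survival probability. Both allow velocities up to
    \<open>m + 1\<close>, since passing to the other end of the arc adds at most 1.\<close>
  define E where "E = exp (2 * K * (m + 2))"
  define E2 where "E2 = exp (lam + 2 * K * (m + 2))"
  have E: "1 \<le> E" "E \<le> E2" "1 \<le> E2" unfolding E_def E2_def using K_nonneg m lam_pos by auto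
  let ?p = "\<lambda>z. boomerang_flow (angle z / 2) z"
  define W where "W z = exp (- \<Phi> (fst z))" for z :: "'a \<times> 'a"
  define U where "U t z = (evol f t z - pmean f t (fst z))\<^sup>2" for t z
  define X where "X z = exp (- cum (angle z / 2) z) * (evol f t z - evol f (t - angle z / 2) (?p z))\<^sup>2" for z
  define A where "A z = (pmean f t (fst z) - pmean f (t - angle z / 2) (fst (?p z)))\<^sup>2" for z
  define G where "G z = of_bool (norm (snd z) \<le> m + 1) * W z * A z" for z
  have W0: "0 < W z" for z by (simp add: W_def)
  have A0: "0 \<le> A z" for z by (simp add: A_def)
  have G0: "0 \<le> G z" for z using W0[of z] A0[of z] by (simp add: G_def)
  have osc: "W z \<le> E * W (boomerang_flow s z)" if "0 \<le> s" "s \<le> angle z" "norm (snd z) \<le> m + 1" for s z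
  proof -
    have "2 * K * (norm (snd z) + 1) \<le> 2 * K * (m + 2)" using that K_nonneg by (intro mult_left_mono) auto
    then show ?thesis
      using Phi_flow_osc[OF that(1,2)] unfolding W_def E_def by (auto simp flip: exp_add)
  qed
  have 1: "turn_energy m (pmean f t) z \<le> 2 * G z + 2 * E * G (turn_back z)" for z
  proof (cases "norm (snd z) \<le> m")
    case True
    let ?a = "pmean f t (fst z)" and ?c = "pmean f t (fst (turn z))" and ?d = "pmean f (t - angle z / 2) (fst (?p z))"
    have ang: "angle (turn_back z) = angle z" by (simp add: turn_back_def turn_def)
    have A': "A (turn_back z) = (?c - ?d)\<^sup>2"
      unfolding A_def ang midpoint_turn_back fst_turn_back ..
    have "norm (snd (turn_back z)) \<le> norm (snd z) + 1"
      using norm_snd_flow_le[of "angle z" z] angle_bounds(1)[of z] by (simp add: turn_def)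
    then have G': "G (turn_back z) = W (turn_back z) * (?c - ?d)\<^sup>2" using True by (simp add: G_def A')
    have W': "W z \<le> E * W (turn_back z)"
      using osc[of "angle z" z] angle_bounds(1)[of z] True by (simp add: W_def turn_def)
    have "(?a - ?c)\<^sup>2 \<le> 2 * (?a - ?d)\<^sup>2 + 2 * (?c - ?d)\<^sup>2"
      using zero_le_power2[of "(?a - ?d) + (?c - ?d)"] by (simp add: power2_eq_square algebra_simps)
    then have "W z * (?a - ?c)\<^sup>2 \<le> W z * (2 * (?a - ?d)\<^sup>2 + 2 * (?c - ?d)\<^sup>2)"
      using W0[of z] by (intro mult_left_mono) auto
    also have "\<dots> \<le> 2 * (W z * (?a - ?d)\<^sup>2) + 2 * (E * W (turn_back z) * (?c - ?d)\<^sup>2)"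
      using mult_right_mono[OF W', of "(?c - ?d)\<^sup>2"] by (simp add: distrib_left)
    finally show ?thesis using True by (simp add: turn_energy_def G' G_def[of z] A_def[of z] W_def[of z] mult_ac)
  next
    case False
    then show ?thesis using G0 E by (simp add: turn_energy_def)
  qed
  \<comment> \<open>Three increments: from the average at \<open>z\<close> to the value at
    \<open>z\<close>, from there to the value at the midpoint at the earlier time, and on to the
    average at the midpoint. The outer two are velocity deviations, the middle one is bounded by
    \<open>flow_dissipation\<close>.\<close>
  have 2: "G z \<le> 3 * (U t z * W z) + 3 * E2 * (X z * W z) + 3 * E * (U (t - angle z / 2) (?p z) * W (?p z))" for z
  proof (cases "norm (snd z) \<le> m + 1")
    case True
    let ?s = "angle z / 2"
    have s: "0 \<le> ?s" "?s \<le> angle z" using angle_bounds(1)[of z] by auto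
    have "2 * K * (norm (snd z) + 1) \<le> 2 * K * (m + 2)" using True K_nonneg by (intro mult_left_mono) auto
    then have "cum ?s z \<le> lam + 2 * K * (m + 2)" using cum_le[OF s] by linarith
    then have c: "1 \<le> E2 * exp (- cum ?s z)" unfolding E2_def by (simp flip: exp_add)
    let ?a = "pmean f t (fst z) - evol f t z" and ?b = "evol f t z - evol f (t - ?s) (?p z)"
      and ?c = "evol f (t - ?s) (?p z) - pmean f (t - ?s) (fst (?p z))"
    have three: "(a + b + c)\<^sup>2 \<le> 3 * a\<^sup>2 + 3 * b\<^sup>2 + 3 * c\<^sup>2" for a b c :: real
      using zero_le_power2[of "a - b"] zero_le_power2[of "b - c"] zero_le_power2[of "a - c"]
      by (simp add: power2_eq_square algebra_simps)
    have "A z = (?a + ?b + ?c)\<^sup>2" by (simp add: A_def)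
    also have "\<dots> \<le> 3 * ?a\<^sup>2 + 3 * ?b\<^sup>2 + 3 * ?c\<^sup>2" by (rule three)
    also have "?a\<^sup>2 = U t z" by (simp add: U_def power2_commute)
    also have "?c\<^sup>2 = U (t - ?s) (?p z)" by (simp add: U_def)
    finally have "A z * W z \<le> (3 * U t z + 3 * ?b\<^sup>2 + 3 * U (t - ?s) (?p z)) * W z"
      using W0[of z] by (intro mult_right_mono) auto
    moreover have "?b\<^sup>2 * W z \<le> E2 * X z * W z"
      using mult_right_mono[OF c, of "?b\<^sup>2"] W0[of z] unfolding X_def by (intro mult_right_mono) (auto simp: mult_ac)
    moreover have "U (t - ?s) (?p z) * W z \<le> U (t - ?s) (?p z) * (E * W (?p z))"
      using osc[OF s True] by (intro mult_left_mono) (auto simp: U_def)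
    ultimately show ?thesis using True by (simp add: G_def algebra_simps)
  next
    case False
    have "0 \<le> U s y * W y" "0 \<le> X z * W z" for s y using W0[of y] W0[of z] by (simp_all add: U_def X_def)
    then show ?thesis using False E by (simp add: G_def add_nonneg_nonneg)
  qed
  have [measurable]: "W \<in> borel_measurable borel" unfolding W_def by measurable
  have fp [measurable]: "?p \<in> borel_measurable borel" by measurable
  have fp' [measurable]: "(\<lambda>z. fst (?p z)) \<in> borel_measurable borel" by (rule measurable_fst_borel[OF fp])
  have nsnd [measurable]: "(\<lambda>z::'a \<times> 'a. norm (snd z)) \<in> borel_measurable borel" by measurable
  have [measurable]: "A \<in> borel_measurable borel" unfolding A_def by measurable
  have [measurable]: "X \<in> borel_measurable borel" unfolding X_def by measurable
  have U1 [measurable]: "U t \<in> borel_measurable borel" unfolding U_def by measurable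
  have U2 [measurable]: "(\<lambda>z. U (t - angle z / 2) z) \<in> borel_measurable borel" unfolding U_def by measurable
  have U3 [measurable]: "(\<lambda>z. U (t - angle z / 2) (?p z)) \<in> borel_measurable borel" unfolding U_def by measurable
  have [measurable]: "G \<in> borel_measurable borel" unfolding G_def by measurable
  have U0: "0 \<le> U s y" "0 \<le> X y" for s y by (simp_all add: U_def X_def)
  have "(\<integral>\<^sup>+z. ennreal (turn_energy m (pmean f t) z) \<partial>\<gamma>) \<le> (\<integral>\<^sup>+z. ennreal 2 * ennreal (G z) + ennreal (2 * E) * ennreal (G (turn_back z)) \<partial>\<gamma>)"
  proof (rule nn_integral_mono)
    fix z
    show "ennreal (turn_energy m (pmean f t) z) \<le> ennreal 2 * ennreal (G z) + ennreal (2 * E) * ennreal (G (turn_back z))"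
      using 1[of z] G0 E by (simp flip: ennreal_mult' ennreal_plus del: ennreal_numeral add: ennreal_leI)
  qed
  also have "\<dots> = ennreal 2 * (\<integral>\<^sup>+z. ennreal (G z) \<partial>\<gamma>) + ennreal (2 * E) * (\<integral>\<^sup>+z. ennreal (G (turn_back z)) \<partial>\<gamma>)"
    by (simp add: nn_integral_add nn_integral_cmult del: ennreal_numeral)
  also have "(\<integral>\<^sup>+z. ennreal (G (turn_back z)) \<partial>\<gamma>) = (\<integral>\<^sup>+z. ennreal (G z) \<partial>\<gamma>)"
    by (rule gamma_turn_back[of "\<lambda>z. ennreal (G z)"]) measurable
  also have "ennreal 2 * (\<integral>\<^sup>+z. ennreal (G z) \<partial>\<gamma>) + ennreal (2 * E) * (\<integral>\<^sup>+z. ennreal (G z) \<partial>\<gamma>) = ennreal (2 * (1 + E)) * (\<integral>\<^sup>+z. ennreal (G z) \<partial>\<gamma>)"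
    using E by (simp add: distrib_right[symmetric] ennreal_plus[symmetric] del: ennreal_numeral ennreal_plus)
  also have "(\<integral>\<^sup>+z. ennreal (G z) \<partial>\<gamma>) \<le> (\<integral>\<^sup>+z. ennreal (3 * E2) * (ennreal (U t z * W z) + ennreal (X z * W z) + ennreal (U (t - angle z / 2) (?p z) * W (?p z))) \<partial>\<gamma>)"
  proof (rule nn_integral_mono)
    fix z
    let ?u = "U t z * W z" and ?x = "X z * W z" and ?v = "U (t - angle z / 2) (?p z) * W (?p z)"
    have nn: "0 \<le> ?u" "0 \<le> ?x" "0 \<le> ?v" using U0 W0 by (simp_all add: less_imp_le)
    have "3 * ?u \<le> 3 * E2 * ?u" using mult_right_mono[OF E(3) nn(1)] by linarith
    moreover have "3 * E * ?v \<le> 3 * E2 * ?v" using mult_right_mono[OF E(2) nn(3)] by linarith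
    ultimately have "G z \<le> 3 * E2 * (?u + ?x + ?v)" using 2[of z] by (simp add: distrib_left)
    then show "ennreal (G z) \<le> ennreal (3 * E2) * (ennreal ?u + ennreal ?x + ennreal ?v)"
      using nn E by (simp flip: ennreal_mult' ennreal_plus add: ennreal_leI)
  qed
  also have "\<dots> = ennreal (3 * E2) * ((\<integral>\<^sup>+z. ennreal (U t z * W z) \<partial>\<gamma>) + (\<integral>\<^sup>+z. ennreal (X z * W z) \<partial>\<gamma>) + (\<integral>\<^sup>+z. ennreal (U (t - angle z / 2) (?p z) * W (?p z)) \<partial>\<gamma>))"
    by (simp add: nn_integral_add nn_integral_cmult)
  also have "(\<integral>\<^sup>+z. ennreal (U t z * W z) \<partial>\<gamma>) = wint (dev f t)"
    unfolding wint_def dev_def wt_def U_def W_def by (simp add: ennreal_mult')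
  also have "(\<integral>\<^sup>+z. ennreal (X z * W z) \<partial>\<gamma>) = wint (\<lambda>z. ennreal (X z))"
    unfolding wint_def wt_def W_def using U0 by (simp add: ennreal_mult')
  also have "(\<integral>\<^sup>+z. ennreal (U (t - angle z / 2) (?p z) * W (?p z)) \<partial>\<gamma>) = (\<integral>\<^sup>+z. ennreal (U (t - angle z / 2) z * W z) \<partial>\<gamma>)"
    \<comment> \<open>The rotation to the midpoint leaves its own angle, and with it the delay,
      unchanged, so invariance of \<open>\<gamma>\<close> removes it.\<close>
    using gamma_shell_flow[of "\<lambda>z. ennreal (U (t - angle z / 2) z * W z)" "\<lambda>k. pi / 4 / (real k + 1) / 2"]
    by (simp only: angle_flow angle_def[symmetric] borel_measurable_times_ennreal) measurable
  also have "\<dots> = wint (\<lambda>z. dev f (t - angle z / 2) z)"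
    unfolding wint_def dev_def wt_def U_def W_def by (simp add: ennreal_mult')
  finally have "(\<integral>\<^sup>+z. ennreal (turn_energy m (pmean f t) z) \<partial>\<gamma>) \<le> ennreal (2 * (1 + E)) * (ennreal (3 * E2) * (wint (dev f t) + wint (\<lambda>z. ennreal (X z)) + wint (\<lambda>z. dev f (t - angle z / 2) z)))"
    by (simp add: mult_left_mono)
  also have "\<dots> \<le> ennreal (2 * (1 + E)) * (ennreal (3 * E2) * (wint (dev f t) + diss f + wint (\<lambda>z. dev f (t - angle z / 2) z)))"
    using flow_dissipation[OF t] unfolding X_def by (intro mult_left_mono add_mono) auto
  also have "\<dots> = ennreal (6 * (1 + E) * E2) * (wint (dev f t) + diss f + wint (\<lambda>z. dev f (t - angle z / 2) z))"
  proof -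
    have "2 * (1 + E) * (3 * E2) = 6 * (1 + E) * E2" by (simp add: algebra_simps)
    then have "ennreal (2 * (1 + E)) * ennreal (3 * E2) = ennreal (6 * (1 + E) * E2)"
      using E by (subst ennreal_mult'[symmetric]) auto
    then show ?thesis by (simp only: mult.assoc[symmetric])
  qed
  finally show ?thesis by (simp add: E_def E2_def)
qed

end


section \<open>Contraction of the variance\<close>

definition "mass = (\<integral>x. exp (- \<Phi> x) \<partial>\<nu>)"
definition "mu = density \<gamma> (\<lambda>z. ennreal (exp (- \<Phi> (fst z)) / mass))"

lemma exp_Phi_integrable: "integrable \<nu> (\<lambda>x. exp (- \<Phi> x))"
  using Phi_nonneg by (intro nu_integral_bounded[where B=1]) auto

lemma mass_pos: "0 < mass"
  using nu.expectation_less[of "\<lambda>x. - exp (- \<Phi> x)" 0] exp_Phi_integrable by (simp add: mass_def)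

lemma sets_mu [measurable_cong, simp]: "sets mu = sets borel" unfolding mu_def sets_density by (rule sets_gamma)
lemma space_mu [simp]: "space mu = UNIV" using sets_eq_imp_space_eq[OF sets_mu] by simp

lemma wint_mu:
  assumes [measurable]: "h \<in> borel_measurable borel"
  shows "wint h = ennreal mass * (\<integral>\<^sup>+z. h z \<partial>mu)"
proof -
  have [measurable]: "(\<lambda>z::'a \<times> 'a. \<Phi> (fst z)) \<in> borel_measurable borel" by measurable
  have "ennreal mass * (\<integral>\<^sup>+z. h z \<partial>mu) = (\<integral>\<^sup>+z. ennreal mass * (ennreal (exp (- \<Phi> (fst z)) / mass) * h z) \<partial>\<gamma>)"
    unfolding mu_def by (subst nn_integral_density) (auto simp: nn_integral_cmult)
  also have "\<dots> = wint h"
    unfolding wint_def wt_def using mass_pos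
  proof (intro nn_integral_cong)
    fix z :: "'a \<times> 'a"
    have "ennreal mass * ennreal (exp (- \<Phi> (fst z)) / mass) = ennreal (exp (- \<Phi> (fst z)))"
      using mass_pos by (subst ennreal_mult'[symmetric]) auto
    then show "ennreal mass * (ennreal (exp (- \<Phi> (fst z)) / mass) * h z) = h z * ennreal (exp (- \<Phi> (fst z)))"
      by (simp only: mult.assoc[symmetric]) (simp only: mult.commute)
  qed
  finally show ?thesis by simp
qed

lemma wint_one: "wint (\<lambda>_. 1) = ennreal mass"
  unfolding mass_def using exp_Phi_integrable
  by (simp add: wint_iterated nu.emeasure_space_1[simplified] nn_integral_eq_integral)

sublocale mu: prob_space mu
proof
  have "ennreal mass * emeasure mu UNIV = ennreal mass * 1" using wint_mu[of "\<lambda>_. 1"] wint_one by simp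
  then show "emeasure mu (space mu) = 1" using mass_pos by (subst (asm) ennreal_mult_cancel_left) auto
qed

lemma mu_invariant:
  assumes [measurable]: "f \<in> borel_measurable borel" and t: "0 \<le> t"
  shows "(\<integral>\<^sup>+z. Pt f t z \<partial>mu) = (\<integral>\<^sup>+z. f z \<partial>mu)"
proof -
  have "ennreal mass * (\<integral>\<^sup>+z. Pt f t z \<partial>mu) = ennreal mass * (\<integral>\<^sup>+z. f z \<partial>mu)"
    using Pt_invariant[OF assms] wint_mu[of f] wint_mu[of "Pt f t"] by simp
  then show ?thesis using mass_pos by (subst (asm) ennreal_mult_cancel_left) auto
qed

lemma mu_bounded:
  fixes h :: "'a \<times> 'a \<Rightarrow> real"
  assumes [measurable]: "h \<in> borel_measurable borel" and "\<And>z. \<bar>h z\<bar> \<le> B"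
  shows "integrable mu h"
  by (rule mu.integrable_const_bound[of _ B]) (use assms in auto)

lemma wint_mu_real:
  fixes h :: "'a \<times> 'a \<Rightarrow> real"
  assumes [measurable]: "h \<in> borel_measurable borel" and "\<And>z. 0 \<le> h z" "\<And>z. h z \<le> B"
  shows "wint (\<lambda>z. ennreal (h z)) = ennreal (mass * (\<integral>z. h z \<partial>mu))"
proof -
  have "(\<integral>\<^sup>+z. ennreal (h z) \<partial>mu) = ennreal (\<integral>z. h z \<partial>mu)"
    using assms by (intro nn_integral_eq_integral mu_bounded[where B=B]) auto
  then show ?thesis using mass_pos by (simp add: wint_mu ennreal_mult')
qed

definition var :: "('a \<times> 'a \<Rightarrow> real) \<Rightarrow> real" where
  "var h = (\<integral>z. (h z - (\<integral>y. h y \<partial>mu))\<^sup>2 \<partial>mu)"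

lemma var_le:
  fixes h :: "'a \<times> 'a \<Rightarrow> real"
  assumes [measurable]: "h \<in> borel_measurable borel" and B: "\<And>z. \<bar>h z\<bar> \<le> B"
  shows "var h = (\<integral>z. (h z)\<^sup>2 \<partial>mu) - (\<integral>z. h z \<partial>mu)\<^sup>2" "var h \<le> (\<integral>z. (h z - c)\<^sup>2 \<partial>mu)"
proof -
  have "(h z)\<^sup>2 \<le> B\<^sup>2" for z using B[of z] by (metis abs_ge_zero power2_abs power_mono)
  then have i: "integrable mu h" "integrable mu (\<lambda>z. (h z)\<^sup>2)"
    using B by (auto intro: mu_bounded[where B=B] mu_bounded[where B="B\<^sup>2"])
  show *: "var h = (\<integral>z. (h z)\<^sup>2 \<partial>mu) - (\<integral>z. h z \<partial>mu)\<^sup>2"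
    unfolding var_def by (rule mu.variance_eq[OF i])
  have "(\<integral>z. (h z - c)\<^sup>2 \<partial>mu) = (\<integral>z. (h z)\<^sup>2 - 2 * c * h z + c\<^sup>2 \<partial>mu)"
    by (rule Bochner_Integration.integral_cong[OF HOL.refl]) (simp add: power2_diff)
  also have "\<dots> = (\<integral>z. (h z)\<^sup>2 \<partial>mu) - 2 * c * (\<integral>z. h z \<partial>mu) + c\<^sup>2"
    using i mu.prob_space by simp
  finally have "(\<integral>z. (h z - c)\<^sup>2 \<partial>mu) = (\<integral>z. (h z)\<^sup>2 \<partial>mu) - 2 * c * (\<integral>z. h z \<partial>mu) + c\<^sup>2" .
  moreover have "2 * c * (\<integral>z. h z \<partial>mu) \<le> (\<integral>z. h z \<partial>mu)\<^sup>2 + c\<^sup>2"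
    using sum_squares_bound[of c "\<integral>z. h z \<partial>mu"] by simp
  ultimately show "var h \<le> (\<integral>z. (h z - c)\<^sup>2 \<partial>mu)" unfolding * by linarith
qed

lemma evol_mean:
  assumes [measurable]: "f \<in> borel_measurable borel" and b: "\<And>z. 0 \<le> f z" "\<And>z. f z \<le> b" and t: "0 \<le> t"
  shows "(\<integral>z. evol f t z \<partial>mu) = (\<integral>z. f z \<partial>mu)"
proof -
  note e = evol_eq_Q[OF assms(1) b t]
  have "ennreal (\<integral>z. evol f t z \<partial>mu) = (\<integral>\<^sup>+z. ennreal (evol f t z) \<partial>mu)"
    using e(2,3) by (intro nn_integral_eq_integral[symmetric] mu_bounded[where B=b]) auto
  also have "\<dots> = (\<integral>\<^sup>+z. ennreal (f z) \<partial>mu)" unfolding e(4) using t by (intro mu_invariant) auto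
  also have "\<dots> = ennreal (\<integral>z. f z \<partial>mu)"
    using b by (intro nn_integral_eq_integral mu_bounded[where B=b]) auto
  finally show ?thesis using b e(2) by (subst (asm) ennreal_inj) (auto intro!: integral_nonneg_AE)
qed

lemma var_evol_mono:
  assumes [measurable]: "f \<in> borel_measurable borel" and b: "\<And>z. 0 \<le> f z" "\<And>z. f z \<le> b" and t: "0 \<le> s" "s \<le> t"
  shows "var (evol f t) \<le> var (evol f s)"
proof -
  have e: "\<bar>evol f u z\<bar> \<le> b" "(evol f u z)\<^sup>2 \<le> b\<^sup>2" if "0 \<le> u" for u z
    using evol_eq_Q(2,3)[OF assms(1) b that, of z] by (auto intro: power_mono)
  have v: "var (evol f u) = (\<integral>z. (evol f u z)\<^sup>2 \<partial>mu) - (\<integral>z. f z \<partial>mu)\<^sup>2" if "0 \<le> u" for u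
    using var_le(1)[of "evol f u" b] e that evol_mean[OF assms(1) b that] by simp
  have "ennreal (mass * (\<integral>z. (evol f t z)\<^sup>2 \<partial>mu)) \<le> ennreal (mass * (\<integral>z. (evol f s z)\<^sup>2 \<partial>mu))"
    using wint_evol_mono[OF assms(1) b t] wint_mu_real[of "\<lambda>z. (evol f t z)\<^sup>2" "b\<^sup>2"] wint_mu_real[of "\<lambda>z. (evol f s z)\<^sup>2" "b\<^sup>2"] e t by simp
  then have "(\<integral>z. (evol f t z)\<^sup>2 \<partial>mu) \<le> (\<integral>z. (evol f s z)\<^sup>2 \<partial>mu)"
    using mass_pos by (subst (asm) ennreal_le_iff) (auto intro!: mult_nonneg_nonneg integral_nonneg_AE)
  then show ?thesis using v t by simp
qed

lemma evol_0:
  assumes [measurable]: "f \<in> borel_measurable borel" and "\<And>z. 0 \<le> f z"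
  shows "evol f 0 z = f z"
proof -
  let ?F = "\<lambda>z. ennreal (f z)"
  have "first_jump (Pt ?F) 0 z = (\<integral>\<^sup>+r. J (Pt ?F 0) z * indicator {0::real} r \<partial>lborel)"
    unfolding first_jump_def by (rule nn_integral_cong) (auto simp: indicator_def boomerang_flow_0)
  also have "\<dots> = 0" by (subst nn_integral_cmult_indicator) auto
  finally have "first_jump (Pt ?F) 0 z = 0" .
  then have "Pt ?F 0 z = ?F z" using Pt_restart[of ?F 0 z] by (simp add: boomerang_flow_0)
  then show ?thesis using assms(2) by (simp add: evol_def)
qed

text \<open>For \<open>t\<close> in \<open>[1,2]\<close> the variance at time 2 is at most that at
  time \<open>t\<close>, which consists of a velocity deviation and the variance of
  \<open>pmean f t\<close>; the latter is bounded by the Poincare inequality and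
  \<open>turn_energy_le\<close>. Deviations are controlled only after integration in time, hence the
  average over \<open>t\<close>.\<close>

lemma contraction:
  obtains C where "0 < C"
    "\<And>f b. f \<in> borel_measurable borel \<Longrightarrow> (\<And>z. 0 \<le> f z) \<Longrightarrow> (\<And>z. f z \<le> b) \<Longrightarrow>
       var (evol f 2) \<le> C * (var f - var (evol f 2))"
proof -
  obtain C0 m where C0: "0 < C0" and m: "0 \<le> m" and
    poincare: "\<And>g B. g \<in> borel_measurable borel \<Longrightarrow> (\<And>x. \<bar>g x\<bar> \<le> B) \<Longrightarrow>
      \<exists>c. \<bar>c\<bar> \<le> B \<and> (\<integral>x. (g x - c)\<^sup>2 * exp (- \<Phi> x) \<partial>\<nu>) \<le> C0 * (\<integral>z. turn_energy m g z \<partial>\<gamma>)"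
    using position_poincare by blast
  define C1 where "C1 = 6 * (1 + exp (2 * K * (m + 2))) * exp (lam + 2 * K * (m + 2))"
  \<comment> \<open>The window \<open>[1,2]\<close> has length one. Each time integral of a
    deviation, shifted or not, contributes \<open>1 / lam\<close>; the flow term contributes
    1.\<close>
  define C where "C = 2 / lam + 2 * C0 * C1 * (2 / lam + 1)"
  have C1: "0 < C1" unfolding C1_def by (intro mult_pos_pos add_pos_pos) auto
  have C: "0 < C" unfolding C_def using C0 C1 lam_pos by (intro add_pos_pos mult_pos_pos) auto
  show ?thesis
  proof (rule that[OF C])
    fix f :: "'a \<times> 'a \<Rightarrow> real" and b
    assume f [measurable]: "f \<in> borel_measurable borel" and b: "\<And>z. 0 \<le> f z" "\<And>z. f z \<le> b"
    note e = evol_eq_Q[OF f b]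
    have b0: "0 \<le> b" using b[of undefined] by linarith
    let ?v = "var (evol f 2)"
    have pt: "ennreal (mass * ?v) \<le> ennreal 2 * wint (dev f t) + ennreal (2 * C0 * C1) * (wint (dev f t) + diss f + wint (\<lambda>z. dev f (t - angle z / 2) z))"
      if t: "1 \<le> t" "t \<le> 2" for t
    proof -
      have t0: "0 \<le> t" using t by simp
      let ?g = "pmean f t"
      have g: "\<bar>?g x\<bar> \<le> b" for x using pmean_bounds(2,3)[OF f b t0] by simp
      obtain c where c: "\<bar>c\<bar> \<le> b" "(\<integral>x. (?g x - c)\<^sup>2 * exp (- \<Phi> x) \<partial>\<nu>) \<le> C0 * (\<integral>z. turn_energy m ?g z \<partial>\<gamma>)"
        using poincare[of ?g b] g by auto
      have ge: "(?g x - c)\<^sup>2 \<le> (2 * b)\<^sup>2" for x by (rule diff_power2_bound[OF g c(1)])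
      have ev: "\<bar>evol f t z\<bar> \<le> b" for z using e(2,3)[OF t0, of z] by simp
      have dv: "(evol f t z - c)\<^sup>2 \<le> (2 * b)\<^sup>2" for z by (rule diff_power2_bound[OF ev c(1)])
      have [measurable]: "(\<lambda>z::'a \<times> 'a. ?g (fst z)) \<in> borel_measurable borel" by measurable
      have "?v \<le> var (evol f t)" using t by (intro var_evol_mono[OF f b]) auto
      also have "\<dots> \<le> (\<integral>z. (evol f t z - c)\<^sup>2 \<partial>mu)" by (rule var_le(2)[OF _ ev]) simp
      finally have "ennreal (mass * ?v) \<le> ennreal (mass * (\<integral>z. (evol f t z - c)\<^sup>2 \<partial>mu))"
        using mass_pos by (intro ennreal_leI mult_left_mono) auto
      also have "\<dots> = wint (\<lambda>z. ennreal ((evol f t z - c)\<^sup>2))"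
        by (rule wint_mu_real[symmetric, OF _ _ dv]) auto
      also have "\<dots> \<le> wint (\<lambda>z. ennreal 2 * dev f t z + ennreal 2 * ennreal ((?g (fst z) - c)\<^sup>2))"
      proof (rule wint_mono)
        fix z
        have "(evol f t z - c)\<^sup>2 \<le> 2 * (evol f t z - ?g (fst z))\<^sup>2 + 2 * (?g (fst z) - c)\<^sup>2"
          using zero_le_power2[of "(evol f t z - ?g (fst z)) - (?g (fst z) - c)"] by (simp add: power2_eq_square algebra_simps)
        then show "ennreal ((evol f t z - c)\<^sup>2) \<le> ennreal 2 * dev f t z + ennreal 2 * ennreal ((?g (fst z) - c)\<^sup>2)"
          unfolding dev_def by (simp flip: ennreal_mult' ennreal_plus del: ennreal_numeral add: ennreal_leI)
      qed
      also have "\<dots> = ennreal 2 * wint (dev f t) + ennreal 2 * wint (\<lambda>z. ennreal ((?g (fst z) - c)\<^sup>2))"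
        unfolding wint_def by (simp add: distrib_right nn_integral_add nn_integral_cmult mult.assoc del: ennreal_numeral)
      also have "wint (\<lambda>z. ennreal ((?g (fst z) - c)\<^sup>2)) = (\<integral>\<^sup>+x. ennreal ((?g x - c)\<^sup>2 * exp (- \<Phi> x)) \<partial>\<nu>)"
        by (simp add: wint_iterated nu.emeasure_space_1[simplified] ennreal_mult')
      also have "\<dots> = ennreal (\<integral>x. (?g x - c)\<^sup>2 * exp (- \<Phi> x) \<partial>\<nu>)"
      proof (intro nn_integral_eq_integral nu_integral_bounded[where B="(2 * b)\<^sup>2 * 1"])
        show "\<bar>(?g x - c)\<^sup>2 * exp (- \<Phi> x)\<bar> \<le> (2 * b)\<^sup>2 * 1" for x
          unfolding abs_mult using ge Phi_nonneg by (intro mult_mono) auto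
      qed auto
      also have "\<dots> \<le> ennreal (C0 * (\<integral>z. turn_energy m ?g z \<partial>\<gamma>))" by (rule ennreal_leI[OF c(2)])
      also have "\<dots> = ennreal C0 * (\<integral>\<^sup>+z. ennreal (turn_energy m ?g z) \<partial>\<gamma>)"
        using C0 turn_energy_integrable[of ?g b m] g
        by (subst nn_integral_eq_integral) (auto simp: ennreal_mult' turn_energy_def)
      also have "\<dots> \<le> ennreal C0 * (ennreal C1 * (wint (dev f t) + diss f + wint (\<lambda>z. dev f (t - angle z / 2) z)))"
        unfolding C1_def by (intro mult_left_mono turn_energy_le[OF f b m t]) auto
      finally have "ennreal (mass * ?v) \<le> ennreal 2 * wint (dev f t) + ennreal 2 * (ennreal C0 * (ennreal C1 * (wint (dev f t) + diss f + wint (\<lambda>z. dev f (t - angle z / 2) z))))"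
        by (simp add: add_left_mono mult_left_mono)
      moreover have "ennreal (2 * C0 * C1) = ennreal 2 * (ennreal C0 * ennreal C1)"
        using C0 C1 by (simp add: ennreal_mult' mult.assoc)
      ultimately show ?thesis by (simp only: mult.assoc)
    qed
    have m1 [measurable]: "(\<lambda>t. wint (dev f t)) \<in> borel_measurable borel"
    proof -
      have "(\<lambda>(t, z). dev f t z * wt z) \<in> borel_measurable (borel \<Otimes>\<^sub>M \<gamma>)" by measurable
      then show ?thesis unfolding wint_def by measurable
    qed
    have m2 [measurable]: "(\<lambda>t. wint (\<lambda>z. dev f (t - angle z / 2) z)) \<in> borel_measurable borel"
    proof -
      have "(\<lambda>(t, z). dev f (t - angle z / 2) z * wt z) \<in> borel_measurable (borel \<Otimes>\<^sub>M \<gamma>)" by measurable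
      then show ?thesis unfolding wint_def by measurable
    qed
    let ?ind = "indicator {1..2} :: real \<Rightarrow> ennreal"
    have int1: "(\<integral>\<^sup>+t. c * ?ind t \<partial>lborel) = c" for c :: ennreal
      by (simp add: nn_integral_cmult_indicator)
    have D1: "(\<integral>\<^sup>+t. wint (dev f t) * ?ind t \<partial>lborel) \<le> ennreal (1 / lam) * diss f"
      by (rule order_trans[OF nn_integral_mono dev_dissipation[OF f b]]) (auto simp: indicator_def)
    have D2: "(\<integral>\<^sup>+t. wint (\<lambda>z. dev f (t - angle z / 2) z) * ?ind t \<partial>lborel) \<le> ennreal (1 / lam) * diss f"
      by (rule order_trans[OF dev_shift[OF f b] dev_dissipation[OF f b]])
    have "ennreal (mass * ?v) = (\<integral>\<^sup>+t. ennreal (mass * ?v) * ?ind t \<partial>lborel)" by (rule int1[symmetric])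
    also have "\<dots> \<le> (\<integral>\<^sup>+t. ennreal 2 * (wint (dev f t) * ?ind t) + ennreal (2 * C0 * C1) * (wint (dev f t) * ?ind t + diss f * ?ind t + wint (\<lambda>z. dev f (t - angle z / 2) z) * ?ind t) \<partial>lborel)"
      using pt by (intro nn_integral_mono) (auto simp: indicator_def)
    also have "\<dots> = ennreal 2 * (\<integral>\<^sup>+t. wint (dev f t) * ?ind t \<partial>lborel) + ennreal (2 * C0 * C1) * ((\<integral>\<^sup>+t. wint (dev f t) * ?ind t \<partial>lborel) + diss f + (\<integral>\<^sup>+t. wint (\<lambda>z. dev f (t - angle z / 2) z) * ?ind t \<partial>lborel))"
      by (simp add: nn_integral_add nn_integral_cmult int1 del: ennreal_numeral)
    also have "\<dots> \<le> ennreal 2 * (ennreal (1 / lam) * diss f) + ennreal (2 * C0 * C1) * (ennreal (1 / lam) * diss f + ennreal 1 * diss f + ennreal (1 / lam) * diss f)"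
      using D1 D2 by (intro add_mono mult_left_mono) auto
    also have "\<dots> = ennreal C * diss f"
    proof -
      have p: "0 \<le> 1 / lam" "0 \<le> 2 * C0 * C1" using lam_pos C0 C1 by auto
      have "ennreal 2 * (ennreal (1 / lam) * diss f) = ennreal (2 / lam) * diss f"
        using p by (simp add: mult.assoc[symmetric] ennreal_mult'[symmetric] del: ennreal_numeral)
      moreover have "ennreal (1 / lam) * diss f + ennreal 1 * diss f + ennreal (1 / lam) * diss f = ennreal (2 / lam + 1) * diss f"
      proof -
        have "ennreal (1 / lam) + ennreal 1 + ennreal (1 / lam) = ennreal (1 / lam + 1 + 1 / lam)"
          using p by (simp only: ennreal_plus[symmetric] add_nonneg_nonneg zero_le_one)
        also have "1 / lam + 1 + 1 / lam = 2 / lam + 1" by simp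
        finally show ?thesis by (simp only: distrib_right[symmetric])
      qed
      moreover have "ennreal (2 * C0 * C1) * (ennreal (2 / lam + 1) * diss f) = ennreal (2 * C0 * C1 * (2 / lam + 1)) * diss f"
        using p by (simp only: mult.assoc[symmetric] ennreal_mult')
      moreover have "ennreal (2 / lam) * diss f + ennreal (2 * C0 * C1 * (2 / lam + 1)) * diss f = ennreal C * diss f"
        unfolding distrib_right[symmetric] C_def using p by (subst ennreal_plus[symmetric]) auto
      ultimately show ?thesis by simp
    qed
    also have "diss f = ennreal (mass * (var f - ?v))"
    proof -
      have s: "0 \<le> (f z)\<^sup>2" "(f z)\<^sup>2 \<le> b\<^sup>2" "\<bar>f z\<bar> \<le> b" for z using b[of z] by (auto intro: power_mono)
      have s2: "(evol f 2 z)\<^sup>2 \<le> b\<^sup>2" "\<bar>evol f 2 z\<bar> \<le> b" for z using e(2,3)[of 2 z] by (auto intro: power_mono)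
      have "diss f = ennreal (mass * (\<integral>z. (f z)\<^sup>2 \<partial>mu) - mass * (\<integral>z. (evol f 2 z)\<^sup>2 \<partial>mu))"
        unfolding diss_def using wint_mu_real[of "\<lambda>z. (f z)\<^sup>2" "b\<^sup>2"] wint_mu_real[of "\<lambda>z. (evol f 2 z)\<^sup>2" "b\<^sup>2"] s s2 mass_pos
        by (simp add: ennreal_minus integral_nonneg_AE)
      moreover have "var f = (\<integral>z. (f z)\<^sup>2 \<partial>mu) - (\<integral>z. f z \<partial>mu)\<^sup>2" "?v = (\<integral>z. (evol f 2 z)\<^sup>2 \<partial>mu) - (\<integral>z. f z \<partial>mu)\<^sup>2"
        using var_le(1)[of f b] var_le(1)[of "evol f 2" b] s s2 evol_mean[OF f b, of 2] by simp_all
      ultimately show ?thesis by (simp add: right_diff_distrib)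
    qed
    finally have *: "ennreal (mass * ?v) \<le> ennreal (C * (mass * (var f - ?v)))" using C by (simp add: ennreal_mult')
    have nn: "0 \<le> ?v" unfolding var_def by (intro integral_nonneg_AE) auto
    have "mass * ?v \<le> C * (mass * (var f - ?v))"
    \<comment> \<open>\<open>ennreal\<close> sends negative numbers to zero, so the return to reals
      needs a sign; a negative right-hand side would contradict the monotonicity of the
      variance.\<close>
    proof (cases "0 \<le> C * (mass * (var f - ?v))")
      case True
      then show ?thesis using * by (subst (asm) ennreal_le_iff)
    next
      case False
      then have "ennreal (mass * ?v) = 0" using * by (simp add: ennreal_neg)
      then have "?v = 0" using mass_pos nn by (simp add: ennreal_eq_0_iff mult_le_0_iff)
      moreover have "?v \<le> var f"
      proof -
        have "var f = var (evol f 0)" using evol_0[of f] b(1) by (auto intro!: arg_cong[where f=var])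
        then show ?thesis using var_evol_mono[OF f b, of 0 2] by simp
      qed
      ultimately have False using False C mass_pos by (simp add: zero_le_mult_iff)
      then show ?thesis ..
    qed
    then have "mass * ?v \<le> mass * (C * (var f - ?v))" by (simp add: mult_ac)
    then show "?v \<le> C * (var f - ?v)" using mass_pos by simp
  qed
qed


lemma evol_evol:
  assumes [measurable]: "f \<in> borel_measurable borel" and b: "\<And>z. 0 \<le> f z" "\<And>z. f z \<le> b" and st: "0 \<le> s" "0 \<le> t"
  shows "evol f (t + s) = evol (evol f s) t"
proof
  fix z
  have "Pt (\<lambda>z. ennreal (f z)) s = (\<lambda>z. ennreal (evol f s z))"
    using evol_eq_Q(4)[OF assms(1) b st(1)] by auto
  then show "evol f (t + s) z = evol (evol f s) t z"
    unfolding evol_def[of f "t + s"] evol_def[of "evol f s"] using st by (subst Pt_semigroup) auto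
qed

lemma var_nonneg: "0 \<le> var h"
  unfolding var_def by (intro integral_nonneg_AE) auto

text \<open>The contraction reads \<open>var (evol f 2) \<le> \<rho> * var f\<close> with
  \<open>\<rho> = C / (1 + C)\<close> and is iterated over blocks of length 2. The prefactor
  \<open>exp (- ln \<rho>)\<close>, that is \<open>1 / \<rho>\<close>, pays for the incomplete last
  block.\<close>

lemma decay_nonneg:
  obtains A \<kappa> where "0 < A" "0 < \<kappa>"
    "\<And>f b t. f \<in> borel_measurable borel \<Longrightarrow> (\<And>z. 0 \<le> f z) \<Longrightarrow> (\<And>z. f z \<le> b) \<Longrightarrow> 0 \<le> t \<Longrightarrow>
       var (evol f t) \<le> A * exp (- \<kappa> * t) * var f"
proof -
  obtain C where C: "0 < C" and contr: "\<And>f b. f \<in> borel_measurable borel \<Longrightarrow> (\<And>z. 0 \<le> f z) \<Longrightarrow> (\<And>z. f z \<le> b) \<Longrightarrow>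
       var (evol f 2) \<le> C * (var f - var (evol f 2))"
    using contraction by blast
  define \<rho> where "\<rho> = C / (1 + C)"
  have \<rho>: "0 < \<rho>" "\<rho> < 1" using C by (auto simp: \<rho>_def)
  have ln: "ln \<rho> < 0" using \<rho> by (simp add: ln_less_zero)
  show ?thesis
  proof (rule that[of "exp (- ln \<rho>)" "- ln \<rho> / 2"])
    fix f :: "'a \<times> 'a \<Rightarrow> real" and b t :: real
    assume f [measurable]: "f \<in> borel_measurable borel" and b: "\<And>z. 0 \<le> f z" "\<And>z. f z \<le> b" and t: "0 \<le> t"
    have step: "var (evol f (2 * real n)) \<le> \<rho> ^ n * var f" for n
    proof (induction n)
      case 0
      have "evol f 0 = f" using evol_0[OF f b(1)] by auto
      then show ?case by simp
    next
      case (Suc n)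
      let ?h = "evol f (2 * real n)"
      have h: "?h \<in> borel_measurable borel" "0 \<le> ?h z" "?h z \<le> b" for z
        using evol_eq_Q(2,3)[OF f b, of "2 * real n" z] by auto
      have "evol f (2 * real (Suc n)) = evol ?h 2"
        using evol_evol[OF f b, of "2 * real n" 2] by (simp add: distrib_left)
      moreover have "var (evol ?h 2) \<le> \<rho> * var ?h"
      proof -
        have "var (evol ?h 2) * (1 + C) \<le> C * var ?h" using contr[of ?h b] h by (simp add: algebra_simps)
        then show ?thesis using C by (simp add: \<rho>_def field_simps)
      qed
      moreover have "\<rho> * var ?h \<le> \<rho> * (\<rho> ^ n * var f)" using Suc \<rho> by (intro mult_left_mono) auto
      ultimately show ?case by (simp add: mult_ac)
    qed
    define n where "n = nat \<lfloor>t / 2\<rfloor>"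
    have n: "2 * real n \<le> t" "t / 2 - 1 \<le> real n" unfolding n_def using t by linarith+
    have "var (evol f t) \<le> var (evol f (2 * real n))" using n t by (intro var_evol_mono[OF f b]) auto
    also have "\<dots> \<le> \<rho> ^ n * var f" by (rule step)
    also have "\<dots> \<le> exp (- ln \<rho>) * exp (- (- ln \<rho> / 2) * t) * var f"
    proof (intro mult_right_mono var_nonneg)
      have "\<rho> ^ n = exp (real n * ln \<rho>)" using \<rho> by (simp add: exp_of_nat_mult)
      also have "\<dots> \<le> exp ((t / 2 - 1) * ln \<rho>)" using n ln by (simp add: mult_right_mono_neg)
      also have "\<dots> = exp (- ln \<rho>) * exp (- (- ln \<rho> / 2) * t)" by (simp flip: exp_add add: algebra_simps)
      finally show "\<rho> ^ n \<le> exp (- ln \<rho>) * exp (- (- ln \<rho> / 2) * t)" .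
    qed
    finally show "var (evol f t) \<le> exp (- ln \<rho>) * exp (- (- ln \<rho> / 2) * t) * var f" .
  qed (use ln in auto)
qed

lemma Q_measurable [measurable]:
  fixes f :: "'a \<times> 'a \<Rightarrow> real"
  assumes [measurable]: "f \<in> borel_measurable borel"
  shows "Q t f \<in> borel_measurable borel"
proof -
  interpret prob_space "noise \<nu>" by (rule prob_space_noise)
  have "(\<lambda>(z, \<omega>). f (boomerang_path lam \<Phi> R z \<omega> t)) \<in> borel_measurable (borel \<Otimes>\<^sub>M noise \<nu>)"
    unfolding boomerang_path_eq noise_eq split_beta' by measurable
  then show ?thesis unfolding boomerang_semigroup_def[abs_def] by measurable
qed

text \<open>Adding the constant \<open>b\<close> makes \<open>f\<close> nonnegative and changes
  neither the variance nor the centred evolution.\<close>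

lemma decay_bounded:
  obtains A \<kappa> where "0 < A" "0 < \<kappa>"
    "\<And>f b t. f \<in> borel_measurable borel \<Longrightarrow> (\<And>z. \<bar>f z\<bar> \<le> b) \<Longrightarrow> 0 \<le> t \<Longrightarrow>
       (\<integral>z. (Q t f z - (\<integral>y. f y \<partial>mu))\<^sup>2 \<partial>mu) \<le> A * exp (- \<kappa> * t) * var f"
proof -
  obtain A \<kappa> where A: "0 < A" "0 < \<kappa>" and d: "\<And>f b t. f \<in> borel_measurable borel \<Longrightarrow> (\<And>z. 0 \<le> f z) \<Longrightarrow> (\<And>z. f z \<le> b) \<Longrightarrow> 0 \<le> t \<Longrightarrow>
       var (evol f t) \<le> A * exp (- \<kappa> * t) * var f" using decay_nonneg by blast
  show ?thesis
  proof (rule that[OF A])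
    fix f :: "'a \<times> 'a \<Rightarrow> real" and b t :: real
    assume f [measurable]: "f \<in> borel_measurable borel" and b: "\<And>z. \<bar>f z\<bar> \<le> b" and t: "0 \<le> t"
    interpret P: prob_space "noise \<nu>" by (rule prob_space_noise)
    let ?h = "\<lambda>z. f z + b"
    have h: "0 \<le> ?h z" "?h z \<le> 2 * b" for z using b[of z] by auto
    have hm: "?h \<in> borel_measurable borel" by measurable
    have "integrable mu f" by (rule mu_bounded[OF f b])
    then have mean: "(\<integral>z. ?h z \<partial>mu) = (\<integral>z. f z \<partial>mu) + b" using mu.prob_space by simp
    have "evol ?h t z = Q t f z + b" for z
      unfolding evol_eq_Q(1)[OF hm h t] boomerang_semigroup_def
      using path_integrable[OF f b, of z t] P.prob_space by simp
    then have "var (evol ?h t) = (\<integral>z. (Q t f z - (\<integral>y. f y \<partial>mu))\<^sup>2 \<partial>mu)"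
      unfolding var_def evol_mean[OF hm h t] mean by simp
    moreover have "var ?h = var f" unfolding var_def mean by simp
    ultimately show "(\<integral>z. (Q t f z - (\<integral>y. f y \<partial>mu))\<^sup>2 \<partial>mu) \<le> A * exp (- \<kappa> * t) * var f"
      using d[OF hm h t] by simp
  qed
qed

section \<open>From bounded to square integrable functions\<close>

lemma path_integrable_AE:
  fixes f :: "'a \<times> 'a \<Rightarrow> real"
  assumes [measurable]: "f \<in> borel_measurable borel" and i: "integrable mu f" and t: "0 \<le> t"
  shows "AE z in mu. integrable (noise \<nu>) (\<lambda>\<omega>. f (boomerang_path lam \<Phi> R z \<omega> t))"
proof -
  let ?F = "\<lambda>z. ennreal \<bar>f z\<bar>"
  have "(\<integral>\<^sup>+z. Pt ?F t z \<partial>mu) = (\<integral>\<^sup>+z. ?F z \<partial>mu)" using t by (intro mu_invariant) auto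
  also have "\<dots> < \<infinity>" using i by (simp add: integrable_iff_bounded)
  finally have "AE z in mu. Pt ?F t z \<noteq> \<infinity>" by (intro nn_integral_noteq_infinite) auto
  then show ?thesis
  proof (rule eventually_mono)
    fix z assume "Pt ?F t z \<noteq> \<infinity>"
    then show "integrable (noise \<nu>) (\<lambda>\<omega>. f (boomerang_path lam \<Phi> R z \<omega> t))"
      using nn_integral_boomerang_path[of ?F t z] t by (auto simp: integrable_iff_bounded less_top)
  qed
qed

definition trunc :: "real \<Rightarrow> real \<Rightarrow> real" where "trunc n y = max (- n) (min n y)"

lemma trunc_measurable [measurable]: "trunc n \<in> borel_measurable borel"
  unfolding trunc_def by measurable

lemma trunc_bounds: "0 \<le> n \<Longrightarrow> \<bar>trunc n y\<bar> \<le> n" "0 \<le> n \<Longrightarrow> \<bar>trunc n y\<bar> \<le> \<bar>y\<bar>"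
  by (auto simp: trunc_def)

lemma trunc_tendsto: "(\<lambda>n. trunc (real n) y) \<longlonglongrightarrow> y"
proof (rule tendsto_eventually)
  show "\<forall>\<^sub>F n in sequentially. trunc (real n) y = y"
    using eventually_ge_at_top[of "nat \<lceil>\<bar>y\<bar>\<rceil>"]
    by (rule eventually_mono) (auto simp: trunc_def nat_ceiling_le_eq abs_le_iff max_def min_def)
qed

text \<open>The truncations satisfy the bounded estimate and Fatou's lemma passes it on; the
  required convergence of \<open>Q t (F n)\<close> almost everywhere is dominated convergence on the
  path space. The square root halves the exponent.\<close>

theorem decay:
  obtains C \<kappa> where "0 < C" "0 < \<kappa>"
    "\<And>f t. f \<in> L2 mu \<Longrightarrow> 0 \<le> t \<Longrightarrow> Q t f \<in> L2 mu \<and>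
       L2_norm mu (\<lambda>z. Q t f z - (\<integral>y. f y \<partial>mu)) \<le> C * exp (- \<kappa> * t) * L2_norm mu (\<lambda>z. f z - (\<integral>y. f y \<partial>mu))"
proof -
  obtain A \<kappa> where A: "0 < A" "0 < \<kappa>" and d: "\<And>f b t. f \<in> borel_measurable borel \<Longrightarrow> (\<And>z. \<bar>f z\<bar> \<le> b) \<Longrightarrow> 0 \<le> t \<Longrightarrow>
       (\<integral>z. (Q t f z - (\<integral>y. f y \<partial>mu))\<^sup>2 \<partial>mu) \<le> A * exp (- \<kappa> * t) * var f" using decay_bounded by blast
  show ?thesis
  proof (rule that[of "sqrt A" "\<kappa> / 2"])
    fix f :: "'a \<times> 'a \<Rightarrow> real" and t :: real
    assume fL: "f \<in> L2 mu" and t: "0 \<le> t"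
    have f [measurable]: "f \<in> borel_measurable borel" and i2: "integrable mu (\<lambda>z. (f z)\<^sup>2)"
      using fL by (auto simp: L2_def cong: measurable_cong_sets)
    have i1: "integrable mu f" by (rule mu.square_integrable_imp_integrable[OF _ i2]) simp
    define F where "F n z = trunc (real n) (f z)" for n z
    have [measurable]: "F n \<in> borel_measurable borel" for n unfolding F_def by measurable
    have Fb: "\<bar>F n z\<bar> \<le> real n" "\<bar>F n z\<bar> \<le> \<bar>f z\<bar>" for n z unfolding F_def by (auto intro: trunc_bounds)
    have Flim: "(\<lambda>n. F n z) \<longlonglongrightarrow> f z" for z unfolding F_def by (rule trunc_tendsto)
    define M where "M n = (\<integral>z. F n z \<partial>mu)" for n
    let ?M = "\<integral>z. f z \<partial>mu"
    have Mlim: "M \<longlonglongrightarrow> ?M" unfolding M_def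
      by (rule integral_dominated_convergence[where w="\<lambda>z. \<bar>f z\<bar>"]) (use i1 Fb Flim in auto)
    have "(\<lambda>n. \<integral>z. (F n z)\<^sup>2 \<partial>mu) \<longlonglongrightarrow> (\<integral>z. (f z)\<^sup>2 \<partial>mu)"
      by (rule integral_dominated_convergence[where w="\<lambda>z. (f z)\<^sup>2"])
        (use i2 Fb(2) in \<open>auto intro!: tendsto_power Flim simp: abs_le_square_iff\<close>)
    then have "(\<lambda>n. (\<integral>z. (F n z)\<^sup>2 \<partial>mu) - (M n)\<^sup>2) \<longlonglongrightarrow> (\<integral>z. (f z)\<^sup>2 \<partial>mu) - ?M\<^sup>2"
      by (intro tendsto_intros Mlim)
    moreover have "var (F n) = (\<integral>z. (F n z)\<^sup>2 \<partial>mu) - (M n)\<^sup>2" for n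
      unfolding M_def by (rule var_le(1)[OF _ Fb(1)]) simp
    moreover have "var f = (\<integral>z. (f z)\<^sup>2 \<partial>mu) - ?M\<^sup>2"
      unfolding var_def by (rule mu.variance_eq[OF i1 i2])
    ultimately have vlim: "(\<lambda>n. var (F n)) \<longlonglongrightarrow> var f" by simp
    have Qlim: "AE z in mu. (\<lambda>n. Q t (F n) z) \<longlonglongrightarrow> Q t f z"
      using path_integrable_AE[OF f i1 t]
    proof (rule eventually_mono)
      fix z assume "integrable (noise \<nu>) (\<lambda>\<omega>. f (boomerang_path lam \<Phi> R z \<omega> t))"
      then show "(\<lambda>n. Q t (F n) z) \<longlonglongrightarrow> Q t f z"
        unfolding boomerang_semigroup_def
        by (intro integral_dominated_convergence[where w="\<lambda>\<omega>. \<bar>f (boomerang_path lam \<Phi> R z \<omega> t)\<bar>"])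
          (use Fb Flim in auto)
    qed
    let ?c = "A * exp (- \<kappa> * t)"
    have "(\<integral>\<^sup>+z. ennreal ((Q t f z - ?M)\<^sup>2) \<partial>mu) = (\<integral>\<^sup>+z. liminf (\<lambda>n. ennreal ((Q t (F n) z - M n)\<^sup>2)) \<partial>mu)"
    proof (rule nn_integral_cong_AE, rule eventually_mono[OF Qlim])
      fix z assume "(\<lambda>n. Q t (F n) z) \<longlonglongrightarrow> Q t f z"
      then have "(\<lambda>n. ennreal ((Q t (F n) z - M n)\<^sup>2)) \<longlonglongrightarrow> ennreal ((Q t f z - ?M)\<^sup>2)"
        by (intro tendsto_intros Mlim)
      then show "ennreal ((Q t f z - ?M)\<^sup>2) = liminf (\<lambda>n. ennreal ((Q t (F n) z - M n)\<^sup>2))"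
        by (intro lim_imp_Liminf[symmetric]) auto
    qed
    also have "\<dots> \<le> liminf (\<lambda>n. \<integral>\<^sup>+z. ennreal ((Q t (F n) z - M n)\<^sup>2) \<partial>mu)"
      by (rule nn_integral_liminf) measurable
    also have "\<dots> \<le> liminf (\<lambda>n. ennreal (?c * var (F n)))"
    proof (rule Liminf_mono, rule always_eventually, rule allI)
      fix n
      interpret P: prob_space "noise \<nu>" by (rule prob_space_noise)
      have "\<bar>Q t (F n) z\<bar> \<le> real n" for z
      proof -
        have "\<bar>Q t (F n) z\<bar> \<le> (\<integral>\<omega>. \<bar>F n (boomerang_path lam \<Phi> R z \<omega> t)\<bar> \<partial>noise \<nu>)"
          unfolding boomerang_semigroup_def by (rule integral_abs_bound)
        also have "\<dots> \<le> (\<integral>\<omega>. real n \<partial>noise \<nu>)"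
          using path_integrable[of "F n" "real n" z t] Fb by (intro integral_mono) auto
        finally show ?thesis using P.prob_space by simp
      qed
      moreover have "\<bar>M n\<bar> \<le> real n"
      proof -
        have "\<bar>M n\<bar> \<le> (\<integral>z. \<bar>F n z\<bar> \<partial>mu)" unfolding M_def by (rule integral_abs_bound)
        also have "\<dots> \<le> (\<integral>z. real n \<partial>mu)" using mu_bounded[of "F n" "real n"] Fb by (intro integral_mono) auto
        finally show ?thesis using mu.prob_space by simp
      qed
      ultimately have "(\<integral>\<^sup>+z. ennreal ((Q t (F n) z - M n)\<^sup>2) \<partial>mu) = ennreal (\<integral>z. (Q t (F n) z - M n)\<^sup>2 \<partial>mu)"
        using diff_power2_bound[of "Q t (F n) _" "real n" "M n"]
        by (intro nn_integral_eq_integral mu_bounded[where B="(2 * real n)\<^sup>2"]) auto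
      also have "\<dots> \<le> ennreal (?c * var (F n))"
        unfolding M_def by (intro ennreal_leI d[OF _ Fb(1) t]) simp
      finally show "(\<integral>\<^sup>+z. ennreal ((Q t (F n) z - M n)\<^sup>2) \<partial>mu) \<le> ennreal (?c * var (F n))" .
    qed
    also have "\<dots> = ennreal (?c * var f)"
      by (intro lim_imp_Liminf tendsto_intros vlim) auto
    finally have le: "(\<integral>\<^sup>+z. ennreal ((Q t f z - ?M)\<^sup>2) \<partial>mu) \<le> ennreal (?c * var f)" .
    then have iQ: "integrable mu (\<lambda>z. (Q t f z - ?M)\<^sup>2)"
      by (intro integrableI_bounded) (auto intro: order.strict_trans1)
    have "ennreal (\<integral>z. (Q t f z - ?M)\<^sup>2 \<partial>mu) \<le> ennreal (?c * var f)"
      using le by (subst nn_integral_eq_integral[symmetric]) (use iQ in auto)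
    then have fin: "(\<integral>z. (Q t f z - ?M)\<^sup>2 \<partial>mu) \<le> ?c * var f"
      using A var_nonneg[of f] by (subst (asm) ennreal_le_iff) auto
    have "integrable mu (\<lambda>z. (Q t f z)\<^sup>2)"
    proof (rule Bochner_Integration.integrable_bound[of _ "\<lambda>z. 2 * (Q t f z - ?M)\<^sup>2 + 2 * ?M\<^sup>2"])
      have "x\<^sup>2 \<le> 2 * (x - m)\<^sup>2 + 2 * m\<^sup>2" for x m :: real
        using zero_le_power2[of "x - 2 * m"] by (simp add: power2_eq_square algebra_simps)
      then show "AE z in mu. norm ((Q t f z)\<^sup>2) \<le> norm (2 * (Q t f z - ?M)\<^sup>2 + 2 * ?M\<^sup>2)" by simp
    qed (use iQ in auto)
    moreover have "L2_norm mu (\<lambda>z. Q t f z - ?M) \<le> sqrt A * exp (- (\<kappa> / 2) * t) * L2_norm mu (\<lambda>z. f z - ?M)"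
    proof -
      have "sqrt (exp (- \<kappa> * t)) = exp (- (\<kappa> / 2) * t)"
        by (rule real_sqrt_unique) (simp_all flip: exp_double)
      then have "sqrt (?c * var f) = sqrt A * exp (- (\<kappa> / 2) * t) * sqrt (var f)"
        by (simp add: real_sqrt_mult)
      then show ?thesis using real_sqrt_le_mono[OF fin] by (simp add: L2_norm_def var_def)
    qed
    ultimately show "Q t f \<in> L2 mu \<and> L2_norm mu (\<lambda>z. Q t f z - ?M) \<le> sqrt A * exp (- (\<kappa> / 2) * t) * L2_norm mu (\<lambda>z. f z - ?M)"
      by (simp add: L2_def cong: measurable_cong_sets)
  qed (use A in auto)
qed

lemma mu_eq: "mu = gibbs_measure \<Phi> \<nu> \<Otimes>\<^sub>M \<nu>"
proof -
  have "density \<nu> (\<lambda>_. 1) = \<nu>" by (rule density_1)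
  moreover have "density \<nu> (\<lambda>x. ennreal (exp (- \<Phi> x) / mass)) \<Otimes>\<^sub>M density \<nu> (\<lambda>_. 1)
      = density \<gamma> (\<lambda>(x, y). ennreal (exp (- \<Phi> x) / mass) * 1)"
    by (rule pair_measure_density) (auto simp: density_1 intro: nu.sigma_finite_measure_axioms)
  ultimately show ?thesis by (simp add: mu_def gibbs_measure_def mass_def split_beta')
qed

end

section \<open>Gradients on Hilbert spaces\<close>

text \<open>\<open>gradient\<close> is a definite description, so its defining property rests on the
  existence of a vector representing the derivative. That vector is a multiple of the point of least
  norm in the hyperplane \<open>f x = 1\<close>, where minimising sequences are Cauchy by the
  parallelogram law.\<close>

lemma riesz_representation:
  fixes f :: "'a::{real_inner, complete_space} \<Rightarrow> real"
  assumes "bounded_linear f"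
  obtains y where "\<And>x. f x = x \<bullet> y"
proof (cases "\<exists>x. f x \<noteq> 0")
  case False
  then show ?thesis by (intro that[of 0]) auto
next
  case True
  interpret bounded_linear f by fact
  let ?A = "{x. f x = 1}"
  obtain x1 where "f x1 \<noteq> 0" using True by blast
  then have "x1 /\<^sub>R f x1 \<in> ?A" by (simp add: scaleR)
  then have ne: "norm ` ?A \<noteq> {}" by blast
  define d where "d = Inf (norm ` ?A)"
  have bdd: "bdd_below (norm ` ?A)" by (auto intro!: bdd_belowI[of _ 0])
  have d_le: "d \<le> norm x" if "f x = 1" for x unfolding d_def using that by (intro cInf_lower bdd) auto
  have d0: "0 \<le> d" unfolding d_def by (intro cInf_greatest ne) auto
  have "\<exists>x. f x = 1 \<and> norm x < d + 1 / Suc n" for n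
    using cInf_lessD[OF ne, of "d + 1 / Suc n"] unfolding d_def by auto
  then obtain X where X: "\<And>n. f (X n) = 1" "\<And>n. norm (X n) < d + 1 / Suc n" by metis
  have gap: "(norm (x - y))\<^sup>2 \<le> 4 * e * (2 * d + e)" if "f x = 1" "f y = 1" "norm x \<le> d + e" "norm y \<le> d + e" "0 \<le> e" for x y e
  proof -
    have "f ((1/2) *\<^sub>R (x + y)) = 1" using that by (simp add: scaleR add)
    from d_le[OF this] have "2 * d \<le> norm (x + y)" by simp
    then have "(2 * d)\<^sup>2 \<le> (norm (x + y))\<^sup>2" using d0 by (intro power_mono) auto
    moreover have "(norm (x - y))\<^sup>2 = 2 * (norm x)\<^sup>2 + 2 * (norm y)\<^sup>2 - (norm (x + y))\<^sup>2"
      by (simp add: power2_norm_eq_inner inner_simps inner_commute)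
    moreover have "(norm x)\<^sup>2 \<le> (d + e)\<^sup>2" "(norm y)\<^sup>2 \<le> (d + e)\<^sup>2" using that by (auto intro: power_mono)
    ultimately have "(norm (x - y))\<^sup>2 \<le> 4 * (d + e)\<^sup>2 - (2 * d)\<^sup>2" by linarith
    then show ?thesis by (simp add: power2_eq_square algebra_simps)
  qed
  have "Cauchy X"
  proof (rule metric_CauchyI)
    fix \<epsilon> :: real assume \<epsilon>: "0 < \<epsilon>"
    have "(\<lambda>n. 4 * (1 / real (Suc n)) * (2 * d + 1 / real (Suc n))) \<longlonglongrightarrow> 4 * 0 * (2 * d + 0)"
      by (intro tendsto_intros LIMSEQ_Suc[OF lim_1_over_n])
    then have "\<forall>\<^sub>F n in sequentially. 4 * (1 / real (Suc n)) * (2 * d + 1 / real (Suc n)) < \<epsilon>\<^sup>2"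
      by (rule order_tendstoD) (use \<epsilon> in simp)
    then obtain N where N: "4 * (1 / real (Suc N)) * (2 * d + 1 / real (Suc N)) < \<epsilon>\<^sup>2"
      by (auto simp: eventually_sequentially)
    have "dist (X m) (X n) < \<epsilon>" if "N \<le> m" "N \<le> n" for m n
    proof -
      have "norm (X k) \<le> d + 1 / real (Suc N)" if "N \<le> k" for k
      proof -
        have "1 / real (Suc k) \<le> 1 / real (Suc N)" using that by (simp add: field_simps)
        then show ?thesis using X(2)[of k] by linarith
      qed
      then have "(norm (X m - X n))\<^sup>2 \<le> 4 * (1 / real (Suc N)) * (2 * d + 1 / real (Suc N))"
        using that X(1) by (intro gap) auto
      then have "(norm (X m - X n))\<^sup>2 < \<epsilon>\<^sup>2" using N by linarith
      then show ?thesis using \<epsilon> unfolding dist_norm by (intro power2_less_imp_less[of _ \<epsilon>]) auto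
    qed
    then show "\<exists>M. \<forall>m\<ge>M. \<forall>n\<ge>M. dist (X m) (X n) < \<epsilon>" by blast
  qed
  then obtain z where z: "X \<longlonglongrightarrow> z" using Cauchy_convergent convergent_def by blast
  have "(\<lambda>n. f (X n)) \<longlonglongrightarrow> f z" by (rule tendsto[OF z])
  then have fz: "f z = 1" using X(1) by (simp add: LIMSEQ_const_iff)
  have "(\<lambda>n. d + 1 / real (Suc n)) \<longlonglongrightarrow> d + 0"
    by (intro tendsto_intros LIMSEQ_Suc[OF lim_1_over_n])
  then have "norm z \<le> d + 0"
    using tendsto_norm[OF z] X(2) by (intro LIMSEQ_le) (auto intro: less_imp_le)
  then have zmin: "norm z \<le> norm x" if "f x = 1" for x using d_le[OF that] by simp
  have orth: "z \<bullet> u = 0" if "f u = 0" for u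
  proof (rule ccontr)
    assume n: "z \<bullet> u \<noteq> 0"
    then have u: "0 < u \<bullet> u" by auto
    \<comment> \<open>Minimises the norm along the line \<open>z + s *\<^sub>R u\<close>, which
      stays in the hyperplane.\<close>
    define s where "s = - (z \<bullet> u) / (u \<bullet> u)"
    have "f (z + s *\<^sub>R u) = 1" using fz that by (simp add: add scaleR)
    from zmin[OF this] have "(norm z)\<^sup>2 \<le> (norm (z + s *\<^sub>R u))\<^sup>2" by (intro power_mono) auto
    also have "\<dots> = (norm z)\<^sup>2 + (2 * s * (z \<bullet> u) + s\<^sup>2 * (u \<bullet> u))"
      unfolding power2_norm_eq_inner by (simp add: inner_simps inner_commute[of u z] power2_eq_square algebra_simps)
    finally have "0 \<le> 2 * s * (z \<bullet> u) + s\<^sup>2 * (u \<bullet> u)" by simp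
    also have "\<dots> = - (z \<bullet> u)\<^sup>2 / (u \<bullet> u)"
      using u by (simp add: s_def power2_eq_square field_simps)
    finally show False using n u by (simp add: divide_less_0_iff not_less[symmetric])
  qed
  have nz: "z \<noteq> 0" using fz zero by auto
  show ?thesis
  proof (rule that)
    fix x
    have "f (x - f x *\<^sub>R z) = 0" using fz by (simp add: diff scaleR)
    from orth[OF this] have "z \<bullet> x = f x * (z \<bullet> z)" by (simp add: inner_simps)
    then show "f x = x \<bullet> (z /\<^sub>R (z \<bullet> z))" using nz by (simp add: inner_commute)
  qed
qed

lemma gradient_eqI:
  assumes "GDERIV f x :> D" shows "gradient f x = D"
  unfolding gradient_def
proof (rule the_equality[where P="\<lambda>D. GDERIV f x :> D", OF assms])
  fix D' assume "GDERIV f x :> D'"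
  then have "(\<lambda>h. h \<bullet> D') = (\<lambda>h. h \<bullet> D)"
    using assms unfolding gderiv_def by (rule has_derivative_unique)
  then have "(D' - D) \<bullet> (D' - D) = 0"
    by (metis inner_diff_right right_minus_eq)
  then show "D' = D" by simp
qed

lemma GDERIV_gradient:
  fixes f :: "'a::{real_inner, complete_space} \<Rightarrow> real"
  assumes "f differentiable (at x)"
  shows "GDERIV f x :> gradient f x"
proof -
  obtain f' where f': "(f has_derivative f') (at x)" using assms by (auto simp: differentiable_def)
  obtain y where "f' h = h \<bullet> y" for h using riesz_representation has_derivative_bounded_linear[OF f'] by blast
  then have "f' = (\<lambda>h. h \<bullet> y)" by auto
  with f' have "GDERIV f x :> y" by (simp add: gderiv_def)
  then show ?thesis using gradient_eqI by metis
qed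

text \<open>Mean value theorem for the symmetric sum
  \<open>f (p + s *\<^sub>R h) + f (p - s *\<^sub>R h)\<close> in \<open>s\<close>: its derivative
  is a difference of gradients at two points at most \<open>2 * norm h\<close> apart.\<close>

lemma second_difference_le:
  fixes f :: "'a::real_inner \<Rightarrow> real"
  assumes g: "\<And>x. GDERIV f x :> g x" and lip: "\<And>x y. norm (g x - g y) \<le> L * norm (x - y)"
  shows "\<bar>f (p + h) + f (p - h) - 2 * f p\<bar> \<le> 2 * L * (norm h)\<^sup>2"
proof -
  define \<phi> where "\<phi> s = f (p + s *\<^sub>R h) + f (p - s *\<^sub>R h)" for s
  have d: "(\<phi> has_real_derivative (h \<bullet> (g (p + s *\<^sub>R h) - g (p - s *\<^sub>R h)))) (at s)" for s
  proof -
    have 1: "(f has_derivative (\<lambda>h. h \<bullet> g x)) (at x)" for x using g[of x] by (simp add: gderiv_def)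
    have a: "((\<lambda>s. p + s *\<^sub>R h) has_derivative (\<lambda>t. t *\<^sub>R h)) (at s)"
      "((\<lambda>s. p - s *\<^sub>R h) has_derivative (\<lambda>t. - (t *\<^sub>R h))) (at s)"
      by (auto intro!: derivative_eq_intros)
    have "((\<lambda>s. f (p + s *\<^sub>R h)) has_derivative (\<lambda>t. (t *\<^sub>R h) \<bullet> g (p + s *\<^sub>R h))) (at s)"
      "((\<lambda>s. f (p - s *\<^sub>R h)) has_derivative (\<lambda>t. (- (t *\<^sub>R h)) \<bullet> g (p - s *\<^sub>R h))) (at s)"
      by (rule has_derivative_compose[OF a(1) 1], rule has_derivative_compose[OF a(2) 1])
    then have "(\<phi> has_derivative (\<lambda>t. (t *\<^sub>R h) \<bullet> g (p + s *\<^sub>R h) + (- (t *\<^sub>R h)) \<bullet> g (p - s *\<^sub>R h))) (at s)"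
      unfolding \<phi>_def[abs_def] by (rule has_derivative_add)
    then show ?thesis unfolding has_field_derivative_def
      by (rule has_derivative_eq_rhs) (auto simp: inner_diff_right algebra_simps)
  qed
  obtain s where s: "0 < s" "s < 1" "\<phi> 1 - \<phi> 0 = (1 - 0) * (h \<bullet> (g (p + s *\<^sub>R h) - g (p - s *\<^sub>R h)))"
    using MVT2[of 0 1 \<phi>, OF _ d] by auto
  have n: "norm (p + s *\<^sub>R h - (p - s *\<^sub>R h)) = 2 * s * norm h"
  proof -
    have "p + s *\<^sub>R h - (p - s *\<^sub>R h) = (2 * s) *\<^sub>R h" by (simp add: scaleR_2[symmetric] scaleR_add_left[symmetric])
    then show ?thesis using s by simp
  qed
  have L0: "0 \<le> L * norm h" using order_trans[OF norm_ge_zero lip[of h 0]] by simp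
  have "\<bar>\<phi> 1 - \<phi> 0\<bar> \<le> norm h * norm (g (p + s *\<^sub>R h) - g (p - s *\<^sub>R h))"
    unfolding s(3) using Cauchy_Schwarz_ineq2 by simp
  also have "\<dots> \<le> norm h * (L * (2 * s * norm h))"
    using lip[of "p + s *\<^sub>R h" "p - s *\<^sub>R h"] unfolding n by (intro mult_left_mono) auto
  also have "\<dots> = s * (2 * (L * norm h) * norm h)" by simp
  also have "\<dots> \<le> 1 * (2 * (L * norm h) * norm h)"
    using s mult_nonneg_nonneg[OF L0 norm_ge_zero[of h]] by (intro mult_right_mono) linarith+
  finally show ?thesis by (simp add: \<phi>_def power2_eq_square mult.assoc)
qed

theorem theorem6p2:
  fixes \<Sigma> :: "'a::{real_inner, polish_space} \<Rightarrow> 'a"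
    and \<Phi> :: "'a \<Rightarrow> real"
    and R :: "nat \<Rightarrow> 'a \<Rightarrow> 'a"
    and lam_r c\<^sub>1 c\<^sub>2 :: real
    and \<pi>\<^sub>0 \<nu>\<^sub>0 \<pi> :: "'a measure"
    and \<mu> :: "('a \<times> 'a) measure"
  assumes infinite_dim: "\<nexists>B :: 'a set. finite B \<and> span B = UNIV"
    and Sigma: "pos_definite \<Sigma>" "selfadjoint \<Sigma>" "trace_class \<Sigma>"
    and G: "assumption_G \<Phi>"
    and refresh: "lam_r > 0"
    and reflections: "boomerang_reflections \<Sigma> R"
    and C2: "C2_bounded_hessian \<Phi>"
    and c: "c\<^sub>2 \<ge> 0" "c\<^sub>1 > 0"
    and drift: "\<And>x. gen_A \<Sigma> \<Phi> \<Phi> x \<le> c\<^sub>2 - c\<^sub>1 * (norm (op_sqrt \<Sigma> (gradient \<Phi> x)))\<^sup>2"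
    and gauss: "centered_gaussian \<Sigma> \<pi>\<^sub>0" "\<nu>\<^sub>0 = \<pi>\<^sub>0"
    and L1: "integrable \<pi>\<^sub>0 (\<lambda>x. exp (- \<Phi> x))"
    and pi_def: "\<pi> = gibbs_measure \<Phi> \<pi>\<^sub>0"
    and mu_def: "\<mu> = \<pi> \<Otimes>\<^sub>M \<nu>\<^sub>0"
  shows "\<exists>C>0. \<exists>\<kappa>>0. \<forall>f\<in>L2 \<mu>. \<forall>t\<ge>0.
           boomerang_semigroup lam_r \<Phi> R \<nu>\<^sub>0 t f \<in> L2 \<mu> \<and>
           L2_norm \<mu> (\<lambda>z. boomerang_semigroup lam_r \<Phi> R \<nu>\<^sub>0 t f z - (\<integral>y. f y \<partial>\<mu>))
             \<le> C * exp (- \<kappa> * t) * L2_norm \<mu> (\<lambda>z. f z - (\<integral>y. f y \<partial>\<mu>))"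
proof -
  note G' = G[unfolded assumption_G_def]
  from G'[THEN conjunct1] obtain K where K': "(\<forall>x. 0 \<le> \<Phi> x \<and> \<Phi> x \<le> K * (1 + (norm x)\<^sup>2)) \<and> (\<forall>x. \<Phi> differentiable (at x)) \<and>
      (\<forall>B. bounded B \<longrightarrow> (\<exists>L. L-lipschitz_on B (gradient \<Phi>))) \<and> (\<forall>x. norm (gradient \<Phi> x) \<le> K * (1 + norm x))"
    by (rule exE)
  then have K: "\<And>x. 0 \<le> \<Phi> x" "\<And>x. \<Phi> x \<le> K * (1 + (norm x)\<^sup>2)" "\<And>x. \<Phi> differentiable (at x)"
      "\<And>x. norm (gradient \<Phi> x) \<le> K * (1 + norm x)"
    by simp_all
  from G'[THEN conjunct2] obtain \<Phi>\<^sub>1 \<Phi>\<^sub>2 M where split: "\<forall>x. \<Phi> x = \<Phi>\<^sub>1 x + \<Phi>\<^sub>2 x" and conv: "convex_on UNIV \<Phi>\<^sub>1"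
    and diff: "\<forall>x. \<Phi>\<^sub>2 differentiable (at x) \<and> gradient \<Phi>\<^sub>2 differentiable (at x)"
    and bnd: "\<forall>x. \<bar>\<Phi>\<^sub>2 x\<bar> \<le> M \<and> norm (gradient \<Phi>\<^sub>2 x) \<le> M \<and> onorm (hessian \<Phi>\<^sub>2 x) \<le> M"
    by (elim exE conjE) (rule that)
  have \<Phi>: "\<Phi> x = \<Phi>\<^sub>1 x + \<Phi>\<^sub>2 x" and M: "\<bar>\<Phi>\<^sub>2 x\<bar> \<le> M" "onorm (hessian \<Phi>\<^sub>2 x) \<le> M"
    and \<Phi>2: "\<Phi>\<^sub>2 differentiable (at x)" "gradient \<Phi>\<^sub>2 differentiable (at x)" for x
    using split diff bnd by blast+
  obtain H where H: "\<And>x. (gradient \<Phi> has_derivative blinfun_apply (H x)) (at x)" and "bounded (range H)"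
    using C2 unfolding C2_bounded_hessian_def by blast
  then obtain B where B: "\<And>x. norm (H x) \<le> B" by (auto simp: bounded_iff)
  \<comment> \<open>The bounded Hessian makes the gradient globally Lipschitz, where (G) speaks of
    bounded sets only.\<close>
  have lip: "norm (gradient \<Phi> x - gradient \<Phi> y) \<le> B * norm (x - y)" for x y
    using H B by (intro differentiable_bound[of UNIV "gradient \<Phi>" "\<lambda>x. blinfun_apply (H x)"])
      (auto simp: norm_blinfun.rep_eq[symmetric])
  have lip2: "norm (gradient \<Phi>\<^sub>2 x - gradient \<Phi>\<^sub>2 y) \<le> M * norm (x - y)" for x y
    using \<Phi>2(2) M(2) by (intro differentiable_bound[of UNIV "gradient \<Phi>\<^sub>2" "hessian \<Phi>\<^sub>2"])
      (auto simp: hessian_def frechet_derivative_works)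
  have grad: "GDERIV \<Phi> x :> gradient \<Phi> x" "GDERIV \<Phi>\<^sub>2 x :> gradient \<Phi>\<^sub>2 x" for x
    using K(3) \<Phi>2(1) by (auto intro: GDERIV_gradient)
  \<comment> \<open>(G) provides derivatives of \<open>\<Phi>\<close> and
    \<open>\<Phi>\<^sub>2\<close>; the second differences of the convex part are the difference of
    theirs.\<close>
  have second: "\<Phi>\<^sub>1 (p + h) + \<Phi>\<^sub>1 (p - h) - 2 * \<Phi>\<^sub>1 p \<le> (2 * B + 2 * M) * (norm h)\<^sup>2" for p h
    using second_difference_le[OF grad(1) lip, of p h] second_difference_le[OF grad(2) lip2, of p h]
    unfolding \<Phi> by (simp add: distrib_right abs_le_iff)
  have cont: "continuous_on UNIV \<Phi>" "continuous_on UNIV \<Phi>\<^sub>2" "continuous_on UNIV (gradient \<Phi>)"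
    using K(3) \<Phi>2(1) H
    by (auto simp: continuous_on_eq_continuous_at intro: differentiable_imp_continuous_within has_derivative_continuous)
  have "\<Phi>\<^sub>1 = (\<lambda>x. \<Phi> x - \<Phi>\<^sub>2 x)" using \<Phi> by auto
  then have meas: "\<Phi>\<^sub>1 \<in> borel_measurable borel"
    using cont by (auto intro!: borel_measurable_continuous_onI continuous_intros)
  have nn: "0 \<le> 2 * B + 2 * M" using order_trans[OF norm_ge_zero B] order_trans[OF abs_ge_zero M(1)] by simp
  have lin: "linear \<Sigma>" using Sigma(3) by (simp add: trace_class_def bounded_linear.linear)
  have near: "\<bar>\<Phi> x - \<Phi>\<^sub>1 x\<bar> \<le> M" for x using M(1)[of x] \<Phi>[of x] by simp
  have g: "centered_gaussian \<Sigma> \<nu>\<^sub>0" using gauss by simp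
  note \<mu> = mu_def[unfolded pi_def, folded gauss(2)]
  interpret boomerang_convex \<Sigma> R \<Phi> lam_r \<nu>\<^sub>0 K \<Phi>\<^sub>1 "2 * B + 2 * M" M
    by (intro boomerang_convex.intro boomerang.intro boomerang_convex_axioms.intro) (fact g Sigma(1) lin reflections refresh grad(1) K near conv second meas nn cont(3))+
  obtain C \<kappa> where "0 < C" "0 < \<kappa>" "\<And>f t. f \<in> L2 mu \<Longrightarrow> 0 \<le> t \<Longrightarrow> Q t f \<in> L2 mu \<and>
       L2_norm mu (\<lambda>z. Q t f z - (\<integral>y. f y \<partial>mu)) \<le> C * exp (- \<kappa> * t) * L2_norm mu (\<lambda>z. f z - (\<integral>y. f y \<partial>mu))"
    using decay by blast
  moreover have "mu = \<mu>" by (simp only: mu_eq \<mu>)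
  ultimately show ?thesis by blast
qed

end
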